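(* Let $\frac14<\alpha<\frac12$ and $\delta\in[0,\alpha)$, and set $$s(\delta)=\begin{cases}\frac14+\delta, & 0\le\delta\le\alpha-\frac14,\\ \frac12-\alpha+2\delta, & \alpha-\frac14<\delta<\frac{\alpha}{2},\\ \frac{\delta}{\alpha}, & \delta\ge\frac{\alpha}{2}.\end{cases}$$ (i) Let $\gamma:\mathbb{R}\times[-1,1]\to\mathbb{R}$ be any continuous map with $\gamma(x,0)=x$ for all $x$ which is bilipschitz continuous in $x$ (uniformly in $t$) and $\alpha$-Hölder continuous in $t$ (uniformly in $x$). Then for every $s>s(\delta)$ and every $f\in H^s(\mathbb{R})$, $$\lim_{t\to0^+}\frac{U_\gamma f(x,t)-f(x)}{t^\delta}=0\quad\text{for a.e. }x\in\mathbb{R}.$$ (ii) Conversely, there exists a map $\gamma$ satisfying all the assumptions in (i) such that for every $s<s(\delta)$ the statement "for every $f\in H^s(\mathbb{R})$, $\lim_{t\to0^+}\frac{U_\gamma f(x,t)-f(x)}{t^\delta}=0$ for a.e. $x\in\mathbb{R}$" is false.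
   Context: For a map $\gamma:\mathbb{R}\times[-1,1]\to\mathbb{R}$, define $$U_\gamma f(x,t)=\frac{1}{2\pi}\int_{\mathbb{R}}e^{i(\gamma(x,t)\xi+t|\xi|^2)}\widehat f(\xi)\,d\xi,\qquad \widehat f(\xi)=\int_{\mathbb{R}}e^{-ix\xi}f(x)\,dx.$$ When $\widehat f$ is not integrable, the integral is understood as the limit, as $N\to\infty$ through powers of $2$, of the integrals over $\{|\xi|\le N\}$; $f(x)$ is understood as $U_\gamma f(x,0)$. Bilipschitz continuous in $x$: there are constants $C_1,C_2>0$ with $\frac{1}{C_1}|x-x'|\le|\gamma(x,t)-\gamma(x',t)|\le C_2|x-x'|$ for all $t\in[-1,1]$, $x,x'\in\mathbb{R}$. $\alpha$-Hölder continuous in $t$: there is a constant $C_3>0$ with $|\gamma(x,t)-\gamma(x,t')|\le C_3|t-t'|^\alpha$ for all $x\in\mathbb{R}$, $t,t'\in[-1,1]$. $H^s(\mathbb{R})$ is the $L^2$-based Sobolev space with norm $\|(1+|\xi|^2)^{s/2}\widehat f\|_{L^2}$. *)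

theory Defs
  imports "HOL-Analysis.Analysis"
begin

section \<open>Tempered distributions on the real line and their Fourier transform\<close>

definition vderiv :: "(real \<Rightarrow> complex) \<Rightarrow> real \<Rightarrow> complex" where
  "vderiv \<phi> = (\<lambda>x. vector_derivative \<phi> (at x))"

definition schwartz :: "(real \<Rightarrow> complex) set" where
  "schwartz = {\<phi>. \<forall>m. (\<forall>x. (vderiv ^^ m) \<phi> differentiable (at x)) \<and>
      (\<forall>k. bdd_above (range (\<lambda>x. \<bar>x\<bar> ^ k * cmod ((vderiv ^^ m) \<phi> x))))}"

definition schwartz_seminorm :: "nat \<Rightarrow> nat \<Rightarrow> (real \<Rightarrow> complex) \<Rightarrow> real" where
  "schwartz_seminorm k m \<phi> = (SUP x. \<bar>x\<bar> ^ k * cmod ((vderiv ^^ m) \<phi> x))"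

definition fourier :: "(real \<Rightarrow> complex) \<Rightarrow> real \<Rightarrow> complex" where
  "fourier \<phi> = (\<lambda>\<xi>. LINT x|lborel. cis (- (x * \<xi>)) * \<phi> x)"

text \<open>A tempered distribution is a functional on all functions of which only the values on
  Schwartz functions matter. Continuity is expressed through the Schwartz seminorms.\<close>

type_synonym distr = "(real \<Rightarrow> complex) \<Rightarrow> complex"

definition tempered :: "distr \<Rightarrow> bool" where
  "tempered f \<longleftrightarrow>
     (\<forall>\<phi>\<in>schwartz. \<forall>\<psi>\<in>schwartz. f (\<lambda>x. \<phi> x + \<psi> x) = f \<phi> + f \<psi>) \<and>
     (\<forall>\<phi>\<in>schwartz. \<forall>c. f (\<lambda>x. c * \<phi> x) = c * f \<phi>) \<and>
     (\<exists>C N. \<forall>\<phi>\<in>schwartz. cmod (f \<phi>) \<le> C * (\<Sum>k\<le>N. \<Sum>m\<le>N. schwartz_seminorm k m \<phi>))"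

text \<open>The distributional Fourier transform of \<open>f\<close> sends \<open>\<phi>\<close> to \<open>f (fourier \<phi>)\<close>;
  the predicate says that it is (integration against) the function \<open>g\<close>.\<close>

definition has_fourier_transform :: "distr \<Rightarrow> (real \<Rightarrow> complex) \<Rightarrow> bool" where
  "has_fourier_transform f g \<longleftrightarrow>
     g \<in> borel_measurable lborel \<and>
     (\<forall>\<phi>\<in>schwartz. integrable lborel (\<lambda>\<xi>. g \<xi> * \<phi> \<xi>) \<and>
        f (fourier \<phi>) = (LINT \<xi>|lborel. g \<xi> * \<phi> \<xi>))"

text \<open>Such a \<open>g\<close> is unique up to null sets, and only integrals of it are used below, so the choice
  of representative is immaterial.\<close>

definition fhat :: "distr \<Rightarrow> real \<Rightarrow> complex" where
  "fhat f = (SOME g. has_fourier_transform f g)"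

text \<open>Distributions are used, rather than square integrable functions, because the exponent
  \<open>s\<close> may be negative.\<close>

definition sobolev :: "real \<Rightarrow> distr set" where
  "sobolev s = {f. tempered f \<and> (\<exists>g. has_fourier_transform f g) \<and>
     integrable lborel (\<lambda>\<xi>. ((1 + \<xi>\<^sup>2) powr (s / 2) * cmod (fhat f \<xi>))\<^sup>2)}"

section \<open>The operator along a curve\<close>

definition U_integrand ::
    "(real \<Rightarrow> real \<Rightarrow> real) \<Rightarrow> distr \<Rightarrow> real \<Rightarrow> real \<Rightarrow> real \<Rightarrow> complex" where
  "U_integrand \<gamma> f x t \<xi> = cis (\<gamma> x t * \<xi> + t * \<bar>\<xi>\<bar>\<^sup>2) * fhat f \<xi>"

definition U_partial ::
    "(real \<Rightarrow> real \<Rightarrow> real) \<Rightarrow> distr \<Rightarrow> real \<Rightarrow> real \<Rightarrow> nat \<Rightarrow> complex" where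
  "U_partial \<gamma> f x t k = (LINT \<xi>:{\<xi>. \<bar>\<xi>\<bar> \<le> 2 ^ k}|lborel. U_integrand \<gamma> f x t \<xi>)"

definition U :: "(real \<Rightarrow> real \<Rightarrow> real) \<Rightarrow> distr \<Rightarrow> real \<Rightarrow> real \<Rightarrow> complex" where
  "U \<gamma> f x t = complex_of_real (1 / (2 * pi)) *
     (if integrable lborel (fhat f) then (LINT \<xi>|lborel. U_integrand \<gamma> f x t \<xi>)
      else lim (U_partial \<gamma> f x t))"

text \<open>\<open>lim\<close> is an arbitrary value when the limit does not exist, so existence is tracked
  separately.\<close>

definition U_exists :: "(real \<Rightarrow> real \<Rightarrow> real) \<Rightarrow> distr \<Rightarrow> real \<Rightarrow> real \<Rightarrow> bool" where
  "U_exists \<gamma> f x t \<longleftrightarrow> integrable lborel (fhat f) \<or> convergent (U_partial \<gamma> f x t)"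

text \<open>For almost every \<open>x\<close>, the quotient is meaningful for all small \<open>t > 0\<close> and tends to zero;
  \<open>f(x)\<close> is \<open>U \<gamma> f x 0\<close>.\<close>

definition pointwise_rate ::
    "(real \<Rightarrow> real \<Rightarrow> real) \<Rightarrow> real \<Rightarrow> distr \<Rightarrow> bool" where
  "pointwise_rate \<gamma> \<delta> f \<longleftrightarrow>
     (AE x in lborel.
        U_exists \<gamma> f x 0 \<and> (\<forall>\<^sub>F t in at_right 0. U_exists \<gamma> f x t) \<and>
        ((\<lambda>t. (U \<gamma> f x t - U \<gamma> f x 0) / complex_of_real (t powr \<delta>)) \<longlongrightarrow> 0) (at_right 0))"

section \<open>Curves and the critical exponent\<close>

definition bilipschitz_in_x :: "(real \<Rightarrow> real \<Rightarrow> real) \<Rightarrow> bool" where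
  "bilipschitz_in_x \<gamma> \<longleftrightarrow>
     (\<exists>C1 > 0. \<exists>C2 > 0. \<forall>t\<in>{-1..1}. \<forall>x x'.
        1 / C1 * \<bar>x - x'\<bar> \<le> \<bar>\<gamma> x t - \<gamma> x' t\<bar> \<and> \<bar>\<gamma> x t - \<gamma> x' t\<bar> \<le> C2 * \<bar>x - x'\<bar>)"

definition hoelder_in_t :: "real \<Rightarrow> (real \<Rightarrow> real \<Rightarrow> real) \<Rightarrow> bool" where
  "hoelder_in_t \<alpha> \<gamma> \<longleftrightarrow>
     (\<exists>C3 > 0. \<forall>x. \<forall>t\<in>{-1..1}. \<forall>t'\<in>{-1..1}. \<bar>\<gamma> x t - \<gamma> x t'\<bar> \<le> C3 * \<bar>t - t'\<bar> powr \<alpha>)"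

text \<open>A map on the strip is a curried total function whose values for \<open>t\<close> outside \<open>{-1..1}\<close>
  are ignored.\<close>

definition admissible_curve :: "real \<Rightarrow> (real \<Rightarrow> real \<Rightarrow> real) \<Rightarrow> bool" where
  "admissible_curve \<alpha> \<gamma> \<longleftrightarrow>
     continuous_on (UNIV \<times> {-1..1}) (\<lambda>(x, t). \<gamma> x t) \<and> (\<forall>x. \<gamma> x 0 = x) \<and>
     bilipschitz_in_x \<gamma> \<and> hoelder_in_t \<alpha> \<gamma>"

definition s_crit :: "real \<Rightarrow> real \<Rightarrow> real" where
  "s_crit \<alpha> \<delta> =
     (if \<delta> \<le> \<alpha> - 1/4 then 1/4 + \<delta>
      else if \<delta> < \<alpha> / 2 then 1/2 - \<alpha> + 2 * \<delta>
      else \<delta> / \<alpha>)"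

end

theory Submission
  imports Defs "HOL-Probability.Probability" "HOL-Real_Asymp.Real_Asymp"
begin

text \<open>
  For the positive part, \<open>f\<close> is cut into dyadic frequency pieces \<open>\<bar>\<xi>\<bar> \<approx> 2\<^sup>k\<close> and the times into dyadic
  ranges \<open>t \<approx> 2\<^sup>-\<^sup>j\<close>. A maximal function over finitely many times is linearised by a measurable choice of
  \<open>t\<close>, and the \<open>TT\<^sup>*\<close> method with a Gaussian frequency weight reduces its \<open>L\<^sup>2\<close> bound to a Schur test
  for an explicit chirped Gaussian kernel. For \<open>t \<ge> 2\<^sup>-\<^sup>k\<^sup>/\<^sup>\<alpha>\<close> the kernel decays because two points are
  separated either in space or, through the Hoelder condition, in time; for shorter times the difference
  \<open>U f(x,t) - f(x)\<close> is an average of derivatives along the segment from \<open>(x,0)\<close> to \<open>(\<gamma>(x,t),t)\<close>. Above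
  the critical exponent all bounds decay geometrically in \<open>k + j\<close>, so almost everywhere the pieces sum up
  to \<open>o(t\<^sup>\<delta>)\<close>.

  For the negative part, the curve is \<open>x\<close> if \<open>\<delta> \<le> \<alpha> - 1/4\<close> and \<open>x + \<bar>t\<bar>\<^sup>\<alpha>\<close> otherwise. A Gaussian times a
  Dirichlet kernel with \<open>K\<close> frequencies of spacing \<open>\<omega>\<close> is, at times \<open>T\<close> with \<open>T (K \<omega>)\<^sup>2\<close> small, transported
  rigidly to \<open>\<gamma>(x,t) + 2 t \<nu>\<close>, where \<open>\<nu>\<close> is its frequency shift. Either the group velocity \<open>\<nu>\<close> or the curve
  moves this point through a whole period \<open>2 \<pi> / \<omega>\<close>, so that it meets a peak and a zero of the kernel. A sparse series of
  such blocks violates the rate on \<open>[0,1]\<close>.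
\<close>

section \<open>Chirped Gaussians\<close>

text \<open>The three branches of the exponent belong to three times at frequency N. At time 1/N the
  group velocity carries a wave over a distance of order one, which gives 1/4 + \<delta>. At time
  N^(-2) dispersion is about to set in and the curve has moved by N^(-2 \<alpha>), which gives 1/2 -
  \<alpha> + 2 \<delta>. At time N^(-1/\<alpha>) the curve has moved by one wavelength 1/N, which
  gives \<delta>/\<alpha>. With time N^(-\<beta>) the examples on the moving curve reach 1/2 +
  \<beta> (\<delta> - \<alpha>/2). This is linear in \<beta>, so only the endpoints 2 and 1/\<alpha>
  matter, and they exchange roles at \<delta> = \<alpha>/2. A Gaussian weight is preferred to a
  sharp frequency cutoff because the modulus of the resulting kernel is an explicit function of the
  displacement and of the time difference. Of the curve, the kernel bounds then use only a lower
  bound for the displacement, which follows from the Lipschitz and Hoelder conditions by the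
  triangle inequality.\<close>

lemma integrable_power_gauss:
  fixes c :: real
  assumes "0 < c"
  shows "integrable lborel (\<lambda>x. x ^ k * exp (- c * x\<^sup>2))"
proof -
  let ?s = "1 / sqrt (2 * c)"
  have "integrable lborel (\<lambda>x. sqrt (2 * pi * ?s\<^sup>2) * (normal_density 0 ?s x * (x - 0) ^ k))"
    using assms by (intro integrable_mult_right integrable_normal_moment) auto
  also have "(\<lambda>x. sqrt (2 * pi * ?s\<^sup>2) * (normal_density 0 ?s x * (x - 0) ^ k)) =
      (\<lambda>x. x ^ k * exp (- c * x\<^sup>2))"
    using assms by (auto simp: normal_density_def fun_eq_iff power_divide field_simps)
  finally show ?thesis .
qed

lemma integrable_gauss:
  fixes c :: real
  assumes "0 < c"
  shows "integrable lborel (\<lambda>x. exp (- c * x\<^sup>2))"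
  using integrable_power_gauss[OF assms, of 0] by simp

lemma integrable_gauss_shift:
  fixes c m :: real
  assumes "0 < c"
  shows "integrable lborel (\<lambda>x. exp (- c * (x - m)\<^sup>2))"
  using lborel_integrable_real_affine[OF integrable_gauss[OF assms], of 1 "-m"] by simp

lemma integrable_cis_mult:
  fixes f :: "real \<Rightarrow> complex"
  assumes "integrable M f" "p \<in> borel_measurable M"
  shows "integrable M (\<lambda>x. cis (p x) * f x)"
proof (rule Bochner_Integration.integrable_bound[OF assms(1)])
  have [measurable]: "p \<in> borel_measurable M" "f \<in> borel_measurable M" using assms by auto
  show "(\<lambda>x. cis (p x) * f x) \<in> borel_measurable M" unfolding cis_conv_exp by measurable
qed (simp add: norm_mult)

text \<open>Rescaling by the standard deviation \<open>s\<close> reduces this to the characteristic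
  function of the standard normal law.\<close>

lemma fourier_gauss:
  fixes a c :: real
  assumes c: "0 < c"
  shows "(LINT x|lborel. cis (a * x) * complex_of_real (exp (- c * x\<^sup>2))) =
     complex_of_real (sqrt (pi / c) * exp (- a\<^sup>2 / (4 * c)))"
proof -
  define s where "s = 1 / sqrt (2 * c)"
  have s: "s > 0" using c by (simp add: s_def)
  have "char std_normal_distribution (a * s) =
      (LINT x|lborel. std_normal_density x *\<^sub>R cis (a * s * x))"
    unfolding char_def by (subst integral_density) (auto simp: cis_conv_exp algebra_simps)
  then have 1: "(LINT x|lborel. std_normal_density x *\<^sub>R cis (a * s * x)) =
      complex_of_real (exp (- ((a * s)\<^sup>2) / 2))"
    by (simp add: char_std_normal_distribution)
  have "(LINT x|lborel. cis (a * x) * complex_of_real (exp (- c * x\<^sup>2))) =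
     \<bar>s\<bar> *\<^sub>R (LINT x|lborel. cis (a * (0 + s * x)) * complex_of_real (exp (- c * (0 + s * x)\<^sup>2)))"
    using s by (intro lborel_integral_real_affine) auto
  also have "(\<lambda>x. cis (a * (0 + s * x)) * complex_of_real (exp (- c * (0 + s * x)\<^sup>2))) =
      (\<lambda>x. complex_of_real (sqrt (2 * pi)) * (std_normal_density x *\<^sub>R cis (a * s * x)))"
    using c by (auto simp: std_normal_density_def s_def power_divide power_mult_distrib fun_eq_iff
        scaleR_conv_of_real mult_ac)
  finally have "(LINT x|lborel. cis (a * x) * complex_of_real (exp (- c * x\<^sup>2))) =
     complex_of_real (s * sqrt (2 * pi) * exp (- ((a * s)\<^sup>2) / 2))"
    using s by (simp only: integral_mult_right_zero 1) (simp add: scaleR_conv_of_real)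
  also have "s * sqrt (2 * pi) = sqrt (pi / c)"
    using c by (simp add: s_def real_sqrt_mult real_sqrt_divide)
  also have "- ((a * s)\<^sup>2) / 2 = - a\<^sup>2 / (4 * c)"
    using c by (simp add: s_def power_divide power_mult_distrib)
  finally show ?thesis by simp
qed

lemma fourier_gauss_shift:
  fixes a c m :: real
  assumes c: "0 < c"
  shows "(LINT x|lborel. cis (a * x) * complex_of_real (exp (- c * (x - m)\<^sup>2))) =
     cis (a * m) * complex_of_real (sqrt (pi / c) * exp (- a\<^sup>2 / (4 * c)))"
proof -
  have "(LINT x|lborel. cis (a * x) * complex_of_real (exp (- c * (x - m)\<^sup>2))) =
     \<bar>1\<bar> *\<^sub>R (LINT x|lborel. cis (a * (m + 1 * x)) * complex_of_real (exp (- c * ((m + 1 * x) - m)\<^sup>2)))"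
    by (intro lborel_integral_real_affine) auto
  also have "\<dots> = (LINT x|lborel. cis (a * m) * (cis (a * x) * complex_of_real (exp (- c * x\<^sup>2))))"
    by (simp add: cis_mult distrib_left mult.assoc[symmetric])
  also have "\<dots> = cis (a * m) * complex_of_real (sqrt (pi / c) * exp (- a\<^sup>2 / (4 * c)))"
    using fourier_gauss[OF c, of a] by simp
  finally show ?thesis .
qed

text \<open>The Fourier integral at \<open>a\<close> of a Gaussian with the complex rate w - i b. It
  is the TT* kernel, with \<open>a\<close> and \<open>b\<close> the differences of position and
  time, and later also the evolved profile of a single Gaussian packet.\<close>

definition chirp_gauss :: "real \<Rightarrow> real \<Rightarrow> real \<Rightarrow> complex" where
  "chirp_gauss w a b = (LINT x|lborel. cis (a * x + b * x\<^sup>2) * complex_of_real (exp (- w * x\<^sup>2)))"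

lemma integrable_chirp_gauss:
  assumes "0 < w"
  shows "integrable lborel (\<lambda>x. cis (a * x + b * x\<^sup>2) * complex_of_real (exp (- w * x\<^sup>2)))"
  using integrable_gauss[OF assms] by (intro integrable_cis_mult) auto

text \<open>The square of the modulus is a double integral in which the chirps cancel up to a linear
  phase after translating one variable by the other; two real Gaussian integrals remain.\<close>

lemma norm_chirp_gauss:
  assumes w: "0 < w"
  shows "(cmod (chirp_gauss w a b))\<^sup>2 =
    pi / sqrt (w\<^sup>2 + b\<^sup>2) * exp (- a\<^sup>2 * w / (2 * (w\<^sup>2 + b\<^sup>2)))"
proof -
  define h where "h x = cis (a * x + b * x\<^sup>2) * complex_of_real (exp (- w * x\<^sup>2))" for x
  have hi: "integrable lborel h" unfolding h_def by (rule integrable_chirp_gauss[OF w])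
  have hm[measurable]: "h \<in> borel_measurable borel" using hi by auto
  have nh: "cmod (h x) = exp (- w * x\<^sup>2)" for x by (simp add: h_def norm_mult)
  define k where "k = (\<lambda>(u, y). cis (a * u + b * u\<^sup>2 + 2 * b * u * y) *
      complex_of_real (exp (- w * ((y + u)\<^sup>2 + y\<^sup>2))))"
  have hk: "h (y + u) * cnj (h y) = k (u, y)" for u y
  proof -
    have "h (y + u) * cnj (h y) = (cis (a * (y + u) + b * (y + u)\<^sup>2) * cis (- (a * y + b * y\<^sup>2))) *
        complex_of_real (exp (- w * (y + u)\<^sup>2) * exp (- w * y\<^sup>2))"
      by (simp add: h_def cis_cnj)
    also have "cis (a * (y + u) + b * (y + u)\<^sup>2) * cis (- (a * y + b * y\<^sup>2)) =
        cis (a * u + b * u\<^sup>2 + 2 * b * u * y)"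
      unfolding cis_mult by (rule arg_cong[where f=cis]) (simp add: power2_eq_square algebra_simps)
    also have "exp (- w * (y + u)\<^sup>2) * exp (- w * y\<^sup>2) = exp (- w * ((y + u)\<^sup>2 + y\<^sup>2))"
      unfolding exp_add[symmetric] by (simp add: distrib_left)
    finally show ?thesis by (simp add: k_def)
  qed
  have km[measurable]: "k \<in> borel_measurable (lborel \<Otimes>\<^sub>M lborel)"
    unfolding k_def cis_conv_exp by measurable
  have c2: "complex_of_real ((cmod (chirp_gauss w a b))\<^sup>2) =
      (LINT y|lborel. (LINT u|lborel. k (u, y)))"
  proof -
    have "complex_of_real ((cmod (chirp_gauss w a b))\<^sup>2) = integral\<^sup>L lborel h * cnj (integral\<^sup>L lborel h)"
      unfolding chirp_gauss_def h_def[abs_def] complex_norm_square[symmetric] of_real_power[symmetric] ..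
    also have "\<dots> = (LINT y|lborel. integral\<^sup>L lborel h * cnj (h y))"
      using hi by simp
    also have "\<dots> = (LINT y|lborel. (LINT u|lborel. k (u, y)))"
    proof (rule Bochner_Integration.integral_cong[OF refl])
      fix y
      have "integral\<^sup>L lborel h = (LINT u|lborel. h (y + u))"
        using lborel_integral_real_affine[of 1 h y] by simp
      then have "integral\<^sup>L lborel h * cnj (h y) = (LINT u|lborel. h (y + u) * cnj (h y))"
        by simp
      then show "integral\<^sup>L lborel h * cnj (h y) = (LINT u|lborel. k (u, y))" by (simp add: hk)
    qed
    finally show ?thesis .
  qed
  have ki: "integrable (lborel \<Otimes>\<^sub>M lborel) k"
  proof (rule lborel_pair.Fubini_integrable)
    have sq: "(y + u)\<^sup>2 + y\<^sup>2 = 2 * (y - (- u / 2))\<^sup>2 + u\<^sup>2 / 2" for y u :: real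
      by (simp add: power2_eq_square algebra_simps)
    have eq: "norm (k (u, y)) = exp (- w / 2 * u\<^sup>2) * exp (- (2 * w) * (y - (- u / 2))\<^sup>2)" for u y
      unfolding k_def sq by (simp add: norm_mult exp_add[symmetric] algebra_simps)
    have "(LINT y|lborel. exp (- (2 * w) * (y - m)\<^sup>2)) = sqrt (pi / (2 * w))" for m
    proof -
      have "complex_of_real (LINT y|lborel. exp (- (2 * w) * (y - m)\<^sup>2)) =
          (LINT y|lborel. cis (0 * y) * complex_of_real (exp (- (2 * w) * (y - m)\<^sup>2)))"
        by (simp add: integral_complex_of_real)
      also have "\<dots> = complex_of_real (sqrt (pi / (2 * w)))"
        using w by (subst fourier_gauss_shift) auto
      finally show ?thesis by (simp only: of_real_eq_iff)
    qed
    then have "(\<lambda>u. LINT y|lborel. norm (k (u, y))) = (\<lambda>u. exp (- w / 2 * u\<^sup>2) * sqrt (pi / (2 * w)))"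
      unfolding eq integral_mult_right_zero by metis
    then show "integrable lborel (\<lambda>u. LINT y|lborel. norm (k (u, y)))"
      using integrable_gauss[of "w/2"] w by auto
    show "AE u in lborel. integrable lborel (\<lambda>y. k (u, y))"
    proof (intro AE_I2)
      fix u
      have "integrable lborel (\<lambda>y. norm (k (u, y)))"
        unfolding eq using w by (intro integrable_mult_right integrable_gauss_shift) auto
      then show "integrable lborel (\<lambda>y. k (u, y))"
        by (rule integrable_norm_cancel) simp
    qed
  qed simp
  \<comment> \<open>In \<open>y\<close> the integrand is a shifted Gaussian with the linear phase 2
    b u y. Its transform contributes the factor exp(-b^2 u^2/(2 w)), which turns the remaining
    integral in \<open>u\<close> into a Gaussian of rate w/2 + b^2/(2 w).\<close>
  have "(LINT y|lborel. (LINT u|lborel. k (u, y))) = (LINT u|lborel. (LINT y|lborel. k (u, y)))"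
    using lborel_pair.Fubini_integral[of "\<lambda>u y. k (u, y)"] ki by simp
  also have "\<dots> = (LINT u|lborel. cis (a * u) * complex_of_real (exp (- (w / 2 + b\<^sup>2 / (2 * w)) * u\<^sup>2))
      * complex_of_real (sqrt (pi / (2 * w))))"
  proof (rule Bochner_Integration.integral_cong[OF refl])
    fix u
    have "k (u, y) = cis (a * u + b * u\<^sup>2) * complex_of_real (exp (- w / 2 * u\<^sup>2)) *
        (cis (2 * b * u * y) * complex_of_real (exp (- (2 * w) * (y - (- u / 2))\<^sup>2)))" for y
    proof -
      have sq: "(y + u)\<^sup>2 + y\<^sup>2 = 2 * (y - (- u / 2))\<^sup>2 + u\<^sup>2 / 2"
        by (simp add: power2_eq_square algebra_simps)
      have "exp (- w * ((y + u)\<^sup>2 + y\<^sup>2)) = exp (- w / 2 * u\<^sup>2) * exp (- (2 * w) * (y - (- u / 2))\<^sup>2)"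
        unfolding sq by (simp add: exp_add[symmetric] algebra_simps)
      then show ?thesis unfolding k_def by (simp add: cis_mult[symmetric] mult_ac)
    qed
    then have "(LINT y|lborel. k (u, y)) = cis (a * u + b * u\<^sup>2) * complex_of_real (exp (- w / 2 * u\<^sup>2)) *
        (LINT y|lborel. (cis (2 * b * u * y) * complex_of_real (exp (- (2 * w) * (y - (- u / 2))\<^sup>2))))"
      by simp
    also have "\<dots> = cis (a * u + b * u\<^sup>2) * complex_of_real (exp (- w / 2 * u\<^sup>2)) *
        (cis (2 * b * u * (- u / 2)) * complex_of_real (sqrt (pi / (2 * w)) *
          exp (- (2 * b * u)\<^sup>2 / (4 * (2 * w)))))"
      using w by (subst fourier_gauss_shift) auto
    also have "\<dots> = (cis (a * u + b * u\<^sup>2) * cis (2 * b * u * (- u / 2))) *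
       complex_of_real (exp (- w / 2 * u\<^sup>2) * exp (- (2 * b * u)\<^sup>2 / (4 * (2 * w)))) *
       complex_of_real (sqrt (pi / (2 * w)))"
      by (simp add: mult_ac)
    also have "cis (a * u + b * u\<^sup>2) * cis (2 * b * u * (- u / 2)) = cis (a * u)"
      by (simp add: cis_mult power2_eq_square)
    also have "exp (- w / 2 * u\<^sup>2) * exp (- (2 * b * u)\<^sup>2 / (4 * (2 * w))) =
        exp (- (w / 2 + b\<^sup>2 / (2 * w)) * u\<^sup>2)"
      using w by (simp add: exp_add[symmetric] power2_eq_square field_simps)
    finally show "(LINT y|lborel. k (u, y)) = cis (a * u) *
        complex_of_real (exp (- (w / 2 + b\<^sup>2 / (2 * w)) * u\<^sup>2)) * complex_of_real (sqrt (pi / (2 * w)))" .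
  qed
  also have "\<dots> = complex_of_real (sqrt (pi / (w / 2 + b\<^sup>2 / (2 * w))) *
      exp (- a\<^sup>2 / (4 * (w / 2 + b\<^sup>2 / (2 * w)))) * sqrt (pi / (2 * w)))"
    using w by (subst integral_mult_left_zero, subst fourier_gauss) (auto intro!: add_pos_nonneg)
  finally have c3: "(cmod (chirp_gauss w a b))\<^sup>2 = sqrt (pi / (w / 2 + b\<^sup>2 / (2 * w))) *
      exp (- a\<^sup>2 / (4 * (w / 2 + b\<^sup>2 / (2 * w)))) * sqrt (pi / (2 * w))"
    unfolding c2[symmetric] by (simp only: of_real_eq_iff)
  have e: "w / 2 + b\<^sup>2 / (2 * w) = (w\<^sup>2 + b\<^sup>2) / (2 * w)"
    using w by (simp add: field_simps power2_eq_square)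
  have r: "sqrt (pi / (w / 2 + b\<^sup>2 / (2 * w))) * sqrt (pi / (2 * w)) = pi / sqrt (w\<^sup>2 + b\<^sup>2)"
    unfolding e real_sqrt_mult[symmetric] using w
    by (simp add: real_sqrt_divide)
  have "sqrt (pi / (w / 2 + b\<^sup>2 / (2 * w))) * exp (- a\<^sup>2 / (4 * (w / 2 + b\<^sup>2 / (2 * w)))) *
      sqrt (pi / (2 * w)) = pi / sqrt (w\<^sup>2 + b\<^sup>2) * exp (- a\<^sup>2 / (4 * (w / 2 + b\<^sup>2 / (2 * w))))"
    unfolding r[symmetric] by (simp only: mult_ac)
  with c3 have c4: "(cmod (chirp_gauss w a b))\<^sup>2 =
      pi / sqrt (w\<^sup>2 + b\<^sup>2) * exp (- a\<^sup>2 / (4 * (w / 2 + b\<^sup>2 / (2 * w))))"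
    by (simp only:)
  have "- a\<^sup>2 / (4 * (w / 2 + b\<^sup>2 / (2 * w))) = - a\<^sup>2 * w / (2 * (w\<^sup>2 + b\<^sup>2))"
  proof -
    have "- a\<^sup>2 / (4 * (D / (2 * w))) = - a\<^sup>2 * w / (2 * D)" if "D > 0" for D
      using w that by (simp add: field_simps)
    from this[of "w\<^sup>2 + b\<^sup>2"] show ?thesis unfolding e using w by (metis add_pos_nonneg zero_le_power2 zero_less_power)
  qed
  with c4 show ?thesis by (simp only:)
qed

section \<open>Oscillatory integrals and the TT* estimate\<close>

text \<open>Up to the factor 2 pi, the free evolution with frequency profile \<open>g\<close> at
  position \<open>p\<close> and time \<open>q\<close>. Position and time are independent arguments
  so that both can later be measurable functions of a base point, as linearised suprema
  require.\<close>

definition osc :: "real \<Rightarrow> real \<Rightarrow> (real \<Rightarrow> complex) \<Rightarrow> complex" where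
  "osc p q g = (LINT \<xi>|lborel. cis (p * \<xi> + q * \<xi>\<^sup>2) * g \<xi>)"

lemma measurable_cis [measurable]: "cis \<in> borel_measurable borel"
  unfolding cis_conv_exp[abs_def] by measurable

lemma measurable_cnj [measurable]: "cnj \<in> borel_measurable borel"
  by (intro borel_measurable_continuous_onI continuous_intros)

text \<open>Integrability is not assumed: the integral of a function that is not integrable is 0 by
  default.\<close>

lemma norm_integral_le_nn_integral:
  fixes f :: "'a \<Rightarrow> 'b :: {banach, second_countable_topology}"
  shows "ennreal (norm (integral\<^sup>L M f)) \<le> (\<integral>\<^sup>+x. ennreal (norm (f x)) \<partial>M)"
  by (cases "integrable M f") (auto simp: integral_norm_bound_ennreal not_integrable_integral_eq)

lemma integrable_osc:
  "integrable lborel g \<Longrightarrow> integrable lborel (\<lambda>\<xi>. cis (p * \<xi> + q * \<xi>\<^sup>2) * g \<xi>)"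
  by (rule integrable_cis_mult) auto

lemma norm_osc_le: "cmod (osc p q g) \<le> (LINT \<xi>|lborel. cmod (g \<xi>))"
  unfolding osc_def by (rule order_trans[OF integral_norm_bound]) (simp add: norm_mult)

lemma measurable_osc:
  assumes [measurable]: "g \<in> borel_measurable borel" "p \<in> borel_measurable M" "q \<in> borel_measurable M"
  shows "(\<lambda>x. osc (p x) (q x) g) \<in> borel_measurable M"
  unfolding osc_def by measurable

text \<open>Fubini in the form of a duality: the map that sends \<open>h\<close> to the function x
  |-> osc (p x) (q x) h is paired with \<open>H\<close>, and the inner integral on the right is its
  transpose applied to \<open>H\<close>.\<close>

lemma osc_swap:
  fixes H h :: "real \<Rightarrow> complex" and p q :: "real \<Rightarrow> real"
  assumes H: "integrable lborel H" and h: "integrable lborel h"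
    and [measurable]: "p \<in> borel_measurable borel" "q \<in> borel_measurable borel"
  shows "(LINT x|lborel. H x * osc (p x) (q x) h) =
    (LINT \<xi>|lborel. h \<xi> * (LINT x|lborel. H x * cis (p x * \<xi> + q x * \<xi>\<^sup>2)))"
proof -
  have [measurable]: "H \<in> borel_measurable borel" "h \<in> borel_measurable borel" using H h by auto
  define f where "f = (\<lambda>(x, \<xi>). H x * cis (p x * \<xi> + q x * \<xi>\<^sup>2) * h \<xi>)"
  have [measurable]: "f \<in> borel_measurable (lborel \<Otimes>\<^sub>M lborel)" unfolding f_def by measurable
  have fi: "integrable (lborel \<Otimes>\<^sub>M lborel) f"
  proof (rule lborel_pair.Fubini_integrable)
    show "integrable lborel (\<lambda>x. LINT \<xi>|lborel. norm (f (x, \<xi>)))"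
      using H by (simp add: f_def norm_mult)
    show "AE x in lborel. integrable lborel (\<lambda>\<xi>. f (x, \<xi>))"
      using integrable_osc[OF h] by (auto simp: f_def mult.assoc)
  qed simp
  have "(LINT x|lborel. H x * osc (p x) (q x) h) = (LINT x|lborel. (LINT \<xi>|lborel. f (x, \<xi>)))"
    by (simp add: osc_def f_def mult.assoc)
  also have "\<dots> = (LINT \<xi>|lborel. (LINT x|lborel. f (x, \<xi>)))"
    using lborel_pair.Fubini_integral[of "\<lambda>x \<xi>. f (x, \<xi>)"] fi by simp
  also have "\<dots> = (LINT \<xi>|lborel. h \<xi> * (LINT x|lborel. H x * cis (p x * \<xi> + q x * \<xi>\<^sup>2)))"
    by (simp add: f_def mult.commute)
  finally show ?thesis .
qed

lemma cnj_chirp_gauss: "cnj (chirp_gauss w a b) = chirp_gauss w (- a) (- b)"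
proof -
  have "(\<lambda>x. cnj (cis (a * x + b * x\<^sup>2) * complex_of_real (exp (- w * x\<^sup>2)))) =
      (\<lambda>x. cis (- a * x + - b * x\<^sup>2) * complex_of_real (exp (- w * x\<^sup>2)))"
    by (auto simp: cis_cnj)
  then show ?thesis unfolding chirp_gauss_def Bochner_Integration.integral_cnj[symmetric]
    by simp
qed

lemma measurable_chirp_gauss [measurable (raw)]:
  assumes [measurable]: "a \<in> borel_measurable M" "b \<in> borel_measurable M"
  shows "(\<lambda>x. chirp_gauss w (a x) (b x)) \<in> borel_measurable M"
  unfolding chirp_gauss_def by measurable

text \<open>On the bounded support, |g| is at most 1 + |g|^2.\<close>

lemma square_integrable_imp_integrable:
  fixes g :: "real \<Rightarrow> complex"
  assumes [measurable]: "g \<in> borel_measurable borel" and g2: "integrable lborel (\<lambda>\<xi>. (cmod (g \<xi>))\<^sup>2)"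
    and supp: "\<And>\<xi>. g \<xi> \<noteq> 0 \<Longrightarrow> \<bar>\<xi>\<bar> \<le> N"
  shows "integrable lborel g"
proof (rule Bochner_Integration.integrable_bound)
  show "integrable lborel (\<lambda>\<xi>. indicat_real {-N..N} \<xi> + (cmod (g \<xi>))\<^sup>2)"
    using g2 by (intro Bochner_Integration.integrable_add integrable_real_indicator) (auto simp: emeasure_lborel_Icc_eq)
  show "AE \<xi> in lborel. norm (g \<xi>) \<le> norm (indicat_real {-N..N} \<xi> + (cmod (g \<xi>))\<^sup>2)"
  proof (intro AE_I2)
    fix \<xi>
    show "norm (g \<xi>) \<le> norm (indicat_real {-N..N} \<xi> + (cmod (g \<xi>))\<^sup>2)"
    proof (cases "g \<xi> = 0")
      case False
      then have "\<xi> \<in> {-N..N}" using supp[OF False] by auto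
      moreover have "cmod (g \<xi>) \<le> 1 + (cmod (g \<xi>))\<^sup>2"
        using zero_le_power2[of "cmod (g \<xi>) - 1"] norm_ge_zero[of "g \<xi>"]
        unfolding power2_diff one_power2 mult_1_right by linarith
      ultimately show ?thesis by simp
    qed simp
  qed
qed simp

text \<open>The \<open>TT\<^sup>*\<close> method with a Gaussian frequency weight, which keeps the kernel explicit, and
  Schur's test.\<close>

proposition osc_TTstar:
  fixes g :: "real \<Rightarrow> complex" and p q :: "real \<Rightarrow> real"
  assumes N: "0 < N" and B[measurable]: "B \<in> sets borel" and Bf: "emeasure lborel B < \<infinity>"
    and pq[measurable]: "p \<in> borel_measurable borel" "q \<in> borel_measurable borel"
    and g[measurable]: "g \<in> borel_measurable borel" and g2: "integrable lborel (\<lambda>\<xi>. (cmod (g \<xi>))\<^sup>2)"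
    and supp: "\<And>\<xi>. g \<xi> \<noteq> 0 \<Longrightarrow> \<bar>\<xi>\<bar> \<le> N"
    and A: "0 < A"
    and schur: "\<And>x. x \<in> B \<Longrightarrow> (\<integral>\<^sup>+y\<in>B. ennreal (cmod (chirp_gauss (1 / N\<^sup>2) (p x - p y) (q x - q y))) \<partial>lborel) \<le> ennreal A"
  shows "(\<integral>\<^sup>+x\<in>B. ennreal ((cmod (osc (p x) (q x) g))\<^sup>2) \<partial>lborel)
     \<le> ennreal (exp 1 * A * (LINT \<xi>|lborel. (cmod (g \<xi>))\<^sup>2))"
proof -
  define w where "w = 1 / N\<^sup>2"
  have w: "w > 0" using N by (simp add: w_def)
  define F where "F x = osc (p x) (q x) g" for x
  have gi: "integrable lborel g" by (rule square_integrable_imp_integrable[OF g g2 supp])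
  have [measurable]: "F \<in> borel_measurable borel" unfolding F_def by (rule measurable_osc) auto
  define CF where "CF = (LINT \<xi>|lborel. cmod (g \<xi>))"
  have FC: "cmod (F x) \<le> CF" for x unfolding F_def CF_def by (rule norm_osc_le)
  \<comment> \<open>The function that realises the norm by duality: integrating \<open>H\<close>
    against \<open>F\<close> returns the square norm of \<open>F\<close> on \<open>B\<close>, which
    is \<open>X\<close>.\<close>
  define H where "H x = indicator B x * cnj (F x)" for x
  have [measurable]: "H \<in> borel_measurable borel" unfolding H_def[abs_def] by simp
  have Hb: "cmod (H x) \<le> CF * indicator B x" for x
    using FC[of x] by (simp add: H_def norm_mult split: split_indicator)
  have Bi: "integrable lborel (\<lambda>x. CF * indicat_real B x)"
    using Bf by (intro integrable_mult_right integrable_real_indicator) auto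
  have Hi: "integrable lborel H"
    by (rule Bochner_Integration.integrable_bound[OF Bi]) (use Hb in \<open>auto intro!: AE_I2 order_trans[OF Hb]\<close>)
  have H2i: "integrable lborel (\<lambda>x. (cmod (H x))\<^sup>2)"
  proof (rule Bochner_Integration.integrable_bound)
    show "integrable lborel (\<lambda>x. CF * cmod (H x))" using Hi by simp
    show "AE x in lborel. norm ((cmod (H x))\<^sup>2) \<le> norm (CF * cmod (H x))"
    proof (intro AE_I2)
      fix x
      have "cmod (H x) \<le> CF" using Hb[of x] order_trans[OF norm_ge_zero FC[of x]]
        by (simp split: split_indicator_asm)
      then show "norm ((cmod (H x))\<^sup>2) \<le> norm (CF * cmod (H x))"
        using order_trans[OF norm_ge_zero FC[of x]] by (simp add: power2_eq_square mult_right_mono)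
    qed
  qed simp
  define X where "X = (LINT x|lborel. (cmod (H x))\<^sup>2)"
  have X0: "0 \<le> X" unfolding X_def by simp
  have HF: "H x * F x = complex_of_real ((cmod (H x))\<^sup>2)" for x
    using complex_norm_square[of "F x"] by (cases "x \<in> B") (simp_all add: H_def mult.commute)
  define G where "G \<xi> = (LINT x|lborel. H x * cis (p x * \<xi> + q x * \<xi>\<^sup>2))" for \<xi>
  have [measurable]: "G \<in> borel_measurable borel" unfolding G_def by measurable
  define CG where "CG = (LINT x|lborel. cmod (H x))"
  have GC: "cmod (G \<xi>) \<le> CG" for \<xi>
    unfolding G_def CG_def by (rule order_trans[OF integral_norm_bound]) (simp add: norm_mult)
  \<comment> \<open>The additive 1 in the exponent makes the weight at least 1 for all frequencies
    up to \<open>N\<close>; it is the origin of the factor \<open>exp 1\<close> in the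
    bound.\<close>
  define wt where "wt \<xi> = exp (1 - w * \<xi>\<^sup>2)" for \<xi> :: real
  have [measurable]: "wt \<in> borel_measurable borel" unfolding wt_def[abs_def] by simp
  have wt0: "wt \<xi> > 0" for \<xi> by (simp add: wt_def)
  have wti: "integrable lborel wt"
    using integrable_mult_right[OF integrable_gauss[OF w], of "exp 1"]
    by (simp add: wt_def[abs_def] exp_diff exp_minus divide_inverse)
  have wt1: "wt \<xi> \<ge> 1" if "g \<xi> \<noteq> 0" for \<xi>
  proof -
    have "\<xi>\<^sup>2 \<le> N\<^sup>2" using supp[OF that] N by (meson abs_le_square_iff abs_of_pos order_trans abs_ge_self)
    then show ?thesis using N by (simp add: wt_def w_def)
  qed
  have wtGi: "integrable lborel (\<lambda>\<xi>. wt \<xi> * (cmod (G \<xi>))\<^sup>2)"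
  proof (rule Bochner_Integration.integrable_bound)
    show "integrable lborel (\<lambda>\<xi>. wt \<xi> * CG\<^sup>2)" using wti by simp
    show "AE \<xi> in lborel. norm (wt \<xi> * (cmod (G \<xi>))\<^sup>2) \<le> norm (wt \<xi> * CG\<^sup>2)"
      using GC wt0 by (auto intro!: AE_I2 mult_left_mono power_mono simp: abs_mult less_imp_le)
  qed simp
  define Y where "Y = (LINT \<xi>|lborel. wt \<xi> * (cmod (G \<xi>))\<^sup>2)"
  \<comment> \<open>The TT* step: \<open>Y\<close> is the weighted square norm of the transposed
    function \<open>G\<close>. Written as a double integral of \<open>H\<close> against the explicit
    kernel, it is controlled by the Schur hypothesis.\<close>
  have YX: "Y \<le> exp 1 * A * X"
  proof -
    have chirp_sym: "cmod (chirp_gauss w (p y - p x) (q y - q x)) = cmod (chirp_gauss w (p x - p y) (q x - q y))"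
      for x y using cnj_chirp_gauss[of w "p x - p y" "q x - q y"] by (metis complex_mod_cnj minus_diff_eq)
    define k where "k x y = ennreal (exp 1 * cmod (chirp_gauss w (p x - p y) (q x - q y)))" for x y
    have ksym: "k x y = k y x" for x y unfolding k_def by (simp add: chirp_sym[of x y])
    have [measurable]: "case_prod k \<in> borel_measurable (lborel \<Otimes>\<^sub>M lborel)"
      unfolding k_def by measurable
    define S where "S x = ennreal ((cmod (H x))\<^sup>2 / 2)" for x
    have [measurable]: "S \<in> borel_measurable borel" unfolding S_def by measurable
    have inner: "cnj (osc (p x) (q x) (\<lambda>\<xi>. wt \<xi> * cnj (G \<xi>))) =
        (LINT y|lborel. H y * (exp 1 * chirp_gauss w (p y - p x) (q y - q x)))" for x
    proof -
      have "cnj (osc (p x) (q x) (\<lambda>\<xi>. wt \<xi> * cnj (G \<xi>))) =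
          (LINT \<xi>|lborel. (cis (- (p x * \<xi> + q x * \<xi>\<^sup>2)) * wt \<xi>) * G \<xi>)"
        unfolding osc_def Bochner_Integration.integral_cnj[symmetric]
        by (simp add: cis_cnj mult.assoc)
      also have "\<dots> = (LINT y|lborel. H y * osc (p y) (q y) (\<lambda>\<xi>. cis (- (p x * \<xi> + q x * \<xi>\<^sup>2)) * wt \<xi>))"
        unfolding G_def using wti
        by (intro osc_swap[symmetric] Hi pq integrable_cis_mult) auto
      also have "(\<lambda>y. osc (p y) (q y) (\<lambda>\<xi>. cis (- (p x * \<xi> + q x * \<xi>\<^sup>2)) * wt \<xi>)) =
          (\<lambda>y. exp 1 * chirp_gauss w (p y - p x) (q y - q x))"
      proof
        fix y
        have "cis (p y * \<xi> + q y * \<xi>\<^sup>2) * (cis (- (p x * \<xi> + q x * \<xi>\<^sup>2)) * wt \<xi>) =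
          exp 1 * (cis ((p y - p x) * \<xi> + (q y - q x) * \<xi>\<^sup>2) * complex_of_real (exp (- w * \<xi>\<^sup>2)))" for \<xi>
        proof -
          have "cis (p y * \<xi> + q y * \<xi>\<^sup>2) * cis (- (p x * \<xi> + q x * \<xi>\<^sup>2)) =
              cis ((p y - p x) * \<xi> + (q y - q x) * \<xi>\<^sup>2)"
            unfolding cis_mult by (rule arg_cong[where f=cis]) (simp add: algebra_simps)
          moreover have "complex_of_real (wt \<xi>) = exp 1 * complex_of_real (exp (- w * \<xi>\<^sup>2))"
            by (simp add: wt_def exp_diff exp_minus divide_inverse flip: exp_of_real)
          ultimately show ?thesis by (simp add: mult.assoc[symmetric])
        qed
        then show "osc (p y) (q y) (\<lambda>\<xi>. cis (- (p x * \<xi> + q x * \<xi>\<^sup>2)) * wt \<xi>) =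
            exp 1 * chirp_gauss w (p y - p x) (q y - q x)"
          by (simp add: osc_def chirp_gauss_def)
      qed
      finally show ?thesis .
    qed
    have "integrable lborel (\<lambda>\<xi>. wt \<xi> * cnj (G \<xi>))"
    proof (rule Bochner_Integration.integrable_bound)
      show "integrable lborel (\<lambda>\<xi>. wt \<xi> * CG)" using wti by simp
      show "AE \<xi> in lborel. norm (wt \<xi> * cnj (G \<xi>)) \<le> norm (wt \<xi> * CG)"
        using GC wt0 by (auto intro!: AE_I2 mult_left_mono order_trans[OF GC abs_ge_self]
            simp: norm_mult abs_mult less_imp_le)
    qed simp
    then have "(LINT x|lborel. H x * osc (p x) (q x) (\<lambda>\<xi>. wt \<xi> * cnj (G \<xi>))) =
        (LINT \<xi>|lborel. wt \<xi> * cnj (G \<xi>) * G \<xi>)"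
      unfolding G_def by (intro osc_swap Hi pq) auto
    also have "\<dots> = complex_of_real Y"
      unfolding Y_def integral_complex_of_real[symmetric]
      by (rule Bochner_Integration.integral_cong) (auto simp: complex_norm_square simp flip: of_real_power)
    finally have "ennreal Y \<le> ennreal (cmod (LINT x|lborel. H x * osc (p x) (q x) (\<lambda>\<xi>. wt \<xi> * cnj (G \<xi>))))"
      by (intro ennreal_leI) simp
    also have "\<dots> \<le> (\<integral>\<^sup>+x. ennreal (cmod (H x * osc (p x) (q x) (\<lambda>\<xi>. wt \<xi> * cnj (G \<xi>)))) \<partial>lborel)"
      by (rule norm_integral_le_nn_integral)
    also have "\<dots> \<le> (\<integral>\<^sup>+x. \<integral>\<^sup>+y. S x * indicator B y * k x y + S y * indicator B x * k x y \<partial>lborel \<partial>lborel)"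
    proof (rule nn_integral_mono)
      fix x
      have "ennreal (cmod (H x * osc (p x) (q x) (\<lambda>\<xi>. wt \<xi> * cnj (G \<xi>)))) =
          ennreal (cmod (H x)) * ennreal (cmod (cnj (osc (p x) (q x) (\<lambda>\<xi>. wt \<xi> * cnj (G \<xi>)))))"
        by (simp add: norm_mult ennreal_mult)
      also have "\<dots> \<le> ennreal (cmod (H x)) * (\<integral>\<^sup>+y. ennreal (cmod (H y * (exp 1 * chirp_gauss w (p y - p x) (q y - q x)))) \<partial>lborel)"
        unfolding inner by (intro mult_left_mono norm_integral_le_nn_integral) simp
      also have "\<dots> = (\<integral>\<^sup>+y. ennreal (cmod (H x)) * ennreal (cmod (H y * (exp 1 * chirp_gauss w (p y - p x) (q y - q x)))) \<partial>lborel)"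
        by (intro nn_integral_cmult[symmetric]) measurable
      also have "\<dots> \<le> (\<integral>\<^sup>+y. S x * indicator B y * k x y + S y * indicator B x * k x y \<partial>lborel)"
      proof (rule nn_integral_mono)
        fix y
        \<comment> \<open>Schur's test in symmetric form: the product of the two values is split
          into half squares, and by \<open>ksym\<close> both halves give the same double
          integral.\<close>
        have "cmod (H x) * (cmod (H y) * (exp 1 * cmod (chirp_gauss w (p x - p y) (q x - q y)))) \<le>
            (cmod (H x))\<^sup>2 / 2 * indicat_real B y * (exp 1 * cmod (chirp_gauss w (p x - p y) (q x - q y))) +
            (cmod (H y))\<^sup>2 / 2 * indicat_real B x * (exp 1 * cmod (chirp_gauss w (p x - p y) (q x - q y)))"
        proof (cases "x \<in> B \<and> y \<in> B")
          case True
          have "cmod (H x) * cmod (H y) \<le> (cmod (H x))\<^sup>2 / 2 + (cmod (H y))\<^sup>2 / 2"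
            using zero_le_power2[of "cmod (H x) - cmod (H y)"] by (simp add: power2_diff)
          from mult_right_mono[OF this, of "exp 1 * cmod (chirp_gauss w (p x - p y) (q x - q y))"] True
          show ?thesis by (simp add: algebra_simps)
        qed (auto simp: H_def)
        then show "ennreal (cmod (H x)) * ennreal (cmod (H y * (exp 1 * chirp_gauss w (p y - p x) (q y - q x)))) \<le>
            S x * indicator B y * k x y + S y * indicator B x * k x y"
          unfolding S_def k_def chirp_sym[of x y] norm_mult
          by (simp add: ennreal_mult[symmetric] ennreal_plus[symmetric] ennreal_indicator[symmetric] ennreal_leI
            del: ennreal_plus)
      qed
      finally show "ennreal (cmod (H x * osc (p x) (q x) (\<lambda>\<xi>. wt \<xi> * cnj (G \<xi>)))) \<le>
          (\<integral>\<^sup>+y. S x * indicator B y * k x y + S y * indicator B x * k x y \<partial>lborel)" .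
    qed
    also have "\<dots> = (\<integral>\<^sup>+x. \<integral>\<^sup>+y. S x * indicator B y * k x y \<partial>lborel \<partial>lborel) +
        (\<integral>\<^sup>+x. \<integral>\<^sup>+y. S y * indicator B x * k x y \<partial>lborel \<partial>lborel)"
      by (simp add: nn_integral_add)
    also have "(\<integral>\<^sup>+x. \<integral>\<^sup>+y. S y * indicator B x * k x y \<partial>lborel \<partial>lborel) =
        (\<integral>\<^sup>+y. \<integral>\<^sup>+x. S y * indicator B x * k x y \<partial>lborel \<partial>lborel)"
      by (rule lborel_pair.Fubini'[symmetric]) measurable
    also have "\<dots> = (\<integral>\<^sup>+x. \<integral>\<^sup>+y. S x * indicator B y * k x y \<partial>lborel \<partial>lborel)"
      by (simp add: ksym)
    also have "(\<integral>\<^sup>+x. \<integral>\<^sup>+y. S x * indicator B y * k x y \<partial>lborel \<partial>lborel) \<le> (\<integral>\<^sup>+x. S x * (exp 1 * A) \<partial>lborel)"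
    proof (rule nn_integral_mono)
      fix x
      show "(\<integral>\<^sup>+y. S x * indicator B y * k x y \<partial>lborel) \<le> S x * (exp 1 * A)"
      proof (cases "x \<in> B")
        case True
        have "(\<integral>\<^sup>+y. S x * indicator B y * k x y \<partial>lborel) =
           (\<integral>\<^sup>+y. (S x * ennreal (exp 1)) * (ennreal (cmod (chirp_gauss (1 / N\<^sup>2) (p x - p y) (q x - q y))) * indicator B y) \<partial>lborel)"
          by (intro nn_integral_cong) (simp add: k_def w_def ennreal_mult mult_ac)
        also have "\<dots> = (S x * ennreal (exp 1)) * (\<integral>\<^sup>+y\<in>B. ennreal (cmod (chirp_gauss (1 / N\<^sup>2) (p x - p y) (q x - q y))) \<partial>lborel)"
          by (rule nn_integral_cmult) measurable
        also have "\<dots> \<le> (S x * ennreal (exp 1)) * ennreal A"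
          by (intro mult_left_mono schur True) simp
        finally show ?thesis using A by (simp add: ennreal_mult mult.assoc)
      qed (simp add: S_def H_def)
    qed
    also have "(\<integral>\<^sup>+x. S x * (exp 1 * A) \<partial>lborel) = ennreal (X / 2) * ennreal (exp 1 * A)"
    proof -
      have "(\<integral>\<^sup>+x. S x \<partial>lborel) = ennreal (X / 2)"
        unfolding S_def X_def using H2i by (subst nn_integral_eq_integral) auto
      then show ?thesis by (simp add: nn_integral_multc)
    qed
    finally have "ennreal Y \<le> ennreal (X / 2) * ennreal (exp 1 * A) + ennreal (X / 2) * ennreal (exp 1 * A)"
      by (simp add: add_mono)
    also have "\<dots> = ennreal (exp 1 * A * X)"
      using A X0 by (simp add: ennreal_mult[symmetric] ennreal_plus[symmetric] del: ennreal_plus)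
    finally show ?thesis using A X0 by (simp add: ennreal_le_iff)
  qed
  have "complex_of_real X = (LINT x|lborel. H x * F x)"
    unfolding HF X_def integral_complex_of_real ..
  also have "\<dots> = (LINT \<xi>|lborel. g \<xi> * G \<xi>)"
    unfolding F_def G_def by (rule osc_swap[OF Hi gi pq])
  finally have "X = cmod (LINT \<xi>|lborel. g \<xi> * G \<xi>)" using X0 by (metis abs_of_nonneg norm_of_real)
  also have "\<dots> \<le> (LINT \<xi>|lborel. cmod (g \<xi> * G \<xi>))" by (rule integral_norm_bound)
  \<comment> \<open>Arithmetic-geometric mean with the ratio e A. By \<open>YX\<close> the second
    term then integrates to at most X/2, which is absorbed on the left.\<close>
  also have "\<dots> \<le> (LINT \<xi>|lborel. (exp 1 * A) / 2 * (cmod (g \<xi>))\<^sup>2 + 1 / (2 * (exp 1 * A)) * (wt \<xi> * (cmod (G \<xi>))\<^sup>2))"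
  proof (rule integral_mono_AE')
    show "integrable lborel (\<lambda>\<xi>. (exp 1 * A) / 2 * (cmod (g \<xi>))\<^sup>2 + 1 / (2 * (exp 1 * A)) * (wt \<xi> * (cmod (G \<xi>))\<^sup>2))"
      using g2 wtGi by auto
    show "AE \<xi> in lborel. cmod (g \<xi> * G \<xi>) \<le> (exp 1 * A) / 2 * (cmod (g \<xi>))\<^sup>2 + 1 / (2 * (exp 1 * A)) * (wt \<xi> * (cmod (G \<xi>))\<^sup>2)"
    proof (intro AE_I2)
      fix \<xi>
      define L where "L = exp 1 * A"
      have L: "L > 0" using A by (simp add: L_def)
      have am: "u * v \<le> L / 2 * u\<^sup>2 + 1 / (2 * L) * v\<^sup>2" for u v
      proof -
        have "0 \<le> (L * u - v)\<^sup>2 / (2 * L)" using L by simp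
        also have "\<dots> = L / 2 * u\<^sup>2 + 1 / (2 * L) * v\<^sup>2 - u * v"
          using L by (simp add: power2_eq_square field_simps)
        finally show ?thesis by simp
      qed
      show "cmod (g \<xi> * G \<xi>) \<le> (exp 1 * A) / 2 * (cmod (g \<xi>))\<^sup>2 + 1 / (2 * (exp 1 * A)) * (wt \<xi> * (cmod (G \<xi>))\<^sup>2)"
      proof (cases "g \<xi> = 0")
        case True then show ?thesis using A wt0[of \<xi>] by simp
      next
        case False
        have "1 * (cmod (G \<xi>))\<^sup>2 \<le> wt \<xi> * (cmod (G \<xi>))\<^sup>2" by (intro mult_right_mono wt1 False) auto
        then have "1 / (2 * L) * (cmod (G \<xi>))\<^sup>2 \<le> 1 / (2 * L) * (wt \<xi> * (cmod (G \<xi>))\<^sup>2)"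
          using L by (intro mult_left_mono) auto
        with am[of "cmod (g \<xi>)" "cmod (G \<xi>)"] show ?thesis by (simp add: norm_mult L_def)
      qed
    qed
  qed (use A wt0 in \<open>auto intro!: AE_I2 add_nonneg_nonneg simp: less_imp_le\<close>)
  also have "\<dots> = (exp 1 * A) / 2 * (LINT \<xi>|lborel. (cmod (g \<xi>))\<^sup>2) + 1 / (2 * (exp 1 * A)) * Y"
    using g2 wtGi by (simp add: Y_def)
  also have "\<dots> \<le> (exp 1 * A) / 2 * (LINT \<xi>|lborel. (cmod (g \<xi>))\<^sup>2) + X / 2"
    using mult_left_mono[OF YX, of "1 / (2 * (exp 1 * A))"] A by simp
  finally have "X \<le> exp 1 * A * (LINT \<xi>|lborel. (cmod (g \<xi>))\<^sup>2)" by simp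
  moreover have "(\<integral>\<^sup>+x\<in>B. ennreal ((cmod (osc (p x) (q x) g))\<^sup>2) \<partial>lborel) = ennreal X"
    unfolding X_def using H2i
    by (subst nn_integral_eq_integral[symmetric])
      (auto intro!: nn_integral_cong simp: H_def F_def norm_mult split: split_indicator)
  ultimately show ?thesis by (simp add: ennreal_leI)
qed

section \<open>Kernel bounds\<close>

text \<open>\<open>Q\<close> is comparable to the larger of N^(-2) and |b|. The kernel has height of
  order Q^(-1/2) and spatial width of order N Q: up to the time N^(-2) it is a bump of width 1/N,
  afterwards it spreads with the group velocity.\<close>

lemma norm_chirp_gauss_Q:
  assumes N: "0 < N" and Q: "Q = sqrt (1 / N ^ 4 + b\<^sup>2)"
  shows "cmod (chirp_gauss (1 / N\<^sup>2) a b) = sqrt (pi / Q) * exp (- a\<^sup>2 / (4 * N\<^sup>2 * Q\<^sup>2))"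
proof -
  have Q0: "Q > 0" unfolding Q using N by (intro real_sqrt_gt_zero add_pos_nonneg) auto
  have Q2: "(1 / N\<^sup>2)\<^sup>2 + b\<^sup>2 = Q\<^sup>2" using N unfolding Q by (simp add: power_divide flip: power_mult)
  have "(cmod (chirp_gauss (1 / N\<^sup>2) a b))\<^sup>2 = pi / sqrt (Q\<^sup>2) * exp (- a\<^sup>2 * (1 / N\<^sup>2) / (2 * Q\<^sup>2))"
    using norm_chirp_gauss[of "1 / N\<^sup>2" a b] N unfolding Q2 by simp
  also have "\<dots> = (sqrt (pi / Q) * exp (- a\<^sup>2 / (4 * N\<^sup>2 * Q\<^sup>2)))\<^sup>2"
    using Q0 by (simp add: power_mult_distrib exp_double[symmetric] field_simps)
  finally show ?thesis using Q0 by (simp add: power2_eq_iff_nonneg)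
qed

lemma norm_chirp_gauss_le_N:
  assumes N: "0 < N"
  shows "cmod (chirp_gauss (1 / N\<^sup>2) a b) \<le> 2 * N"
proof -
  define Q where "Q = sqrt (1 / N ^ 4 + b\<^sup>2)"
  have "sqrt (1 / N ^ 4) \<le> Q" unfolding Q_def by (rule real_sqrt_le_mono) simp
  moreover have "sqrt (1 / N ^ 4) = 1 / N\<^sup>2"
    using N by (intro real_sqrt_unique) (auto simp: power_divide simp flip: power_mult)
  ultimately have Q: "1 / N\<^sup>2 \<le> Q" by simp
  then have "pi / Q \<le> 4 / (1 / N\<^sup>2)" using pi_less_4 N by (intro frac_le) auto
  then have "sqrt (pi / Q) \<le> sqrt ((2 * N)\<^sup>2)" by (intro real_sqrt_le_mono) (simp add: power_mult_distrib del: real_sqrt_le_iff)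
  then have "sqrt (pi / Q) \<le> 2 * N" using N by (simp only: real_sqrt_abs)
  moreover have "sqrt (pi / Q) * exp (- a\<^sup>2 / (4 * N\<^sup>2 * Q\<^sup>2)) \<le> sqrt (pi / Q) * 1"
    using Q N by (intro mult_left_mono) (auto simp: order_trans[OF _ Q])
  ultimately show ?thesis unfolding norm_chirp_gauss_Q[OF N Q_def] by simp
qed

lemma norm_chirp_gauss_le_b:
  assumes N: "0 < N" and b: "b \<noteq> 0"
  shows "cmod (chirp_gauss (1 / N\<^sup>2) a b) \<le> 2 * \<bar>b\<bar> powr (- 1 / 2)"
proof -
  define Q where "Q = sqrt (1 / N ^ 4 + b\<^sup>2)"
  have "sqrt (b\<^sup>2) \<le> Q" unfolding Q_def by (rule real_sqrt_le_mono) (use N in simp)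
  then have Q: "\<bar>b\<bar> \<le> Q" by simp
  then have "pi / Q \<le> 4 / \<bar>b\<bar>" using pi_less_4 b by (intro frac_le) auto
  then have "sqrt (pi / Q) \<le> sqrt (4 / \<bar>b\<bar>)" by (rule real_sqrt_le_mono)
  also have "\<dots> = 2 * \<bar>b\<bar> powr (- 1 / 2)"
    using b by (simp add: real_sqrt_divide powr_minus_divide powr_half_sqrt)
  finally have "sqrt (pi / Q) \<le> 2 * \<bar>b\<bar> powr (- 1 / 2)" .
  moreover have "sqrt (pi / Q) * exp (- a\<^sup>2 / (4 * N\<^sup>2 * Q\<^sup>2)) \<le> sqrt (pi / Q) * 1"
    using Q N b by (intro mult_left_mono) auto
  ultimately show ?thesis unfolding norm_chirp_gauss_Q[OF N Q_def] by simp
qed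

lemma power2_powr:
  fixes N :: real
  assumes "0 < N"
  shows "(N\<^sup>2) powr x = N powr (2 * x)"
  using assms powr_powr[of N 2 x] by (simp add: powr_numeral)

text \<open>The bounds N and |b|^(-1/2) agree at |b| = N^(-2). On either side of this point the
  stronger of the two is below each of their weighted geometric means.\<close>

lemma norm_chirp_gauss_interp:
  assumes N: "0 < N" and b: "b \<noteq> 0" and \<theta>: "0 \<le> \<theta>" "\<theta> \<le> 1 / 2"
  shows "cmod (chirp_gauss (1 / N\<^sup>2) a b) \<le> 2 * (N powr (1 - 2 * \<theta>) * \<bar>b\<bar> powr (- \<theta>))"
proof (cases "\<bar>b\<bar> * N\<^sup>2 \<le> 1")
  case True
  have "1 \<le> (\<bar>b\<bar> * N\<^sup>2) powr (- \<theta>)"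
    using True b N \<theta> by (simp add: powr_minus one_le_inverse powr_le1)
  then have "N * 1 \<le> N * (\<bar>b\<bar> * N\<^sup>2) powr (- \<theta>)" using N by (intro mult_left_mono) auto
  also have "\<dots> = N powr (1 - 2 * \<theta>) * \<bar>b\<bar> powr (- \<theta>)"
    using N powr_add[of N 1 "- 2 * \<theta>"] by (simp add: powr_mult power2_powr)
  finally show ?thesis using norm_chirp_gauss_le_N[OF N, of a b] by simp
next
  case False
  have "\<bar>b\<bar> powr (- 1 / 2) = \<bar>b\<bar> powr (- \<theta>) * \<bar>b\<bar> powr (\<theta> - 1 / 2)"
    by (simp flip: powr_add)
  moreover have "\<bar>b\<bar> powr (\<theta> - 1 / 2) \<le> (1 / N\<^sup>2) powr (\<theta> - 1 / 2)"
    using False N \<theta> by (intro powr_mono2') (auto simp: field_simps)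
  moreover have "(1 / N\<^sup>2) powr (\<theta> - 1 / 2) = N powr (1 - 2 * \<theta>)"
    using N by (simp add: powr_divide power2_powr powr_minus_divide[symmetric] flip: powr_minus)
  ultimately have "\<bar>b\<bar> powr (- 1 / 2) \<le> N powr (1 - 2 * \<theta>) * \<bar>b\<bar> powr (- \<theta>)"
    by (metis mult.commute mult_left_mono powr_ge_zero)
  then show ?thesis using norm_chirp_gauss_le_b[OF N b, of a] by simp
qed

lemma exp_neg_square_le_powr:
  fixes z p :: real
  assumes z: "0 < z" and p: "0 \<le> p" "p \<le> 1"
  shows "exp (- z\<^sup>2) \<le> z powr (- p)"
proof -
  have "z powr p \<le> exp (z\<^sup>2)"
  proof (cases "z \<le> 1")
    case True
    have "z powr p \<le> 1" using z p True by (simp add: powr_le1)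
    also have "1 \<le> exp (z\<^sup>2)" by simp
    finally show ?thesis .
  next
    case False
    have "z powr p \<le> z powr 1" using p False by (intro powr_mono) auto
    also have "\<dots> \<le> 1 + z\<^sup>2" using z zero_le_power2[of "z - 1"] by (simp add: power2_diff)
    also have "\<dots> \<le> exp (z\<^sup>2)" by (rule exp_ge_add_one_self)
    finally show ?thesis .
  qed
  then show ?thesis using z by (simp add: exp_minus powr_minus le_imp_inverse_le)
qed

text \<open>The Gaussian decay in \<open>a\<close> is traded for a power of \<open>r\<close> with a
  free exponent \<open>p\<close>. This keeps \<open>p\<close> available for balancing the powers of
  N, T and r in each range of times.\<close>

lemma norm_chirp_gauss_decay:
  assumes N: "0 < N" and Q: "Q = sqrt (1 / N ^ 4 + b\<^sup>2)" and p: "0 \<le> p" "p \<le> 1"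
    and a: "c * r \<le> \<bar>a\<bar>" and c: "0 < c" and r: "0 < r"
  shows "cmod (chirp_gauss (1 / N\<^sup>2) a b) \<le> 2 * (2 / c) powr p * (N powr p * Q powr (p - 1 / 2) * r powr (- p))"
proof -
  have Q0: "Q > 0" unfolding Q using N by (intro real_sqrt_gt_zero add_pos_nonneg) auto
  define z where "z = c * r / (2 * N * Q)"
  have z: "0 < z" using N Q0 c r by (simp add: z_def)
  have "(c * r)\<^sup>2 \<le> a\<^sup>2" using a c r by (intro abs_le_square_iff[THEN iffD1]) auto
  then have "z\<^sup>2 \<le> a\<^sup>2 / (4 * N\<^sup>2 * Q\<^sup>2)"
    using N Q0 by (simp add: z_def power_divide power_mult_distrib divide_right_mono)
  then have "exp (- a\<^sup>2 / (4 * N\<^sup>2 * Q\<^sup>2)) \<le> exp (- z\<^sup>2)" by simp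
  also have "\<dots> \<le> z powr (- p)" by (rule exp_neg_square_le_powr[OF z p])
  finally have e: "exp (- a\<^sup>2 / (4 * N\<^sup>2 * Q\<^sup>2)) \<le> z powr (- p)" .
  have "sqrt (pi / Q) \<le> sqrt (4 / Q)" using pi_less_4 Q0 by (intro real_sqrt_le_mono divide_right_mono) auto
  also have "\<dots> = 2 * Q powr (- 1 / 2)"
    using Q0 by (simp add: real_sqrt_divide powr_minus_divide powr_half_sqrt)
  finally have "sqrt (pi / Q) * exp (- a\<^sup>2 / (4 * N\<^sup>2 * Q\<^sup>2)) \<le> 2 * Q powr (- 1 / 2) * z powr (- p)"
    using e Q0 by (intro mult_mono) auto
  also have "z powr (- p) = (2 / c) powr p * N powr p * Q powr p * r powr (- p)"
    using N Q0 c r by (simp add: z_def powr_divide powr_mult powr_minus_divide)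
  also have "2 * Q powr (- 1 / 2) * ((2 / c) powr p * N powr p * Q powr p * r powr (- p)) =
     2 * (2 / c) powr p * (N powr p * (Q powr (- 1 / 2) * Q powr p) * r powr (- p))"
    by (simp only: mult_ac)
  also have "Q powr (- 1 / 2) * Q powr p = Q powr (p - 1 / 2)"
    by (simp flip: powr_add)
  finally show ?thesis unfolding norm_chirp_gauss_Q[OF N Q] .
qed

text \<open>Up to times of order N^(-2) the kernel is dominated by an approximate identity at scale
  1/N, and errors of order 1/N in the displacement are harmless. If N r is at most 2 C / c, the
  error may hide the displacement, but then the height 2 N suffices; otherwise the displacement is
  at least c r / 2.\<close>

lemma norm_chirp_gauss_short_time:
  assumes c: "0 < c" and C: "0 \<le> C" and M: "0 \<le> M"
  obtains D where "0 < D"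
    "\<And>N a b r. \<lbrakk>0 < N; 0 \<le> r; \<bar>b\<bar> \<le> M / N\<^sup>2; c * r - C / N \<le> \<bar>a\<bar>\<rbrakk> \<Longrightarrow>
       cmod (chirp_gauss (1 / N\<^sup>2) a b) \<le> D * (N * inverse (1 + (N * r)\<^sup>2))"
proof
  \<comment> \<open>The second entry is the coefficient of (N r)^2 in the Gaussian exponent after
    inserting the bounds for \<open>a\<close> and \<open>Q\<close>. The cap 1 permits \<kappa> (1 +
    z) \<le> 1 + \<kappa> z.\<close>
  define \<kappa> where "\<kappa> = min 1 (c\<^sup>2 / (16 * (1 + M\<^sup>2)))"
  have M1: "1 + M\<^sup>2 > 0" by (simp add: add_pos_nonneg)
  have \<kappa>: "0 < \<kappa>" "\<kappa> \<le> 1" using c M1 by (auto simp: \<kappa>_def)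
  define D where "D = 2 / \<kappa> + 2 * (1 + (2 * C / c)\<^sup>2)"
  show "0 < D" unfolding D_def using \<kappa> by (intro add_pos_nonneg) auto
  fix N a b r :: real
  assume N: "0 < N" and r: "0 \<le> r" and b: "\<bar>b\<bar> \<le> M / N\<^sup>2" and a: "c * r - C / N \<le> \<bar>a\<bar>"
  have pos: "1 + (N * r)\<^sup>2 > 0" by (simp add: add_pos_nonneg)
  show "cmod (chirp_gauss (1 / N\<^sup>2) a b) \<le> D * (N * inverse (1 + (N * r)\<^sup>2))"
  proof (cases "N * r \<le> 2 * C / c")
    case True
    have "(N * r)\<^sup>2 \<le> (2 * C / c)\<^sup>2" using True N r by (intro power_mono) auto
    then have "1 \<le> (1 + (2 * C / c)\<^sup>2) * inverse (1 + (N * r)\<^sup>2)"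
      using pos by (simp add: field_simps)
    then have "2 * N * 1 \<le> 2 * N * ((1 + (2 * C / c)\<^sup>2) * inverse (1 + (N * r)\<^sup>2))"
      using N by (intro mult_left_mono) auto
    also have "\<dots> = (2 * (1 + (2 * C / c)\<^sup>2)) * (N * inverse (1 + (N * r)\<^sup>2))" by simp
    also have "\<dots> \<le> D * (N * inverse (1 + (N * r)\<^sup>2))"
      unfolding D_def using \<kappa> N pos by (intro mult_right_mono) auto
    finally show ?thesis using norm_chirp_gauss_le_N[OF N, of a b] by simp
  next
    case False
    define Q where "Q = sqrt (1 / N ^ 4 + b\<^sup>2)"
    have Q0: "Q > 0" unfolding Q_def using N by (intro real_sqrt_gt_zero add_pos_nonneg) auto
    have "b\<^sup>2 \<le> (M / N\<^sup>2)\<^sup>2" using b by (metis abs_ge_zero power2_abs power_mono)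
    then have "Q\<^sup>2 \<le> (1 + M\<^sup>2) / N ^ 4"
      unfolding Q_def by (simp add: power_divide add_divide_distrib flip: power_mult)
    then have Q2: "4 * N\<^sup>2 * Q\<^sup>2 \<le> 4 * (1 + M\<^sup>2) / N\<^sup>2"
      using N by (simp add: field_simps power4_eq_xxxx power2_eq_square)
    have "C / N \<le> c * r / 2" using False N c by (simp add: field_simps)
    then have a': "c * r / 2 \<le> \<bar>a\<bar>" using a by simp
    have "\<kappa> * (N * r)\<^sup>2 \<le> c\<^sup>2 / (16 * (1 + M\<^sup>2)) * (N * r)\<^sup>2"
      by (intro mult_right_mono) (auto simp: \<kappa>_def)
    also have "\<dots> = (c * r / 2)\<^sup>2 / (4 * (1 + M\<^sup>2) / N\<^sup>2)"
      using N M1 by (simp add: power_divide power_mult_distrib)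
    also have "\<dots> \<le> a\<^sup>2 / (4 * N\<^sup>2 * Q\<^sup>2)"
      using a' c r N Q0 Q2 by (intro frac_le) (auto intro!: abs_le_square_iff[THEN iffD1])
    finally have "exp (- a\<^sup>2 / (4 * N\<^sup>2 * Q\<^sup>2)) \<le> exp (- (\<kappa> * (N * r)\<^sup>2))" by simp
    also have "\<dots> \<le> inverse (1 + \<kappa> * (N * r)\<^sup>2)"
      unfolding exp_minus using \<kappa> by (intro le_imp_inverse_le exp_ge_add_one_self add_pos_nonneg) auto
    also have "\<dots> \<le> inverse (\<kappa> * (1 + (N * r)\<^sup>2))"
      using \<kappa> pos by (intro le_imp_inverse_le) (auto simp: distrib_left intro!: add_pos_nonneg)
    finally have e: "exp (- a\<^sup>2 / (4 * N\<^sup>2 * Q\<^sup>2)) \<le> 1 / \<kappa> * inverse (1 + (N * r)\<^sup>2)"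
      by (simp only: inverse_mult_distrib divide_inverse mult_1)
    have "sqrt (1 / N ^ 4) \<le> Q" unfolding Q_def by (rule real_sqrt_le_mono) simp
    moreover have "sqrt (1 / N ^ 4) = 1 / N\<^sup>2"
      using N by (intro real_sqrt_unique) (auto simp: power_divide simp flip: power_mult)
    ultimately have Q: "1 / N\<^sup>2 \<le> Q" by simp
    then have "pi / Q \<le> 4 / (1 / N\<^sup>2)" using pi_less_4 N by (intro frac_le) auto
    then have "sqrt (pi / Q) \<le> sqrt ((2 * N)\<^sup>2)" by (intro real_sqrt_le_mono) (simp add: power_mult_distrib del: real_sqrt_le_iff)
    then have "sqrt (pi / Q) \<le> 2 * N" using N by (simp only: real_sqrt_abs)
    with e have "sqrt (pi / Q) * exp (- a\<^sup>2 / (4 * N\<^sup>2 * Q\<^sup>2)) \<le> 2 * N * (1 / \<kappa> * inverse (1 + (N * r)\<^sup>2))"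
      using Q0 N by (intro mult_mono) auto
    also have "\<dots> = 2 / \<kappa> * (N * inverse (1 + (N * r)\<^sup>2))" by simp
    also have "\<dots> \<le> D * (N * inverse (1 + (N * r)\<^sup>2))"
      unfolding D_def using \<kappa> N pos by (intro mult_right_mono) auto
    finally show ?thesis unfolding norm_chirp_gauss_Q[OF N Q_def] .
  qed
qed

section \<open>Integrals of the two Schur majorants\<close>

lemma nn_integral_Cauchy_kernel:
  obtains J :: real where "0 < J"
    "\<And>N x. 0 < N \<Longrightarrow> (\<integral>\<^sup>+y. ennreal (N * inverse (1 + (N * \<bar>x - y\<bar>)\<^sup>2)) \<partial>lborel) \<le> ennreal J"
proof
  define f where "f x = inverse (1 + x\<^sup>2)" for x :: real
  have f0: "0 \<le> f x" for x by (simp add: f_def)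
  have fi: "integrable lborel f"
    using integrable_inverse_1_plus_square by (simp add: f_def[abs_def] set_integrable_def einterval_def)
  \<comment> \<open>The added 1 gives strict positivity without evaluating the integral.\<close>
  define J where "J = (LINT x|lborel. f x) + 1"
  have J: "0 \<le> (LINT x|lborel. f x)" using f0 by simp
  then show "0 < J" unfolding J_def by simp
  fix N x :: real assume N: "0 < N"
  have "(\<integral>\<^sup>+y. ennreal (N * inverse (1 + (N * \<bar>x - y\<bar>)\<^sup>2)) \<partial>lborel) =
     \<bar>1 / N\<bar> * (\<integral>\<^sup>+u. ennreal (N * inverse (1 + (N * \<bar>x - (x + 1 / N * u)\<bar>)\<^sup>2)) \<partial>lborel)"
    using N by (intro nn_integral_real_affine) auto
  also have "\<dots> = ennreal (1 / N) * (\<integral>\<^sup>+u. ennreal N * ennreal (f u) \<partial>lborel)"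
    using N f0 by (simp add: f_def ennreal_mult power_mult_distrib power_divide)
  also have "\<dots> = ennreal (LINT x|lborel. f x)"
    using N fi f0 by (simp add: nn_integral_cmult nn_integral_eq_integral ennreal_mult[symmetric] J flip: mult.assoc)
  finally show "(\<integral>\<^sup>+y. ennreal (N * inverse (1 + (N * \<bar>x - y\<bar>)\<^sup>2)) \<partial>lborel) \<le> ennreal J"
    by (simp add: J_def ennreal_leI)
qed

text \<open>The exponent lies just above -1, the limit of integrability; this is why the long-time
  estimate needs a positive \<eta>. The two sides of the singularity are each bounded by an integral
  over a full interval of length 2 R.\<close>

lemma nn_integral_powr_kernel:
  fixes \<eta> R :: real
  assumes \<eta>: "0 < \<eta>" and R: "0 \<le> R" and x: "\<bar>x\<bar> \<le> R"
  shows "(\<integral>\<^sup>+y\<in>{-R..R}. ennreal (\<bar>x - y\<bar> powr (\<eta> - 1)) \<partial>lborel) \<le> ennreal (2 * ((2 * R) powr \<eta> / \<eta>))"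
proof -
  define I where "I = (2 * R) powr \<eta> / \<eta>"
  have I0: "0 \<le> I" using \<eta> by (simp add: I_def)
  have half: "(\<integral>\<^sup>+u. ennreal (u powr (\<eta> - 1)) * indicator {0..2 * R} u \<partial>lborel) = ennreal I"
    using has_integral_powr_from_0[of "\<eta> - 1" "2 * R"] \<eta> R
    by (intro nn_integral_has_integral_lebesgue') (auto simp: I_def)
  have "(\<integral>\<^sup>+y\<in>{-R..R}. ennreal (\<bar>x - y\<bar> powr (\<eta> - 1)) \<partial>lborel) =
      ennreal \<bar>1\<bar> * (\<integral>\<^sup>+u. ennreal (\<bar>x - (x + 1 * u)\<bar> powr (\<eta> - 1)) * indicator {-R..R} (x + 1 * u) \<partial>lborel)"
    by (rule nn_integral_real_affine) auto
  also have "\<dots> \<le> (\<integral>\<^sup>+u. ennreal (u powr (\<eta> - 1)) * indicator {0..2 * R} u +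
       ennreal ((- u) powr (\<eta> - 1)) * indicator {0..2 * R} (- u) \<partial>lborel)"
  proof -
    have "ennreal (\<bar>x - (x + 1 * u)\<bar> powr (\<eta> - 1)) * indicator {-R..R} (x + 1 * u) \<le>
        ennreal (u powr (\<eta> - 1)) * indicator {0..2 * R} u +
       ennreal ((- u) powr (\<eta> - 1)) * indicator {0..2 * R} (- u)" for u
      using x by (cases "u \<ge> 0") (auto split: split_indicator)
    then show ?thesis by (simp add: nn_integral_mono)
  qed
  also have "\<dots> = ennreal I + (\<integral>\<^sup>+u. ennreal ((- u) powr (\<eta> - 1)) * indicator {0..2 * R} (- u) \<partial>lborel)"
    by (subst nn_integral_add) (auto simp: half)
  also have "(\<integral>\<^sup>+u. ennreal ((- u) powr (\<eta> - 1)) * indicator {0..2 * R} (- u) \<partial>lborel) = ennreal I"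
    using nn_integral_real_affine[of "\<lambda>u. ennreal (u powr (\<eta> - 1)) * indicator {0..2 * R} u" "-1" 0] half by simp
  finally show ?thesis using I0 by (simp add: I_def flip: ennreal_plus)
qed

section \<open>Consequences of the hypotheses on the curve and on the exponent\<close>

lemma admissible_curveE:
  assumes "admissible_curve \<alpha> \<gamma>"
  obtains c C where "0 < c" "0 < C"
    "\<And>t x y. t \<in> {-1..1} \<Longrightarrow> c * \<bar>x - y\<bar> \<le> \<bar>\<gamma> x t - \<gamma> y t\<bar>"
    "\<And>x t t'. \<lbrakk>t \<in> {-1..1}; t' \<in> {-1..1}\<rbrakk> \<Longrightarrow> \<bar>\<gamma> x t - \<gamma> x t'\<bar> \<le> C * \<bar>t - t'\<bar> powr \<alpha>"
    "\<And>x. \<gamma> x 0 = x"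
    "\<And>\<tau>. \<lbrakk>\<tau> \<in> borel_measurable borel; \<And>x. \<tau> x \<in> {-1..1}\<rbrakk> \<Longrightarrow> (\<lambda>x. \<gamma> x (\<tau> x)) \<in> borel_measurable borel"
proof -
  from assms have cont: "continuous_on (UNIV \<times> {-1..1}) (\<lambda>(x, t). \<gamma> x t)" and z: "\<And>x. \<gamma> x 0 = x"
    and b: "bilipschitz_in_x \<gamma>" and h: "hoelder_in_t \<alpha> \<gamma>"
    by (auto simp: admissible_curve_def)
  from b obtain C1 where C1: "C1 > 0" "\<And>t x y. t \<in> {-1..1} \<Longrightarrow> 1 / C1 * \<bar>x - y\<bar> \<le> \<bar>\<gamma> x t - \<gamma> y t\<bar>"
    unfolding bilipschitz_in_x_def by blast
  from h obtain C where C: "C > 0"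
      "\<And>x t t'. \<lbrakk>t \<in> {-1..1}; t' \<in> {-1..1}\<rbrakk> \<Longrightarrow> \<bar>\<gamma> x t - \<gamma> x t'\<bar> \<le> C * \<bar>t - t'\<bar> powr \<alpha>"
    unfolding hoelder_in_t_def by blast
  have meas: "(\<lambda>x. \<gamma> x (\<tau> x)) \<in> borel_measurable borel"
    if [measurable]: "\<tau> \<in> borel_measurable borel" and \<tau>: "\<And>x. \<tau> x \<in> {-1..1}" for \<tau> :: "real \<Rightarrow> real"
  proof -
    define \<Gamma> where "\<Gamma> z = (case z of (x, t) \<Rightarrow> \<gamma> x t)" for z
    \<comment> \<open>Continuity is known only on the strip. Clamping the time to [-1,1] gives a
      continuous function on the plane that agrees with the curve at the times considered.\<close>
    have "continuous_on UNIV (\<lambda>z. \<Gamma> (fst z, max (-1) (min 1 (snd z))))"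
      using cont unfolding \<Gamma>_def[symmetric]
      by (rule continuous_on_compose2) (auto intro!: continuous_intros)
    then have [measurable]: "(\<lambda>z. \<Gamma> (fst z, max (-1) (min 1 (snd z)))) \<in> borel_measurable (borel \<Otimes>\<^sub>M borel)"
      unfolding borel_prod by (rule borel_measurable_continuous_onI)
    have "(\<lambda>x. \<Gamma> (fst (x, \<tau> x), max (-1) (min 1 (snd (x, \<tau> x))))) \<in> borel_measurable borel"
      by measurable
    moreover have "max (-1) (min 1 (\<tau> x)) = \<tau> x" for x using \<tau>[of x] by auto
    ultimately show ?thesis by (simp add: \<Gamma>_def)
  qed
  show thesis by (rule that[of "1 / C1" C]) (use C1 C z meas in auto)
qed

lemma s_crit_ge:
  fixes \<alpha> \<delta> :: real
  assumes "1/4 < \<alpha>" "\<alpha> < 1/2" "0 \<le> \<delta>" "\<delta> < \<alpha>"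
  shows "1 / 4 + \<delta> \<le> s_crit \<alpha> \<delta>" "\<delta> / \<alpha> \<le> s_crit \<alpha> \<delta>"
    "\<delta> < \<alpha> / 2 \<Longrightarrow> 1 / 2 - \<alpha> + 2 * \<delta> \<le> s_crit \<alpha> \<delta>"
proof -
  have a: "1 / 4 + \<delta> \<le> \<delta> / \<alpha>" if "\<alpha> / 2 \<le> \<delta>"
  proof -
    have "(\<alpha> / 2) * (1 - \<alpha>) \<le> \<delta> * (1 - \<alpha>)" using that assms by (intro mult_right_mono) auto
    moreover have "\<alpha> / 4 \<le> (\<alpha> / 2) * (1 - \<alpha>)" using assms by (simp add: field_simps)
    ultimately have "\<alpha> / 4 + \<alpha> * \<delta> \<le> \<delta>" by (simp add: algebra_simps diff_divide_distrib)
    then show ?thesis using assms by (simp add: field_simps)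
  qed
  have b: "\<delta> / \<alpha> \<le> 1 / 2 - \<alpha> + 2 * \<delta>" if "\<delta> \<le> \<alpha> / 2"
  proof -
    have "\<delta> * (1 - 2 * \<alpha>) \<le> (\<alpha> / 2) * (1 - 2 * \<alpha>)" using that assms by (intro mult_right_mono) auto
    then show ?thesis using assms by (simp add: field_simps)
  qed
  show "1 / 4 + \<delta> \<le> s_crit \<alpha> \<delta>" "\<delta> / \<alpha> \<le> s_crit \<alpha> \<delta>"
    "\<delta> < \<alpha> / 2 \<Longrightarrow> 1 / 2 - \<alpha> + 2 * \<delta> \<le> s_crit \<alpha> \<delta>"
    using a b assms by (auto simp: s_crit_def)
qed

text \<open>Here \<open>r\<close> is the distance of the base points and \<open>b\<close> the time
  difference. If c r \<le> 2 C |b|^\<alpha>, the curve may cancel the spatial separation, but then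
  |b| is bounded below by a power of r and temporal decay applies. Otherwise |a| is at least c r / 2
  and spatial decay applies, in two variants according to whether T is below or above N^(-2). Every
  case must produce the same integrable power of r; the small loss \<eta> is paid by the excess of s
  over the critical exponent.\<close>

proposition long_time_kernel:
  fixes \<alpha> \<delta> s c C R :: real
  assumes \<alpha>: "1/4 < \<alpha>" "\<alpha> < 1/2" and \<delta>: "0 \<le> \<delta>" "\<delta> < \<alpha>" and s: "s_crit \<alpha> \<delta> < s"
    and c: "0 < c" and C: "0 < C" and R: "0 < R"
  obtains \<eta> D where "0 < \<eta>" "0 < D"
    "\<And>N T a b r. \<lbrakk>1 \<le> N; 0 < T; T \<le> 1; N powr (- 1 / \<alpha>) \<le> T; 0 < r; r \<le> 2 * R; \<bar>b\<bar> \<le> T;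
        c * r - C * \<bar>b\<bar> powr \<alpha> \<le> \<bar>a\<bar>\<rbrakk> \<Longrightarrow>
      cmod (chirp_gauss (1 / N\<^sup>2) a b) \<le> D * (T powr (2 * \<delta>) * N powr (2 * s) * r powr (\<eta> - 1))"
proof -
  note sc = s_crit_ge[OF \<alpha> \<delta>]
  define \<sigma> where "\<sigma> = s - s_crit \<alpha> \<delta>"
  have \<sigma>: "0 < \<sigma>" using s by (simp add: \<sigma>_def)
  \<comment> \<open>The bound by \<sigma> pays for the lost power of \<open>N\<close>, 1/4 keeps 1/2
    - \<eta> positive, and the last condition keeps the interpolation exponent \<theta> below
    nonnegative.\<close>
  obtain \<eta> where \<eta>: "0 < \<eta>" "\<eta> \<le> 1 / 4" "\<eta> \<le> \<sigma>" and \<eta>2: "\<delta> < \<alpha> / 2 \<Longrightarrow> \<alpha> * \<eta> \<le> \<alpha> - 2 * \<delta>"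
  proof (cases "\<delta> < \<alpha> / 2")
    case True
    show ?thesis
    proof (rule that[of "min (min (1/4) \<sigma>) ((\<alpha> - 2 * \<delta>) / \<alpha>)"])
      have "\<alpha> * min (min (1/4) \<sigma>) ((\<alpha> - 2 * \<delta>) / \<alpha>) \<le> \<alpha> * ((\<alpha> - 2 * \<delta>) / \<alpha>)"
        using \<alpha> by (intro mult_left_mono) auto
      then show "\<alpha> * min (min (1/4) \<sigma>) ((\<alpha> - 2 * \<delta>) / \<alpha>) \<le> \<alpha> - 2 * \<delta>" using \<alpha> by simp
      have "min (min (1/4) \<sigma>) ((\<alpha> - 2 * \<delta>) / \<alpha>) \<le> min (1/4) \<sigma>" by (rule min.cobounded1)
      then show "min (min (1/4) \<sigma>) ((\<alpha> - 2 * \<delta>) / \<alpha>) \<le> 1 / 4" "min (min (1/4) \<sigma>) ((\<alpha> - 2 * \<delta>) / \<alpha>) \<le> \<sigma>"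
        by (simp_all only: min.bounded_iff)
    qed (use True \<sigma> \<alpha> in auto)
  next
    case False
    then show ?thesis using that[of "min (1/4) \<sigma>"] \<sigma> by auto
  qed
  \<comment> \<open>The value 2 \<delta> would reproduce T^(2 \<delta>) exactly, but the decay
    exponent 1/2 + q in \<open>r\<close> may not exceed 1 - \<eta>, hence the cap.\<close>
  define q where "q = min (2 * \<delta>) (1 / 2 - \<eta>)"
  have q: "0 \<le> q" "q \<le> 2 * \<delta>" "q \<le> 1 / 2 - \<eta>" using \<delta> \<eta> by (auto simp: q_def)
  have qs: "1 / 2 - q + 4 * \<delta> \<le> 2 * s"
  proof (cases "2 * \<delta> \<le> 1 / 2 - \<eta>")
    case True
    then show ?thesis using sc(1) s by (simp add: q_def)
  next
    case False
    have "2 * \<delta> \<le> \<delta> / \<alpha>" using \<alpha> \<delta> mult_left_mono[of "2 * \<alpha>" 1 \<delta>] by (simp add: field_simps)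
    then have "2 * \<delta> \<le> s_crit \<alpha> \<delta>" using sc(2) by simp
    then show ?thesis using False \<eta> by (simp add: q_def \<sigma>_def)
  qed
  define DA where "DA = 2 * (2 * C / c) powr (1 - \<eta>)"
  define DB where "DB = 4 * (4 / c) powr (1 - \<eta>)"
  define DC where "DC = 2 * (4 / c) powr (1 / 2 + q) * 2 * max 1 (2 * R)"
  have D0: "0 < DA" "0 < DB" "0 < DC" using c C R by (auto simp: DA_def DB_def DC_def)
  show thesis
  proof (rule that[of \<eta> "DA + DB + DC"])
    show "0 < \<eta>" by fact
    show "0 < DA + DB + DC" using D0 by simp
    fix N T a b r :: real
    assume N: "1 \<le> N" and T: "0 < T" "T \<le> 1" and NT: "N powr (- 1 / \<alpha>) \<le> T" and r: "0 < r" "r \<le> 2 * R"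
      and b: "\<bar>b\<bar> \<le> T" and a: "c * r - C * \<bar>b\<bar> powr \<alpha> \<le> \<bar>a\<bar>"
    have N0: "0 < N" using N by simp
    define X where "X = T powr (2 * \<delta>) * N powr (2 * s) * r powr (\<eta> - 1)"
    have X0: "0 \<le> X" by (simp add: X_def)
    \<comment> \<open>The lower bound T \<ge> N^(-1/\<alpha>) converts negative powers of
      \<open>T\<close> into powers of \<open>N\<close>; this conversion is where \<delta>/\<alpha>
      comes from.\<close>
    have TN: "T powr x \<le> N powr (- x / \<alpha>)" if "x \<le> 0" for x
      using powr_mono2'[of "x" "N powr (- 1 / \<alpha>)" T] that NT N0
      by (simp add: powr_powr) 
    let ?K = "cmod (chirp_gauss (1 / N\<^sup>2) a b)"
    have "?K \<le> DA * X \<or> ?K \<le> DB * X \<or> ?K \<le> DC * X"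
    proof (cases "c * r \<le> 2 * C * \<bar>b\<bar> powr \<alpha>")
      case near: True
      have b0: "b \<noteq> 0"
      proof
        assume "b = 0"
        with near have "c * r \<le> 0" by simp
        then show False using mult_pos_pos[OF c r(1)] by linarith
      qed
      have bb: "(\<bar>b\<bar> powr \<alpha>) powr (\<eta> - 1) \<le> (2 * C / c) powr (1 - \<eta>) * r powr (\<eta> - 1)"
      proof -
        have "c * r / (2 * C) \<le> \<bar>b\<bar> powr \<alpha>" using near C by (simp add: field_simps)
        then have "(\<bar>b\<bar> powr \<alpha>) powr (\<eta> - 1) \<le> (c * r / (2 * C)) powr (\<eta> - 1)"
          using c C r \<eta> by (intro powr_mono2') auto
        also have "c * r / (2 * C) = inverse (2 * C / c) * r" using c C by (simp add: field_simps)
        also have "(inverse (2 * C / c) * r) powr (\<eta> - 1) = inverse (2 * C / c) powr (\<eta> - 1) * r powr (\<eta> - 1)"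
          using c C r by (intro powr_mult)
        also have "inverse (2 * C / c) powr (\<eta> - 1) = (2 * C / c) powr (1 - \<eta>)"
        proof -
          have "inverse z powr (\<eta> - 1) = z powr (1 - \<eta>)" if "0 < z" for z :: real
            using that powr_minus[of z "\<eta> - 1"] by (simp add: inverse_powr)
          then show ?thesis using c C by (simp del: inverse_divide)
        qed
        finally show ?thesis .
      qed
      have "?K \<le> DA * X"
      proof (cases "\<delta> < \<alpha> / 2")
        case True
        \<comment> \<open>Chosen so that |b|^(-\<theta>) factors as |b|^(2 \<delta>), bounded by
          T^(2 \<delta>), times (|b|^\<alpha>)^(\<eta> - 1), bounded by r^(\<eta> - 1).\<close>
        define \<theta> where "\<theta> = \<alpha> - 2 * \<delta> - \<alpha> * \<eta>"
        have \<theta>: "0 \<le> \<theta>" "\<theta> \<le> 1 / 2" 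
        proof -
          have "0 \<le> \<alpha> * \<eta>" using \<alpha> \<eta> by simp
          then show "0 \<le> \<theta>" "\<theta> \<le> 1 / 2" unfolding \<theta>_def using \<eta>2[OF True] \<alpha> \<delta> by linarith+
        qed
        have "\<bar>b\<bar> powr (- \<theta>) = \<bar>b\<bar> powr (2 * \<delta>) * (\<bar>b\<bar> powr \<alpha>) powr (\<eta> - 1)"
          using b0 by (simp add: powr_powr powr_add[symmetric] \<theta>_def algebra_simps)
        also have "\<dots> \<le> T powr (2 * \<delta>) * ((2 * C / c) powr (1 - \<eta>) * r powr (\<eta> - 1))"
          using bb b \<delta> by (intro mult_mono powr_mono2) auto
        finally have 1: "\<bar>b\<bar> powr (- \<theta>) \<le> T powr (2 * \<delta>) * ((2 * C / c) powr (1 - \<eta>) * r powr (\<eta> - 1))" .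
        have "\<alpha> * \<eta> \<le> \<sigma>" using mult_mono[of \<alpha> 1 \<eta> \<sigma>] \<alpha> \<eta> by simp
        then have "1 - 2 * \<theta> \<le> 2 * s" using sc(3)[OF True] by (simp add: \<theta>_def \<sigma>_def)
        then have "N powr (1 - 2 * \<theta>) \<le> N powr (2 * s)" using N by (intro powr_mono) auto
        then have "N powr (1 - 2 * \<theta>) * \<bar>b\<bar> powr (- \<theta>) \<le> N powr (2 * s) * (T powr (2 * \<delta>) * ((2 * C / c) powr (1 - \<eta>) * r powr (\<eta> - 1)))"
          using 1 by (intro mult_mono) auto
        then have "2 * (N powr (1 - 2 * \<theta>) * \<bar>b\<bar> powr (- \<theta>)) \<le> DA * X"
          by (simp add: DA_def X_def mult_ac)
        then show ?thesis using norm_chirp_gauss_interp[OF N0 b0 \<theta>, of a] by simp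
      next
        case False
        \<comment> \<open>For large \<delta> the exponent \<theta> would be negative. Temporal decay
          is replaced by the trivial bound N, and the missing negative power of \<open>T\<close> is
          paid in powers of \<open>N\<close> through \<open>TN\<close>.\<close>
        have "\<alpha> * \<eta> > 0" using \<alpha> \<eta> by simp
        then have neg: "\<alpha> * (1 - \<eta>) - 2 * \<delta> \<le> 0" using False by (simp add: algebra_simps)
        have "1 = (\<bar>b\<bar> powr \<alpha>) powr (1 - \<eta>) * (\<bar>b\<bar> powr \<alpha>) powr (\<eta> - 1)"
          using b0 by (simp add: powr_add[symmetric])
        also have "\<dots> \<le> T powr (\<alpha> * (1 - \<eta>)) * ((2 * C / c) powr (1 - \<eta>) * r powr (\<eta> - 1))"
          using bb b \<alpha> \<eta> unfolding powr_powr[of "\<bar>b\<bar>" \<alpha> "1 - \<eta>"] by (intro mult_mono powr_mono2) auto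
        also have "T powr (\<alpha> * (1 - \<eta>)) = T powr (2 * \<delta>) * T powr (\<alpha> * (1 - \<eta>) - 2 * \<delta>)"
          by (simp add: powr_add[symmetric])
        also have "\<dots> \<le> T powr (2 * \<delta>) * N powr (- (\<alpha> * (1 - \<eta>) - 2 * \<delta>) / \<alpha>)"
          by (intro mult_left_mono TN neg) auto
        also have "- (\<alpha> * (1 - \<eta>) - 2 * \<delta>) / \<alpha> = 2 * \<delta> / \<alpha> - 1 + \<eta>"
          using \<alpha> by (simp add: field_simps)
        finally have "N * 1 \<le> N * (T powr (2 * \<delta>) * N powr (2 * \<delta> / \<alpha> - 1 + \<eta>) * ((2 * C / c) powr (1 - \<eta>) * r powr (\<eta> - 1)))"
          using N0 by (intro mult_left_mono) (auto simp: mult_right_mono)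
        also have "\<dots> = (N powr 1 * N powr (2 * \<delta> / \<alpha> - 1 + \<eta>)) * (T powr (2 * \<delta>) * ((2 * C / c) powr (1 - \<eta>) * r powr (\<eta> - 1)))"
          using N0 by (simp add: mult_ac)
        also have "N powr 1 * N powr (2 * \<delta> / \<alpha> - 1 + \<eta>) = N powr (2 * \<delta> / \<alpha> + \<eta>)"
          unfolding powr_add[symmetric] by simp
        also have "N powr (2 * \<delta> / \<alpha> + \<eta>) * (T powr (2 * \<delta>) * ((2 * C / c) powr (1 - \<eta>) * r powr (\<eta> - 1)))
            \<le> N powr (2 * s) * (T powr (2 * \<delta>) * ((2 * C / c) powr (1 - \<eta>) * r powr (\<eta> - 1)))"
          using sc(2) \<eta> N by (intro mult_right_mono powr_mono) (auto simp: \<sigma>_def)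
        finally have "2 * N \<le> DA * X" by (simp add: DA_def X_def mult_ac)
        then show ?thesis using norm_chirp_gauss_le_N[OF N0, of a b] by simp
      qed
      then show ?thesis by blast
    next
      case False
      then have ar: "(c / 2) * r \<le> \<bar>a\<bar>" using a by simp
      define Q where "Q = sqrt (1 / N ^ 4 + b\<^sup>2)"
      have Q0: "Q > 0" unfolding Q_def using N by (intro real_sqrt_gt_zero add_pos_nonneg) auto
      have "Q \<le> sqrt (1 / N ^ 4) + sqrt (b\<^sup>2)" unfolding Q_def by (rule sqrt_add_le_add_sqrt) auto
      moreover have "sqrt (1 / N ^ 4) = 1 / N\<^sup>2"
        using N by (intro real_sqrt_unique) (auto simp: power_divide simp flip: power_mult)
      ultimately have Q: "Q \<le> 1 / N\<^sup>2 + T" using b by simp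
      show ?thesis
      proof (cases "T \<le> 1 / N\<^sup>2")
        case True
        \<comment> \<open>With \<open>Q\<close> of order N^(-2), the decay exponent p = 1 - \<eta>
          leaves only N^\<eta> r^(\<eta> - 1).\<close>
        have "Q powr (1 / 2 - \<eta>) \<le> (2 * (1 / N\<^sup>2)) powr (1 / 2 - \<eta>)"
          using True Q Q0 \<eta> by (intro powr_mono2) auto
        also have "\<dots> = 2 powr (1 / 2 - \<eta>) * (1 / N\<^sup>2) powr (1 / 2 - \<eta>)" by (rule powr_mult)
        also have "(1 / N\<^sup>2) powr (1 / 2 - \<eta>) = N powr (2 * \<eta> - 1)"
          using N0 by (simp add: powr_divide power2_powr powr_minus_divide[symmetric] flip: powr_minus)
        also have "2 powr (1 / 2 - \<eta>) * N powr (2 * \<eta> - 1) \<le> 2 powr 1 * N powr (2 * \<eta> - 1)"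
          using \<eta> by (intro mult_right_mono powr_mono) auto
        finally have q2: "Q powr (1 / 2 - \<eta>) \<le> 2 * N powr (2 * \<eta> - 1)" by simp
        have "N powr (1 - \<eta>) * Q powr (1 / 2 - \<eta>) * r powr (\<eta> - 1) \<le>
            N powr (1 - \<eta>) * (2 * N powr (2 * \<eta> - 1)) * r powr (\<eta> - 1)"
          using q2 by (intro mult_right_mono mult_left_mono) auto
        also have "\<dots> = 2 * (N powr (1 - \<eta>) * N powr (2 * \<eta> - 1)) * r powr (\<eta> - 1)" by simp
        also have "N powr (1 - \<eta>) * N powr (2 * \<eta> - 1) = N powr \<eta>" by (simp flip: powr_add)
        also have "N powr \<eta> \<le> T powr (2 * \<delta>) * N powr (2 * s)"
        proof -
          have "T powr (- (2 * \<delta>)) \<le> N powr (2 * \<delta> / \<alpha>)" using TN[of "- (2 * \<delta>)"] \<delta> by simp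
          then have "N powr \<eta> * T powr (- (2 * \<delta>)) \<le> N powr \<eta> * N powr (2 * \<delta> / \<alpha>)" by (intro mult_left_mono) auto
          also have "\<dots> = N powr (\<eta> + 2 * \<delta> / \<alpha>)" by (simp flip: powr_add)
          also have "\<dots> \<le> N powr (2 * s)" using sc(2) \<eta> N by (intro powr_mono) (auto simp: \<sigma>_def)
          finally show ?thesis using T by (simp add: powr_minus field_simps)
        qed
        finally have "N powr (1 - \<eta>) * Q powr (1 / 2 - \<eta>) * r powr (\<eta> - 1) \<le> 2 * X"
          by (simp add: X_def mult_right_mono)
        then have "2 * (2 / (c / 2)) powr (1 - \<eta>) * (N powr (1 - \<eta>) * Q powr (1 / 2 - \<eta>) * r powr (\<eta> - 1)) \<le>
            2 * (2 / (c / 2)) powr (1 - \<eta>) * (2 * X)" by (intro mult_left_mono) auto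
        also have "\<dots> = DB * X" by (simp add: DB_def)
        finally show ?thesis
          using norm_chirp_gauss_decay[OF N0 Q_def, of "1 - \<eta>" "c / 2" r a] ar c r \<eta> by auto
      next
        case False
        then have TN2: "1 / N\<^sup>2 \<le> T" by simp
        \<comment> \<open>The decay exponent p = 1/2 + q leaves Q^q. From it T^(2 \<delta>) is split
          off, and the deficit T^(q - 2 \<delta>) is converted by T \<ge> N^(-2).\<close>
        have "Q powr q \<le> (2 * T) powr q" using Q TN2 Q0 q by (intro powr_mono2) auto
        also have "\<dots> = 2 powr q * T powr q" by (rule powr_mult)
        also have "\<dots> \<le> 2 powr 1 * T powr q" using q \<eta> by (intro mult_right_mono powr_mono) auto
        also have "T powr q = T powr (2 * \<delta>) * T powr (q - 2 * \<delta>)" by (simp flip: powr_add)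
        also have "T powr (q - 2 * \<delta>) \<le> (1 / N\<^sup>2) powr (q - 2 * \<delta>)"
          using TN2 N0 q by (intro powr_mono2') auto
        also have "(1 / N\<^sup>2) powr (q - 2 * \<delta>) = N powr (4 * \<delta> - 2 * q)"
          using N0 by (simp add: powr_divide power2_powr powr_minus_divide[symmetric] flip: powr_minus)
        finally have q2: "Q powr q \<le> 2 * (T powr (2 * \<delta>) * N powr (4 * \<delta> - 2 * q))"
          by (simp add: mult_left_mono)
        have "r powr (- (1 / 2 + q)) = r powr (\<eta> - 1) * r powr (1 / 2 - \<eta> - q)" by (simp flip: powr_add)
        also have "r powr (1 / 2 - \<eta> - q) \<le> max 1 (2 * R)"
        proof -
          have "r powr (1 / 2 - \<eta> - q) \<le> (max 1 (2 * R)) powr (1 / 2 - \<eta> - q)"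
            using r q by (intro powr_mono2) auto
          also have "\<dots> \<le> (max 1 (2 * R)) powr 1" using q \<eta> by (intro powr_mono) auto
          finally show ?thesis by simp
        qed
        finally have r2: "r powr (- (1 / 2 + q)) \<le> r powr (\<eta> - 1) * max 1 (2 * R)"
          by (simp add: mult_left_mono)
        have "N powr (1 / 2 + q) * Q powr q * r powr (- (1 / 2 + q)) \<le>
           N powr (1 / 2 + q) * (2 * (T powr (2 * \<delta>) * N powr (4 * \<delta> - 2 * q))) * (r powr (\<eta> - 1) * max 1 (2 * R))"
          using q2 r2 by (intro mult_mono) auto
        also have "\<dots> = (N powr (1 / 2 + q) * N powr (4 * \<delta> - 2 * q)) * (2 * max 1 (2 * R) * T powr (2 * \<delta>) * r powr (\<eta> - 1))"
          by (simp only: mult_ac)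
        also have "N powr (1 / 2 + q) * N powr (4 * \<delta> - 2 * q) = N powr (1 / 2 - q + 4 * \<delta>)"
          unfolding powr_add[symmetric] by (simp add: algebra_simps)
        also have "\<dots> * (2 * max 1 (2 * R) * T powr (2 * \<delta>) * r powr (\<eta> - 1)) \<le>
            N powr (2 * s) * (2 * max 1 (2 * R) * T powr (2 * \<delta>) * r powr (\<eta> - 1))"
          using qs N by (intro mult_right_mono powr_mono) auto
        also have "\<dots> = 2 * max 1 (2 * R) * X" by (simp add: X_def mult_ac)
        finally have "2 * (2 / (c / 2)) powr (1 / 2 + q) * (N powr (1 / 2 + q) * Q powr q * r powr (- (1 / 2 + q))) \<le>
           2 * (2 / (c / 2)) powr (1 / 2 + q) * (2 * max 1 (2 * R) * X)" by (intro mult_left_mono) auto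
        also have "\<dots> = DC * X" by (simp add: DC_def mult_ac)
        finally show ?thesis
          using norm_chirp_gauss_decay[OF N0 Q_def, of "1 / 2 + q" "c / 2" r a] ar c r q \<eta> by auto
      qed
    qed
    moreover have "DA * X \<le> (DA + DB + DC) * X" "DB * X \<le> (DA + DB + DC) * X" "DC * X \<le> (DA + DB + DC) * X"
      using D0 X0 by (auto intro!: mult_right_mono)
    ultimately have "?K \<le> (DA + DB + DC) * X" by linarith
    then show "?K \<le> (DA + DB + DC) * (T powr (2 * \<delta>) * N powr (2 * s) * r powr (\<eta> - 1))"
      by (simp add: X_def)
  qed
qed

section \<open>Maximal estimates at a single scale\<close>

text \<open>Positions may be perturbed by C/N and times by M/N^2 without loss of a power of N,
  because the kernel still is an approximate identity at scale 1/N. This covers a fixed time as well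
  as intermediate points on a short segment.\<close>

proposition short_time_estimate:
  fixes c C M :: real
  assumes c: "0 < c" and C: "0 \<le> C" and M: "0 \<le> M"
  obtains D where "0 < D"
    "\<And>N B p q g. \<lbrakk>0 < N; B \<in> sets borel; emeasure lborel B < \<infinity>;
        p \<in> borel_measurable borel; q \<in> borel_measurable borel;
        g \<in> borel_measurable borel; integrable lborel (\<lambda>\<xi>. (cmod (g \<xi>))\<^sup>2); \<And>\<xi>. g \<xi> \<noteq> 0 \<Longrightarrow> \<bar>\<xi>\<bar> \<le> N;
        \<And>x y. c * \<bar>x - y\<bar> - C / N \<le> \<bar>p x - p y\<bar>; \<And>x y. \<bar>q x - q y\<bar> \<le> M / N\<^sup>2\<rbrakk> \<Longrightarrow>
      (\<integral>\<^sup>+x\<in>B. ennreal ((cmod (osc (p x) (q x) g))\<^sup>2) \<partial>lborel) \<le> ennreal (D * (LINT \<xi>|lborel. (cmod (g \<xi>))\<^sup>2))"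
proof -
  obtain D where D: "0 < D"
    "\<And>N a b r. \<lbrakk>0 < N; 0 \<le> r; \<bar>b\<bar> \<le> M / N\<^sup>2; c * r - C / N \<le> \<bar>a\<bar>\<rbrakk> \<Longrightarrow>
       cmod (chirp_gauss (1 / N\<^sup>2) a b) \<le> D * (N * inverse (1 + (N * r)\<^sup>2))"
    by (rule norm_chirp_gauss_short_time[OF c C M]) blast
  obtain J :: real where J: "0 < J"
    "\<And>N x. 0 < N \<Longrightarrow> (\<integral>\<^sup>+y. ennreal (N * inverse (1 + (N * \<bar>x - y\<bar>)\<^sup>2)) \<partial>lborel) \<le> ennreal J"
    by (rule nn_integral_Cauchy_kernel) blast
  show thesis
  proof (rule that[of "exp 1 * (D * J)"])
    show "0 < exp 1 * (D * J)" using D J by simp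
    fix N :: real and B :: "real set" and p q :: "real \<Rightarrow> real" and g :: "real \<Rightarrow> complex"
    assume N: "0 < N" and B[measurable]: "B \<in> sets borel" and Bf: "emeasure lborel B < \<infinity>"
      and pq: "p \<in> borel_measurable borel" "q \<in> borel_measurable borel"
      and g: "g \<in> borel_measurable borel" "integrable lborel (\<lambda>\<xi>. (cmod (g \<xi>))\<^sup>2)" "\<And>\<xi>. g \<xi> \<noteq> 0 \<Longrightarrow> \<bar>\<xi>\<bar> \<le> N"
      and p: "\<And>x y. c * \<bar>x - y\<bar> - C / N \<le> \<bar>p x - p y\<bar>" and q: "\<And>x y. \<bar>q x - q y\<bar> \<le> M / N\<^sup>2"
    show "(\<integral>\<^sup>+x\<in>B. ennreal ((cmod (osc (p x) (q x) g))\<^sup>2) \<partial>lborel) \<le>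
        ennreal (exp 1 * (D * J) * (LINT \<xi>|lborel. (cmod (g \<xi>))\<^sup>2))"
    proof (rule osc_TTstar[OF N B Bf pq g])
      show "0 < D * J" using D J by simp
      fix x
      have "(\<integral>\<^sup>+y\<in>B. ennreal (cmod (chirp_gauss (1 / N\<^sup>2) (p x - p y) (q x - q y))) \<partial>lborel) \<le>
          (\<integral>\<^sup>+y. ennreal D * ennreal (N * inverse (1 + (N * \<bar>x - y\<bar>)\<^sup>2)) \<partial>lborel)"
      proof (rule nn_integral_mono)
        fix y
        have "cmod (chirp_gauss (1 / N\<^sup>2) (p x - p y) (q x - q y)) \<le> D * (N * inverse (1 + (N * \<bar>x - y\<bar>)\<^sup>2))"
          using p q by (intro D N) auto
        then have "ennreal (cmod (chirp_gauss (1 / N\<^sup>2) (p x - p y) (q x - q y))) \<le>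
           ennreal D * ennreal (N * inverse (1 + (N * \<bar>x - y\<bar>)\<^sup>2))"
          using D(1) N by (subst ennreal_mult[symmetric]) (auto intro!: ennreal_leI mult_nonneg_nonneg add_nonneg_nonneg)
        then show "ennreal (cmod (chirp_gauss (1 / N\<^sup>2) (p x - p y) (q x - q y))) * indicator B y \<le>
           ennreal D * ennreal (N * inverse (1 + (N * \<bar>x - y\<bar>)\<^sup>2))"
          by (simp split: split_indicator)
      qed
      also have "\<dots> = ennreal D * (\<integral>\<^sup>+y. ennreal (N * inverse (1 + (N * \<bar>x - y\<bar>)\<^sup>2)) \<partial>lborel)"
        by (rule nn_integral_cmult) measurable
      also have "\<dots> \<le> ennreal D * ennreal J" by (intro mult_left_mono J N) simp
      also have "\<dots> = ennreal (D * J)" using D J by (simp add: ennreal_mult)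
      finally show "(\<integral>\<^sup>+y\<in>B. ennreal (cmod (chirp_gauss (1 / N\<^sup>2) (p x - p y) (q x - q y))) \<partial>lborel) \<le> ennreal (D * J)" .
    qed
  qed
qed

proposition long_time_estimate:
  fixes \<alpha> \<delta> s R :: real and \<gamma> :: "real \<Rightarrow> real \<Rightarrow> real"
  assumes \<alpha>: "1/4 < \<alpha>" "\<alpha> < 1/2" and \<delta>: "0 \<le> \<delta>" "\<delta> < \<alpha>" and s: "s_crit \<alpha> \<delta> < s"
    and \<gamma>: "admissible_curve \<alpha> \<gamma>" and R: "0 < R"
  obtains D where "0 < D"
    "\<And>N T \<tau> g. \<lbrakk>1 \<le> N; 0 < T; T \<le> 1; N powr (- 1 / \<alpha>) \<le> T; \<tau> \<in> borel_measurable borel;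
        \<And>x. 0 \<le> \<tau> x \<and> \<tau> x \<le> T;
        g \<in> borel_measurable borel; integrable lborel (\<lambda>\<xi>. (cmod (g \<xi>))\<^sup>2); \<And>\<xi>. g \<xi> \<noteq> 0 \<Longrightarrow> \<bar>\<xi>\<bar> \<le> N\<rbrakk> \<Longrightarrow>
      (\<integral>\<^sup>+x\<in>{-R..R}. ennreal ((cmod (osc (\<gamma> x (\<tau> x)) (\<tau> x) g))\<^sup>2) \<partial>lborel) \<le>
        ennreal (D * (T powr (2 * \<delta>) * N powr (2 * s)) * (LINT \<xi>|lborel. (cmod (g \<xi>))\<^sup>2))"
proof -
  obtain c C where c: "0 < c" and C: "0 < C"
    and lower: "\<And>t x y. t \<in> {-1..1} \<Longrightarrow> c * \<bar>x - y\<bar> \<le> \<bar>\<gamma> x t - \<gamma> y t\<bar>"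
    and hoelder: "\<And>x t t'. \<lbrakk>t \<in> {-1..1}; t' \<in> {-1..1}\<rbrakk> \<Longrightarrow> \<bar>\<gamma> x t - \<gamma> x t'\<bar> \<le> C * \<bar>t - t'\<bar> powr \<alpha>"
    and meas: "\<And>\<tau>. \<lbrakk>\<tau> \<in> borel_measurable borel; \<And>x. \<tau> x \<in> {-1..1}\<rbrakk> \<Longrightarrow> (\<lambda>x. \<gamma> x (\<tau> x)) \<in> borel_measurable borel"
    by (rule admissible_curveE[OF \<gamma>]) blast
  obtain \<eta> D where \<eta>: "0 < \<eta>" and D: "0 < D" and K: "\<And>N T a b r. \<lbrakk>1 \<le> N; 0 < T; T \<le> 1; N powr (- 1 / \<alpha>) \<le> T; 0 < r; r \<le> 2 * R; \<bar>b\<bar> \<le> T;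
        c * r - C * \<bar>b\<bar> powr \<alpha> \<le> \<bar>a\<bar>\<rbrakk> \<Longrightarrow>
      cmod (chirp_gauss (1 / N\<^sup>2) a b) \<le> D * (T powr (2 * \<delta>) * N powr (2 * s) * r powr (\<eta> - 1))"
    by (rule long_time_kernel[OF \<alpha> \<delta> s c C R]) blast
  define I where "I = 2 * ((2 * R) powr \<eta> / \<eta>)"
  have I: "0 < I" using \<eta> R by (simp add: I_def)
  show thesis
  proof (rule that[of "exp 1 * (D * I)"])
    show "0 < exp 1 * (D * I)" using D I by simp
    fix N T :: real and \<tau> :: "real \<Rightarrow> real" and g :: "real \<Rightarrow> complex"
    assume N: "1 \<le> N" and T: "0 < T" "T \<le> 1" "N powr (- 1 / \<alpha>) \<le> T"
      and \<tau>m[measurable]: "\<tau> \<in> borel_measurable borel" and \<tau>: "\<And>x. 0 \<le> \<tau> x \<and> \<tau> x \<le> T"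
      and g: "g \<in> borel_measurable borel" "integrable lborel (\<lambda>\<xi>. (cmod (g \<xi>))\<^sup>2)" "\<And>\<xi>. g \<xi> \<noteq> 0 \<Longrightarrow> \<bar>\<xi>\<bar> \<le> N"
    have \<tau>1: "\<tau> x \<in> {-1..1}" for x using \<tau>[of x] T by auto
    define W where "W = T powr (2 * \<delta>) * N powr (2 * s)"
    have W: "0 < W" using T N by (simp add: W_def)
    have "(\<integral>\<^sup>+x\<in>{-R..R}. ennreal ((cmod (osc (\<gamma> x (\<tau> x)) (\<tau> x) g))\<^sup>2) \<partial>lborel) \<le>
        ennreal (exp 1 * (D * W * I) * (LINT \<xi>|lborel. (cmod (g \<xi>))\<^sup>2))"
    proof (rule osc_TTstar[OF _ _ _ _ _ g])
      show "0 < D * W * I" using D W I by simp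
      show "(\<lambda>x. \<gamma> x (\<tau> x)) \<in> borel_measurable borel" using \<tau>m \<tau>1 by (rule meas)
      show "emeasure lborel {- R..R} < \<infinity>" using R by simp
      fix x assume x: "x \<in> {-R..R}"
      have "(\<integral>\<^sup>+y\<in>{-R..R}. ennreal (cmod (chirp_gauss (1 / N\<^sup>2) (\<gamma> x (\<tau> x) - \<gamma> y (\<tau> y)) (\<tau> x - \<tau> y))) \<partial>lborel) \<le>
          (\<integral>\<^sup>+y. ennreal (D * W) * (ennreal (\<bar>x - y\<bar> powr (\<eta> - 1)) * indicator {-R..R} y) \<partial>lborel)"
      proof (rule nn_integral_mono_AE)
        \<comment> \<open>The diagonal has to be discarded: \<open>0 powr (\<eta> - 1)\<close> is 0,
          so the majorant vanishes there.\<close>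
        have "AE y in lborel. y \<noteq> x" using AE_lborel_singleton[of x] by simp
        then show "AE y in lborel. ennreal (cmod (chirp_gauss (1 / N\<^sup>2) (\<gamma> x (\<tau> x) - \<gamma> y (\<tau> y)) (\<tau> x - \<tau> y))) * indicator {-R..R} y \<le>
            ennreal (D * W) * (ennreal (\<bar>x - y\<bar> powr (\<eta> - 1)) * indicator {-R..R} y)"
        proof (rule AE_mp, intro AE_I2 impI)
          fix y assume xy: "y \<noteq> x"
          show "ennreal (cmod (chirp_gauss (1 / N\<^sup>2) (\<gamma> x (\<tau> x) - \<gamma> y (\<tau> y)) (\<tau> x - \<tau> y))) * indicator {-R..R} y \<le>
            ennreal (D * W) * (ennreal (\<bar>x - y\<bar> powr (\<eta> - 1)) * indicator {-R..R} y)"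
          proof (cases "y \<in> {-R..R}")
            case True
            have "cmod (chirp_gauss (1 / N\<^sup>2) (\<gamma> x (\<tau> x) - \<gamma> y (\<tau> y)) (\<tau> x - \<tau> y)) \<le>
                D * (T powr (2 * \<delta>) * N powr (2 * s) * \<bar>x - y\<bar> powr (\<eta> - 1))"
            proof (rule K[OF N T])
              show "0 < \<bar>x - y\<bar>" "\<bar>x - y\<bar> \<le> 2 * R" using xy x True by auto
              show "\<bar>\<tau> x - \<tau> y\<bar> \<le> T" using \<tau>[of x] \<tau>[of y] by auto
              have "c * \<bar>x - y\<bar> \<le> \<bar>\<gamma> x (\<tau> x) - \<gamma> y (\<tau> x)\<bar>" by (rule lower[OF \<tau>1])
              moreover have "\<bar>\<gamma> y (\<tau> x) - \<gamma> y (\<tau> y)\<bar> \<le> C * \<bar>\<tau> x - \<tau> y\<bar> powr \<alpha>" by (rule hoelder[OF \<tau>1 \<tau>1])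
              ultimately show "c * \<bar>x - y\<bar> - C * \<bar>\<tau> x - \<tau> y\<bar> powr \<alpha> \<le> \<bar>\<gamma> x (\<tau> x) - \<gamma> y (\<tau> y)\<bar>" by linarith
            qed
            then have "ennreal (cmod (chirp_gauss (1 / N\<^sup>2) (\<gamma> x (\<tau> x) - \<gamma> y (\<tau> y)) (\<tau> x - \<tau> y))) \<le>
                ennreal (D * W) * ennreal (\<bar>x - y\<bar> powr (\<eta> - 1))"
              using D W by (subst ennreal_mult[symmetric]) (auto intro!: ennreal_leI simp: W_def mult.assoc)
            then show ?thesis using True by simp
          qed simp
        qed
      qed
      also have "\<dots> = ennreal (D * W) * (\<integral>\<^sup>+y\<in>{-R..R}. ennreal (\<bar>x - y\<bar> powr (\<eta> - 1)) \<partial>lborel)"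
        by (rule nn_integral_cmult) measurable
      also have "\<dots> \<le> ennreal (D * W) * ennreal I"
        unfolding I_def using x R \<eta> by (intro mult_left_mono nn_integral_powr_kernel) auto
      also have "\<dots> = ennreal (D * W * I)" using D W I by (simp add: ennreal_mult)
      finally show "(\<integral>\<^sup>+y\<in>{-R..R}. ennreal (cmod (chirp_gauss (1 / N\<^sup>2) (\<gamma> x (\<tau> x) - \<gamma> y (\<tau> y)) (\<tau> x - \<tau> y))) \<partial>lborel) \<le> ennreal (D * W * I)" .
    qed (use N in auto)
    then show "(\<integral>\<^sup>+x\<in>{-R..R}. ennreal ((cmod (osc (\<gamma> x (\<tau> x)) (\<tau> x) g))\<^sup>2) \<partial>lborel) \<le>
        ennreal (exp 1 * (D * I) * (T powr (2 * \<delta>) * N powr (2 * s)) * (LINT \<xi>|lborel. (cmod (g \<xi>))\<^sup>2))"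
      by (simp add: W_def mult_ac)
  qed
qed

section \<open>Differences from time 0 at very short times\<close>

text \<open>Taylor expansion of the phase to first order: differentiating in position multiplies
  \<open>g\<close> by i \<xi>, differentiating in time by i \<xi>^2. The remainder is quadratic in
  the step \<open>h\<close>; its constant is crude because the step length tends to 0 in the
  application.\<close>

lemma norm_osc_step:
  fixes p q h y t N Y :: real and g :: "real \<Rightarrow> complex"
  assumes g: "integrable lborel g" and supp: "\<And>\<xi>. g \<xi> \<noteq> 0 \<Longrightarrow> \<bar>\<xi>\<bar> \<le> N" and N: "1 \<le> N"
    and y: "\<bar>y\<bar> \<le> Y" and t: "\<bar>t\<bar> \<le> Y"
  shows "cmod (osc (p + h * y) (q + h * t) g - osc p q g) \<le>
    \<bar>h\<bar> * (\<bar>y\<bar> * cmod (osc p q (\<lambda>\<xi>. complex_of_real \<xi> * g \<xi>)) + \<bar>t\<bar> * cmod (osc p q (\<lambda>\<xi>. complex_of_real (\<xi>\<^sup>2) * g \<xi>))) +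
    h\<^sup>2 * (2 * Y * N\<^sup>2)\<^sup>2 * (LINT \<xi>|lborel. cmod (g \<xi>))"
proof -
  have Y: "0 \<le> Y" using y by simp
  have gm[measurable]: "g \<in> borel_measurable borel" using g by auto
  have g1: "integrable lborel (\<lambda>\<xi>. complex_of_real \<xi> * g \<xi>)"
  proof (rule Bochner_Integration.integrable_bound)
    show "integrable lborel (\<lambda>\<xi>. complex_of_real N * g \<xi>)" using g by simp
    show "AE \<xi> in lborel. norm (complex_of_real \<xi> * g \<xi>) \<le> norm (complex_of_real N * g \<xi>)"
    proof (intro AE_I2)
      fix \<xi>
      have "\<bar>\<xi>\<bar> \<le> \<bar>N\<bar>" if "g \<xi> \<noteq> 0" using supp[OF that] by simp
      then show "norm (complex_of_real \<xi> * g \<xi>) \<le> norm (complex_of_real N * g \<xi>)"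
        by (cases "g \<xi> = 0") (auto simp: norm_mult intro!: mult_right_mono)
    qed
  qed measurable
  have g2: "integrable lborel (\<lambda>\<xi>. complex_of_real (\<xi>\<^sup>2) * g \<xi>)"
  proof (rule Bochner_Integration.integrable_bound)
    show "integrable lborel (\<lambda>\<xi>. complex_of_real (N\<^sup>2) * g \<xi>)" using g by simp
    show "AE \<xi> in lborel. norm (complex_of_real (\<xi>\<^sup>2) * g \<xi>) \<le> norm (complex_of_real (N\<^sup>2) * g \<xi>)"
    proof (intro AE_I2)
      fix \<xi>
      have "\<xi>\<^sup>2 \<le> N\<^sup>2" if "g \<xi> \<noteq> 0" using supp[OF that] N by (intro abs_le_square_iff[THEN iffD1]) auto
      then show "norm (complex_of_real (\<xi>\<^sup>2) * g \<xi>) \<le> norm (complex_of_real (N\<^sup>2) * g \<xi>)"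
        by (cases "g \<xi> = 0") (auto simp: norm_mult norm_power intro!: mult_right_mono)
    qed
  qed measurable
  define e where "e \<xi> = h * (y * \<xi> + t * \<xi>\<^sup>2)" for \<xi>
  define r where "r \<xi> = cis (e \<xi>) - 1 - \<i> * e \<xi>" for \<xi>
  have [measurable]: "r \<in> borel_measurable borel" unfolding r_def e_def by measurable
  have rb: "cmod (r \<xi> * g \<xi>) \<le> (h\<^sup>2 * (2 * Y * N\<^sup>2)\<^sup>2) * cmod (g \<xi>)" for \<xi>
  proof (cases "g \<xi> = 0")
    case False
    have \<xi>: "\<bar>\<xi>\<bar> \<le> N" by (rule supp[OF False])
    then have \<xi>2: "\<xi>\<^sup>2 \<le> N\<^sup>2" using N by (intro abs_le_square_iff[THEN iffD1]) auto
    have "\<bar>\<xi>\<bar> \<le> N\<^sup>2" using \<xi> N self_le_power[of N 2] by simp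
    have "\<bar>y * \<xi> + t * \<xi>\<^sup>2\<bar> \<le> \<bar>y\<bar> * \<bar>\<xi>\<bar> + \<bar>t\<bar> * \<xi>\<^sup>2"
      by (rule order_trans[OF abs_triangle_ineq]) (simp add: abs_mult)
    also have "\<dots> \<le> Y * N\<^sup>2 + Y * N\<^sup>2"
      using y t \<xi>2 \<open>\<bar>\<xi>\<bar> \<le> N\<^sup>2\<close> Y by (intro add_mono mult_mono) auto
    finally have "\<bar>y * \<xi> + t * \<xi>\<^sup>2\<bar> \<le> \<bar>2 * Y * N\<^sup>2\<bar>" using Y by simp
    then have "(y * \<xi> + t * \<xi>\<^sup>2)\<^sup>2 \<le> (2 * Y * N\<^sup>2)\<^sup>2" by (rule abs_le_square_iff[THEN iffD1])
    then have "h\<^sup>2 * (y * \<xi> + t * \<xi>\<^sup>2)\<^sup>2 \<le> h\<^sup>2 * (2 * Y * N\<^sup>2)\<^sup>2" by (intro mult_left_mono) auto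
    moreover have "cmod (r \<xi>) \<le> (e \<xi>)\<^sup>2"
    proof -
      have "2 * cmod (r \<xi>) \<le> (e \<xi>)\<^sup>2"
        using iexp_approx1[of "e \<xi>" 1] by (simp add: r_def cis_conv_exp numeral_2_eq_2[symmetric] algebra_simps)
      then show ?thesis using norm_ge_zero[of "r \<xi>"] by linarith
    qed
    ultimately show ?thesis by (simp add: norm_mult e_def power_mult_distrib mult_right_mono)
  qed simp
  have ri: "integrable lborel (\<lambda>\<xi>. r \<xi> * g \<xi>)"
  proof (rule Bochner_Integration.integrable_bound)
    show "integrable lborel (\<lambda>\<xi>. (h\<^sup>2 * (2 * Y * N\<^sup>2)\<^sup>2) * cmod (g \<xi>))" using g by simp
  qed (use rb in \<open>auto intro!: AE_I2 order_trans[OF rb]\<close>)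
  have "osc (p + h * y) (q + h * t) g = osc p q (\<lambda>\<xi>. cis (e \<xi>) * g \<xi>)"
  proof -
    have "cis ((p + h * y) * \<xi> + (q + h * t) * \<xi>\<^sup>2) = cis (p * \<xi> + q * \<xi>\<^sup>2) * cis (e \<xi>)" for \<xi>
      unfolding cis_mult e_def by (rule arg_cong[where f=cis]) (simp add: algebra_simps)
    then show ?thesis by (simp add: osc_def mult.assoc)
  qed
  also have "(\<lambda>\<xi>. cis (e \<xi>) * g \<xi>) =
     (\<lambda>\<xi>. g \<xi> + ((\<i> * h * y) * (complex_of_real \<xi> * g \<xi>) + (\<i> * h * t) * (complex_of_real (\<xi>\<^sup>2) * g \<xi>)) + r \<xi> * g \<xi>)"
    by (auto simp: r_def e_def fun_eq_iff algebra_simps)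
  also have "osc p q \<dots> = osc p q g + ((\<i> * h * y) * osc p q (\<lambda>\<xi>. complex_of_real \<xi> * g \<xi>) + (\<i> * h * t) * osc p q (\<lambda>\<xi>. complex_of_real (\<xi>\<^sup>2) * g \<xi>)) +
      osc p q (\<lambda>\<xi>. r \<xi> * g \<xi>)"
  proof -
    note i0 = integrable_osc[OF g, of p q] and i1 = integrable_osc[OF g1, of p q]
      and i2 = integrable_osc[OF g2, of p q] and i3 = integrable_osc[OF ri, of p q]
    have "osc p q (\<lambda>\<xi>. g \<xi> + ((\<i> * h * y) * (complex_of_real \<xi> * g \<xi>) + (\<i> * h * t) * (complex_of_real (\<xi>\<^sup>2) * g \<xi>)) + r \<xi> * g \<xi>) =
      (LINT \<xi>|lborel. cis (p * \<xi> + q * \<xi>\<^sup>2) * g \<xi> + ((\<i> * h * y) * (cis (p * \<xi> + q * \<xi>\<^sup>2) * (complex_of_real \<xi> * g \<xi>)) +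
        (\<i> * h * t) * (cis (p * \<xi> + q * \<xi>\<^sup>2) * (complex_of_real (\<xi>\<^sup>2) * g \<xi>))) + cis (p * \<xi> + q * \<xi>\<^sup>2) * (r \<xi> * g \<xi>))"
      unfolding osc_def by (rule Bochner_Integration.integral_cong) (simp_all add: algebra_simps)
    also have "\<dots> = (LINT \<xi>|lborel. cis (p * \<xi> + q * \<xi>\<^sup>2) * g \<xi>) +
       ((\<i> * h * y) * (LINT \<xi>|lborel. cis (p * \<xi> + q * \<xi>\<^sup>2) * (complex_of_real \<xi> * g \<xi>)) +
        (\<i> * h * t) * (LINT \<xi>|lborel. cis (p * \<xi> + q * \<xi>\<^sup>2) * (complex_of_real (\<xi>\<^sup>2) * g \<xi>))) +
       (LINT \<xi>|lborel. cis (p * \<xi> + q * \<xi>\<^sup>2) * (r \<xi> * g \<xi>))"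
      by (subst Bochner_Integration.integral_add Bochner_Integration.integral_mult_right_zero;
        (intro Bochner_Integration.integrable_add integrable_mult_right i0 i1 i2 i3)?)+ simp
    finally show ?thesis unfolding osc_def .
  qed
  finally have "osc (p + h * y) (q + h * t) g - osc p q g =
     ((\<i> * h * y) * osc p q (\<lambda>\<xi>. complex_of_real \<xi> * g \<xi>) + (\<i> * h * t) * osc p q (\<lambda>\<xi>. complex_of_real (\<xi>\<^sup>2) * g \<xi>)) + osc p q (\<lambda>\<xi>. r \<xi> * g \<xi>)"
    by simp
  also have "cmod \<dots> \<le> (\<bar>h\<bar> * \<bar>y\<bar> * cmod (osc p q (\<lambda>\<xi>. complex_of_real \<xi> * g \<xi>)) + \<bar>h\<bar> * \<bar>t\<bar> * cmod (osc p q (\<lambda>\<xi>. complex_of_real (\<xi>\<^sup>2) * g \<xi>))) +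
      cmod (osc p q (\<lambda>\<xi>. r \<xi> * g \<xi>))"
    by (intro norm_triangle_le add_mono norm_triangle_le) (simp_all add: norm_mult)
  also have "cmod (osc p q (\<lambda>\<xi>. r \<xi> * g \<xi>)) \<le> (LINT \<xi>|lborel. cmod (r \<xi> * g \<xi>))" by (rule norm_osc_le)
  also have "\<dots> \<le> (LINT \<xi>|lborel. (h\<^sup>2 * (2 * Y * N\<^sup>2)\<^sup>2) * cmod (g \<xi>))"
    using g ri rb by (intro integral_mono) auto
  finally show ?thesis by (simp add: algebra_simps)
qed

lemma square_weight_integrable:
  fixes g :: "real \<Rightarrow> complex" and h :: "real \<Rightarrow> real"
  assumes [measurable]: "g \<in> borel_measurable borel" "h \<in> borel_measurable borel"
    and g2: "integrable lborel (\<lambda>\<xi>. (cmod (g \<xi>))\<^sup>2)"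
    and h: "\<And>\<xi>. g \<xi> \<noteq> 0 \<Longrightarrow> \<bar>h \<xi>\<bar> \<le> M"
  shows "integrable lborel (\<lambda>\<xi>. (cmod (complex_of_real (h \<xi>) * g \<xi>))\<^sup>2)"
    "(LINT \<xi>|lborel. (cmod (complex_of_real (h \<xi>) * g \<xi>))\<^sup>2) \<le> M\<^sup>2 * (LINT \<xi>|lborel. (cmod (g \<xi>))\<^sup>2)"
proof -
  have le: "(cmod (complex_of_real (h \<xi>) * g \<xi>))\<^sup>2 \<le> M\<^sup>2 * (cmod (g \<xi>))\<^sup>2" for \<xi>
  proof (cases "g \<xi> = 0")
    case False
    have "(h \<xi>)\<^sup>2 \<le> M\<^sup>2" using h[OF False] by (metis abs_ge_zero power2_abs power_mono)
    then show ?thesis by (simp add: norm_mult power_mult_distrib mult_right_mono)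
  qed simp
  have i: "integrable lborel (\<lambda>\<xi>. M\<^sup>2 * (cmod (g \<xi>))\<^sup>2)" using g2 by simp
  show 1: "integrable lborel (\<lambda>\<xi>. (cmod (complex_of_real (h \<xi>) * g \<xi>))\<^sup>2)"
    by (rule Bochner_Integration.integrable_bound[OF i]) (use le in \<open>auto intro!: AE_I2\<close>)
  show "(LINT \<xi>|lborel. (cmod (complex_of_real (h \<xi>) * g \<xi>))\<^sup>2) \<le> M\<^sup>2 * (LINT \<xi>|lborel. (cmod (g \<xi>))\<^sup>2)"
    using integral_mono[OF 1 i] le by simp
qed

text \<open>Cauchy-Schwarz for averages: the bound for an average does not deteriorate with the
  number of terms.\<close>

lemma square_sum_le:
  fixes a :: "nat \<Rightarrow> real"
  assumes "0 < n"
  shows "(1 / n * (\<Sum>i<n. a i))\<^sup>2 \<le> 1 / n * (\<Sum>i<n. (a i)\<^sup>2)"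
proof -
  have "(\<Sum>i<n. a i)\<^sup>2 \<le> real n * (\<Sum>i<n. (a i)\<^sup>2)"
    using sum_squared_le_sum_of_squares[of a "{..<n}"] by (simp add: mult.commute)
  from divide_right_mono[OF this, of "(real n)\<^sup>2"] assms show ?thesis
    by (simp add: power_mult_distrib power_divide power2_eq_square)
qed

text \<open>The segment from (x,0) to (\<gamma> x (\<tau> x), \<tau> x) is cut into n equal steps.
  At each node the first derivatives are controlled by \<open>short_time_estimate\<close>, since for
  T \<le> N^(-1/\<alpha>) the node is within C/N of x. The Taylor errors add up to order 1/n for
  fixed \<open>g\<close> and vanish in the limit, so a Riemann sum does the work of an integral
  along the segment.\<close>

proposition short_time_difference:
  fixes \<alpha> :: real and \<gamma> :: "real \<Rightarrow> real \<Rightarrow> real"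
  assumes \<alpha>: "0 < \<alpha>" "\<alpha> < 1/2" and \<gamma>: "admissible_curve \<alpha> \<gamma>"
  obtains D where "0 < D"
    "\<And>N T B \<tau> g. \<lbrakk>1 \<le> N; 0 < T; T \<le> N powr (- 1 / \<alpha>); B \<in> sets borel; emeasure lborel B < \<infinity>;
        \<tau> \<in> borel_measurable borel; \<And>x. 0 \<le> \<tau> x \<and> \<tau> x \<le> T;
        g \<in> borel_measurable borel; integrable lborel (\<lambda>\<xi>. (cmod (g \<xi>))\<^sup>2); \<And>\<xi>. g \<xi> \<noteq> 0 \<Longrightarrow> \<bar>\<xi>\<bar> \<le> N\<rbrakk> \<Longrightarrow>
      (\<integral>\<^sup>+x\<in>B. ennreal ((cmod (osc (\<gamma> x (\<tau> x)) (\<tau> x) g - osc x 0 g))\<^sup>2) \<partial>lborel) \<le>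
        ennreal (D * (T powr \<alpha> * N)\<^sup>2 * (LINT \<xi>|lborel. (cmod (g \<xi>))\<^sup>2))"
proof -
  obtain c C where c: "0 < c" and C: "0 < C"
    and lower: "\<And>t x y. t \<in> {-1..1} \<Longrightarrow> c * \<bar>x - y\<bar> \<le> \<bar>\<gamma> x t - \<gamma> y t\<bar>"
    and hoelder: "\<And>x t t'. \<lbrakk>t \<in> {-1..1}; t' \<in> {-1..1}\<rbrakk> \<Longrightarrow> \<bar>\<gamma> x t - \<gamma> x t'\<bar> \<le> C * \<bar>t - t'\<bar> powr \<alpha>"
    and \<gamma>0: "\<And>x. \<gamma> x 0 = x"
    and meas: "\<And>\<tau>. \<lbrakk>\<tau> \<in> borel_measurable borel; \<And>x. \<tau> x \<in> {-1..1}\<rbrakk> \<Longrightarrow> (\<lambda>x. \<gamma> x (\<tau> x)) \<in> borel_measurable borel"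
    by (rule admissible_curveE[OF \<gamma>]) blast
  obtain D where D: "0 < D" and est: "\<And>N B p q g. \<lbrakk>0 < N; B \<in> sets borel; emeasure lborel B < \<infinity>;
        p \<in> borel_measurable borel; q \<in> borel_measurable borel;
        g \<in> borel_measurable borel; integrable lborel (\<lambda>\<xi>. (cmod (g \<xi>))\<^sup>2); \<And>\<xi>. g \<xi> \<noteq> 0 \<Longrightarrow> \<bar>\<xi>\<bar> \<le> N;
        \<And>x y. 1 * \<bar>x - y\<bar> - (2 * C) / N \<le> \<bar>p x - p y\<bar>; \<And>x y. \<bar>q x - q y\<bar> \<le> 1 / N\<^sup>2\<rbrakk> \<Longrightarrow>
      (\<integral>\<^sup>+x\<in>B. ennreal ((cmod (osc (p x) (q x) g))\<^sup>2) \<partial>lborel) \<le> ennreal (D * (LINT \<xi>|lborel. (cmod (g \<xi>))\<^sup>2))"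
    by (rule short_time_estimate[of 1 "2 * C" 1]) (use C in auto)
  \<comment> \<open>The inner coefficients bound the square of \<open>A\<close> by its two
    derivative terms; the outer factor 2 comes from separating the average from the Taylor
    error.\<close>
  define V0 where "V0 = 2 * (2 * C\<^sup>2 * D + 2 * D)"
  show thesis
  proof (rule that[of V0])
    show "0 < V0" unfolding V0_def using D C by (simp add: add_pos_pos)
    fix N T :: real and B :: "real set" and \<tau> :: "real \<Rightarrow> real" and g :: "real \<Rightarrow> complex"
    assume N: "1 \<le> N" and T: "0 < T" "T \<le> N powr (- 1 / \<alpha>)"
      and B[measurable]: "B \<in> sets borel" and Bf: "emeasure lborel B < \<infinity>"
      and \<tau>m[measurable]: "\<tau> \<in> borel_measurable borel" and \<tau>: "\<And>x. 0 \<le> \<tau> x \<and> \<tau> x \<le> T"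
      and g[measurable]: "g \<in> borel_measurable borel" and g2: "integrable lborel (\<lambda>\<xi>. (cmod (g \<xi>))\<^sup>2)"
      and supp: "\<And>\<xi>. g \<xi> \<noteq> 0 \<Longrightarrow> \<bar>\<xi>\<bar> \<le> N"
    have N0: "0 < N" using N by simp
    have gi: "integrable lborel g" by (rule square_integrable_imp_integrable[OF g g2 supp])
    \<comment> \<open>The condition \<alpha> < 1/2 enters here: the short times considered lie below
      the dispersive time N^(-2).\<close>
    have "N powr (- 1 / \<alpha>) \<le> N powr (-2)" using N \<alpha> by (intro powr_mono) (auto simp: field_simps)
    then have TN2: "T \<le> 1 / N\<^sup>2" using T N0 by (simp add: powr_minus_divide powr_numeral)
    moreover have "1 / N\<^sup>2 \<le> 1" using N by simp
    ultimately have T1: "T \<le> 1" by linarith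
    have \<tau>1: "\<tau> x \<in> {-1..1}" for x using \<tau>[of x] T1 by auto
    have "T powr \<alpha> \<le> (N powr (- 1 / \<alpha>)) powr \<alpha>" using T \<alpha> by (intro powr_mono2) auto
    also have "\<dots> = N powr (- 1)" unfolding powr_powr using \<alpha> by simp
    finally have Ta: "T powr \<alpha> \<le> 1 / N" using N0 by (simp add: powr_minus_divide)
    have "T powr (1 - \<alpha>) \<le> (N powr (- 1 / \<alpha>)) powr (1 - \<alpha>)" using T \<alpha> by (intro powr_mono2) auto
    also have "\<dots> = N powr (- (1 - \<alpha>) / \<alpha>)" unfolding powr_powr by (rule arg_cong[where f="\<lambda>z. N powr z"]) (use \<alpha> in \<open>simp add: field_simps\<close>)
    also have "\<dots> \<le> N powr (- 1)" using N \<alpha> by (intro powr_mono) (auto simp: field_simps)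
    finally have T1a: "T powr (1 - \<alpha>) \<le> 1 / N" using N0 by (simp add: powr_minus_divide)
    \<comment> \<open>The time derivative costs T N^2 and the space derivative T^\<alpha> N; in this
      range the second dominates.\<close>
    have TT: "T * N\<^sup>2 \<le> T powr \<alpha> * N"
    proof -
      have "T = T powr \<alpha> * T powr (1 - \<alpha>)" using T by (simp flip: powr_add)
      also have "\<dots> \<le> T powr \<alpha> * (1 / N)" using T1a by (intro mult_left_mono) auto
      finally have "T * N\<^sup>2 \<le> T powr \<alpha> * (1 / N) * N\<^sup>2" by (intro mult_right_mono) auto
      then show ?thesis using N0 by (simp add: power2_eq_square)
    qed
    define G where "G = (LINT \<xi>|lborel. (cmod (g \<xi>))\<^sup>2)"
    have G0: "0 \<le> G" by (simp add: G_def)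
    define y where "y x = \<gamma> x (\<tau> x) - x" for x
    have [measurable]: "(\<lambda>x. \<gamma> x (\<tau> x)) \<in> borel_measurable borel" using \<tau>m \<tau>1 by (rule meas)
    have [measurable]: "y \<in> borel_measurable borel" unfolding y_def by measurable
    have yb: "\<bar>y x\<bar> \<le> C * T powr \<alpha>" for x
    proof -
      have "\<bar>y x\<bar> \<le> C * \<bar>\<tau> x - 0\<bar> powr \<alpha>" using hoelder[OF \<tau>1[of x], of 0 x] by (simp add: y_def \<gamma>0)
      also have "\<dots> \<le> C * T powr \<alpha>" using \<tau>[of x] C \<alpha> by (intro mult_left_mono powr_mono2) auto
      finally show ?thesis .
    qed
    define Y where "Y = max (C * T powr \<alpha>) T"
    define g1 where "g1 \<xi> = complex_of_real \<xi> * g \<xi>" for \<xi>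
    define g2' where "g2' \<xi> = complex_of_real (\<xi>\<^sup>2) * g \<xi>" for \<xi>
    have [measurable]: "g1 \<in> borel_measurable borel" "g2' \<in> borel_measurable borel"
      unfolding g1_def g2'_def by measurable
    have n1: "integrable lborel (\<lambda>\<xi>. (cmod (g1 \<xi>))\<^sup>2)" "(LINT \<xi>|lborel. (cmod (g1 \<xi>))\<^sup>2) \<le> N\<^sup>2 * G"
      unfolding g1_def G_def using square_weight_integrable[of g "\<lambda>\<xi>. \<xi>" N, OF g _ g2 supp] by simp_all
    have supp2: "\<bar>\<xi>\<^sup>2\<bar> \<le> N\<^sup>2" if "g \<xi> \<noteq> 0" for \<xi>
      using supp[OF that] N by (simp add: abs_le_square_iff[symmetric])
    have n2: "integrable lborel (\<lambda>\<xi>. (cmod (g2' \<xi>))\<^sup>2)" "(LINT \<xi>|lborel. (cmod (g2' \<xi>))\<^sup>2) \<le> (N\<^sup>2)\<^sup>2 * G"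
      unfolding g2'_def G_def using square_weight_integrable[of g "\<lambda>\<xi>. \<xi>\<^sup>2" "N\<^sup>2", OF g _ g2 supp2] by simp_all
    \<comment> \<open>The evolution at the point a fraction \<open>u\<close> along the
      segment.\<close>
    define P where "P u x = osc (x + u * y x) (u * \<tau> x)" for u x
    have Pm[measurable]: "(\<lambda>x. P u x h) \<in> borel_measurable borel" if [measurable]: "h \<in> borel_measurable borel" for u h
      unfolding P_def by (rule measurable_osc) auto
    have Pest: "(\<integral>\<^sup>+x\<in>B. ennreal ((cmod (P u x h))\<^sup>2) \<partial>lborel) \<le> ennreal (D * (LINT \<xi>|lborel. (cmod (h \<xi>))\<^sup>2))"
      if u: "0 \<le> u" "u \<le> 1" and h: "h \<in> borel_measurable borel" "integrable lborel (\<lambda>\<xi>. (cmod (h \<xi>))\<^sup>2)"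
        "\<And>\<xi>. h \<xi> \<noteq> 0 \<Longrightarrow> \<bar>\<xi>\<bar> \<le> N" for u h
      unfolding P_def
    proof (rule est[OF N0 B Bf _ _ h])
      fix x z
      have "\<bar>u * y x\<bar> \<le> C / N" for x
      proof -
        have "\<bar>u * y x\<bar> \<le> 1 * (C * T powr \<alpha>)" unfolding abs_mult using u yb by (intro mult_mono) auto
        also have "\<dots> \<le> C / N" using mult_left_mono[OF Ta, of C] C by simp
        finally show ?thesis .
      qed
      then have uy: "\<bar>u * y x\<bar> \<le> C / N" "\<bar>u * y z\<bar> \<le> C / N" by blast+
      have tri: "\<bar>x - z\<bar> - (k + k) \<le> \<bar>(x + a) - (z + b)\<bar>" if "\<bar>a\<bar> \<le> k" "\<bar>b\<bar> \<le> k" for a b k :: real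
        using that by linarith
      show "1 * \<bar>x - z\<bar> - (2 * C) / N \<le> \<bar>(x + u * y x) - (z + u * y z)\<bar>"
        using tri[OF uy] by (simp only: mult_2 add_divide_distrib mult_1)
      have "\<bar>u * \<tau> x - u * \<tau> z\<bar> = u * \<bar>\<tau> x - \<tau> z\<bar>" unfolding right_diff_distrib[symmetric] abs_mult using u by simp
      also have "\<dots> \<le> 1 * T" using u \<tau>[of x] \<tau>[of z] by (intro mult_mono) auto
      finally show "\<bar>u * \<tau> x - u * \<tau> z\<bar> \<le> 1 / N\<^sup>2" using TN2 by simp
    qed auto
    define A where "A u x = C * T powr \<alpha> * cmod (P u x g1) + T * cmod (P u x g2')" for u x
    have [measurable]: "(\<lambda>x. A u x) \<in> borel_measurable borel" for u unfolding A_def by measurable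
    have Aest: "(\<integral>\<^sup>+x\<in>B. ennreal ((A u x)\<^sup>2) \<partial>lborel) \<le> ennreal (V0 / 2 * (T powr \<alpha> * N)\<^sup>2 * G)"
      if u: "0 \<le> u" "u \<le> 1" for u
    proof -
      have "(\<integral>\<^sup>+x\<in>B. ennreal ((A u x)\<^sup>2) \<partial>lborel) \<le>
        (\<integral>\<^sup>+x. ennreal (2 * (C * T powr \<alpha>)\<^sup>2) * (ennreal ((cmod (P u x g1))\<^sup>2) * indicator B x) +
           ennreal (2 * T\<^sup>2) * (ennreal ((cmod (P u x g2'))\<^sup>2) * indicator B x) \<partial>lborel)"
      proof (rule nn_integral_mono)
        fix x
        have "(a + b)\<^sup>2 \<le> 2 * a\<^sup>2 + 2 * b\<^sup>2" for a b :: real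
          using zero_le_power2[of "a - b"] by (simp add: power2_sum power2_diff)
        from this[of "C * T powr \<alpha> * cmod (P u x g1)" "T * cmod (P u x g2')"]
        have "(A u x)\<^sup>2 \<le> 2 * (C * T powr \<alpha>)\<^sup>2 * (cmod (P u x g1))\<^sup>2 + 2 * T\<^sup>2 * (cmod (P u x g2'))\<^sup>2"
          by (simp add: A_def power_mult_distrib mult.assoc)
        from ennreal_leI[OF this]
        show "ennreal ((A u x)\<^sup>2) * indicator B x \<le> ennreal (2 * (C * T powr \<alpha>)\<^sup>2) * (ennreal ((cmod (P u x g1))\<^sup>2) * indicator B x) +
           ennreal (2 * T\<^sup>2) * (ennreal ((cmod (P u x g2'))\<^sup>2) * indicator B x)"
          by (simp add: ennreal_mult split: split_indicator)
      qed
      also have "\<dots> = ennreal (2 * (C * T powr \<alpha>)\<^sup>2) * (\<integral>\<^sup>+x\<in>B. ennreal ((cmod (P u x g1))\<^sup>2) \<partial>lborel) +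
          ennreal (2 * T\<^sup>2) * (\<integral>\<^sup>+x\<in>B. ennreal ((cmod (P u x g2'))\<^sup>2) \<partial>lborel)"
        by (subst nn_integral_add) (auto simp: nn_integral_cmult)
      also have "\<dots> \<le> ennreal (2 * (C * T powr \<alpha>)\<^sup>2) * ennreal (D * (LINT \<xi>|lborel. (cmod (g1 \<xi>))\<^sup>2)) +
          ennreal (2 * T\<^sup>2) * ennreal (D * (LINT \<xi>|lborel. (cmod (g2' \<xi>))\<^sup>2))"
        using supp by (intro add_mono mult_left_mono Pest u n1 n2) (auto simp: g1_def g2'_def)
      also have "\<dots> = ennreal (2 * (C * T powr \<alpha>)\<^sup>2 * (D * (LINT \<xi>|lborel. (cmod (g1 \<xi>))\<^sup>2)) +
           2 * T\<^sup>2 * (D * (LINT \<xi>|lborel. (cmod (g2' \<xi>))\<^sup>2)))"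
        using D by (simp add: ennreal_mult[symmetric] ennreal_plus[symmetric] del: ennreal_plus)
      also have "\<dots> \<le> ennreal (V0 / 2 * (T powr \<alpha> * N)\<^sup>2 * G)"
      proof (rule ennreal_leI)
        have "2 * (C * T powr \<alpha>)\<^sup>2 * (D * (LINT \<xi>|lborel. (cmod (g1 \<xi>))\<^sup>2)) \<le> 2 * (C * T powr \<alpha>)\<^sup>2 * (D * (N\<^sup>2 * G))"
          using D n1(2) by (intro mult_left_mono) auto
        moreover have "2 * T\<^sup>2 * (D * (LINT \<xi>|lborel. (cmod (g2' \<xi>))\<^sup>2)) \<le> 2 * T\<^sup>2 * (D * ((N\<^sup>2)\<^sup>2 * G))"
          using D n2(2) by (intro mult_left_mono) auto
        moreover have "2 * T\<^sup>2 * (D * ((N\<^sup>2)\<^sup>2 * G)) = 2 * D * G * (T * N\<^sup>2)\<^sup>2" by (simp add: power_mult_distrib)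
        moreover have "\<dots> \<le> 2 * D * G * (T powr \<alpha> * N)\<^sup>2"
          using D G0 TT T N0 by (intro mult_left_mono power_mono) auto
        ultimately show "2 * (C * T powr \<alpha>)\<^sup>2 * (D * (LINT \<xi>|lborel. (cmod (g1 \<xi>))\<^sup>2)) +
           2 * T\<^sup>2 * (D * (LINT \<xi>|lborel. (cmod (g2' \<xi>))\<^sup>2)) \<le> V0 / 2 * (T powr \<alpha> * N)\<^sup>2 * G"
          unfolding V0_def by (simp add: power_mult_distrib algebra_simps)
      qed
      finally show ?thesis .
    qed
    define E where "E = (2 * Y * N\<^sup>2)\<^sup>2 * (LINT \<xi>|lborel. cmod (g \<xi>))"
    have E0: "0 \<le> E" by (simp add: E_def)
    define b where "b = measure lborel B"
    have b: "emeasure lborel B = ennreal b" "0 \<le> b"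
      using Bf unfolding b_def by (auto intro: emeasure_eq_ennreal_measure)
    let ?L = "\<integral>\<^sup>+x\<in>B. ennreal ((cmod (osc (\<gamma> x (\<tau> x)) (\<tau> x) g - osc x 0 g))\<^sup>2) \<partial>lborel"
    have main: "?L \<le> ennreal (V0 * (T powr \<alpha> * N)\<^sup>2 * G + 2 * (E / real (Suc m))\<^sup>2 * b)" for m
    proof -
      define n where "n = Suc m"
      have n: "0 < n" by (simp add: n_def)
      have pt: "(cmod (osc (\<gamma> x (\<tau> x)) (\<tau> x) g - osc x 0 g))\<^sup>2 \<le>
          2 * (1 / n * (\<Sum>i<n. (A (real i / n) x)\<^sup>2)) + 2 * (E / n)\<^sup>2" for x
      proof -
        have step: "cmod (P (real (Suc i) / n) x g - P (real i / n) x g) \<le> 1 / n * A (real i / n) x + 1 / n * (E / n)" for i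
        proof -
          have "P (real (Suc i) / n) x g = osc ((x + real i / n * y x) + 1 / n * y x) (real i / n * \<tau> x + 1 / n * \<tau> x) g"
            unfolding P_def by (simp add: add_divide_distrib distrib_right add_ac)
          moreover have "cmod (osc ((x + real i / n * y x) + 1 / n * y x) (real i / n * \<tau> x + 1 / n * \<tau> x) g - osc (x + real i / n * y x) (real i / n * \<tau> x) g) \<le>
             \<bar>1 / n\<bar> * (\<bar>y x\<bar> * cmod (osc (x + real i / n * y x) (real i / n * \<tau> x) (\<lambda>\<xi>. complex_of_real \<xi> * g \<xi>)) + \<bar>\<tau> x\<bar> * cmod (osc (x + real i / n * y x) (real i / n * \<tau> x) (\<lambda>\<xi>. complex_of_real (\<xi>\<^sup>2) * g \<xi>))) +
             (1 / n)\<^sup>2 * (2 * Y * N\<^sup>2)\<^sup>2 * (LINT \<xi>|lborel. cmod (g \<xi>))"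
            using yb[of x] \<tau>[of x] by (intro norm_osc_step gi supp N) (auto simp: Y_def)
          ultimately have "cmod (P (real (Suc i) / n) x g - P (real i / n) x g) \<le>
             1 / n * (\<bar>y x\<bar> * cmod (P (real i / n) x g1) + \<bar>\<tau> x\<bar> * cmod (P (real i / n) x g2')) + 1 / n * (E / n)"
            by (simp add: P_def g1_def[abs_def] g2'_def[abs_def] E_def power2_eq_square mult_ac)
          also have "\<dots> \<le> 1 / n * A (real i / n) x + 1 / n * (E / n)"
            unfolding A_def using yb[of x] \<tau>[of x] by (intro add_mono mult_left_mono mult_right_mono) auto
          finally show ?thesis .
        qed
        have "osc (\<gamma> x (\<tau> x)) (\<tau> x) g - osc x 0 g = P (real n / n) x g - P (real 0 / n) x g"
          using n by (simp add: P_def y_def)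
        also have "\<dots> = (\<Sum>i<n. P (real (Suc i) / n) x g - P (real i / n) x g)"
          by (rule sum_lessThan_telescope[symmetric])
        finally have "cmod (osc (\<gamma> x (\<tau> x)) (\<tau> x) g - osc x 0 g) \<le> (\<Sum>i<n. 1 / n * A (real i / n) x + 1 / n * (E / n))"
          using sum_norm_le[of "{..<n}" "\<lambda>i. P (real (Suc i) / n) x g - P (real i / n) x g"] step by simp
        also have "\<dots> = 1 / n * (\<Sum>i<n. A (real i / n) x) + E / n"
          using n by (simp add: sum.distrib sum_distrib_left)
        finally have "(cmod (osc (\<gamma> x (\<tau> x)) (\<tau> x) g - osc x 0 g))\<^sup>2 \<le> (1 / n * (\<Sum>i<n. A (real i / n) x) + E / n)\<^sup>2"
          by (intro power_mono) auto
        also have "\<dots> \<le> 2 * (1 / n * (\<Sum>i<n. A (real i / n) x))\<^sup>2 + 2 * (E / n)\<^sup>2"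
          using zero_le_power2[of "1 / n * (\<Sum>i<n. A (real i / n) x) - E / n"]
          unfolding power2_sum power2_diff by linarith
        also have "\<dots> \<le> 2 * (1 / n * (\<Sum>i<n. (A (real i / n) x)\<^sup>2)) + 2 * (E / n)\<^sup>2"
          using square_sum_le[OF n, of "\<lambda>i. A (real i / n) x"] by simp
        finally show ?thesis .
      qed
      have "?L \<le> (\<integral>\<^sup>+x. ennreal (2 / n) * (\<Sum>i<n. ennreal ((A (real i / n) x)\<^sup>2) * indicator B x) + ennreal (2 * (E / n)\<^sup>2) * indicator B x \<partial>lborel)"
      proof (rule nn_integral_mono)
        fix x
        have "ennreal ((cmod (osc (\<gamma> x (\<tau> x)) (\<tau> x) g - osc x 0 g))\<^sup>2) \<le> ennreal (2 / n * (\<Sum>i<n. (A (real i / n) x)\<^sup>2) + 2 * (E / n)\<^sup>2)"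
          using pt[of x] by (intro ennreal_leI) simp
        also have "\<dots> = ennreal (2 / n) * (\<Sum>i<n. ennreal ((A (real i / n) x)\<^sup>2)) + ennreal (2 * (E / n)\<^sup>2)"
          by (simp add: ennreal_plus ennreal_mult sum_nonneg del: times_divide_eq_left)
        finally show "ennreal ((cmod (osc (\<gamma> x (\<tau> x)) (\<tau> x) g - osc x 0 g))\<^sup>2) * indicator B x \<le>
            ennreal (2 / n) * (\<Sum>i<n. ennreal ((A (real i / n) x)\<^sup>2) * indicator B x) + ennreal (2 * (E / n)\<^sup>2) * indicator B x"
          by (cases "x \<in> B") simp_all
      qed
      also have "\<dots> = ennreal (2 / n) * (\<Sum>i<n. \<integral>\<^sup>+x\<in>B. ennreal ((A (real i / n) x)\<^sup>2) \<partial>lborel) + ennreal (2 * (E / n)\<^sup>2) * emeasure lborel B"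
      proof -
        define f where "f i x = ennreal ((A (real i / n) x)\<^sup>2) * indicator B x" for i x
        have [measurable]: "f i \<in> borel_measurable borel" for i unfolding f_def by measurable
        show ?thesis unfolding f_def[symmetric]
          by (subst nn_integral_add) (auto simp: nn_integral_cmult nn_integral_sum nn_integral_cmult_indicator)
      qed
      also have "\<dots> \<le> ennreal (2 / n) * (\<Sum>i<n. ennreal (V0 / 2 * (T powr \<alpha> * N)\<^sup>2 * G)) + ennreal (2 * (E / n)\<^sup>2) * ennreal b"
        unfolding b using n by (intro add_mono mult_left_mono sum_mono Aest order_refl) auto
      also have "\<dots> = ennreal (2 / n * (n * (V0 / 2 * (T powr \<alpha> * N)\<^sup>2 * G)) + 2 * (E / n)\<^sup>2 * b)"
      proof -
        have "0 \<le> V0 / 2 * (T powr \<alpha> * N)\<^sup>2 * G" using \<open>0 < V0\<close> G0 by simp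
        then show ?thesis using b(2)
          by (simp add: ennreal_plus ennreal_mult ennreal_of_nat_eq_real_of_nat del: times_divide_eq_left)
      qed
      also have "2 / n * (n * (V0 / 2 * (T powr \<alpha> * N)\<^sup>2 * G)) = V0 * (T powr \<alpha> * N)\<^sup>2 * G" using n by simp
      finally show ?thesis by (simp add: n_def)
    qed
    \<comment> \<open>The constant \<open>E\<close> depends on the integral norm of \<open>g\<close>
      and not only on its square norm, but the left side does not depend on the number of steps, so
      the term disappears.\<close>
    have "(\<lambda>m. (E / real (Suc m))\<^sup>2) \<longlonglongrightarrow> 0"
      using tendsto_power[OF LIMSEQ_Suc[OF lim_const_over_n[of E]], of 2] by simp
    then have "(\<lambda>m. V0 * (T powr \<alpha> * N)\<^sup>2 * G + 2 * (E / real (Suc m))\<^sup>2 * b) \<longlonglongrightarrow> V0 * (T powr \<alpha> * N)\<^sup>2 * G + 2 * 0 * b"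
      by (intro tendsto_intros)
    then have "(\<lambda>m. V0 * (T powr \<alpha> * N)\<^sup>2 * G + 2 * (E / real (Suc m))\<^sup>2 * b) \<longlonglongrightarrow> V0 * (T powr \<alpha> * N)\<^sup>2 * G"
      by simp
    then have "(\<lambda>m. ennreal (V0 * (T powr \<alpha> * N)\<^sup>2 * G + 2 * (E / real (Suc m))\<^sup>2 * b)) \<longlonglongrightarrow> ennreal (V0 * (T powr \<alpha> * N)\<^sup>2 * G)"
      by (rule tendsto_ennrealI)
    then show "?L \<le> ennreal (V0 * (T powr \<alpha> * N)\<^sup>2 * (LINT \<xi>|lborel. (cmod (g \<xi>))\<^sup>2))"
      unfolding G_def[symmetric] by (rule LIMSEQ_le_const) (use main in auto)
  qed
qed

section \<open>Linearised suprema and the combined estimate\<close>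

text \<open>The induction carries measurability of x |-> h (\<tau> x) x along, since
  \<open>h\<close> is measurable only for each fixed first argument; this makes the set on which the
  new time wins measurable.\<close>

lemma measurable_maximizer:
  fixes h :: "real \<Rightarrow> real \<Rightarrow> real"
  assumes "finite S" "S \<noteq> {}" and "\<And>t. t \<in> S \<Longrightarrow> h t \<in> borel_measurable borel"
  obtains \<tau> where "\<tau> \<in> borel_measurable borel" "\<And>x. \<tau> x \<in> S" "\<And>x t. t \<in> S \<Longrightarrow> h t x \<le> h (\<tau> x) x"
proof -
  have "\<exists>\<tau>. \<tau> \<in> borel_measurable borel \<and> (\<lambda>x. h (\<tau> x) x) \<in> borel_measurable borel \<and> (\<forall>x. \<tau> x \<in> S) \<and> (\<forall>x. \<forall>t\<in>S. h t x \<le> h (\<tau> x) x)"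
    using assms
  proof (induction S rule: finite_ne_induct)
    case (singleton t)
    then show ?case by (intro exI[of _ "\<lambda>_. t"]) auto
  next
    case (insert t S)
    have "\<exists>\<tau>. \<tau> \<in> borel_measurable borel \<and> (\<lambda>x. h (\<tau> x) x) \<in> borel_measurable borel \<and> (\<forall>x. \<tau> x \<in> S) \<and> (\<forall>x. \<forall>t\<in>S. h t x \<le> h (\<tau> x) x)"
      by (rule insert.IH) (use insert.prems in auto)
    then obtain \<tau> where \<tau>: "\<tau> \<in> borel_measurable borel" "(\<lambda>x. h (\<tau> x) x) \<in> borel_measurable borel"
      "\<And>x. \<tau> x \<in> S" "\<And>x t. t \<in> S \<Longrightarrow> h t x \<le> h (\<tau> x) x" by blast
    have [measurable]: "\<tau> \<in> borel_measurable borel" "(\<lambda>x. h (\<tau> x) x) \<in> borel_measurable borel" "h t \<in> borel_measurable borel"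
      using \<tau> insert.prems by auto
    define \<sigma> where "\<sigma> x = (if h (\<tau> x) x < h t x then t else \<tau> x)" for x
    have "\<sigma> \<in> borel_measurable borel" unfolding \<sigma>_def by measurable
    moreover have "(\<lambda>x. h (\<sigma> x) x) = (\<lambda>x. if h (\<tau> x) x < h t x then h t x else h (\<tau> x) x)"
      by (auto simp: \<sigma>_def)
    then have "(\<lambda>x. h (\<sigma> x) x) \<in> borel_measurable borel" by simp
    moreover have "\<sigma> x \<in> insert t S" for x using \<tau>(3)[of x] by (simp add: \<sigma>_def)
    moreover have "h u x \<le> h (\<sigma> x) x" if "u \<in> insert t S" for u x
      using \<tau>(4)[of u x] that by (auto simp: \<sigma>_def)
    ultimately show ?case by blast
  qed
  then show thesis using that by blast
qed

lemma powr_two_nat: "(2 ^ k) powr x = (2 powr x) ^ k" for x :: real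
  by (simp add: powr_powr powr_realpow[symmetric] mult.commute)

text \<open>Both estimates are combined into a bound with geometric decay in the frequency index \<open>k\<close> and
  the time index \<open>j\<close>, so that no logarithmic count of time scales is needed.\<close>

proposition scale_maximal_estimate:
  fixes \<alpha> \<delta> s R :: real and \<gamma> :: "real \<Rightarrow> real \<Rightarrow> real"
  assumes \<alpha>: "1/4 < \<alpha>" "\<alpha> < 1/2" and \<delta>: "0 \<le> \<delta>" "\<delta> < \<alpha>" and s: "s_crit \<alpha> \<delta> < s"
    and \<gamma>: "admissible_curve \<alpha> \<gamma>" and R: "0 < R"
  obtains D \<rho> where "0 < D" "0 < \<rho>" "\<rho> < 1"
    "\<And>k j \<tau> g. \<lbrakk>\<tau> \<in> borel_measurable borel; \<And>x. 0 \<le> \<tau> x \<and> \<tau> x \<le> 1 / 2 ^ j;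
        g \<in> borel_measurable borel; integrable lborel (\<lambda>\<xi>. (cmod (g \<xi>))\<^sup>2); \<And>\<xi>. g \<xi> \<noteq> 0 \<Longrightarrow> \<bar>\<xi>\<bar> \<le> 2 ^ k\<rbrakk> \<Longrightarrow>
      (\<integral>\<^sup>+x\<in>{-R..R}. ennreal ((cmod (osc (\<gamma> x (\<tau> x)) (\<tau> x) g - osc x 0 g))\<^sup>2) \<partial>lborel) \<le>
        ennreal (D * ((1 / 2 ^ j) powr (2 * \<delta>) * (2 ^ k) powr (2 * s) * (\<rho> ^ k * \<rho> ^ j)) * (LINT \<xi>|lborel. (cmod (g \<xi>))\<^sup>2))"
    "\<And>k g. \<lbrakk>g \<in> borel_measurable borel; integrable lborel (\<lambda>\<xi>. (cmod (g \<xi>))\<^sup>2); \<And>\<xi>. g \<xi> \<noteq> 0 \<Longrightarrow> \<bar>\<xi>\<bar> \<le> 2 ^ k\<rbrakk> \<Longrightarrow>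
      (\<integral>\<^sup>+x\<in>{-R..R}. ennreal ((cmod (osc x 0 g))\<^sup>2) \<partial>lborel) \<le>
        ennreal (D * (2 ^ k) powr (2 * s) * \<rho> ^ k * (LINT \<xi>|lborel. (cmod (g \<xi>))\<^sup>2))"
proof -
  note sc = s_crit_ge[OF \<alpha> \<delta>]
  \<comment> \<open>Half of the excess keeps \<open>s0\<close> above the critical exponent; the
    other half is turned into geometric decay.\<close>
  define \<epsilon> where "\<epsilon> = (s - s_crit \<alpha> \<delta>) / 2"
  have \<epsilon>: "0 < \<epsilon>" using s by (simp add: \<epsilon>_def)
  define s0 where "s0 = s - \<epsilon>"
  have s0: "s_crit \<alpha> \<delta> < s0" using s by (simp add: s0_def \<epsilon>_def field_simps)
  \<comment> \<open>The first bound makes N^\<epsilon> T^\<rho>' at least 1 whenever T \<ge>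
    N^(-1/\<alpha>); the second leaves a nonnegative power of \<open>T\<close> in the short-time
    case.\<close>
  define \<rho>' where "\<rho>' = min (\<epsilon> * \<alpha>) (2 * (\<alpha> - \<delta>))"
  have \<rho>': "0 < \<rho>'" "\<rho>' \<le> \<epsilon> * \<alpha>" "\<rho>' \<le> 2 * (\<alpha> - \<delta>)" using \<epsilon> \<alpha> \<delta> by (auto simp: \<rho>'_def)
  define \<rho> where "\<rho> = 2 powr (- min \<epsilon> \<rho>')"
  have \<rho>: "0 < \<rho>" "\<rho> < 1" using \<epsilon> \<rho>' by (auto simp: \<rho>_def powr_less_one)
  obtain D1 where D1: "0 < D1" and long: "\<And>N T \<tau> g. \<lbrakk>1 \<le> N; 0 < T; T \<le> 1; N powr (- 1 / \<alpha>) \<le> T; \<tau> \<in> borel_measurable borel;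
        \<And>x. 0 \<le> \<tau> x \<and> \<tau> x \<le> T;
        g \<in> borel_measurable borel; integrable lborel (\<lambda>\<xi>. (cmod (g \<xi>))\<^sup>2); \<And>\<xi>. g \<xi> \<noteq> 0 \<Longrightarrow> \<bar>\<xi>\<bar> \<le> N\<rbrakk> \<Longrightarrow>
      (\<integral>\<^sup>+x\<in>{-R..R}. ennreal ((cmod (osc (\<gamma> x (\<tau> x)) (\<tau> x) g))\<^sup>2) \<partial>lborel) \<le>
        ennreal (D1 * (T powr (2 * \<delta>) * N powr (2 * s0)) * (LINT \<xi>|lborel. (cmod (g \<xi>))\<^sup>2))"
    by (rule long_time_estimate[OF \<alpha> \<delta> s0 \<gamma> R]) blast
  obtain D2 where D2: "0 < D2" and fixed: "\<And>N B p q g. \<lbrakk>0 < N; B \<in> sets borel; emeasure lborel B < \<infinity>;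
        p \<in> borel_measurable borel; q \<in> borel_measurable borel;
        g \<in> borel_measurable borel; integrable lborel (\<lambda>\<xi>. (cmod (g \<xi>))\<^sup>2); \<And>\<xi>. g \<xi> \<noteq> 0 \<Longrightarrow> \<bar>\<xi>\<bar> \<le> N;
        \<And>x y. 1 * \<bar>x - y\<bar> - 0 / N \<le> \<bar>p x - p y\<bar>; \<And>x y. \<bar>q x - q y\<bar> \<le> 0 / N\<^sup>2\<rbrakk> \<Longrightarrow>
      (\<integral>\<^sup>+x\<in>B. ennreal ((cmod (osc (p x) (q x) g))\<^sup>2) \<partial>lborel) \<le> ennreal (D2 * (LINT \<xi>|lborel. (cmod (g \<xi>))\<^sup>2))"
    by (rule short_time_estimate[of 1 0 0]) auto
  have "0 < \<alpha>" using \<alpha> by simp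
  then obtain D3 where D3: "0 < D3" and short: "\<And>N T B \<tau> g. \<lbrakk>1 \<le> N; 0 < T; T \<le> N powr (- 1 / \<alpha>); B \<in> sets borel; emeasure lborel B < \<infinity>;
        \<tau> \<in> borel_measurable borel; \<And>x. 0 \<le> \<tau> x \<and> \<tau> x \<le> T;
        g \<in> borel_measurable borel; integrable lborel (\<lambda>\<xi>. (cmod (g \<xi>))\<^sup>2); \<And>\<xi>. g \<xi> \<noteq> 0 \<Longrightarrow> \<bar>\<xi>\<bar> \<le> N\<rbrakk> \<Longrightarrow>
      (\<integral>\<^sup>+x\<in>B. ennreal ((cmod (osc (\<gamma> x (\<tau> x)) (\<tau> x) g - osc x 0 g))\<^sup>2) \<partial>lborel) \<le>
        ennreal (D3 * (T powr \<alpha> * N)\<^sup>2 * (LINT \<xi>|lborel. (cmod (g \<xi>))\<^sup>2))"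
    by (rule short_time_difference[OF _ \<alpha>(2) \<gamma>]) blast
  obtain c C where meas: "\<And>\<tau>. \<lbrakk>\<tau> \<in> borel_measurable borel; \<And>x. \<tau> x \<in> {-1..1}\<rbrakk> \<Longrightarrow> (\<lambda>x. \<gamma> x (\<tau> x)) \<in> borel_measurable borel"
    by (rule admissible_curveE[OF \<gamma>]) blast
  define D where "D = 2 * D1 + 2 * D2 + D3"
  have base: "(\<integral>\<^sup>+x\<in>{-R..R}. ennreal ((cmod (osc x 0 g))\<^sup>2) \<partial>lborel) \<le> ennreal (D2 * (LINT \<xi>|lborel. (cmod (g \<xi>))\<^sup>2))"
    if "g \<in> borel_measurable borel" "integrable lborel (\<lambda>\<xi>. (cmod (g \<xi>))\<^sup>2)" "\<And>\<xi>. g \<xi> \<noteq> 0 \<Longrightarrow> \<bar>\<xi>\<bar> \<le> 2 ^ k" for k :: nat and g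
    using R that by (intro fixed[where N="2 ^ k"]) auto
  show thesis
  proof (rule that[of D \<rho>])
    show "0 < D" using D1 D2 D3 by (simp add: D_def)
    show "0 < \<rho>" "\<rho> < 1" by fact+
  next
    fix k :: nat and g :: "real \<Rightarrow> complex"
    assume g: "g \<in> borel_measurable borel" "integrable lborel (\<lambda>\<xi>. (cmod (g \<xi>))\<^sup>2)" "\<And>\<xi>. g \<xi> \<noteq> 0 \<Longrightarrow> \<bar>\<xi>\<bar> \<le> 2 ^ k"
    have "0 \<le> \<delta> / \<alpha>" using \<delta> \<alpha> by simp
    \<comment> \<open>A single time yields no power of \<open>N\<close>, so the factor \<rho>^k is
      borrowed from \<open>(2 ^ k) powr (2 * s)\<close>. This requires 2^(2 s) \<rho> \<ge>
      1.\<close>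
    then have "min \<epsilon> \<rho>' \<le> 2 * s" using sc(2) s \<epsilon> by (simp add: \<epsilon>_def min_le_iff_disj)
    then have "1 \<le> 2 powr (2 * s) * 2 powr (- min \<epsilon> \<rho>')"
      unfolding powr_add[symmetric] by (intro ge_one_powr_ge_zero) auto
    then have "1 \<le> (2 powr (2 * s) * 2 powr (- min \<epsilon> \<rho>')) ^ k" by (rule one_le_power)
    then have "1 \<le> (2 ^ k) powr (2 * s) * \<rho> ^ k" by (simp add: \<rho>_def power_mult_distrib powr_two_nat)
    then have "D2 * 1 \<le> D * ((2 ^ k) powr (2 * s) * \<rho> ^ k)" using D1 D2 D3 by (intro mult_mono) (auto simp: D_def)
    then have "D2 * (LINT \<xi>|lborel. (cmod (g \<xi>))\<^sup>2) \<le> D * (2 ^ k) powr (2 * s) * \<rho> ^ k * (LINT \<xi>|lborel. (cmod (g \<xi>))\<^sup>2)"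
      by (intro mult_right_mono) (auto simp: mult.assoc)
    then show "(\<integral>\<^sup>+x\<in>{-R..R}. ennreal ((cmod (osc x 0 g))\<^sup>2) \<partial>lborel) \<le>
        ennreal (D * (2 ^ k) powr (2 * s) * \<rho> ^ k * (LINT \<xi>|lborel. (cmod (g \<xi>))\<^sup>2))"
      using order_trans[OF base[OF g] ennreal_leI] by blast
  next
    fix k j :: nat and \<tau> :: "real \<Rightarrow> real" and g :: "real \<Rightarrow> complex"
    assume \<tau>m[measurable]: "\<tau> \<in> borel_measurable borel" and \<tau>: "\<And>x. 0 \<le> \<tau> x \<and> \<tau> x \<le> 1 / 2 ^ j"
      and g: "g \<in> borel_measurable borel" "integrable lborel (\<lambda>\<xi>. (cmod (g \<xi>))\<^sup>2)" "\<And>\<xi>. g \<xi> \<noteq> 0 \<Longrightarrow> \<bar>\<xi>\<bar> \<le> 2 ^ k"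
    define N where "N = (2::real) ^ k"
    define T where "T = 1 / (2::real) ^ j"
    have N: "1 \<le> N" "0 < N" by (auto simp: N_def)
    have T: "0 < T" "T \<le> 1" by (auto simp: T_def)
    have \<tau>T: "0 \<le> \<tau> x \<and> \<tau> x \<le> T" for x using \<tau>[of x] by (simp add: T_def)
    have supp: "\<And>\<xi>. g \<xi> \<noteq> 0 \<Longrightarrow> \<bar>\<xi>\<bar> \<le> N" unfolding N_def by (rule g(3))
    define G where "G = (LINT \<xi>|lborel. (cmod (g \<xi>))\<^sup>2)"
    have G0: "0 \<le> G" by (simp add: G_def)
    define X where "X = T powr (2 * \<delta>) * N powr (2 * s) * (N powr (- \<epsilon>) * T powr \<rho>')"
    let ?L = "\<integral>\<^sup>+x\<in>{-R..R}. ennreal ((cmod (osc (\<gamma> x (\<tau> x)) (\<tau> x) g - osc x 0 g))\<^sup>2) \<partial>lborel"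
    have "?L \<le> ennreal (D * X * G)"
    proof (cases "N powr (- 1 / \<alpha>) \<le> T")
      case True
      have [measurable]: "(\<lambda>x. \<gamma> x (\<tau> x)) \<in> borel_measurable borel"
      proof (rule meas[OF \<tau>m])
        show "\<tau> x \<in> {-1..1}" for x using \<tau>T[of x] T by auto
      qed
      have [measurable]: "(\<lambda>x. osc (\<gamma> x (\<tau> x)) (\<tau> x) g) \<in> borel_measurable borel" "(\<lambda>x. osc x 0 g) \<in> borel_measurable borel"
        using g(1) by (auto intro!: measurable_osc)
      have TN: "T powr x \<le> N powr (- x / \<alpha>)" if "x \<le> 0" for x
        using powr_mono2'[of x "N powr (- 1 / \<alpha>)" T] that True N by (simp add: powr_powr)
      define Z where "Z = T powr (2 * \<delta>) * N powr (2 * s0)"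
      \<comment> \<open>Long times allow no cancellation between the evolution and its value at time
        0. The latter is bounded separately and is absorbed because \<open>Z\<close> is at least
        1.\<close>
      have Z1: "1 \<le> Z"
      proof -
        have "T powr (- (2 * \<delta>)) \<le> N powr (2 * \<delta> / \<alpha>)" using TN[of "- (2 * \<delta>)"] \<delta> by simp
        also have "\<dots> \<le> N powr (2 * s0)" using sc(2) s0 N by (intro powr_mono) auto
        finally show ?thesis using T by (simp add: Z_def powr_minus field_simps)
      qed
      have ZX: "Z \<le> X"
      proof -
        have "T powr (- \<rho>') \<le> N powr (\<rho>' / \<alpha>)" using TN[of "- \<rho>'"] \<rho>' by simp
        also have "\<dots> \<le> N powr \<epsilon>" using \<rho>' \<alpha> N by (intro powr_mono) (auto simp: field_simps)
        finally have "1 \<le> N powr \<epsilon> * T powr \<rho>'" using T by (simp add: powr_minus field_simps)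
        then have "Z * 1 \<le> Z * (N powr \<epsilon> * T powr \<rho>')" using Z1 by (intro mult_left_mono) auto
        also have "\<dots> = T powr (2 * \<delta>) * (N powr (2 * s0) * N powr \<epsilon>) * T powr \<rho>'" by (simp add: Z_def mult_ac)
        also have "N powr (2 * s0) * N powr \<epsilon> = N powr (2 * s) * N powr (- \<epsilon>)"
          unfolding powr_add[symmetric] by (simp add: s0_def)
        finally show ?thesis by (simp add: X_def mult_ac)
      qed
      have "?L \<le> (\<integral>\<^sup>+x. 2 * (ennreal ((cmod (osc (\<gamma> x (\<tau> x)) (\<tau> x) g))\<^sup>2) * indicator {-R..R} x) +
          2 * (ennreal ((cmod (osc x 0 g))\<^sup>2) * indicator {-R..R} x) \<partial>lborel)"
      proof (rule nn_integral_mono)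
        fix x
        have "(cmod (a - b))\<^sup>2 \<le> 2 * (cmod a)\<^sup>2 + 2 * (cmod b)\<^sup>2" for a b :: complex
        proof -
          have "(cmod (a - b))\<^sup>2 \<le> (cmod a + cmod b)\<^sup>2" by (intro power_mono norm_triangle_ineq4) simp
          also have "\<dots> \<le> 2 * (cmod a)\<^sup>2 + 2 * (cmod b)\<^sup>2"
            using zero_le_power2[of "cmod a - cmod b"] unfolding power2_sum power2_diff by linarith
          finally show ?thesis .
        qed
        then have "ennreal ((cmod (osc (\<gamma> x (\<tau> x)) (\<tau> x) g - osc x 0 g))\<^sup>2) \<le>
            ennreal (2 * (cmod (osc (\<gamma> x (\<tau> x)) (\<tau> x) g))\<^sup>2 + 2 * (cmod (osc x 0 g))\<^sup>2)"
          by (rule ennreal_leI)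
        then show "ennreal ((cmod (osc (\<gamma> x (\<tau> x)) (\<tau> x) g - osc x 0 g))\<^sup>2) * indicator {-R..R} x \<le>
            2 * (ennreal ((cmod (osc (\<gamma> x (\<tau> x)) (\<tau> x) g))\<^sup>2) * indicator {-R..R} x) +
            2 * (ennreal ((cmod (osc x 0 g))\<^sup>2) * indicator {-R..R} x)"
          by (simp add: ennreal_mult split: split_indicator)
      qed
      also have "\<dots> = 2 * (\<integral>\<^sup>+x\<in>{-R..R}. ennreal ((cmod (osc (\<gamma> x (\<tau> x)) (\<tau> x) g))\<^sup>2) \<partial>lborel) +
          2 * (\<integral>\<^sup>+x\<in>{-R..R}. ennreal ((cmod (osc x 0 g))\<^sup>2) \<partial>lborel)"
        by (subst nn_integral_add) (auto simp: nn_integral_cmult)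
      also have "\<dots> \<le> 2 * ennreal (D1 * Z * G) + 2 * ennreal (D2 * G)"
        unfolding Z_def G_def using True T N \<tau>T
        by (intro add_mono mult_left_mono base[OF g] long g(1,2) supp \<tau>m) auto
      also have "\<dots> = ennreal ((2 * D1 * Z + 2 * D2) * G)"
        using D1 D2 Z1 G0 by (simp add: ennreal_mult ennreal_plus distrib_right mult.assoc)
      also have "\<dots> \<le> ennreal (D * X * G)"
      proof (intro ennreal_leI mult_right_mono G0)
        have "2 * D1 * Z + 2 * D2 * 1 \<le> 2 * D1 * X + 2 * D2 * X"
          using D1 D2 Z1 ZX by (intro add_mono mult_left_mono) auto
        also have "\<dots> \<le> D * X" using D3 Z1 ZX by (simp add: D_def distrib_right)
        finally show "2 * D1 * Z + 2 * D2 \<le> D * X" by simp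
      qed
      finally show ?thesis .
    next
      case False
      \<comment> \<open>What remains of T^(2 \<alpha>) after T^(2 \<delta>) and the decay T^\<rho>'
        are split off. Since T \<le> N^(-1/\<alpha>), this remainder compensates the factor N^2 up
        to N^(2 s - \<epsilon>).\<close>
      define \<beta> where "\<beta> = 2 * (\<alpha> - \<delta>) - \<rho>'"
      have \<beta>: "0 \<le> \<beta>" using \<rho>' by (simp add: \<beta>_def)
      have "T powr \<beta> \<le> (N powr (- 1 / \<alpha>)) powr \<beta>" using False T \<beta> by (intro powr_mono2) auto
      also have "\<dots> = N powr (- 1 / \<alpha> * \<beta>)" by (simp add: powr_powr)
      also have "\<dots> \<le> N powr (2 * s - 2 - \<epsilon>)"
      proof (rule powr_mono)
        have "\<rho>' / \<alpha> \<le> \<epsilon>" using \<rho>' \<alpha> by (simp add: field_simps)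
        moreover have "- 1 / \<alpha> * \<beta> = - 2 + 2 * (\<delta> / \<alpha>) + \<rho>' / \<alpha>"
          using \<alpha> by (simp add: \<beta>_def field_simps)
        moreover have "2 * (\<delta> / \<alpha>) \<le> 2 * s_crit \<alpha> \<delta>" by (rule mult_left_mono[OF sc(2)]) simp
        moreover have "2 * s_crit \<alpha> \<delta> = 2 * s - 2 * \<epsilon> - 2 * \<epsilon>" by (simp add: \<epsilon>_def field_simps)
        ultimately show "- 1 / \<alpha> * \<beta> \<le> 2 * s - 2 - \<epsilon>" using \<epsilon> by linarith
      qed (use N in auto)
      finally have b: "T powr \<beta> \<le> N powr (2 * s - 2 - \<epsilon>)" .
      have "(T powr \<alpha> * N)\<^sup>2 = T powr (2 * \<alpha>) * N powr 2"
        using T N by (simp add: power_mult_distrib powr_power powr_numeral)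
      also have "T powr (2 * \<alpha>) = T powr (2 * \<delta>) * T powr \<rho>' * T powr \<beta>"
        unfolding powr_add[symmetric] by (simp add: \<beta>_def)
      also have "T powr (2 * \<delta>) * T powr \<rho>' * T powr \<beta> * N powr 2 \<le>
         T powr (2 * \<delta>) * T powr \<rho>' * N powr (2 * s - 2 - \<epsilon>) * N powr 2"
        using b by (intro mult_left_mono mult_right_mono) auto
      also have "\<dots> = T powr (2 * \<delta>) * T powr \<rho>' * (N powr (2 * s - 2 - \<epsilon>) * N powr 2)" by simp
      also have "N powr (2 * s - 2 - \<epsilon>) * N powr 2 = N powr (2 * s) * N powr (- \<epsilon>)"
        unfolding powr_add[symmetric] by simp
      finally have le: "(T powr \<alpha> * N)\<^sup>2 \<le> X" by (simp add: X_def mult_ac)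
      have "?L \<le> ennreal (D3 * (T powr \<alpha> * N)\<^sup>2 * G)"
        unfolding G_def using False R by (intro short[OF N(1) T(1) _ _ _ \<tau>m \<tau>T g(1,2) supp]) auto
      also have "\<dots> \<le> ennreal (D * X * G)"
        using le D1 D2 D3 G0 by (intro ennreal_leI mult_right_mono mult_mono) (auto simp: D_def)
      finally show ?thesis .
    qed
    also have "\<dots> \<le> ennreal (D * (T powr (2 * \<delta>) * N powr (2 * s) * (\<rho> ^ k * \<rho> ^ j)) * G)"
    proof -
      have "N powr (- \<epsilon>) \<le> \<rho> ^ k"
        unfolding N_def powr_two_nat \<rho>_def by (intro power_mono powr_mono) auto
      moreover have "T powr \<rho>' \<le> \<rho> ^ j"
      proof -
        have "T powr \<rho>' = (2 powr (- \<rho>')) ^ j"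
          unfolding T_def powr_two_nat[symmetric] by (simp add: powr_divide powr_minus_divide)
        also have "\<dots> \<le> \<rho> ^ j" unfolding \<rho>_def by (intro power_mono powr_mono) auto
        finally show ?thesis .
      qed
      ultimately have "X \<le> T powr (2 * \<delta>) * N powr (2 * s) * (\<rho> ^ k * \<rho> ^ j)"
        unfolding X_def using \<rho> by (intro mult_left_mono mult_mono) auto
      then show ?thesis using D1 D2 D3 G0 by (intro ennreal_leI mult_right_mono mult_left_mono) (auto simp: D_def)
    qed
    finally show "?L \<le> ennreal (D * ((1 / 2 ^ j) powr (2 * \<delta>) * (2 ^ k) powr (2 * s) * (\<rho> ^ k * \<rho> ^ j)) * (LINT \<xi>|lborel. (cmod (g \<xi>))\<^sup>2))"
      by (simp add: T_def N_def G_def)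
  qed
qed

section \<open>Almost everywhere convergence above the critical exponent\<close>

lemma continuous_osc:
  fixes S :: "real set"
  assumes g: "integrable lborel g" and p: "continuous_on S p" and q: "continuous_on S q"
  shows "continuous_on S (\<lambda>t. osc (p t) (q t) g)"
proof (unfold continuous_on_sequentially, intro allI ballI impI)
  fix x a assume a: "a \<in> S" and x: "(\<forall>n. x n \<in> S) \<and> x \<longlonglongrightarrow> a"
  have pa: "(\<lambda>n. p (x n)) \<longlonglongrightarrow> p a" and qa: "(\<lambda>n. q (x n)) \<longlonglongrightarrow> q a"
    using p q a x unfolding continuous_on_sequentially comp_def by blast+
  have [measurable]: "g \<in> borel_measurable borel" using g by auto
  have "(\<lambda>n. LINT \<xi>|lborel. cis (p (x n) * \<xi> + q (x n) * \<xi>\<^sup>2) * g \<xi>) \<longlonglongrightarrow> (LINT \<xi>|lborel. cis (p a * \<xi> + q a * \<xi>\<^sup>2) * g \<xi>)"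
  proof (rule integral_dominated_convergence)
    show "integrable lborel (\<lambda>\<xi>. cmod (g \<xi>))" using g by simp
    show "AE \<xi> in lborel. (\<lambda>n. cis (p (x n) * \<xi> + q (x n) * \<xi>\<^sup>2) * g \<xi>) \<longlonglongrightarrow> cis (p a * \<xi> + q a * \<xi>\<^sup>2) * g \<xi>"
    proof (intro AE_I2 tendsto_mult tendsto_const)
      fix \<xi>
      have "(\<lambda>n. p (x n) * \<xi> + q (x n) * \<xi>\<^sup>2) \<longlonglongrightarrow> p a * \<xi> + q a * \<xi>\<^sup>2"
        by (intro tendsto_intros pa qa)
      then show "(\<lambda>n. cis (p (x n) * \<xi> + q (x n) * \<xi>\<^sup>2)) \<longlonglongrightarrow> cis (p a * \<xi> + q a * \<xi>\<^sup>2)"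
        unfolding cis_conv_exp by (intro tendsto_intros pa qa)
    qed
  qed (auto simp: norm_mult)
  then show "((\<lambda>t. osc (p t) (q t) g) \<circ> x) \<longlonglongrightarrow> osc (p a) (q a) g"
    by (simp add: osc_def comp_def)
qed

lemma U_integrand_eq: "U_integrand \<gamma> f x t \<xi> = cis (\<gamma> x t * \<xi> + t * \<xi>\<^sup>2) * fhat f \<xi>"
  by (simp add: U_integrand_def)

lemma U_partial_eq_osc:
  "U_partial \<gamma> f x t n = osc (\<gamma> x t) t (\<lambda>\<xi>. if \<bar>\<xi>\<bar> \<le> 2 ^ n then fhat f \<xi> else 0)"
  unfolding U_partial_def set_lebesgue_integral_def osc_def U_integrand_eq
  by (intro Bochner_Integration.integral_cong) (auto simp: indicator_def)

lemma osc_truncate_tendsto: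
  assumes g: "integrable lborel g"
  shows "(\<lambda>n. osc p q (\<lambda>\<xi>. if \<bar>\<xi>\<bar> \<le> 2 ^ n then g \<xi> else 0)) \<longlonglongrightarrow> osc p q g"
  unfolding osc_def
proof (rule integral_dominated_convergence)
  have [measurable]: "g \<in> borel_measurable borel" using g by auto
  show "integrable lborel (\<lambda>\<xi>. cmod (g \<xi>))" using g by simp
  show "AE \<xi> in lborel. (\<lambda>n. cis (p * \<xi> + q * \<xi>\<^sup>2) * (if \<bar>\<xi>\<bar> \<le> 2 ^ n then g \<xi> else 0)) \<longlonglongrightarrow> cis (p * \<xi> + q * \<xi>\<^sup>2) * g \<xi>"
  proof (intro AE_I2 tendsto_eventually)
    fix \<xi> :: real
    obtain m where "\<bar>\<xi>\<bar> < 2 ^ m" using real_arch_pow[of 2 "\<bar>\<xi>\<bar>"] by auto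
    then have "\<bar>\<xi>\<bar> \<le> 2 ^ n" if "m \<le> n" for n
      using power_increasing[OF that, of "2::real"] by linarith
    then show "\<forall>\<^sub>F n in sequentially. cis (p * \<xi> + q * \<xi>\<^sup>2) * (if \<bar>\<xi>\<bar> \<le> 2 ^ n then g \<xi> else 0) = cis (p * \<xi> + q * \<xi>\<^sup>2) * g \<xi>"
      by (auto simp: eventually_sequentially)
  qed
  show "(\<lambda>\<xi>. cis (p * \<xi> + q * \<xi>\<^sup>2) * (if \<bar>\<xi>\<bar> \<le> 2 ^ n then g \<xi> else 0)) \<in> borel_measurable lborel" for n
    by measurable
qed (use g in \<open>auto simp: norm_mult\<close>)

text \<open>Removes the case distinction in \<open>U\<close>: when the transform is integrable,
  dominated convergence shows that the full integral is the dyadic limit too.\<close>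

lemma U_exists_tendsto:
  assumes e: "U_exists \<gamma> f x t"
  shows "U_partial \<gamma> f x t \<longlonglongrightarrow> complex_of_real (2 * pi) * U \<gamma> f x t"
proof (cases "integrable lborel (fhat f)")
  case True
  then show ?thesis
    using osc_truncate_tendsto[OF True] unfolding U_partial_eq_osc[abs_def]
    by (simp add: U_def osc_def U_integrand_eq[abs_def])
next
  case False
  then have "convergent (U_partial \<gamma> f x t)" using e by (simp add: U_exists_def)
  then show ?thesis using False by (simp add: U_def convergent_LIMSEQ_iff)
qed

text \<open>Finite maxima are attained at measurable selections, for which the bound is assumed;
  monotone convergence along an enumeration passes to the countable supremum.\<close>

lemma countable_maximal:
  fixes h :: "real \<Rightarrow> real \<Rightarrow> real"
  assumes Q: "countable Q" "Q \<noteq> {}" and B[measurable]: "B \<in> sets borel"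
    and hm: "\<And>t. t \<in> Q \<Longrightarrow> h t \<in> borel_measurable borel"
    and bound: "\<And>\<tau>. \<lbrakk>\<tau> \<in> borel_measurable borel; \<And>x. \<tau> x \<in> Q\<rbrakk> \<Longrightarrow> (\<integral>\<^sup>+x\<in>B. ennreal (h (\<tau> x) x) \<partial>lborel) \<le> c"
  obtains M where "M \<in> borel_measurable borel" "(\<integral>\<^sup>+x\<in>B. M x \<partial>lborel) \<le> c"
    "\<And>t x. t \<in> Q \<Longrightarrow> ennreal (h t x) \<le> M x"
proof -
  define e where "e = from_nat_into Q"
  have eQ: "e n \<in> Q" for n using Q by (simp add: e_def from_nat_into)
  have [measurable]: "h (e n) \<in> borel_measurable borel" for n by (rule hm[OF eQ])
  define F where "F n x = (SUP m\<in>{..n}. ennreal (h (e m) x))" for n x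
  have [measurable]: "F n \<in> borel_measurable borel" for n unfolding F_def by measurable
  define M where "M x = (SUP n. F n x)" for x
  have inc: "incseq (\<lambda>n x. F n x * indicator B x)"
    unfolding incseq_def le_fun_def F_def by (intro allI impI mult_right_mono SUP_subset_mono) auto
  have Fb: "(\<integral>\<^sup>+x. F n x * indicator B x \<partial>lborel) \<le> c" for n
  proof -
    obtain \<tau> where \<tau>: "\<tau> \<in> borel_measurable borel" "\<And>x. \<tau> x \<in> e ` {..n}" "\<And>x t. t \<in> e ` {..n} \<Longrightarrow> h t x \<le> h (\<tau> x) x"
      by (rule measurable_maximizer[of "e ` {..n}" h]) auto
    have "F n x \<le> ennreal (h (\<tau> x) x)" for x
      unfolding F_def using \<tau>(3) by (intro SUP_least ennreal_leI) auto
    then have "(\<integral>\<^sup>+x. F n x * indicator B x \<partial>lborel) \<le> (\<integral>\<^sup>+x\<in>B. ennreal (h (\<tau> x) x) \<partial>lborel)"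
      by (intro nn_integral_mono mult_right_mono) auto
    also have "\<dots> \<le> c"
    proof (rule bound[OF \<tau>(1)])
      show "\<tau> x \<in> Q" for x using \<tau>(2)[of x] eQ by auto
    qed
    finally show ?thesis .
  qed
  show thesis
  proof (rule that[of M])
    show "M \<in> borel_measurable borel" unfolding M_def by measurable
    have "(\<integral>\<^sup>+x\<in>B. M x \<partial>lborel) = (\<integral>\<^sup>+x. (SUP n. F n x * indicator B x) \<partial>lborel)"
      unfolding M_def by (intro nn_integral_cong) (simp add: SUP_mult_right_ennreal)
    also have "\<dots> = (SUP n. \<integral>\<^sup>+x. F n x * indicator B x \<partial>lborel)"
      by (rule nn_integral_monotone_convergence_SUP[OF inc]) measurable
    also have "\<dots> \<le> c" by (rule SUP_least) (rule Fb)
    finally show "(\<integral>\<^sup>+x\<in>B. M x \<partial>lborel) \<le> c" .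
    fix t x assume "t \<in> Q"
    then obtain m where m: "t = e m" using from_nat_into_surj[OF Q(1)] unfolding e_def by metis
    have "ennreal (h t x) \<le> F m x" unfolding F_def m by (rule SUP_upper) simp
    also have "\<dots> \<le> M x" unfolding M_def by (rule SUP_upper) simp
    finally show "ennreal (h t x) \<le> M x" .
  qed
qed

text \<open>Dividing by the square root of the assumed decay leaves a convergent double series of
  integrals. Its sum is finite almost everywhere and bounds every term, so half of the exponent is
  spent on passing from integral to pointwise bounds.\<close>

lemma AE_geometric_bound:
  fixes M :: "nat \<Rightarrow> nat \<Rightarrow> real \<Rightarrow> ennreal"
  assumes B[measurable]: "B \<in> sets borel" and M[measurable]: "\<And>k j. M k j \<in> borel_measurable borel"
    and \<rho>: "0 < \<rho>" "\<rho> < 1" and A: "0 \<le> A"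
    and bound: "\<And>k j. (\<integral>\<^sup>+x\<in>B. M k j x \<partial>lborel) \<le> ennreal (A * (\<rho> ^ k * \<rho> ^ j))"
  shows "AE x in lborel. x \<in> B \<longrightarrow> (\<exists>C\<ge>0. \<forall>k j. M k j x \<le> ennreal (C * (sqrt \<rho> ^ k * sqrt \<rho> ^ j)))"
proof -
  define q where "q = sqrt \<rho>"
  have q: "0 < q" "q < 1" "q * q = \<rho>" using \<rho> by (auto simp: q_def)
  define w where "w k j = ennreal (1 / (q ^ k * q ^ j))" for k j
  define S where "S x = (\<Sum>k. \<Sum>j. w k j * (M k j x * indicator B x))" for x
  have [measurable]: "S \<in> borel_measurable borel" unfolding S_def by measurable
  have geo: "(\<Sum>j. ennreal (q ^ j)) = ennreal (1 / (1 - q))"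
    by (rule suminf_ennreal_eq) (use q geometric_sums[of q] in auto)
  have "(\<integral>\<^sup>+x. S x \<partial>lborel) = (\<Sum>k. \<Sum>j. \<integral>\<^sup>+x. w k j * (M k j x * indicator B x) \<partial>lborel)"
    unfolding S_def by (subst nn_integral_suminf; measurable?)+
  also have "\<dots> \<le> (\<Sum>k. \<Sum>j. (ennreal A * ennreal (q ^ k)) * ennreal (q ^ j))"
  proof (intro suminf_le summableI)
    fix k j
    have "(\<integral>\<^sup>+x. w k j * (M k j x * indicator B x) \<partial>lborel) = w k j * (\<integral>\<^sup>+x\<in>B. M k j x \<partial>lborel)"
      by (rule nn_integral_cmult) measurable
    also have "\<dots> \<le> w k j * ennreal (A * (\<rho> ^ k * \<rho> ^ j))" by (intro mult_left_mono bound) simp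
    also have "\<dots> = ennreal (1 / (q ^ k * q ^ j) * (A * (\<rho> ^ k * \<rho> ^ j)))"
      unfolding w_def using q A \<rho> by (intro ennreal_mult[symmetric]) auto
    also have "1 / (q ^ k * q ^ j) * (A * (\<rho> ^ k * \<rho> ^ j)) = A * q ^ k * q ^ j"
      using q by (simp add: q(3)[symmetric] power_mult_distrib)
    finally show "(\<integral>\<^sup>+x. w k j * (M k j x * indicator B x) \<partial>lborel) \<le> (ennreal A * ennreal (q ^ k)) * ennreal (q ^ j)"
      using A q by (simp add: ennreal_mult)
  qed
  also have "\<dots> = ennreal A * ennreal (1 / (1 - q)) * ennreal (1 / (1 - q))"
    by (simp add: ennreal_suminf_cmult ennreal_suminf_multc geo mult.assoc)
  also have "\<dots> < \<infinity>" by (simp add: ennreal_mult_less_top)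
  finally have "(\<integral>\<^sup>+x. S x \<partial>lborel) \<noteq> \<infinity>" by simp
  then have "AE x in lborel. S x \<noteq> \<infinity>" by (intro nn_integral_PInf_AE) auto
  then show ?thesis
  proof (rule AE_mp, intro AE_I2 impI)
    fix x assume Sx: "S x \<noteq> \<infinity>" and x: "x \<in> B"
    define C where "C = enn2real (S x)"
    have SC: "S x = ennreal C" "0 \<le> C" using Sx by (auto simp: C_def ennreal_enn2real_if)
    show "\<exists>C\<ge>0. \<forall>k j. M k j x \<le> ennreal (C * (sqrt \<rho> ^ k * sqrt \<rho> ^ j))"
    proof (intro exI[of _ C] conjI allI SC)
      fix k j
      have "w k j * (M k j x * indicator B x) \<le> (\<Sum>j. w k j * (M k j x * indicator B x))"
        using sum_le_suminf[OF summableI, of "{j}" "\<lambda>j. w k j * (M k j x * indicator B x)"] by simp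
      also have "\<dots> \<le> S x" unfolding S_def
        using sum_le_suminf[OF summableI, of "{k}" "\<lambda>k. \<Sum>j. w k j * (M k j x * indicator B x)"] by simp
      finally have "ennreal (q ^ k * q ^ j) * (w k j * M k j x) \<le> ennreal (q ^ k * q ^ j) * ennreal C"
        using x by (intro mult_left_mono) (auto simp: SC)
      moreover have "ennreal (q ^ k * q ^ j) * w k j = 1"
        unfolding w_def using q by (subst ennreal_mult[symmetric]) auto
      ultimately have "M k j x \<le> ennreal (q ^ k * q ^ j) * ennreal C" by (simp flip: mult.assoc)
      then show "M k j x \<le> ennreal (C * (sqrt \<rho> ^ k * sqrt \<rho> ^ j))"
        using q SC by (simp add: ennreal_mult[symmetric] q_def mult.commute)
    qed
  qed
qed

section \<open>Dyadic frequency pieces and their decay almost everywhere\<close>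

text \<open>Block 0 is the whole interval [-1,1], so that the blocks up to \<open>n\<close> add up
  exactly to the truncation at 2^n in \<open>U_partial\<close>.\<close>

definition dyadic_block :: "nat \<Rightarrow> real set" where
  "dyadic_block k = {\<xi>. \<bar>\<xi>\<bar> \<le> 2 ^ k \<and> (0 < k \<longrightarrow> 2 ^ (k - 1) < \<bar>\<xi>\<bar>)}"

definition dyadic_piece :: "(real \<Rightarrow> complex) \<Rightarrow> nat \<Rightarrow> real \<Rightarrow> complex" where
  "dyadic_piece G k \<xi> = (if \<xi> \<in> dyadic_block k then G \<xi> else 0)"

lemma sum_dyadic_piece:
  "(\<Sum>k\<le>n. dyadic_piece G k \<xi>) = (if \<bar>\<xi>\<bar> \<le> 2 ^ n then G \<xi> else 0)"
proof (induction n)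
  case 0
  show ?case by (simp add: dyadic_piece_def dyadic_block_def)
next
  case (Suc n)
  show ?case
  proof (cases "\<bar>\<xi>\<bar> \<le> 2 ^ n")
    case True
    have "\<bar>\<xi>\<bar> \<le> 2 ^ Suc n" by (rule order_trans[OF True]) simp
    then show ?thesis using True Suc by (simp add: dyadic_piece_def dyadic_block_def)
  next
    case False
    then show ?thesis using Suc by (simp add: dyadic_piece_def dyadic_block_def)
  qed
qed

lemma measurable_dyadic_piece [measurable]:
  assumes [measurable]: "G \<in> borel_measurable borel"
  shows "dyadic_piece G k \<in> borel_measurable borel"
  unfolding dyadic_piece_def[abs_def] dyadic_block_def by measurable

lemma dyadic_piece_support: "dyadic_piece G k \<xi> \<noteq> 0 \<Longrightarrow> \<bar>\<xi>\<bar> \<le> 2 ^ k"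
  by (auto simp: dyadic_piece_def dyadic_block_def split: if_splits)

text \<open>On block \<open>k\<close> the square root of 1 + \<xi>^2 is at least 2^k / 2, for k = 0
  because it is at least 1. The halving accounts for the factor 4^s.\<close>

lemma dyadic_piece_sobolev:
  assumes [measurable]: "G \<in> borel_measurable borel" and s: "0 \<le> s"
    and W: "integrable lborel (\<lambda>\<xi>. ((1 + \<xi>\<^sup>2) powr (s / 2) * cmod (G \<xi>))\<^sup>2)"
  shows "integrable lborel (\<lambda>\<xi>. (cmod (dyadic_piece G k \<xi>))\<^sup>2)"
    "(LINT \<xi>|lborel. (cmod (dyadic_piece G k \<xi>))\<^sup>2) \<le>
       4 powr s * (2 ^ k) powr (- (2 * s)) * (LINT \<xi>|lborel. ((1 + \<xi>\<^sup>2) powr (s / 2) * cmod (G \<xi>))\<^sup>2)"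
proof -
  define c where "c = 4 powr s * (2 ^ k) powr (- (2 * s))"
  have le: "(cmod (dyadic_piece G k \<xi>))\<^sup>2 \<le> c * ((1 + \<xi>\<^sup>2) powr (s / 2) * cmod (G \<xi>))\<^sup>2" for \<xi>
  proof (cases "\<xi> \<in> dyadic_block k")
    case True
    have "(2 ^ k) / 2 \<le> sqrt (1 + \<xi>\<^sup>2)"
    proof (cases "k = 0")
      case True
      have "sqrt 1 \<le> sqrt (1 + \<xi>\<^sup>2)" by (rule real_sqrt_le_mono) simp
      then have "1 \<le> sqrt (1 + \<xi>\<^sup>2)" by (simp only: real_sqrt_one)
      moreover have "(2::real) ^ k / 2 \<le> 1" using True by simp
      ultimately show ?thesis by (rule order_trans[rotated])
    next
      case False
      then obtain m where m: "k = Suc m" using not0_implies_Suc by blast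
      then have "2 ^ m \<le> \<bar>\<xi>\<bar>" using True by (simp add: dyadic_block_def)
      also have "\<bar>\<xi>\<bar> = sqrt (\<xi>\<^sup>2)" by simp
      also have "\<dots> \<le> sqrt (1 + \<xi>\<^sup>2)" by (rule real_sqrt_le_mono) simp
      finally show ?thesis by (simp add: m)
    qed
    then have "((2 ^ k) / 2) powr (2 * s) \<le> (sqrt (1 + \<xi>\<^sup>2)) powr (2 * s)"
      using s by (intro powr_mono2) auto
    also have "\<dots> = (1 + \<xi>\<^sup>2) powr s"
      by (simp add: powr_half_sqrt[symmetric] powr_powr add_pos_nonneg)
    also have "\<dots> = ((1 + \<xi>\<^sup>2) powr (s / 2))\<^sup>2" by (simp add: power2_eq_square powr_add[symmetric])
    finally have 1: "(2 ^ k) powr (2 * s) / 4 powr s \<le> ((1 + \<xi>\<^sup>2) powr (s / 2))\<^sup>2"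
      using power2_powr[of 2 s] by (simp add: powr_divide)
    then have "1 \<le> c * ((1 + \<xi>\<^sup>2) powr (s / 2))\<^sup>2"
      by (simp add: c_def powr_minus field_simps)
    then have "1 * (cmod (G \<xi>))\<^sup>2 \<le> (c * ((1 + \<xi>\<^sup>2) powr (s / 2))\<^sup>2) * (cmod (G \<xi>))\<^sup>2"
      by (rule mult_right_mono) simp
    then show ?thesis using True by (simp add: dyadic_piece_def power_mult_distrib mult.assoc)
  qed (simp add: dyadic_piece_def c_def)
  have i: "integrable lborel (\<lambda>\<xi>. c * ((1 + \<xi>\<^sup>2) powr (s / 2) * cmod (G \<xi>))\<^sup>2)" using W by simp
  show 1: "integrable lborel (\<lambda>\<xi>. (cmod (dyadic_piece G k \<xi>))\<^sup>2)"
    by (rule Bochner_Integration.integrable_bound[OF i]) (use le in \<open>auto intro!: AE_I2 order_trans[OF le]\<close>)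
  show "(LINT \<xi>|lborel. (cmod (dyadic_piece G k \<xi>))\<^sup>2) \<le>
       4 powr s * (2 ^ k) powr (- (2 * s)) * (LINT \<xi>|lborel. ((1 + \<xi>\<^sup>2) powr (s / 2) * cmod (G \<xi>))\<^sup>2)"
    unfolding c_def[symmetric] using integral_mono[OF 1 i] le W by simp
qed

text \<open>The deterministic information retained at one point x, with \<open>C\<close> and
  \<open>q\<close> depending on x. The convergence statement follows from it without further measure
  theory.\<close>

definition dyadic_decay ::
    "(real \<Rightarrow> real \<Rightarrow> real) \<Rightarrow> real \<Rightarrow> (nat \<Rightarrow> real \<Rightarrow> complex) \<Rightarrow> real \<Rightarrow> real \<Rightarrow> real \<Rightarrow> bool" where
  "dyadic_decay \<gamma> \<delta> g x C q \<longleftrightarrow> 0 \<le> C \<and> 0 < q \<and> q < 1 \<and>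
     (\<forall>k. cmod (osc x 0 (g k)) \<le> C * q ^ k) \<and>
     (\<forall>k j t. 1 / 2 ^ Suc j < t \<and> t \<le> 1 / 2 ^ j \<longrightarrow>
        cmod (osc (\<gamma> x t) t (g k) - osc x 0 (g k)) \<le> C * (q ^ k * q ^ j) * (1 / 2 ^ j) powr \<delta>)"

text \<open>The linearised estimate gives a maximal function over rational times, its bounds are
  summable over all pairs of scales, and continuity in time for each single piece extends the result
  to all times.\<close>

lemma AE_dyadic_decay:
  fixes \<alpha> \<delta> s R :: real and \<gamma> :: "real \<Rightarrow> real \<Rightarrow> real" and G :: "real \<Rightarrow> complex"
  assumes \<alpha>: "1/4 < \<alpha>" "\<alpha> < 1/2" and \<delta>: "0 \<le> \<delta>" "\<delta> < \<alpha>" and s: "s_crit \<alpha> \<delta> < s"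
    and \<gamma>: "admissible_curve \<alpha> \<gamma>" and R: "0 < R"
    and Gm[measurable]: "G \<in> borel_measurable borel"
    and W: "integrable lborel (\<lambda>\<xi>. ((1 + \<xi>\<^sup>2) powr (s / 2) * cmod (G \<xi>))\<^sup>2)"
  shows "AE x in lborel. x \<in> {-R..R} \<longrightarrow> (\<exists>C q. dyadic_decay \<gamma> \<delta> (dyadic_piece G) x C q)"
proof -
  note sc = s_crit_ge[OF \<alpha> \<delta>]
  have s0: "0 \<le> s" using sc(1) \<delta> s by linarith
  obtain D \<rho> where D: "0 < D" and \<rho>: "0 < \<rho>" "\<rho> < 1"
    and est: "\<And>k j \<tau> g. \<lbrakk>\<tau> \<in> borel_measurable borel; \<And>x. 0 \<le> \<tau> x \<and> \<tau> x \<le> 1 / 2 ^ j;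
        g \<in> borel_measurable borel; integrable lborel (\<lambda>\<xi>. (cmod (g \<xi>))\<^sup>2); \<And>\<xi>. g \<xi> \<noteq> 0 \<Longrightarrow> \<bar>\<xi>\<bar> \<le> 2 ^ k\<rbrakk> \<Longrightarrow>
      (\<integral>\<^sup>+x\<in>{-R..R}. ennreal ((cmod (osc (\<gamma> x (\<tau> x)) (\<tau> x) g - osc x 0 g))\<^sup>2) \<partial>lborel) \<le>
        ennreal (D * ((1 / 2 ^ j) powr (2 * \<delta>) * (2 ^ k) powr (2 * s) * (\<rho> ^ k * \<rho> ^ j)) * (LINT \<xi>|lborel. (cmod (g \<xi>))\<^sup>2))"
    and est0: "\<And>k g. \<lbrakk>g \<in> borel_measurable borel; integrable lborel (\<lambda>\<xi>. (cmod (g \<xi>))\<^sup>2); \<And>\<xi>. g \<xi> \<noteq> 0 \<Longrightarrow> \<bar>\<xi>\<bar> \<le> 2 ^ k\<rbrakk> \<Longrightarrow>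
      (\<integral>\<^sup>+x\<in>{-R..R}. ennreal ((cmod (osc x 0 g))\<^sup>2) \<partial>lborel) \<le>
        ennreal (D * (2 ^ k) powr (2 * s) * \<rho> ^ k * (LINT \<xi>|lborel. (cmod (g \<xi>))\<^sup>2))"
    by (rule scale_maximal_estimate[OF \<alpha> \<delta> s \<gamma> R]) blast
  obtain c C0 where meas: "\<And>\<tau>. \<lbrakk>\<tau> \<in> borel_measurable borel; \<And>x. \<tau> x \<in> {-1..1}\<rbrakk> \<Longrightarrow> (\<lambda>x. \<gamma> x (\<tau> x)) \<in> borel_measurable borel"
    by (rule admissible_curveE[OF \<gamma>]) blast
  define g where "g = dyadic_piece G"
  have gm[measurable]: "g k \<in> borel_measurable borel" for k unfolding g_def by measurable
  define W0 where "W0 = (LINT \<xi>|lborel. ((1 + \<xi>\<^sup>2) powr (s / 2) * cmod (G \<xi>))\<^sup>2)"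
  have W0: "0 \<le> W0" by (simp add: W0_def)
  have g2: "integrable lborel (\<lambda>\<xi>. (cmod (g k \<xi>))\<^sup>2)"
    "(LINT \<xi>|lborel. (cmod (g k \<xi>))\<^sup>2) \<le> 4 powr s * (2 ^ k) powr (- (2 * s)) * W0" for k
    unfolding g_def W0_def by (rule dyadic_piece_sobolev[OF Gm s0 W])+
  have supp: "g k \<xi> \<noteq> 0 \<Longrightarrow> \<bar>\<xi>\<bar> \<le> 2 ^ k" for k \<xi> unfolding g_def by (rule dyadic_piece_support)
  have gi: "integrable lborel (g k)" for k by (rule square_integrable_imp_integrable[OF gm g2(1) supp])
  define A where "A = D * 4 powr s * W0"
  have A: "0 \<le> A" using D W0 by (simp add: A_def)
  have gA: "D * (2 ^ k) powr (2 * s) * (LINT \<xi>|lborel. (cmod (g k \<xi>))\<^sup>2) \<le> A" for k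
  proof -
    have "D * (2 ^ k) powr (2 * s) * (LINT \<xi>|lborel. (cmod (g k \<xi>))\<^sup>2) \<le>
       D * (2 ^ k) powr (2 * s) * (4 powr s * (2 ^ k) powr (- (2 * s)) * W0)"
      using D g2(2)[of k] by (intro mult_left_mono) auto
    also have "\<dots> = A" by (simp add: A_def powr_minus)
    finally show ?thesis .
  qed
  define h where "h k j t x = (cmod (osc (\<gamma> x t) t (g k) - osc x 0 (g k)))\<^sup>2 / (1 / 2 ^ j) powr (2 * \<delta>)"
    for k j :: nat and t x :: real
  \<comment> \<open>Rational times keep the supremum countable, hence measurable.\<close>
  define Q where "Q j = {t. (t::real) \<in> \<rat> \<and> 1 / 2 ^ Suc j < t \<and> t \<le> 1 / 2 ^ j}" for j :: nat
  have Q01: "t \<in> {-1..1}" "0 \<le> t" if "t \<in> Q j" for t j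
  proof -
    have "0 < t" by (rule less_trans[of _ "1 / 2 ^ Suc j"]) (use that in \<open>auto simp: Q_def\<close>)
    moreover have "t \<le> 1" by (rule order_trans[of _ "1 / 2 ^ j"]) (use that in \<open>auto simp: Q_def\<close>)
    ultimately show "t \<in> {-1..1}" "0 \<le> t" by auto
  qed
  have hM: "\<exists>M. M \<in> borel_measurable borel \<and> (\<integral>\<^sup>+x\<in>{-R..R}. M x \<partial>lborel) \<le> ennreal (A * (\<rho> ^ k * \<rho> ^ j)) \<and>
     (\<forall>t x. t \<in> Q j \<longrightarrow> ennreal (h k j t x) \<le> M x)" for k j
  proof -
    have meash: "(\<lambda>x. h k j (\<tau> x) x) \<in> borel_measurable borel"
      if [measurable]: "\<tau> \<in> borel_measurable borel" and r: "\<And>x. \<tau> x \<in> Q j" for \<tau>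
    proof -
      have [measurable]: "(\<lambda>x. \<gamma> x (\<tau> x)) \<in> borel_measurable borel" using Q01(1) r by (intro meas) auto
      have [measurable]: "(\<lambda>x. osc (\<gamma> x (\<tau> x)) (\<tau> x) (g k)) \<in> borel_measurable borel" "(\<lambda>x. osc x 0 (g k)) \<in> borel_measurable borel"
        by (auto intro!: measurable_osc)
      show ?thesis unfolding h_def by measurable
    qed
    show ?thesis
    proof (rule countable_maximal[of "Q j" "{-R..R}" "h k j" "ennreal (A * (\<rho> ^ k * \<rho> ^ j))"])
      show "countable (Q j)" unfolding Q_def by (rule countable_subset[OF _ countable_rat]) auto
      have "1 / 2 ^ j \<in> Q j" by (auto simp: Q_def field_simps)
      then show "Q j \<noteq> {}" by blast
      show "h k j t \<in> borel_measurable borel" if "t \<in> Q j" for t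
        using meash[of "\<lambda>_. t"] that by simp
    next
      fix \<tau> :: "real \<Rightarrow> real" assume \<tau>m[measurable]: "\<tau> \<in> borel_measurable borel" and r: "\<And>x. \<tau> x \<in> Q j"
      define w where "w = (1 / 2 ^ j :: real) powr (2 * \<delta>)"
      have w: "0 < w" by (simp add: w_def)
      have [measurable]: "(\<lambda>x. h k j (\<tau> x) x) \<in> borel_measurable borel" by (rule meash[OF \<tau>m r])
      have "ennreal w * (\<integral>\<^sup>+x\<in>{-R..R}. ennreal (h k j (\<tau> x) x) \<partial>lborel) = (\<integral>\<^sup>+x. ennreal w * (ennreal (h k j (\<tau> x) x) * indicator {-R..R} x) \<partial>lborel)"
        by (rule nn_integral_cmult[symmetric]) measurable
      also have "\<dots> = (\<integral>\<^sup>+x\<in>{-R..R}. ennreal ((cmod (osc (\<gamma> x (\<tau> x)) (\<tau> x) (g k) - osc x 0 (g k)))\<^sup>2) \<partial>lborel)"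
        using w by (intro nn_integral_cong) (simp add: h_def w_def[symmetric] ennreal_mult[symmetric] flip: mult.assoc)
      also have "\<dots> \<le> ennreal (D * (w * (2 ^ k) powr (2 * s) * (\<rho> ^ k * \<rho> ^ j)) * (LINT \<xi>|lborel. (cmod (g k \<xi>))\<^sup>2))"
        unfolding w_def
      proof (intro est \<tau>m gm g2(1) supp)
        show "0 \<le> \<tau> x \<and> \<tau> x \<le> 1 / 2 ^ j" for x using r[of x] Q01(2)[of "\<tau> x" j] by (simp add: Q_def)
      qed
      also have "\<dots> \<le> ennreal (w * (A * (\<rho> ^ k * \<rho> ^ j)))"
      proof (rule ennreal_leI)
        have "(w * (\<rho> ^ k * \<rho> ^ j)) * (D * (2 ^ k) powr (2 * s) * (LINT \<xi>|lborel. (cmod (g k \<xi>))\<^sup>2)) \<le> (w * (\<rho> ^ k * \<rho> ^ j)) * A"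
          using w \<rho> gA by (intro mult_left_mono) auto
        then show "D * (w * (2 ^ k) powr (2 * s) * (\<rho> ^ k * \<rho> ^ j)) * (LINT \<xi>|lborel. (cmod (g k \<xi>))\<^sup>2) \<le> w * (A * (\<rho> ^ k * \<rho> ^ j))"
          by (simp add: mult_ac)
      qed
      also have "\<dots> = ennreal w * ennreal (A * (\<rho> ^ k * \<rho> ^ j))" using w A \<rho> by (simp add: ennreal_mult)
      finally show "(\<integral>\<^sup>+x\<in>{-R..R}. ennreal (h k j (\<tau> x) x) \<partial>lborel) \<le> ennreal (A * (\<rho> ^ k * \<rho> ^ j))"
        using w by (simp add: ennreal_mult_le_mult_iff)
    qed (auto simp: )
  qed
  then obtain M where M[measurable]: "\<And>k j. M k j \<in> borel_measurable borel"
      and Mb: "\<And>k j. (\<integral>\<^sup>+x\<in>{-R..R}. M k j x \<partial>lborel) \<le> ennreal (A * (\<rho> ^ k * \<rho> ^ j))"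
      and Mh: "\<And>k j t x. t \<in> Q j \<Longrightarrow> ennreal (h k j t x) \<le> M k j x" by metis
  \<comment> \<open>The values at time 0 are put into a doubly indexed family concentrated on j = 0,
    so that the same summation lemma applies.\<close>
  define M0 where "M0 k j x = (if j = 0 then ennreal ((cmod (osc x 0 (g k)))\<^sup>2) else 0)" for k j :: nat and x
  have [measurable]: "(\<lambda>x. osc x 0 (g k)) \<in> borel_measurable borel" for k by (rule measurable_osc) auto
  have M0m[measurable]: "M0 k j \<in> borel_measurable borel" for k j unfolding M0_def by measurable
  have M0b: "(\<integral>\<^sup>+x\<in>{-R..R}. M0 k j x \<partial>lborel) \<le> ennreal (A * (\<rho> ^ k * \<rho> ^ j))" for k j
  proof (cases "j = 0")
    case True
    have "(\<integral>\<^sup>+x\<in>{-R..R}. M0 k j x \<partial>lborel) \<le> ennreal (D * (2 ^ k) powr (2 * s) * \<rho> ^ k * (LINT \<xi>|lborel. (cmod (g k \<xi>))\<^sup>2))"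
      using True est0[OF gm g2(1) supp, of k] by (simp add: M0_def)
    also have "\<dots> \<le> ennreal (A * (\<rho> ^ k * \<rho> ^ j))"
      using mult_right_mono[OF gA[of k], of "\<rho> ^ k"] \<rho> True by (intro ennreal_leI) (simp add: mult_ac)
    finally show ?thesis .
  qed (simp add: M0_def)
  \<comment> \<open>Two square roots: one is lost in passing from integrals to pointwise bounds, the
    other in passing from squared moduli to moduli.\<close>
  define q0 where "q0 = sqrt \<rho>"
  define q where "q = sqrt q0"
  have q0: "0 < q0" "q0 < 1" using \<rho> by (auto simp: q0_def)
  have q: "0 < q" "q < 1" using q0 by (auto simp: q_def)
  have qq: "q0 ^ n = (q ^ n)\<^sup>2" for n using q0 by (simp add: q_def real_sqrt_power[symmetric])
  have "AE x in lborel. x \<in> {-R..R} \<longrightarrow> (\<exists>C\<ge>0. \<forall>k j. M k j x \<le> ennreal (C * (sqrt \<rho> ^ k * sqrt \<rho> ^ j)))"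
    by (rule AE_geometric_bound[OF _ M \<rho> A Mb]) simp
  moreover have "AE x in lborel. x \<in> {-R..R} \<longrightarrow> (\<exists>C\<ge>0. \<forall>k j. M0 k j x \<le> ennreal (C * (sqrt \<rho> ^ k * sqrt \<rho> ^ j)))"
    by (rule AE_geometric_bound[OF _ M0m \<rho> A M0b]) simp
  ultimately show ?thesis
  proof (eventually_elim, intro impI)
    fix x assume 1: "x \<in> {-R..R} \<longrightarrow> (\<exists>C\<ge>0. \<forall>k j. M k j x \<le> ennreal (C * (sqrt \<rho> ^ k * sqrt \<rho> ^ j)))"
      and 2: "x \<in> {-R..R} \<longrightarrow> (\<exists>C\<ge>0. \<forall>k j. M0 k j x \<le> ennreal (C * (sqrt \<rho> ^ k * sqrt \<rho> ^ j)))"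
      and x: "x \<in> {-R..R}"
    obtain C1 where C1: "0 \<le> C1" "\<And>k j. M k j x \<le> ennreal (C1 * (q0 ^ k * q0 ^ j))" using 1 x by (auto simp: q0_def)
    obtain C2 where C2: "0 \<le> C2" "\<And>k j. M0 k j x \<le> ennreal (C2 * (q0 ^ k * q0 ^ j))" using 2 x by (auto simp: q0_def)
    define C where "C = sqrt C1 + sqrt C2"
    have C: "0 \<le> C" "sqrt C1 \<le> C" "sqrt C2 \<le> C" using C1 C2 by (auto simp: C_def)
    have p0: "cmod (osc x 0 (g k)) \<le> C * q ^ k" for k
    proof -
      have "ennreal ((cmod (osc x 0 (g k)))\<^sup>2) \<le> ennreal (C2 * (q ^ k)\<^sup>2)"
        using C2(2)[of k 0] by (simp add: M0_def qq)
      then have "(cmod (osc x 0 (g k)))\<^sup>2 \<le> (sqrt C2 * q ^ k)\<^sup>2"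
        using C2(1) by (simp add: power_mult_distrib ennreal_le_iff)
      then have "cmod (osc x 0 (g k)) \<le> sqrt C2 * q ^ k" by (rule power2_le_imp_le) (use C2(1) q in simp)
      also have "\<dots> \<le> C * q ^ k" using C q by (intro mult_right_mono) auto
      finally show ?thesis .
    qed
    have pQ: "cmod (osc (\<gamma> x t) t (g k) - osc x 0 (g k)) \<le> C * (q ^ k * q ^ j) * (1 / 2 ^ j) powr \<delta>"
      if t: "t \<in> Q j" for k j t
    proof -
      define w where "w = (1 / 2 ^ j :: real) powr \<delta>"
      have w: "0 < w" "(1 / 2 ^ j :: real) powr (2 * \<delta>) = w\<^sup>2"
        by (auto simp: w_def power2_eq_square powr_add[symmetric])
      have "ennreal (h k j t x) \<le> ennreal (C1 * ((q ^ k)\<^sup>2 * (q ^ j)\<^sup>2))"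
        using order_trans[OF Mh[OF t] C1(2)] by (simp add: qq)
      then have "h k j t x \<le> C1 * ((q ^ k)\<^sup>2 * (q ^ j)\<^sup>2)" using C1(1) by (simp add: ennreal_le_iff)
      then have "(cmod (osc (\<gamma> x t) t (g k) - osc x 0 (g k)))\<^sup>2 \<le> (sqrt C1 * (q ^ k * q ^ j) * w)\<^sup>2"
        using w C1(1) by (simp add: h_def divide_le_eq power_mult_distrib)
      then have "cmod (osc (\<gamma> x t) t (g k) - osc x 0 (g k)) \<le> sqrt C1 * (q ^ k * q ^ j) * w"
        by (rule power2_le_imp_le) (use C1(1) q w in simp)
      also have "\<dots> \<le> C * (q ^ k * q ^ j) * w" using C q w by (intro mult_right_mono) auto
      finally show ?thesis by (simp add: w_def)
    qed
    have cont: "continuous_on {0..1} (\<lambda>t. cmod (osc (\<gamma> x t) t (g k) - osc x 0 (g k)))" for k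
    proof (intro continuous_intros continuous_osc gi)
      have c: "continuous_on (UNIV \<times> {-1..1}) (\<lambda>(x, t). \<gamma> x t)" using \<gamma> by (simp add: admissible_curve_def)
      have "continuous_on {0..1} (\<lambda>t. (\<lambda>(x, t). \<gamma> x t) (x, t))"
        by (rule continuous_on_compose2[OF c]) (auto intro!: continuous_intros)
      then show "continuous_on {0..1} (\<gamma> x)" by simp
    qed
    \<comment> \<open>Rational times slightly to the left of \<open>t\<close> remain in the same
      half-open dyadic interval, so a violation at \<open>t\<close> would by continuity occur at a
      rational time.\<close>
    have pt: "cmod (osc (\<gamma> x t) t (g k) - osc x 0 (g k)) \<le> C * (q ^ k * q ^ j) * (1 / 2 ^ j) powr \<delta>"
      if t: "1 / 2 ^ Suc j < t" "t \<le> 1 / 2 ^ j" for k j t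
    proof (rule ccontr)
      define b where "b = C * (q ^ k * q ^ j) * (1 / 2 ^ j) powr \<delta>"
      define F where "F t = cmod (osc (\<gamma> x t) t (g k) - osc x 0 (g k))" for t
      assume "\<not> ?thesis"
      then have e: "0 < F t - b" by (simp add: b_def F_def)
      have "0 < t" by (rule less_trans[OF _ t(1)]) simp
      moreover have "t \<le> 1" by (rule order_trans[OF t(2)]) simp
      ultimately have t01: "t \<in> {0..1}" by simp
      from cont[of k, folded F_def] t01 e obtain d where d: "0 < d" "\<And>t'. \<lbrakk>t' \<in> {0..1}; dist t' t < d\<rbrakk> \<Longrightarrow> dist (F t') (F t) < F t - b"
        unfolding continuous_on_iff by blast
      obtain r where r: "r \<in> \<rat>" "max (1 / 2 ^ Suc j) (t - d) < r" "r < t"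
        using Rats_dense_in_real[of "max (1 / 2 ^ Suc j) (t - d)" t] t d by auto
      have rQ: "r \<in> Q j" using r t by (simp add: Q_def)
      have "dist (F r) (F t) < F t - b" using r t t01 by (intro d) (auto simp: dist_real_def)
      then have "b < F r" by (simp add: dist_real_def)
      moreover have "F r \<le> b" unfolding F_def b_def by (rule pQ[OF rQ])
      ultimately show False by simp
    qed
    show "\<exists>C q. dyadic_decay \<gamma> \<delta> (dyadic_piece G) x C q"
      using C q p0 pt unfolding dyadic_decay_def g_def[symmetric] by (intro exI[of _ C] exI[of _ q]) auto
  qed
qed

text \<open>Decay in \<open>k\<close> makes the series of pieces converge, which gives existence of
  the dyadic limit and a bound for the difference; the factor q^j, which tends to 0 with t, improves
  the order t^\<delta> to little o.\<close>

theorem pointwise_rate_above_s_crit: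
  fixes \<alpha> \<delta> s :: real and \<gamma> :: "real \<Rightarrow> real \<Rightarrow> real"
  assumes \<alpha>: "1/4 < \<alpha>" "\<alpha> < 1/2" and \<delta>: "0 \<le> \<delta>" "\<delta> < \<alpha>" and s: "s_crit \<alpha> \<delta> < s"
    and \<gamma>: "admissible_curve \<alpha> \<gamma>" and f: "f \<in> sobolev s"
  shows "pointwise_rate \<gamma> \<delta> f"
proof -
  define G where "G = fhat f"
  have ex: "\<exists>g. has_fourier_transform f g" and W: "integrable lborel (\<lambda>\<xi>. ((1 + \<xi>\<^sup>2) powr (s / 2) * cmod (G \<xi>))\<^sup>2)"
    using f by (auto simp: sobolev_def G_def)
  have "has_fourier_transform f G" unfolding G_def fhat_def by (rule someI_ex[OF ex])
  then have Gm[measurable]: "G \<in> borel_measurable borel" by (simp add: has_fourier_transform_def)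
  define g where "g = dyadic_piece G"
  have s0: "0 \<le> s" using s_crit_ge(1)[OF \<alpha> \<delta>] \<delta> s by linarith
  have gi: "integrable lborel (g k)" for k
    unfolding g_def using dyadic_piece_sobolev(1)[OF Gm s0 W] dyadic_piece_support
    by (intro square_integrable_imp_integrable) auto
  have \<gamma>0: "\<gamma> x 0 = x" for x using \<gamma> by (simp add: admissible_curve_def)
  have part: "U_partial \<gamma> f x t n = (\<Sum>k\<le>n. osc (\<gamma> x t) t (g k))" for x t n
  proof -
    have "U_partial \<gamma> f x t n = osc (\<gamma> x t) t (\<lambda>\<xi>. \<Sum>k\<le>n. g k \<xi>)"
      unfolding U_partial_eq_osc g_def sum_dyadic_piece G_def ..
    also have "\<dots> = (\<Sum>k\<le>n. osc (\<gamma> x t) t (g k))"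
      unfolding osc_def sum_distrib_left
      by (rule Bochner_Integration.integral_sum) (rule integrable_osc[OF gi])
    finally show ?thesis .
  qed
  \<comment> \<open>The estimates hold on bounded intervals, with constants depending on the
    interval; countably many intervals cover the line.\<close>
  have "AE x in lborel. \<forall>n::nat. x \<in> {- real (Suc n)..real (Suc n)} \<longrightarrow> (\<exists>C q. dyadic_decay \<gamma> \<delta> g x C q)"
    unfolding AE_all_countable g_def
    by (intro allI AE_dyadic_decay[OF \<alpha> \<delta> s \<gamma> _ Gm W]) simp
  then show ?thesis unfolding pointwise_rate_def
  proof eventually_elim
    case (elim x)
    obtain n where "\<bar>x\<bar> < real n" using reals_Archimedean2 by blast
    then have "x \<in> {- real (Suc n)..real (Suc n)}" by auto
    with elim obtain C q where "dyadic_decay \<gamma> \<delta> g x C q" by blast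
    then have C: "0 \<le> C" and q: "0 < q" "q < 1"
      and b0: "\<And>k. cmod (osc x 0 (g k)) \<le> C * q ^ k"
      and b: "\<And>k j t. \<lbrakk>1 / 2 ^ Suc j < t; t \<le> 1 / 2 ^ j\<rbrakk> \<Longrightarrow>
        cmod (osc (\<gamma> x t) t (g k) - osc x 0 (g k)) \<le> C * (q ^ k * q ^ j) * (1 / 2 ^ j) powr \<delta>"
      unfolding dyadic_decay_def by simp_all
    have geo: "(\<lambda>k. c * q ^ k) sums (c * (1 / (1 - q)))" for c
      using q by (intro sums_mult geometric_sums) auto
    have sum0: "summable (\<lambda>k. osc x 0 (g k))"
      by (rule summable_comparison_test'[of "\<lambda>k. C * q ^ k" 0]) (use geo b0 in \<open>auto simp: sums_iff\<close>)
    have ex: "U_exists \<gamma> f x t \<and> complex_of_real (2 * pi) * U \<gamma> f x t = (\<Sum>k. osc (\<gamma> x t) t (g k))"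
      if "summable (\<lambda>k. osc (\<gamma> x t) t (g k))" for t
    proof -
      have lim: "U_partial \<gamma> f x t \<longlonglongrightarrow> (\<Sum>k. osc (\<gamma> x t) t (g k))"
        unfolding part[abs_def] using summable_LIMSEQ'[OF that] .
      then have e: "U_exists \<gamma> f x t" unfolding U_exists_def by (auto simp: convergent_def)
      have "complex_of_real (2 * pi) * U \<gamma> f x t = (\<Sum>k. osc (\<gamma> x t) t (g k))"
        by (rule LIMSEQ_unique[OF U_exists_tendsto[OF e] lim])
      with e show ?thesis by simp
    qed
    have ex0: "U_exists \<gamma> f x 0" "complex_of_real (2 * pi) * U \<gamma> f x 0 = (\<Sum>k. osc x 0 (g k))"
      using ex[of 0] sum0 by (simp_all add: \<gamma>0)
    define K where "K = 2 * C / (1 - q)"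
    have K: "0 \<le> K" using C q by (simp add: K_def)
    have main: "U_exists \<gamma> f x t \<and> cmod (U \<gamma> f x t - U \<gamma> f x 0) \<le> K * q ^ j * t powr \<delta>"
      if t: "1 / 2 ^ Suc j < t" "t \<le> 1 / 2 ^ j" for t j
    proof -
      have t0: "0 < t" using t(1) by (rule less_trans[rotated]) simp
      define B where "B = C * q ^ j * (1 / 2 ^ j) powr \<delta>"
      have B0: "0 \<le> B" using C q by (simp add: B_def)
      have bt: "cmod (osc (\<gamma> x t) t (g k) - osc x 0 (g k)) \<le> B * q ^ k" for k
        using b[OF t, of k] by (simp add: B_def mult_ac)
      have sumD: "summable (\<lambda>k. cmod (osc (\<gamma> x t) t (g k) - osc x 0 (g k)))"
        by (rule summable_comparison_test'[of "\<lambda>k. B * q ^ k" 0]) (use geo bt in \<open>auto simp: sums_iff\<close>)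
      have sumD': "summable (\<lambda>k. osc (\<gamma> x t) t (g k) - osc x 0 (g k))"
        using sumD by (rule summable_norm_cancel)
      have sumt: "summable (\<lambda>k. osc (\<gamma> x t) t (g k))"
        using summable_add[OF sumD' sum0] by simp
      have "complex_of_real (2 * pi) * (U \<gamma> f x t - U \<gamma> f x 0) = (\<Sum>k. osc (\<gamma> x t) t (g k) - osc x 0 (g k))"
        using ex[OF sumt] ex0(2) suminf_diff[OF sumt sum0] by (simp add: right_diff_distrib)
      then have "2 * pi * cmod (U \<gamma> f x t - U \<gamma> f x 0) = cmod (\<Sum>k. osc (\<gamma> x t) t (g k) - osc x 0 (g k))"
        by (metis abs_of_pos norm_mult norm_of_real pi_gt_zero zero_less_mult_iff zero_less_numeral)
      also have "\<dots> \<le> (\<Sum>k. cmod (osc (\<gamma> x t) t (g k) - osc x 0 (g k)))"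
        by (rule summable_norm[OF sumD])
      also have "\<dots> \<le> (\<Sum>k. B * q ^ k)"
        using geo[of B] by (intro suminf_le bt sumD) (auto simp: sums_iff)
      also have "\<dots> = B * (1 / (1 - q))" using geo[of B] by (simp add: sums_iff)
      finally have 1: "2 * pi * cmod (U \<gamma> f x t - U \<gamma> f x 0) \<le> B * (1 / (1 - q))" .
      have "1 * cmod (U \<gamma> f x t - U \<gamma> f x 0) \<le> 2 * pi * cmod (U \<gamma> f x t - U \<gamma> f x 0)"
        using pi_gt3 by (intro mult_right_mono) auto
      also note 1
      also have "B * (1 / (1 - q)) \<le> K * q ^ j * t powr \<delta>"
      proof -
        \<comment> \<open>Within its dyadic range t is at least half of the upper end, so 2^(-j) may
          be replaced by 2 t.\<close>
        have "(1 / 2 ^ j) powr \<delta> \<le> (2 * t) powr \<delta>" using t \<delta> by (intro powr_mono2) (auto simp: field_simps)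
        also have "\<dots> = 2 powr \<delta> * t powr \<delta>" by (rule powr_mult)
        also have "\<dots> \<le> 2 powr 1 * t powr \<delta>" using \<delta> \<alpha> by (intro mult_right_mono powr_mono) auto
        finally have "(C * q ^ j / (1 - q)) * (1 / 2 ^ j) powr \<delta> \<le> (C * q ^ j / (1 - q)) * (2 * t powr \<delta>)"
          using C q by (intro mult_left_mono) auto
        then show ?thesis by (simp add: B_def K_def mult_ac)
      qed
      finally show ?thesis using ex[OF sumt] by simp
    qed
    have scale: "\<exists>j\<ge>J. 1 / 2 ^ Suc j < t \<and> t \<le> 1 / 2 ^ j" if t: "0 < t" "t \<le> 1 / 2 ^ J" for t :: real and J
    proof -
      define P where "P j \<longleftrightarrow> 1 / 2 ^ Suc j < t" for j
      obtain m where "1 / t < 2 ^ m" using real_arch_pow[of 2 "1 / t"] by auto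
      also have "(2::real) ^ m \<le> 2 ^ Suc m" by simp
      finally have "P m" unfolding P_def using t(1) by (simp add: field_simps)
      define j where "j = (LEAST j. P j)"
      have Pj: "P j" unfolding j_def using \<open>P m\<close> by (rule LeastI)
      have tj: "t \<le> 1 / 2 ^ j"
      proof (cases j)
        case 0
        then show ?thesis using order_trans[OF t(2), of 1] by simp
      next
        case (Suc i)
        then have "\<not> P i" using not_less_Least[of i P] by (simp add: j_def)
        then show ?thesis by (simp add: P_def Suc)
      qed
      have "J \<le> j"
      proof (rule ccontr)
        assume "\<not> J \<le> j"
        then have "(2::real) ^ Suc j \<le> 2 ^ J" by (intro power_increasing) auto
        then have "1 / (2::real) ^ J \<le> 1 / 2 ^ Suc j" by (intro divide_left_mono) auto
        then show False using Pj t by (simp add: P_def)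
      qed
      then show ?thesis using Pj tj by (auto simp: P_def)
    qed
    have small: "\<forall>\<^sub>F t in at_right (0::real). 0 < t \<and> t \<le> 1 / 2 ^ J" for J :: nat
      by (rule eventually_at_rightI[of 0 "1 / 2 ^ J :: real"]) auto
    have "\<forall>\<^sub>F t in at_right 0. U_exists \<gamma> f x t"
      using small[of 0] by eventually_elim (use scale[of _ 0] main in blast)
    moreover have "((\<lambda>t. (U \<gamma> f x t - U \<gamma> f x 0) / complex_of_real (t powr \<delta>)) \<longlongrightarrow> 0) (at_right 0)"
    proof (rule tendstoI)
      fix e :: real assume e: "0 < e"
      have "(\<lambda>j. K * q ^ j) \<longlonglongrightarrow> K * 0" using q by (intro tendsto_intros LIMSEQ_realpow_zero) auto
      then have "\<forall>\<^sub>F j in sequentially. K * q ^ j < e" using e by (intro order_tendstoD(2)) auto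
      then obtain J where J: "\<And>j. J \<le> j \<Longrightarrow> K * q ^ j < e" by (auto simp: eventually_sequentially)
      show "\<forall>\<^sub>F t in at_right 0. dist ((U \<gamma> f x t - U \<gamma> f x 0) / complex_of_real (t powr \<delta>)) 0 < e"
        using small[of J]
      proof eventually_elim
        case (elim t)
        then obtain j where j: "J \<le> j" "1 / 2 ^ Suc j < t" "t \<le> 1 / 2 ^ j" using scale[of t J] by blast
        have "cmod (U \<gamma> f x t - U \<gamma> f x 0) / t powr \<delta> \<le> K * q ^ j"
          using main[OF j(2,3)] elim by (simp add: field_simps)
        then show ?case using J[OF j(1)] by (simp add: norm_divide)
      qed
    qed
    ultimately show ?case using ex0(1) by blast
  qed
qed

section \<open>Distributions given by series of integrable functions\<close>

text \<open>The positive and the negative part of \<open>H\<close> have the same Fourier transform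
  and, by its value at 0, the same mass. Normalised to probability densities they have equal
  characteristic functions, and Levy's uniqueness theorem identifies them.\<close>

lemma Fourier_zero_imp_AE_zero_real:
  fixes H :: "real \<Rightarrow> real"
  assumes H: "integrable lborel H"
    and z: "\<And>x. (LINT \<xi>|lborel. cis (x * \<xi>) * complex_of_real (H \<xi>)) = 0"
  shows "AE \<xi> in lborel. H \<xi> = 0"
proof -
  have [measurable]: "H \<in> borel_measurable borel" using H by auto
  define P where "P \<xi> = max (H \<xi>) 0" for \<xi>
  define N where "N \<xi> = max (- H \<xi>) 0" for \<xi>
  have PN: "H \<xi> = P \<xi> - N \<xi>" "0 \<le> P \<xi>" "0 \<le> N \<xi>" for \<xi> by (auto simp: P_def N_def)
  have [measurable]: "P \<in> borel_measurable borel" "N \<in> borel_measurable borel" unfolding P_def N_def by measurable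
  have Pi: "integrable lborel P"
    by (rule Bochner_Integration.integrable_bound[OF H]) (auto simp: P_def)
  have Ni: "integrable lborel N"
    by (rule Bochner_Integration.integrable_bound[OF H]) (auto simp: N_def)
  have eq: "(LINT \<xi>|lborel. cis (x * \<xi>) * complex_of_real (P \<xi>)) = (LINT \<xi>|lborel. cis (x * \<xi>) * complex_of_real (N \<xi>))" for x
  proof -
    have i: "integrable lborel (\<lambda>\<xi>. cis (x * \<xi>) * complex_of_real (P \<xi>))" "integrable lborel (\<lambda>\<xi>. cis (x * \<xi>) * complex_of_real (N \<xi>))"
      using Pi Ni by (auto intro!: integrable_cis_mult)
    have "0 = (LINT \<xi>|lborel. cis (x * \<xi>) * complex_of_real (P \<xi>) - cis (x * \<xi>) * complex_of_real (N \<xi>))"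
      unfolding z[of x, symmetric] PN(1) by (simp add: right_diff_distrib)
    then show ?thesis using i by simp
  qed
  define c where "c = integral\<^sup>L lborel P"
  have c: "c = integral\<^sup>L lborel N" using eq[of 0] by (simp add: c_def integral_complex_of_real)
  have "0 \<le> c" unfolding c_def using PN by simp
  show ?thesis
  proof (cases "c = 0")
    case True
    have "AE \<xi> in lborel. P \<xi> = 0" using integral_nonneg_eq_0_iff_AE[OF Pi] PN True by (simp add: c_def)
    moreover have "AE \<xi> in lborel. N \<xi> = 0" using integral_nonneg_eq_0_iff_AE[OF Ni] PN True c by simp
    ultimately show ?thesis by eventually_elim (simp add: PN(1))
  next
    case False
    then have c0: "0 < c" using \<open>0 \<le> c\<close> by simp
    have rd: "real_distribution (density lborel (\<lambda>\<xi>. ennreal (Q \<xi> / c)))"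
      and ch: "char (density lborel (\<lambda>\<xi>. ennreal (Q \<xi> / c))) t = (LINT \<xi>|lborel. cis (t * \<xi>) * complex_of_real (Q \<xi>)) / c"
      if Q: "integrable lborel Q" "\<And>\<xi>. 0 \<le> Q \<xi>" "c = integral\<^sup>L lborel Q" for Q t
    proof -
      have [measurable]: "Q \<in> borel_measurable borel" using Q(1) by auto
      have "(\<integral>\<^sup>+\<xi>. ennreal (Q \<xi> / c) \<partial>lborel) = ennreal (LINT \<xi>|lborel. Q \<xi> / c)"
        using Q c0 by (intro nn_integral_eq_integral) auto
      also have "\<dots> = 1" using Q(3) c0 by simp
      finally have "prob_space (density lborel (\<lambda>\<xi>. ennreal (Q \<xi> / c)))"
        by (intro prob_spaceI) (simp add: emeasure_density)
      then show "real_distribution (density lborel (\<lambda>\<xi>. ennreal (Q \<xi> / c)))"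
        by (simp add: real_distribution_def real_distribution_axioms_def)
      have "char (density lborel (\<lambda>\<xi>. ennreal (Q \<xi> / c))) t = (LINT \<xi>|lborel. (Q \<xi> / c) *\<^sub>R cis (t * \<xi>))"
        unfolding char_def using Q c0 by (subst integral_density) (auto simp: cis_conv_exp)
      also have "\<dots> = (LINT \<xi>|lborel. (cis (t * \<xi>) * complex_of_real (Q \<xi>)) / c)"
        by (intro Bochner_Integration.integral_cong) (auto simp: scaleR_conv_of_real)
      finally show "char (density lborel (\<lambda>\<xi>. ennreal (Q \<xi> / c))) t = (LINT \<xi>|lborel. cis (t * \<xi>) * complex_of_real (Q \<xi>)) / c"
        by simp
    qed
    have "density lborel (\<lambda>\<xi>. ennreal (P \<xi> / c)) = density lborel (\<lambda>\<xi>. ennreal (N \<xi> / c))"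
    proof (rule Levy_uniqueness)
      show "char (density lborel (\<lambda>\<xi>. ennreal (P \<xi> / c))) = char (density lborel (\<lambda>\<xi>. ennreal (N \<xi> / c)))"
        using ch[OF Pi PN(2) c_def] ch[OF Ni PN(3) c] eq by (simp add: fun_eq_iff)
    qed (rule rd[OF Pi PN(2) c_def], rule rd[OF Ni PN(3) c])
    then have "AE \<xi> in lborel. ennreal (P \<xi> / c) = ennreal (N \<xi> / c)"
      by (subst (asm) sigma_finite_measure.density_unique_iff[OF sigma_finite_lborel]) auto
    then show ?thesis
    proof eventually_elim
      case (elim \<xi>)
      then have "P \<xi> / c = N \<xi> / c" using PN[of \<xi>] c0 by (subst (asm) ennreal_inj) auto
      then show ?case using c0 by (simp add: PN(1))
    qed
  qed
qed

text \<open>The transform of the conjugate of \<open>H\<close> vanishes as well, by reflection;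
  hence so do those of the real and the imaginary part.\<close>

lemma Fourier_zero_imp_AE_zero:
  fixes H :: "real \<Rightarrow> complex"
  assumes H: "integrable lborel H"
    and z: "\<And>x. (LINT \<xi>|lborel. cis (x * \<xi>) * H \<xi>) = 0"
  shows "AE \<xi> in lborel. H \<xi> = 0"
proof -
  have z': "(LINT \<xi>|lborel. cis (x * \<xi>) * cnj (H \<xi>)) = 0" for x
  proof -
    have "(LINT \<xi>|lborel. cis (x * \<xi>) * cnj (H \<xi>)) = cnj (LINT \<xi>|lborel. cis (- x * \<xi>) * H \<xi>)"
      unfolding Bochner_Integration.integral_cnj[symmetric] by (simp add: cis_cnj)
    then show ?thesis using z[of "- x"] by simp
  qed
  have i: "integrable lborel (\<lambda>\<xi>. cis (x * \<xi>) * H \<xi>)" "integrable lborel (\<lambda>\<xi>. cis (x * \<xi>) * cnj (H \<xi>))" for x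
    using H by (auto intro!: integrable_cis_mult)
  have "AE \<xi> in lborel. Re (H \<xi>) = 0"
  proof (rule Fourier_zero_imp_AE_zero_real)
    show "integrable lborel (\<lambda>\<xi>. Re (H \<xi>))" using H by simp
    fix x
    have eq: "cis (x * \<xi>) * complex_of_real (Re (H \<xi>)) = (cis (x * \<xi>) * H \<xi> + cis (x * \<xi>) * cnj (H \<xi>)) / 2" for \<xi>
      by (simp add: complex_add_cnj distrib_left[symmetric])
    show "(LINT \<xi>|lborel. cis (x * \<xi>) * complex_of_real (Re (H \<xi>))) = 0"
      unfolding eq using i[of x] z[of x] z'[of x] by simp
  qed
  moreover have "AE \<xi> in lborel. Im (H \<xi>) = 0"
  proof (rule Fourier_zero_imp_AE_zero_real)
    show "integrable lborel (\<lambda>\<xi>. Im (H \<xi>))" using H by simp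
    fix x
    have eq: "cis (x * \<xi>) * complex_of_real (Im (H \<xi>)) = (cis (x * \<xi>) * H \<xi> - cis (x * \<xi>) * cnj (H \<xi>)) * (- \<i> / 2)" for \<xi>
      by (simp add: complex_eq_iff algebra_simps add_divide_distrib diff_divide_distrib)
    show "(LINT \<xi>|lborel. cis (x * \<xi>) * complex_of_real (Im (H \<xi>))) = 0"
      unfolding eq using i[of x] z[of x] z'[of x] by simp
  qed
  ultimately show ?thesis by eventually_elim (simp add: complex_eq_iff)
qed

section \<open>Gaussian test functions and uniqueness of the distributional transform\<close>

lemma power_gauss_bound: "\<bar>x\<bar> ^ n * exp (- x\<^sup>2) \<le> fact n * exp 1" for x :: real
proof -
  have "\<bar>x\<bar> ^ n / fact n \<le> exp \<bar>x\<bar>"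
    using sum_le_suminf[OF summable_exp_generic[of "\<bar>x\<bar>"], of "{n}"]
    by (simp add: exp_def divide_inverse mult.commute)
  then have "\<bar>x\<bar> ^ n * exp (- x\<^sup>2) \<le> (fact n * exp \<bar>x\<bar>) * exp (- x\<^sup>2)"
    by (intro mult_right_mono) (auto simp: field_simps)
  also have "\<dots> = fact n * exp (\<bar>x\<bar> - x\<^sup>2)" by (simp add: exp_diff exp_minus divide_inverse)
  also have "\<bar>x\<bar> - x\<^sup>2 \<le> 1" using zero_le_power2[of "\<bar>x\<bar> - 1"] by (simp add: power2_diff)
  finally show ?thesis by simp
qed

lemma poly_gauss_bound: "\<exists>C. \<forall>x::real. \<bar>x\<bar> ^ k * (cmod (poly p (complex_of_real x)) * exp (- x\<^sup>2)) \<le> C"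
proof (induction p arbitrary: k)
  case 0
  show ?case by (intro exI[of _ 0]) simp
next
  case (pCons a p)
  obtain C where C: "\<And>x. \<bar>x\<bar> ^ Suc k * (cmod (poly p (complex_of_real x)) * exp (- x\<^sup>2)) \<le> C"
    using pCons.IH[of "Suc k"] by blast
  show ?case
  proof (intro exI[of _ "cmod a * (fact k * exp 1) + C"] allI)
    fix x :: real
    have "cmod (poly (pCons a p) (complex_of_real x)) \<le> cmod a + \<bar>x\<bar> * cmod (poly p (complex_of_real x))"
      by (simp add: norm_mult norm_triangle_le)
    then have "\<bar>x\<bar> ^ k * (cmod (poly (pCons a p) (complex_of_real x)) * exp (- x\<^sup>2)) \<le>
        \<bar>x\<bar> ^ k * ((cmod a + \<bar>x\<bar> * cmod (poly p (complex_of_real x))) * exp (- x\<^sup>2))"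
      by (intro mult_left_mono mult_right_mono) auto
    also have "\<dots> = cmod a * (\<bar>x\<bar> ^ k * exp (- x\<^sup>2)) + \<bar>x\<bar> ^ Suc k * (cmod (poly p (complex_of_real x)) * exp (- x\<^sup>2))"
      by (simp add: algebra_simps)
    also have "\<dots> \<le> cmod a * (fact k * exp 1) + C"
      by (intro add_mono mult_left_mono power_gauss_bound C) simp
    finally show "\<bar>x\<bar> ^ k * (cmod (poly (pCons a p) (complex_of_real x)) * exp (- x\<^sup>2)) \<le> cmod a * (fact k * exp 1) + C" .
  qed
qed

text \<open>Polynomials times modulated Gaussians are closed under differentiation, which gives all
  Schwartz seminorms by one induction; with the constant polynomial 1 they supply enough test
  functions to determine a Fourier transform.\<close>

definition poly_gauss :: "real \<Rightarrow> complex poly \<Rightarrow> real \<Rightarrow> complex" where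
  "poly_gauss a p x = poly p (complex_of_real x) * exp (- (complex_of_real x)\<^sup>2 + \<i> * a * x)"

lemma poly_gauss_derivative:
  "(poly_gauss a p has_vector_derivative poly_gauss a (pderiv p + p * [:\<i> * a, -2:]) x) (at x)"
proof -
  have "((\<lambda>z. poly p z * exp (- z\<^sup>2 + \<i> * a * z)) has_field_derivative
     poly (pderiv p + p * [:\<i> * a, -2:]) (complex_of_real x) * exp (- (complex_of_real x)\<^sup>2 + \<i> * a * complex_of_real x)) (at (complex_of_real x))"
    by (auto intro!: derivative_eq_intros poly_DERIV simp: algebra_simps)
  then show ?thesis unfolding poly_gauss_def[abs_def] by (rule has_vector_derivative_real_field)
qed

lemma vderiv_poly_gauss: "vderiv (poly_gauss a p) = poly_gauss a (pderiv p + p * [:\<i> * a, -2:])"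
  unfolding vderiv_def using vector_derivative_at[OF poly_gauss_derivative] by blast

lemma vderiv_funpow_poly_gauss: "\<exists>q. (vderiv ^^ m) (poly_gauss a p) = poly_gauss a q"
  by (induction m) (auto simp: vderiv_poly_gauss)

lemma norm_poly_gauss: "cmod (poly_gauss a p x) = cmod (poly p (complex_of_real x)) * exp (- x\<^sup>2)"
  by (simp add: poly_gauss_def norm_mult)

lemma poly_gauss_schwartz: "poly_gauss a p \<in> schwartz"
  unfolding schwartz_def
proof (intro CollectI allI conjI)
  fix m k x
  obtain q where q: "(vderiv ^^ m) (poly_gauss a p) = poly_gauss a q" using vderiv_funpow_poly_gauss by blast
  show "(vderiv ^^ m) (poly_gauss a p) differentiable at x"
    unfolding q using poly_gauss_derivative[of a q x] by (auto simp: has_vector_derivative_def differentiable_def)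
  obtain C where "\<And>x::real. \<bar>x\<bar> ^ k * (cmod (poly q (complex_of_real x)) * exp (- x\<^sup>2)) \<le> C"
    using poly_gauss_bound[of k q] by blast
  then show "bdd_above (range (\<lambda>x. \<bar>x\<bar> ^ k * cmod ((vderiv ^^ m) (poly_gauss a p) x)))"
    unfolding q by (auto simp: bdd_above_def norm_poly_gauss)
qed

text \<open>Testing against modulated Gaussians shows that (g - h) exp(-\<xi>^2), an integrable
  function, has vanishing Fourier transform. This identifies the arbitrary representative
  \<open>fhat\<close> up to null sets.\<close>

lemma has_fourier_transform_unique:
  assumes "has_fourier_transform f g" "has_fourier_transform f h"
  shows "AE \<xi> in lborel. g \<xi> = h \<xi>"
proof -
  define e where "e \<xi> = complex_of_real (exp (- \<xi>\<^sup>2))" for \<xi> :: real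
  have pg: "poly_gauss x 1 \<xi> = cis (x * \<xi>) * e \<xi>" for x \<xi>
    by (simp add: poly_gauss_def e_def cis_conv_exp exp_add[symmetric] exp_of_real[symmetric] mult_ac add.commute del: exp_of_real)
  have i: "integrable lborel (\<lambda>\<xi>. g \<xi> * (cis (x * \<xi>) * e \<xi>))" "integrable lborel (\<lambda>\<xi>. h \<xi> * (cis (x * \<xi>) * e \<xi>))"
      "(LINT \<xi>|lborel. g \<xi> * (cis (x * \<xi>) * e \<xi>)) = (LINT \<xi>|lborel. h \<xi> * (cis (x * \<xi>) * e \<xi>))" for x
    using assms poly_gauss_schwartz[of x 1] unfolding has_fourier_transform_def pg[symmetric] by auto
  have "AE \<xi> in lborel. (g \<xi> - h \<xi>) * e \<xi> = 0"
  proof (rule Fourier_zero_imp_AE_zero)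
    have "integrable lborel (\<lambda>\<xi>. g \<xi> * (cis (0 * \<xi>) * e \<xi>) - h \<xi> * (cis (0 * \<xi>) * e \<xi>))"
      using i[of 0] by (intro Bochner_Integration.integrable_diff)
    then show "integrable lborel (\<lambda>\<xi>. (g \<xi> - h \<xi>) * e \<xi>)" by (simp add: left_diff_distrib)
    fix x
    have "(LINT \<xi>|lborel. cis (x * \<xi>) * ((g \<xi> - h \<xi>) * e \<xi>)) =
        (LINT \<xi>|lborel. g \<xi> * (cis (x * \<xi>) * e \<xi>) - h \<xi> * (cis (x * \<xi>) * e \<xi>))"
      by (simp add: algebra_simps)
    also have "\<dots> = 0" using i[of x] by simp
    finally show "(LINT \<xi>|lborel. cis (x * \<xi>) * ((g \<xi> - h \<xi>) * e \<xi>)) = 0" .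
  qed
  then show ?thesis by eventually_elim (simp add: e_def)
qed

section \<open>Schwartz functions, the multiplication formula, and series of distributions\<close>

lemma schwartzD:
  assumes "\<phi> \<in> schwartz"
  shows "\<phi> \<in> borel_measurable borel" "\<And>x. cmod (\<phi> x) \<le> schwartz_seminorm 0 0 \<phi>" "integrable lborel \<phi>"
proof -
  have d: "\<phi> differentiable at x" and b: "bdd_above (range (\<lambda>x. \<bar>x\<bar> ^ k * cmod (\<phi> x)))" for x k
    using spec[OF assms[unfolded schwartz_def mem_Collect_eq], of 0] by simp_all
  have "continuous_on UNIV \<phi>"
    using d by (auto simp: continuous_on_eq_continuous_at intro: differentiable_imp_continuous_within)
  then show m: "\<phi> \<in> borel_measurable borel" by (rule borel_measurable_continuous_onI)
  show s: "cmod (\<phi> x) \<le> schwartz_seminorm 0 0 \<phi>" for x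
    unfolding schwartz_seminorm_def using cSUP_upper[OF UNIV_I b[of 0], of x] by simp
  obtain C where C: "\<And>x. x\<^sup>2 * cmod (\<phi> x) \<le> C" using b[of 2] by (auto simp: bdd_above_def)
  show "integrable lborel \<phi>"
  proof (rule Bochner_Integration.integrable_bound)
    have "integrable lborel (\<lambda>x::real. inverse (1 + x\<^sup>2))"
      using integrable_inverse_1_plus_square by (simp add: set_integrable_def einterval_def)
    then show "integrable lborel (\<lambda>x. (schwartz_seminorm 0 0 \<phi> + C) * inverse (1 + x\<^sup>2))" by simp
    show "AE x in lborel. norm (\<phi> x) \<le> norm ((schwartz_seminorm 0 0 \<phi> + C) * inverse (1 + x\<^sup>2))"
    proof (intro AE_I2)
      fix x :: real
      have "(1 + x\<^sup>2) * cmod (\<phi> x) \<le> schwartz_seminorm 0 0 \<phi> + C" using s[of x] C[of x] by (simp add: algebra_simps)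
      then have "cmod (\<phi> x) \<le> (schwartz_seminorm 0 0 \<phi> + C) * inverse (1 + x\<^sup>2)"
        by (simp add: divide_inverse[symmetric] pos_le_divide_eq add_pos_nonneg mult.commute)
      then show "norm (\<phi> x) \<le> norm ((schwartz_seminorm 0 0 \<phi> + C) * inverse (1 + x\<^sup>2))" by simp
    qed
  qed (use m in simp)
qed

lemma fourier_eq_osc: "fourier \<phi> \<xi> = osc (- \<xi>) 0 \<phi>"
  by (simp add: fourier_def osc_def mult.commute)

text \<open>The multiplication formula, without complex conjugation; it is what makes the
  distributional transform of an integrable function agree with \<open>fourier\<close>.\<close>

lemma fourier_parseval:
  assumes F: "integrable lborel F" and \<phi>: "integrable lborel \<phi>"
  shows "(LINT x|lborel. F x * fourier \<phi> x) = (LINT \<xi>|lborel. fourier F \<xi> * \<phi> \<xi>)"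
proof -
  have "(LINT x|lborel. F x * osc (- x) 0 \<phi>) = (LINT \<xi>|lborel. \<phi> \<xi> * (LINT x|lborel. F x * cis (- x * \<xi> + 0 * \<xi>\<^sup>2)))"
    by (rule osc_swap[OF F \<phi>]) auto
  then show ?thesis by (simp add: fourier_eq_osc[symmetric]) (simp add: fourier_def mult.commute)
qed

lemma norm_fourier_le: "cmod (fourier F \<xi>) \<le> (LINT x|lborel. cmod (F x))"
  unfolding fourier_eq_osc by (rule norm_osc_le)

lemma measurable_fourier [measurable]:
  "F \<in> borel_measurable borel \<Longrightarrow> fourier F \<in> borel_measurable borel"
  unfolding fourier_eq_osc[abs_def] by (rule measurable_osc) auto

text \<open>Functions with summable \<open>L\<^sup>1\<close> norms define a tempered distribution whose Fourier transform is
  computed termwise, without Fourier inversion.\<close>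

definition series_distr :: "(nat \<Rightarrow> real \<Rightarrow> complex) \<Rightarrow> distr" where
  "series_distr F \<psi> = (\<Sum>n. LINT x|lborel. F n x * \<psi> x)"

lemma series_distr:
  assumes F: "\<And>n. integrable lborel (F n)" and sum: "summable (\<lambda>n. LINT x|lborel. cmod (F n x))"
  shows "tempered (series_distr F)" "has_fourier_transform (series_distr F) (\<lambda>\<xi>. \<Sum>n. fourier (F n) \<xi>)"
proof -
  have [measurable]: "F n \<in> borel_measurable borel" for n using F[of n] by auto
  define L where "L n = (LINT x|lborel. cmod (F n x))" for n
  have sL: "summable L" using sum by (simp add: L_def[abs_def])
  have L0: "0 \<le> L n" for n by (simp add: L_def)
  have prod: "integrable lborel (\<lambda>x. F n x * \<psi> x)" and bound: "cmod (LINT x|lborel. F n x * \<psi> x) \<le> L n * schwartz_seminorm 0 0 \<psi>"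
    if \<psi>: "\<psi> \<in> schwartz" for n \<psi>
  proof -
    note [measurable] = schwartzD(1)[OF \<psi>]
    have le: "cmod (F n x * \<psi> x) \<le> cmod (F n x) * schwartz_seminorm 0 0 \<psi>" for x
      using schwartzD(2)[OF \<psi>, of x] by (simp add: norm_mult mult_left_mono)
    have i: "integrable lborel (\<lambda>x. cmod (F n x) * schwartz_seminorm 0 0 \<psi>)" using F by simp
    show p: "integrable lborel (\<lambda>x. F n x * \<psi> x)"
      by (rule Bochner_Integration.integrable_bound[OF i]) (use le in \<open>auto intro!: AE_I2 order_trans[OF le]\<close>)
    have "cmod (LINT x|lborel. F n x * \<psi> x) \<le> (LINT x|lborel. cmod (F n x * \<psi> x))" by (rule integral_norm_bound)
    also have "\<dots> \<le> (LINT x|lborel. cmod (F n x) * schwartz_seminorm 0 0 \<psi>)"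
      by (rule integral_mono[OF _ i]) (use p le in auto)
    finally show "cmod (LINT x|lborel. F n x * \<psi> x) \<le> L n * schwartz_seminorm 0 0 \<psi>" by (simp add: L_def)
  qed
  have sums: "summable (\<lambda>n. cmod (LINT x|lborel. F n x * \<psi> x))" if \<psi>: "\<psi> \<in> schwartz" for \<psi>
    by (rule summable_comparison_test'[OF summable_mult2[OF sL], of 0]) (use bound[OF \<psi>] in simp)
  show "tempered (series_distr F)"
    unfolding tempered_def
  proof (intro conjI ballI allI)
    fix \<phi> \<psi> assume \<phi>: "\<phi> \<in> schwartz" and \<psi>: "\<psi> \<in> schwartz"
    show "series_distr F (\<lambda>x. \<phi> x + \<psi> x) = series_distr F \<phi> + series_distr F \<psi>"
      unfolding series_distr_def using prod[OF \<phi>] prod[OF \<psi>]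
      by (simp add: distrib_left suminf_add[OF summable_norm_cancel[OF sums[OF \<phi>]] summable_norm_cancel[OF sums[OF \<psi>]]])
  next
    fix \<phi> c assume \<phi>: "\<phi> \<in> schwartz"
    have "(LINT x|lborel. F n x * (c * \<phi> x)) = c * (LINT x|lborel. F n x * \<phi> x)" for n
      by (simp add: mult.left_commute)
    then show "series_distr F (\<lambda>x. c * \<phi> x) = c * series_distr F \<phi>"
      unfolding series_distr_def using suminf_mult[OF summable_norm_cancel[OF sums[OF \<phi>]]] by simp
  next
    show "\<exists>C N. \<forall>\<phi>\<in>schwartz. cmod (series_distr F \<phi>) \<le> C * (\<Sum>k\<le>N. \<Sum>m\<le>N. schwartz_seminorm k m \<phi>)"
    proof (intro exI[of _ "suminf L"] exI[of _ 0] ballI)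
      fix \<phi> assume \<phi>: "\<phi> \<in> schwartz"
      have "cmod (series_distr F \<phi>) \<le> (\<Sum>n. cmod (LINT x|lborel. F n x * \<phi> x))"
        unfolding series_distr_def by (rule summable_norm[OF sums[OF \<phi>]])
      also have "\<dots> \<le> (\<Sum>n. L n * schwartz_seminorm 0 0 \<phi>)"
        by (intro suminf_le bound[OF \<phi>] sums[OF \<phi>] summable_mult2 sL)
      also have "\<dots> = suminf L * schwartz_seminorm 0 0 \<phi>" by (rule suminf_mult2[OF sL, symmetric])
      finally show "cmod (series_distr F \<phi>) \<le> suminf L * (\<Sum>k\<le>0. \<Sum>m\<le>0. schwartz_seminorm k m \<phi>)" by simp
    qed
  qed
  show "has_fourier_transform (series_distr F) (\<lambda>\<xi>. \<Sum>n. fourier (F n) \<xi>)"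
    unfolding has_fourier_transform_def
  proof (intro conjI ballI)
    show "(\<lambda>\<xi>. \<Sum>n. fourier (F n) \<xi>) \<in> borel_measurable lborel" by measurable
    fix \<phi> assume \<phi>: "\<phi> \<in> schwartz"
    note \<phi>i = schwartzD(3)[OF \<phi>]
    note [measurable] = schwartzD(1)[OF \<phi>]
    have le: "cmod (fourier (F n) \<xi> * \<phi> \<xi>) \<le> L n * cmod (\<phi> \<xi>)" for n \<xi>
      unfolding norm_mult L_def by (intro mult_right_mono norm_fourier_le) simp
    have int: "integrable lborel (\<lambda>\<xi>. fourier (F n) \<xi> * \<phi> \<xi>)" for n
    proof (rule Bochner_Integration.integrable_bound)
      show "integrable lborel (\<lambda>\<xi>. L n * cmod (\<phi> \<xi>))" using \<phi>i by simp
    qed (use le in \<open>auto intro!: AE_I2 order_trans[OF le]\<close>)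
    have AE: "AE \<xi> in lborel. summable (\<lambda>n. norm (fourier (F n) \<xi> * \<phi> \<xi>))"
      by (intro AE_I2 summable_comparison_test'[OF summable_mult2[OF sL], of 0]) (use le in simp)
    have si: "summable (\<lambda>n. LINT \<xi>|lborel. norm (fourier (F n) \<xi> * \<phi> \<xi>))"
    proof (rule summable_comparison_test'[OF summable_mult2[OF sL], of 0])
      fix n
      have "(LINT \<xi>|lborel. norm (fourier (F n) \<xi> * \<phi> \<xi>)) \<le> (LINT \<xi>|lborel. L n * cmod (\<phi> \<xi>))"
        using int \<phi>i le by (intro integral_mono) auto
      then show "norm (LINT \<xi>|lborel. norm (fourier (F n) \<xi> * \<phi> \<xi>)) \<le> L n * (LINT \<xi>|lborel. cmod (\<phi> \<xi>))" by simp
    qed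
    have sf: "summable (\<lambda>n. fourier (F n) \<xi>)" for \<xi>
      by (rule summable_comparison_test'[OF sL, of 0]) (use norm_fourier_le in \<open>simp add: L_def\<close>)
    have eq: "(\<Sum>n. fourier (F n) \<xi>) * \<phi> \<xi> = (\<Sum>n. fourier (F n) \<xi> * \<phi> \<xi>)" for \<xi>
      by (rule suminf_mult2[OF sf])
    show "integrable lborel (\<lambda>\<xi>. (\<Sum>n. fourier (F n) \<xi>) * \<phi> \<xi>)"
      unfolding eq by (rule integrable_suminf[OF int AE si])
    show "series_distr F (fourier \<phi>) = (LINT \<xi>|lborel. (\<Sum>n. fourier (F n) \<xi>) * \<phi> \<xi>)"
      unfolding eq integral_suminf[OF int AE si] series_distr_def fourier_parseval[OF F \<phi>i] ..
  qed
qed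

section \<open>Gliding hump\<close>

text \<open>The next index exceeds the sum of the thresholds of all indices up to the current one,
  so the relation holds between any earlier and any later term and not just between
  neighbours.\<close>

lemma ex_fast_subsequence:
  fixes R :: "nat \<Rightarrow> nat \<Rightarrow> bool"
  assumes "\<And>i. eventually (R i) sequentially"
  obtains r :: "nat \<Rightarrow> nat" where "strict_mono r" "\<And>j k. j < k \<Longrightarrow> R (r j) (r k)"
proof -
  obtain N where N: "\<And>i m. N i \<le> m \<Longrightarrow> R i m" using assms unfolding eventually_sequentially by metis
  define r where "r = rec_nat 0 (\<lambda>_ m. Suc m + (\<Sum>i\<le>m. N i))"
  have rS: "r (Suc n) = Suc (r n) + (\<Sum>i\<le>r n. N i)" for n by (simp add: r_def)
  have sm: "strict_mono r" by (rule strict_monoI_Suc) (simp add: rS)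
  have R': "R (r j) (r k)" if jk: "j < k" for j k
  proof -
    obtain n where k: "k = Suc n" using jk by (cases k) auto
    have "r j \<le> r n" using jk k strict_mono_leD[OF sm] by auto
    then have "N (r j) \<le> (\<Sum>i\<le>r n. N i)" by (intro member_le_sum) auto
    then show ?thesis unfolding k rS by (intro N) simp
  qed
  show thesis by (rule that[OF sm]) (rule R')
qed

text \<open>By continuity in t a positive value persists at some rational time. The sets of points
  missed by the first n rational times therefore decrease to the empty set, and their measures tend
  to 0.\<close>

lemma ex_finite_times:
  fixes h :: "real \<Rightarrow> real \<Rightarrow> real"
  assumes hm: "\<And>t. t \<in> {0<..<\<epsilon>} \<Longrightarrow> h t \<in> borel_measurable borel"
    and cont: "\<And>x. continuous_on {0<..<\<epsilon>} (\<lambda>t. h t x)"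
    and pos: "\<And>x. x \<in> {0..1} \<Longrightarrow> \<exists>t\<in>{0<..<\<epsilon>}. 0 < h t x"
    and \<eta>: "0 < \<eta>"
  obtains M where "finite M" "M \<noteq> {}" "M \<subseteq> {0<..<\<epsilon>}"
    "{x\<in>{0..1}. \<forall>t\<in>M. h t x \<le> 0} \<in> sets borel"
    "emeasure lborel {x\<in>{0..1}. \<forall>t\<in>M. h t x \<le> 0} \<le> ennreal \<eta>"
proof -
  define Q where "Q = \<rat> \<inter> {0<..<\<epsilon>}"
  obtain t0 where t0: "t0 \<in> {0<..<\<epsilon>}" using pos[of 0] by auto
  then obtain q where "q \<in> \<rat>" "0 < q" "q < \<epsilon>" using Rats_dense_in_real[of 0 \<epsilon>] by auto
  then have Qne: "Q \<noteq> {}" by (auto simp: Q_def)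
  have Qc: "countable Q" unfolding Q_def by (rule countable_subset[OF _ countable_rat]) auto
  define e where "e = from_nat_into Q"
  have eQ: "e n \<in> Q" for n using Qne by (simp add: e_def from_nat_into)
  have e0: "e n \<in> {0<..<\<epsilon>}" for n using eQ[of n] by (simp add: Q_def)
  have [measurable]: "h (e n) \<in> borel_measurable borel" for n by (rule hm[OF e0])
  define A where "A n = {x\<in>{0..1}. \<forall>t\<in>e ` {..n}. h t x \<le> 0}" for n
  have Am: "A n \<in> sets borel" for n
  proof -
    have "A n = {0..1} \<inter> (\<Inter>i\<in>{..n}. {x. h (e i) x \<le> 0})" by (auto simp: A_def)
    moreover have "{x. h (e i) x \<le> 0} \<in> sets borel" for i
      using measurable_sets[of "h (e i)" borel borel "{..0}"] by (simp add: vimage_def)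
    ultimately show ?thesis by (simp only:) (intro sets.Int sets.finite_INT, auto)
  qed
  have "(\<lambda>n. emeasure lborel (A n)) \<longlonglongrightarrow> emeasure lborel (\<Inter>n. A n)"
  proof (rule Lim_emeasure_decseq)
    show "range A \<subseteq> sets lborel" using Am by auto
    show "decseq A" unfolding decseq_def A_def by fastforce
    have "emeasure lborel (A n) \<le> emeasure lborel {0..1::real}" for n
      by (rule emeasure_mono) (auto simp: A_def)
    then have "emeasure lborel (A n) < \<infinity>" for n by (rule le_less_trans) simp
    then show "emeasure lborel (A n) \<noteq> \<infinity>" for n by (simp add: less_top)
  qed
  moreover have "(\<Inter>n. A n) = {}"
  proof (rule ccontr)
    assume "(\<Inter>n. A n) \<noteq> {}"
    then obtain x where x: "\<And>n. x \<in> A n" by blast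
    then have x01: "x \<in> {0..1}" by (simp add: A_def)
    have xQ: "h t x \<le> 0" if "t \<in> Q" for t
    proof -
      from from_nat_into_surj[OF Qc that] obtain m where m: "e m = t" unfolding e_def by blast
      show ?thesis using x[of m] unfolding A_def m[symmetric] by auto
    qed
    obtain t where t: "t \<in> {0<..<\<epsilon>}" "0 < h t x" using pos[OF x01] by blast
    obtain d where d: "0 < d" "\<And>u. \<lbrakk>u \<in> {0<..<\<epsilon>}; dist u t < d\<rbrakk> \<Longrightarrow> dist (h u x) (h t x) < h t x"
      using cont[of x] t unfolding continuous_on_iff by blast
    obtain r where r: "r \<in> \<rat>" "max 0 (t - d) < r" "r < t"
      using Rats_dense_in_real[of "max 0 (t - d)" t] t d by auto
    have rQ: "r \<in> Q" using r t by (simp add: Q_def)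
    have "dist (h r x) (h t x) < h t x" using r t by (intro d) (auto simp: dist_real_def)
    then have "0 < h r x" by (simp add: dist_real_def)
    then show False using xQ[OF rQ] by simp
  qed
  ultimately have "(\<lambda>n. emeasure lborel (A n)) \<longlonglongrightarrow> 0" by simp
  then have "\<forall>\<^sub>F n in sequentially. emeasure lborel (A n) < ennreal \<eta>"
    using \<eta> by (intro order_tendstoD(2)) auto
  then obtain n where "emeasure lborel (A n) < ennreal \<eta>" by (auto simp: eventually_sequentially)
  note n = this
  show thesis
  proof (rule that[of "e ` {..n}"])
    show "{x\<in>{0..1}. \<forall>t\<in>e ` {..n}. h t x \<le> 0} \<in> sets borel" using Am[of n] unfolding A_def .
    show "emeasure lborel {x\<in>{0..1}. \<forall>t\<in>e ` {..n}. h t x \<le> 0} \<le> ennreal \<eta>"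
      using less_imp_le[OF n] unfolding A_def .
  qed (use e0 in auto)
qed

text \<open>Peeling off terms from the front with |a + b|^2 \<le> 2 |a|^2 + 2 |b|^2 produces the
  weights 2^(k+1). It replaces orthogonality for blocks whose frequency supports overlap; the blocks
  only have to be chosen with energies that beat the weights.\<close>

lemma norm_square_suminf_le:
  fixes z :: "nat \<Rightarrow> complex"
  assumes "summable (\<lambda>k. cmod (z k))"
  shows "ennreal ((cmod (\<Sum>k. z k))\<^sup>2) \<le> (\<Sum>k. ennreal (2 ^ Suc k * (cmod (z k))\<^sup>2))"
proof -
  have fin: "(cmod (\<Sum>k<n. z k))\<^sup>2 \<le> (\<Sum>k<n. 2 ^ Suc k * (cmod (z k))\<^sup>2)" for n and z :: "nat \<Rightarrow> complex"
  proof (induction n arbitrary: z)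
    case (Suc n)
    let ?w = "\<Sum>k<n. z (Suc k)"
    have "(cmod (\<Sum>k<Suc n. z k))\<^sup>2 = (cmod (z 0 + ?w))\<^sup>2" by (simp add: sum.lessThan_Suc_shift del: sum.lessThan_Suc)
    also have "\<dots> \<le> (cmod (z 0) + cmod ?w)\<^sup>2" by (intro power_mono norm_triangle_ineq) simp
    also have "\<dots> \<le> 2 * (cmod (z 0))\<^sup>2 + 2 * (cmod ?w)\<^sup>2"
      using zero_le_power2[of "cmod (z 0) - cmod ?w"] unfolding power2_sum power2_diff by linarith
    also have "\<dots> \<le> 2 * (cmod (z 0))\<^sup>2 + 2 * (\<Sum>k<n. 2 ^ Suc k * (cmod (z (Suc k)))\<^sup>2)"
      using Suc[of "\<lambda>k. z (Suc k)"] by simp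
    also have "\<dots> = (\<Sum>k<Suc n. 2 ^ Suc k * (cmod (z k))\<^sup>2)"
      by (simp add: sum.lessThan_Suc_shift sum_distrib_left mult.assoc del: sum.lessThan_Suc)
    finally show ?case .
  qed simp
  have "(\<lambda>n. \<Sum>k<n. z k) \<longlonglongrightarrow> (\<Sum>k. z k)" using summable_LIMSEQ[OF summable_norm_cancel[OF assms]] .
  then have "(\<lambda>n. ennreal ((cmod (\<Sum>k<n. z k))\<^sup>2)) \<longlonglongrightarrow> ennreal ((cmod (\<Sum>k. z k))\<^sup>2)"
    by (intro tendsto_intros)
  then show ?thesis
  proof (rule LIMSEQ_le_const2, intro exI allI impI)
    fix n
    have "ennreal ((cmod (\<Sum>k<n. z k))\<^sup>2) \<le> (\<Sum>k<n. ennreal (2 ^ Suc k * (cmod (z k))\<^sup>2))"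
      using fin[of z n] by (simp add: sum_ennreal ennreal_leI)
    also have "\<dots> \<le> (\<Sum>k. ennreal (2 ^ Suc k * (cmod (z k))\<^sup>2))" by (rule sum_le_suminf) auto
    finally show "ennreal ((cmod (\<Sum>k<n. z k))\<^sup>2) \<le> (\<Sum>k. ennreal (2 ^ Suc k * (cmod (z k))\<^sup>2))" .
  qed
qed

lemma norm_cis_minus_one_le: "cmod (cis \<theta> - 1) \<le> \<bar>\<theta>\<bar>"
  using iexp_approx1[of \<theta> 0] by (simp add: cis_conv_exp)

text \<open>For a fixed profile with two integrable moments the displacement costs t^\<alpha> and
  the time t \<le> t^\<alpha>. Since \<delta> < \<alpha>, a single block is of smaller order than
  t^\<delta> as t tends to 0.\<close>

lemma osc_time_difference:
  assumes \<gamma>: "\<bar>\<gamma> x t - x\<bar> \<le> C * t powr \<alpha>" and t: "0 < t" "t \<le> 1" and \<alpha>: "0 < \<alpha>" "\<alpha> \<le> 1" and C: "0 \<le> C"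
    and g: "integrable lborel g" and g2: "integrable lborel (\<lambda>\<xi>. (1 + \<xi>\<^sup>2) * cmod (g \<xi>))"
  shows "cmod (osc (\<gamma> x t) t g - osc x 0 g) \<le> (C + 1) * (LINT \<xi>|lborel. (1 + \<xi>\<^sup>2) * cmod (g \<xi>)) * t powr \<alpha>"
proof -
  have tt: "t \<le> t powr \<alpha>" using powr_mono'[of \<alpha> 1 t] t \<alpha> by simp
  have le: "cmod (cis (\<gamma> x t * \<xi> + t * \<xi>\<^sup>2) * g \<xi> - cis (x * \<xi> + 0 * \<xi>\<^sup>2) * g \<xi>) \<le>
      (C + 1) * t powr \<alpha> * ((1 + \<xi>\<^sup>2) * cmod (g \<xi>))" for \<xi>
  proof -
    have "cis (\<gamma> x t * \<xi> + t * \<xi>\<^sup>2) = cis (x * \<xi> + 0 * \<xi>\<^sup>2) * cis ((\<gamma> x t - x) * \<xi> + t * \<xi>\<^sup>2)"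
      unfolding cis_mult by (rule arg_cong[where f=cis]) (simp add: algebra_simps)
    then have "cmod (cis (\<gamma> x t * \<xi> + t * \<xi>\<^sup>2) * g \<xi> - cis (x * \<xi> + 0 * \<xi>\<^sup>2) * g \<xi>) =
        cmod (cis (x * \<xi> + 0 * \<xi>\<^sup>2) * (cis ((\<gamma> x t - x) * \<xi> + t * \<xi>\<^sup>2) - 1) * g \<xi>)"
      by (simp add: algebra_simps)
    also have "\<dots> = cmod (cis ((\<gamma> x t - x) * \<xi> + t * \<xi>\<^sup>2) - 1) * cmod (g \<xi>)" by (simp add: norm_mult)
    also have "\<dots> \<le> ((C + 1) * t powr \<alpha> * (1 + \<xi>\<^sup>2)) * cmod (g \<xi>)"
    proof (rule mult_right_mono)
      have "cmod (cis ((\<gamma> x t - x) * \<xi> + t * \<xi>\<^sup>2) - 1) \<le> \<bar>(\<gamma> x t - x) * \<xi> + t * \<xi>\<^sup>2\<bar>" by (rule norm_cis_minus_one_le)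
      also have "\<dots> \<le> \<bar>\<gamma> x t - x\<bar> * \<bar>\<xi>\<bar> + t * \<xi>\<^sup>2"
        using t by (intro order_trans[OF abs_triangle_ineq]) (simp add: abs_mult)
      also have "\<dots> \<le> (C * t powr \<alpha>) * (1 + \<xi>\<^sup>2) + t powr \<alpha> * (1 + \<xi>\<^sup>2)"
      proof (intro add_mono mult_mono)
        have "0 \<le> (\<bar>\<xi>\<bar> - 1 / 2)\<^sup>2" by simp
        then show "\<bar>\<xi>\<bar> \<le> 1 + \<xi>\<^sup>2" unfolding power2_diff by (simp add: power2_eq_square)
      qed (use \<gamma> tt C t in auto)
      finally show "cmod (cis ((\<gamma> x t - x) * \<xi> + t * \<xi>\<^sup>2) - 1) \<le> (C + 1) * t powr \<alpha> * (1 + \<xi>\<^sup>2)"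
        by (simp add: algebra_simps)
    qed simp
    finally show ?thesis by (simp add: mult.assoc)
  qed
  have "cmod (osc (\<gamma> x t) t g - osc x 0 g) = cmod (LINT \<xi>|lborel. cis (\<gamma> x t * \<xi> + t * \<xi>\<^sup>2) * g \<xi> - cis (x * \<xi> + 0 * \<xi>\<^sup>2) * g \<xi>)"
    unfolding osc_def by (subst Bochner_Integration.integral_diff[OF integrable_osc[OF g] integrable_osc[OF g]]) (rule refl)
  also have "\<dots> \<le> (LINT \<xi>|lborel. cmod (cis (\<gamma> x t * \<xi> + t * \<xi>\<^sup>2) * g \<xi> - cis (x * \<xi> + 0 * \<xi>\<^sup>2) * g \<xi>))"
    by (rule integral_norm_bound)
  also have "\<dots> \<le> (LINT \<xi>|lborel. (C + 1) * t powr \<alpha> * ((1 + \<xi>\<^sup>2) * cmod (g \<xi>)))"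
    by (intro integral_mono integrable_norm Bochner_Integration.integrable_diff integrable_osc g integrable_mult_right g2 le)
  also have "\<dots> = (C + 1) * (LINT \<xi>|lborel. (1 + \<xi>\<^sup>2) * cmod (g \<xi>)) * t powr \<alpha>"
    unfolding integral_mult_right_zero by (simp only: mult_ac)
  finally show ?thesis .
qed

text \<open>Tails are controlled through \<open>liminf\<close> of the truncated integrals, which is measurable and
  defined everywhere; it is the tail of \<open>U \<gamma> f\<close> wherever that exists.\<close>

lemma liminf_tail_estimate:
  fixes \<gamma> :: "real \<Rightarrow> real \<Rightarrow> real"
  assumes \<gamma>: "admissible_curve \<alpha> \<gamma>"
  obtains D where "0 < D"
    "\<And>t h \<mu>. \<lbrakk>t \<in> {-1..1}; h \<in> borel_measurable borel; integrable lborel (\<lambda>\<xi>. (cmod (h \<xi>))\<^sup>2); 0 < \<mu>\<rbrakk> \<Longrightarrow>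
      {x\<in>{0..1}. ennreal (\<mu>\<^sup>2) \<le> liminf (\<lambda>n. ennreal ((cmod (osc (\<gamma> x t) t (\<lambda>\<xi>. if \<bar>\<xi>\<bar> \<le> 2 ^ n then h \<xi> else 0)))\<^sup>2))} \<in> sets borel \<and>
      emeasure lborel {x\<in>{0..1}. ennreal (\<mu>\<^sup>2) \<le> liminf (\<lambda>n. ennreal ((cmod (osc (\<gamma> x t) t (\<lambda>\<xi>. if \<bar>\<xi>\<bar> \<le> 2 ^ n then h \<xi> else 0)))\<^sup>2))}
        \<le> ennreal (D * (LINT \<xi>|lborel. (cmod (h \<xi>))\<^sup>2) / \<mu>\<^sup>2)"
proof -
  obtain c C0 where c: "0 < c" and lower: "\<And>t x y. t \<in> {-1..1} \<Longrightarrow> c * \<bar>x - y\<bar> \<le> \<bar>\<gamma> x t - \<gamma> y t\<bar>"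
    and meas: "\<And>\<tau>. \<lbrakk>\<tau> \<in> borel_measurable borel; \<And>x. \<tau> x \<in> {-1..1}\<rbrakk> \<Longrightarrow> (\<lambda>x. \<gamma> x (\<tau> x)) \<in> borel_measurable borel"
    by (rule admissible_curveE[OF \<gamma>]) blast
  obtain D where D: "0 < D" and fixed: "\<And>N B p q g. \<lbrakk>0 < N; B \<in> sets borel; emeasure lborel B < \<infinity>;
        p \<in> borel_measurable borel; q \<in> borel_measurable borel;
        g \<in> borel_measurable borel; integrable lborel (\<lambda>\<xi>. (cmod (g \<xi>))\<^sup>2); \<And>\<xi>. g \<xi> \<noteq> 0 \<Longrightarrow> \<bar>\<xi>\<bar> \<le> N;
        \<And>x y. c * \<bar>x - y\<bar> - 0 / N \<le> \<bar>p x - p y\<bar>; \<And>x y. \<bar>q x - q y\<bar> \<le> 0 / N\<^sup>2\<rbrakk> \<Longrightarrow>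
      (\<integral>\<^sup>+x\<in>B. ennreal ((cmod (osc (p x) (q x) g))\<^sup>2) \<partial>lborel) \<le> ennreal (D * (LINT \<xi>|lborel. (cmod (g \<xi>))\<^sup>2))"
    by (rule short_time_estimate[OF c order_refl order_refl]) blast
  show thesis
  proof (rule that[OF D])
    fix t \<mu> :: real and h :: "real \<Rightarrow> complex"
    assume t: "t \<in> {-1..1}" and hm[measurable]: "h \<in> borel_measurable borel"
      and h2: "integrable lborel (\<lambda>\<xi>. (cmod (h \<xi>))\<^sup>2)" and \<mu>: "0 < \<mu>"
    define hn where "hn n \<xi> = (if \<bar>\<xi>\<bar> \<le> 2 ^ n then h \<xi> else 0)" for n :: nat and \<xi>
    have hnm[measurable]: "hn n \<in> borel_measurable borel" for n unfolding hn_def by measurable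
    have hn2: "integrable lborel (\<lambda>\<xi>. (cmod (hn n \<xi>))\<^sup>2)" for n
      by (rule Bochner_Integration.integrable_bound[OF h2]) (auto simp: hn_def)
    have hnle: "(LINT \<xi>|lborel. (cmod (hn n \<xi>))\<^sup>2) \<le> (LINT \<xi>|lborel. (cmod (h \<xi>))\<^sup>2)" for n
      by (rule integral_mono[OF hn2 h2]) (simp add: hn_def)
    have [measurable]: "(\<lambda>x. \<gamma> x t) \<in> borel_measurable borel" using meas[of "\<lambda>_. t"] t by simp
    have [measurable]: "(\<lambda>x. osc (\<gamma> x t) t (hn n)) \<in> borel_measurable borel" for n by (rule measurable_osc) auto
    define L where "L x = liminf (\<lambda>n. ennreal ((cmod (osc (\<gamma> x t) t (hn n)))\<^sup>2))" for x
    have [measurable]: "L \<in> borel_measurable borel" unfolding L_def by measurable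
    \<comment> \<open>The bound is uniform in the truncation; Fatou's lemma carries it over to the
      \<open>liminf\<close> and Chebyshev's inequality to the exceptional set.\<close>
    have b: "(\<integral>\<^sup>+x\<in>{0..1}. ennreal ((cmod (osc (\<gamma> x t) t (hn n)))\<^sup>2) \<partial>lborel) \<le> ennreal (D * (LINT \<xi>|lborel. (cmod (h \<xi>))\<^sup>2))" for n
    proof -
      have "(\<integral>\<^sup>+x\<in>{0..1}. ennreal ((cmod (osc (\<gamma> x t) t (hn n)))\<^sup>2) \<partial>lborel) \<le> ennreal (D * (LINT \<xi>|lborel. (cmod (hn n \<xi>))\<^sup>2))"
        by (rule fixed[of "2 ^ n"]) (use hn2 lower t in \<open>auto simp: hn_def split: if_splits\<close>)
      also have "\<dots> \<le> ennreal (D * (LINT \<xi>|lborel. (cmod (h \<xi>))\<^sup>2))"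
        using D hnle by (intro ennreal_leI mult_left_mono) auto
      finally show ?thesis .
    qed
    have "(\<integral>\<^sup>+x\<in>{0..1}. L x \<partial>lborel) \<le> (\<integral>\<^sup>+x. liminf (\<lambda>n. ennreal ((cmod (osc (\<gamma> x t) t (hn n)))\<^sup>2) * indicator {0..1} x) \<partial>lborel)"
      by (rule nn_integral_mono) (simp add: L_def split: split_indicator)
    also have "\<dots> \<le> liminf (\<lambda>n. \<integral>\<^sup>+x\<in>{0..1}. ennreal ((cmod (osc (\<gamma> x t) t (hn n)))\<^sup>2) \<partial>lborel)"
      by (rule nn_integral_liminf) measurable
    also have "\<dots> \<le> ennreal (D * (LINT \<xi>|lborel. (cmod (h \<xi>))\<^sup>2))"
      by (rule Liminf_le) (use b in auto)
    finally have Lb: "(\<integral>\<^sup>+x\<in>{0..1}. L x \<partial>lborel) \<le> ennreal (D * (LINT \<xi>|lborel. (cmod (h \<xi>))\<^sup>2))" .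
    have Am: "{x\<in>{0..1}. ennreal (\<mu>\<^sup>2) \<le> L x} \<in> sets borel" by measurable
    have "ennreal (\<mu>\<^sup>2) * emeasure lborel {x\<in>{0..1}. ennreal (\<mu>\<^sup>2) \<le> L x} =
        (\<integral>\<^sup>+x. ennreal (\<mu>\<^sup>2) * indicator {x\<in>{0..1}. ennreal (\<mu>\<^sup>2) \<le> L x} x \<partial>lborel)"
      using Am by (simp add: nn_integral_cmult_indicator)
    also have "\<dots> \<le> (\<integral>\<^sup>+x\<in>{0..1}. L x \<partial>lborel)"
      by (rule nn_integral_mono) (auto split: split_indicator)
    also note Lb
    also have "ennreal (D * (LINT \<xi>|lborel. (cmod (h \<xi>))\<^sup>2)) = ennreal (\<mu>\<^sup>2) * ennreal (D * (LINT \<xi>|lborel. (cmod (h \<xi>))\<^sup>2) / \<mu>\<^sup>2)"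
      using \<mu> D by (subst ennreal_mult[symmetric]) auto
    finally have "emeasure lborel {x\<in>{0..1}. ennreal (\<mu>\<^sup>2) \<le> L x} \<le> ennreal (D * (LINT \<xi>|lborel. (cmod (h \<xi>))\<^sup>2) / \<mu>\<^sup>2)"
      using \<mu> by (simp add: ennreal_mult_le_mult_iff)
    then show "{x\<in>{0..1}. ennreal (\<mu>\<^sup>2) \<le> liminf (\<lambda>n. ennreal ((cmod (osc (\<gamma> x t) t (\<lambda>\<xi>. if \<bar>\<xi>\<bar> \<le> 2 ^ n then h \<xi> else 0)))\<^sup>2))} \<in> sets borel \<and>
      emeasure lborel {x\<in>{0..1}. ennreal (\<mu>\<^sup>2) \<le> liminf (\<lambda>n. ennreal ((cmod (osc (\<gamma> x t) t (\<lambda>\<xi>. if \<bar>\<xi>\<bar> \<le> 2 ^ n then h \<xi> else 0)))\<^sup>2))}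
        \<le> ennreal (D * (LINT \<xi>|lborel. (cmod (h \<xi>))\<^sup>2) / \<mu>\<^sup>2)"
      using Am by (simp add: L_def hn_def[abs_def])
  qed
qed

text \<open>The integral norm makes a series of blocks a tempered distribution, the weighted square
  norm puts it into the Sobolev space, and the moment condition is the one for
  \<open>osc_time_difference\<close>. The threshold 10 is 8 + 1 + 1/2 + 1/2: the assumed rate times
  2 pi, the earlier blocks, and the later blocks at the two times t and 0.\<close>

definition focusing_block ::
    "(real \<Rightarrow> real \<Rightarrow> real) \<Rightarrow> real \<Rightarrow> real \<Rightarrow> real \<Rightarrow> (real \<Rightarrow> complex) \<Rightarrow> bool" where
  "focusing_block \<gamma> \<delta> s \<epsilon> F \<longleftrightarrow>
     integrable lborel F \<and> (LINT x|lborel. cmod (F x)) \<le> \<epsilon> \<and>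
     integrable lborel (\<lambda>\<xi>. ((1 + \<xi>\<^sup>2) powr (s / 2) * cmod (fourier F \<xi>))\<^sup>2) \<and>
     (LINT \<xi>|lborel. ((1 + \<xi>\<^sup>2) powr (s / 2) * cmod (fourier F \<xi>))\<^sup>2) \<le> \<epsilon> \<and>
     integrable lborel (\<lambda>\<xi>. (1 + \<xi>\<^sup>2) * cmod (fourier F \<xi>)) \<and>
     (\<forall>x\<in>{0..1}. \<exists>t\<in>{0<..<\<epsilon>}.
        10 * t powr \<delta> < cmod (osc (\<gamma> x t) t (fourier F) - osc x 0 (fourier F)))"

lemma weighted_series_square_bound:
  fixes g :: "nat \<Rightarrow> real \<Rightarrow> complex" and w :: "real \<Rightarrow> real"
  assumes [measurable]: "\<And>k. g k \<in> borel_measurable borel" "w \<in> borel_measurable borel"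
    and sum: "\<And>\<xi>. summable (\<lambda>k. cmod (g k \<xi>))"
    and int: "\<And>k. integrable lborel (\<lambda>\<xi>. (w \<xi> * cmod (g k \<xi>))\<^sup>2)"
    and le: "\<And>k. 2 ^ Suc k * (LINT \<xi>|lborel. (w \<xi> * cmod (g k \<xi>))\<^sup>2) \<le> b k"
    and b: "summable b"
  shows "integrable lborel (\<lambda>\<xi>. (w \<xi> * cmod (\<Sum>k. g k \<xi>))\<^sup>2)"
    "(LINT \<xi>|lborel. (w \<xi> * cmod (\<Sum>k. g k \<xi>))\<^sup>2) \<le> suminf b"
proof -
  have b0: "0 \<le> b k" for k
    by (rule order_trans[OF _ le]) simp
  have "(\<integral>\<^sup>+\<xi>. ennreal ((w \<xi> * cmod (\<Sum>k. g k \<xi>))\<^sup>2) \<partial>lborel) \<le>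
      (\<integral>\<^sup>+\<xi>. (\<Sum>k. ennreal (2 ^ Suc k * (w \<xi> * cmod (g k \<xi>))\<^sup>2)) \<partial>lborel)"
  proof (rule nn_integral_mono)
    fix \<xi>
    have "ennreal ((w \<xi> * cmod (\<Sum>k. g k \<xi>))\<^sup>2) = ennreal ((w \<xi>)\<^sup>2) * ennreal ((cmod (\<Sum>k. g k \<xi>))\<^sup>2)"
      by (simp add: power_mult_distrib ennreal_mult)
    also have "\<dots> \<le> ennreal ((w \<xi>)\<^sup>2) * (\<Sum>k. ennreal (2 ^ Suc k * (cmod (g k \<xi>))\<^sup>2))"
      by (intro mult_left_mono norm_square_suminf_le sum) simp
    also have "\<dots> = (\<Sum>k. ennreal (2 ^ Suc k * (w \<xi> * cmod (g k \<xi>))\<^sup>2))"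
      unfolding ennreal_suminf_cmult[symmetric]
      by (intro suminf_cong) (simp add: ennreal_mult[symmetric] power_mult_distrib mult_ac)
    finally show "ennreal ((w \<xi> * cmod (\<Sum>k. g k \<xi>))\<^sup>2) \<le> (\<Sum>k. ennreal (2 ^ Suc k * (w \<xi> * cmod (g k \<xi>))\<^sup>2))" .
  qed
  also have "\<dots> = (\<Sum>k. \<integral>\<^sup>+\<xi>. ennreal (2 ^ Suc k * (w \<xi> * cmod (g k \<xi>))\<^sup>2) \<partial>lborel)"
    by (rule nn_integral_suminf) measurable
  also have "\<dots> \<le> (\<Sum>k. ennreal (b k))"
  proof (intro suminf_le summableI)
    fix k
    have "(\<integral>\<^sup>+\<xi>. ennreal (2 ^ Suc k * (w \<xi> * cmod (g k \<xi>))\<^sup>2) \<partial>lborel) = ennreal (LINT \<xi>|lborel. 2 ^ Suc k * (w \<xi> * cmod (g k \<xi>))\<^sup>2)"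
      using int[of k] by (intro nn_integral_eq_integral) auto
    also have "\<dots> \<le> ennreal (b k)" using le[of k] by (intro ennreal_leI) simp
    finally show "(\<integral>\<^sup>+\<xi>. ennreal (2 ^ Suc k * (w \<xi> * cmod (g k \<xi>))\<^sup>2) \<partial>lborel) \<le> ennreal (b k)" .
  qed
  also have "\<dots> = ennreal (suminf b)" by (rule suminf_ennreal2[OF b0 b])
  finally have fin: "(\<integral>\<^sup>+\<xi>. ennreal ((w \<xi> * cmod (\<Sum>k. g k \<xi>))\<^sup>2) \<partial>lborel) \<le> ennreal (suminf b)" .
  show 1: "integrable lborel (\<lambda>\<xi>. (w \<xi> * cmod (\<Sum>k. g k \<xi>))\<^sup>2)"
    by (rule integrableI_bounded) (use fin in \<open>auto intro: le_less_trans\<close>)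
  then show "(LINT \<xi>|lborel. (w \<xi> * cmod (\<Sum>k. g k \<xi>))\<^sup>2) \<le> suminf b"
    using fin suminf_nonneg[OF b b0] by (subst (asm) nn_integral_eq_integral) (auto simp: ennreal_le_iff)
qed

text \<open>A gliding hump: a sparse series of focusing blocks. Earlier blocks are tame at the times used by
  a later one because those times are small; later blocks are negligible there in mean square
  because only finitely many times are used.\<close>

proposition gliding_hump:
  fixes \<alpha> \<delta> s :: real and \<gamma> :: "real \<Rightarrow> real \<Rightarrow> real"
  assumes \<gamma>: "admissible_curve \<alpha> \<gamma>" and \<alpha>: "0 < \<alpha>" "\<alpha> \<le> 1" and \<delta>: "0 \<le> \<delta>" "\<delta> < \<alpha>" and s: "0 \<le> s"
    and blocks: "\<And>\<epsilon>. 0 < \<epsilon> \<Longrightarrow> \<exists>F. focusing_block \<gamma> \<delta> s \<epsilon> F"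
  shows "\<exists>f\<in>sobolev s. \<not> pointwise_rate \<gamma> \<delta> f"
proof -
  obtain c C where C: "0 < C"
    and hoelder: "\<And>x t t'. \<lbrakk>t \<in> {-1..1}; t' \<in> {-1..1}\<rbrakk> \<Longrightarrow> \<bar>\<gamma> x t - \<gamma> x t'\<bar> \<le> C * \<bar>t - t'\<bar> powr \<alpha>"
    and \<gamma>0: "\<And>x. \<gamma> x 0 = x"
    and meas: "\<And>\<tau>. \<lbrakk>\<tau> \<in> borel_measurable borel; \<And>x. \<tau> x \<in> {-1..1}\<rbrakk> \<Longrightarrow> (\<lambda>x. \<gamma> x (\<tau> x)) \<in> borel_measurable borel"
    by (rule admissible_curveE[OF \<gamma>]) blast
  \<comment> \<open>Starting at 1/2 keeps all block times inside the time domain of the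
    curve.\<close>
  define \<epsilon> where "\<epsilon> m = 1 / real (m + 2)" for m :: nat
  have \<epsilon>: "0 < \<epsilon> m" "\<epsilon> m < 1" for m by (auto simp: \<epsilon>_def)
  have \<epsilon>lim: "\<epsilon> \<longlonglongrightarrow> 0" unfolding \<epsilon>_def[abs_def] by real_asymp
  have "\<forall>m. \<exists>F. focusing_block \<gamma> \<delta> s (\<epsilon> m) F" using blocks \<epsilon>(1) by blast
  then obtain F where F: "\<And>m. focusing_block \<gamma> \<delta> s (\<epsilon> m) (F m)" by metis
  define g where "g m = fourier (F m)" for m
  define w where "w \<xi> = (1 + \<xi>\<^sup>2) powr (s / 2)" for \<xi> :: real
  have w1: "1 \<le> w \<xi>" for \<xi> unfolding w_def using s by (intro ge_one_powr_ge_zero) auto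
  have wm[measurable]: "w \<in> borel_measurable borel" unfolding w_def by measurable
  define L where "L m = (LINT x|lborel. cmod (F m x))" for m
  define H where "H m = (LINT \<xi>|lborel. (w \<xi> * cmod (g m \<xi>))\<^sup>2)" for m
  define E where "E m = (LINT \<xi>|lborel. (1 + \<xi>\<^sup>2) * cmod (g m \<xi>))" for m
  have Fi: "integrable lborel (F m)" and L: "L m \<le> \<epsilon> m" and Hi: "integrable lborel (\<lambda>\<xi>. (w \<xi> * cmod (g m \<xi>))\<^sup>2)"
    and H: "H m \<le> \<epsilon> m" and Ei: "integrable lborel (\<lambda>\<xi>. (1 + \<xi>\<^sup>2) * cmod (g m \<xi>))"
    and foc: "\<And>x. x \<in> {0..1} \<Longrightarrow> \<exists>t\<in>{0<..<\<epsilon> m}. 10 * t powr \<delta> < cmod (osc (\<gamma> x t) t (g m) - osc x 0 (g m))" for m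
    using F[of m] unfolding focusing_block_def L_def H_def g_def w_def by blast+
  have [measurable]: "F m \<in> borel_measurable borel" for m using Fi[of m] by auto
  have gm[measurable]: "g m \<in> borel_measurable borel" for m unfolding g_def by measurable
  have gL: "cmod (g m \<xi>) \<le> L m" for m \<xi> unfolding g_def L_def by (rule norm_fourier_le)
  have gi: "integrable lborel (g m)" for m
  proof (rule Bochner_Integration.integrable_bound[OF Ei[of m]])
    show "AE \<xi> in lborel. norm (g m \<xi>) \<le> norm ((1 + \<xi>\<^sup>2) * cmod (g m \<xi>))"
    proof (intro AE_I2)
      fix \<xi> :: real
      have "1 * cmod (g m \<xi>) \<le> (1 + \<xi>\<^sup>2) * cmod (g m \<xi>)" by (intro mult_right_mono) auto
      then show "norm (g m \<xi>) \<le> norm ((1 + \<xi>\<^sup>2) * cmod (g m \<xi>))" by simp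
    qed
  qed measurable
  have H0: "0 \<le> H m" and E0: "0 \<le> E m" and L0: "0 \<le> L m" for m
    by (auto simp: H_def E_def L_def intro!: Bochner_Integration.integral_nonneg mult_nonneg_nonneg add_nonneg_nonneg)
  define A where "A m M = {x\<in>{0..1}. \<forall>t\<in>M. cmod (osc (\<gamma> x t) t (g m) - osc x 0 (g m)) - 10 * t powr \<delta> \<le> 0}" for m and M :: "real set"
  have exM: "\<exists>M. finite M \<and> M \<noteq> {} \<and> M \<subseteq> {0<..<\<epsilon> m} \<and> A m M \<in> sets borel \<and> emeasure lborel (A m M) \<le> ennreal ((1/2) ^ m)" for m
  proof (rule ex_finite_times[of "\<epsilon> m" "\<lambda>t x. cmod (osc (\<gamma> x t) t (g m) - osc x 0 (g m)) - 10 * t powr \<delta>" "(1/2) ^ m"])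
    fix t assume t: "t \<in> {0<..<\<epsilon> m}"
    have "t \<in> {-1..1}" using t \<epsilon>(2)[of m] by auto
    then have [measurable]: "(\<lambda>x. \<gamma> x t) \<in> borel_measurable borel" using meas[of "\<lambda>_. t"] by simp
    have [measurable]: "(\<lambda>x. osc (\<gamma> x t) t (g m)) \<in> borel_measurable borel" "(\<lambda>x. osc x 0 (g m)) \<in> borel_measurable borel"
      by (auto intro!: measurable_osc)
    show "(\<lambda>x. cmod (osc (\<gamma> x t) t (g m) - osc x 0 (g m)) - 10 * t powr \<delta>) \<in> borel_measurable borel" by measurable
  next
    fix x
    have c: "continuous_on (UNIV \<times> {-1..1}) (\<lambda>(x, t). \<gamma> x t)" using \<gamma> by (simp add: admissible_curve_def)
    have "continuous_on {0<..<\<epsilon> m} (\<lambda>t. (\<lambda>(x, t). \<gamma> x t) (x, t))"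
      by (rule continuous_on_compose2[OF c]) (use \<epsilon>(2)[of m] in \<open>auto intro!: continuous_intros\<close>)
    then have [continuous_intros]: "continuous_on {0<..<\<epsilon> m} (\<gamma> x)" by simp
    show "continuous_on {0<..<\<epsilon> m} (\<lambda>t. cmod (osc (\<gamma> x t) t (g m) - osc x 0 (g m)) - 10 * t powr \<delta>)"
      by (intro continuous_intros continuous_osc gi) auto
  next
    fix x :: real assume "x \<in> {0..1}"
    then show "\<exists>t\<in>{0<..<\<epsilon> m}. 0 < cmod (osc (\<gamma> x t) t (g m) - osc x 0 (g m)) - 10 * t powr \<delta>"
      using foc[of x m] by auto
  next
    show "0 < (1/2 :: real) ^ m" by simp
  next
    fix M assume "finite M" "M \<noteq> {}" "M \<subseteq> {0<..<\<epsilon> m}"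
      "{x\<in>{0..1}. \<forall>t\<in>M. cmod (osc (\<gamma> x t) t (g m) - osc x 0 (g m)) - 10 * t powr \<delta> \<le> 0} \<in> sets borel"
      "emeasure lborel {x\<in>{0..1}. \<forall>t\<in>M. cmod (osc (\<gamma> x t) t (g m) - osc x 0 (g m)) - 10 * t powr \<delta> \<le> 0} \<le> ennreal ((1/2) ^ m)"
    then show ?thesis unfolding A_def by blast
  qed
  then obtain M where M: "\<And>m. finite (M m)" "\<And>m. M m \<noteq> {}" "\<And>m. M m \<subseteq> {0<..<\<epsilon> m}"
    and Am: "\<And>m. A m (M m) \<in> sets borel" and Ab: "\<And>m. emeasure lborel (A m (M m)) \<le> ennreal ((1/2) ^ m)" by metis
  \<comment> \<open>The error allowed from the later blocks: at most t^\<delta>/2 for each of the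
    finitely many times t of the block.\<close>
  define \<mu> where "\<mu> m = Min (M m) powr \<delta> / 2" for m
  have \<mu>: "0 < \<mu> m" for m
  proof -
    have "Min (M m) \<in> M m" using M by simp
    then have "0 < Min (M m)" using M(3)[of m] by auto
    then show ?thesis by (simp add: \<mu>_def)
  qed
  have \<mu>t: "\<mu> m \<le> t powr \<delta> / 2" if "t \<in> M m" for m t
  proof -
    have "Min (M m) \<in> M m" using M by simp
    then have "0 < Min (M m)" using M(3)[of m] by auto
    moreover have "Min (M m) \<le> t" using M that by simp
    ultimately show ?thesis unfolding \<mu>_def using \<delta> by (intro divide_right_mono powr_mono2) auto
  qed
  obtain D where D: "0 < D" and tail_est: "\<And>t h \<mu>. \<lbrakk>t \<in> {-1..1}; h \<in> borel_measurable borel; integrable lborel (\<lambda>\<xi>. (cmod (h \<xi>))\<^sup>2); 0 < \<mu>\<rbrakk> \<Longrightarrow>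
      {x\<in>{0..1}. ennreal (\<mu>\<^sup>2) \<le> liminf (\<lambda>n. ennreal ((cmod (osc (\<gamma> x t) t (\<lambda>\<xi>. if \<bar>\<xi>\<bar> \<le> 2 ^ n then h \<xi> else 0)))\<^sup>2))} \<in> sets borel \<and>
      emeasure lborel {x\<in>{0..1}. ennreal (\<mu>\<^sup>2) \<le> liminf (\<lambda>n. ennreal ((cmod (osc (\<gamma> x t) t (\<lambda>\<xi>. if \<bar>\<xi>\<bar> \<le> 2 ^ n then h \<xi> else 0)))\<^sup>2))}
        \<le> ennreal (D * (LINT \<xi>|lborel. (cmod (h \<xi>))\<^sup>2) / \<mu>\<^sup>2)"
    by (rule liminf_tail_estimate[OF \<gamma>]) blast
  \<comment> \<open>The energy budget for the later blocks: by Chebyshev's inequality each of the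
    card + 1 times, 0 included, then has an exceptional set of measure at most 2^(-m)/(card +
    1).\<close>
  define \<sigma> where "\<sigma> m = (\<mu> m)\<^sup>2 * (1/2) ^ m / (D * real (Suc (card (M m))))" for m
  have \<sigma>: "0 < \<sigma> m" for m using \<mu>[of m] D by (simp add: \<sigma>_def)
  \<comment> \<open>The demands on a later block \<open>m\<close> towards an earlier block
    \<open>i\<close>: its times are so small that block \<open>i\<close> hardly changes, its
    integral norm is summable, and its energy respects the budgets of all blocks up to
    \<open>i\<close>. The powers of 1/8 beat the weights 2^(k+1) of the square estimate.\<close>
  define R where "R i m \<longleftrightarrow> (C + 1) * E i * \<epsilon> m powr (\<alpha> - \<delta>) \<le> (1/2) ^ Suc i \<and> L m \<le> (1/2) ^ i \<and>
     (\<forall>i'\<in>{..i}. H m \<le> (1/8) ^ Suc i * min 1 (\<sigma> i'))" for i m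
  have ev: "eventually (R i) sequentially" for i
    unfolding R_def
  proof (intro eventually_conj eventually_ball_finite ballI)
    have "(\<lambda>m. (C + 1) * E i * \<epsilon> m powr (\<alpha> - \<delta>)) \<longlonglongrightarrow> (C + 1) * E i * 0"
    proof (intro tendsto_mult tendsto_const)
      have "(\<lambda>m. \<epsilon> m powr (\<alpha> - \<delta>)) \<longlonglongrightarrow> 0 powr (\<alpha> - \<delta>)"
        using \<delta> \<epsilon>(1) by (intro tendsto_powr' \<epsilon>lim tendsto_const) (auto simp: less_imp_le)
      then show "(\<lambda>m. \<epsilon> m powr (\<alpha> - \<delta>)) \<longlonglongrightarrow> 0" by simp
    qed
    then have "\<forall>\<^sub>F m in sequentially. (C + 1) * E i * \<epsilon> m powr (\<alpha> - \<delta>) < (1/2) ^ Suc i"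
      by (intro order_tendstoD(2)) auto
    then show "\<forall>\<^sub>F m in sequentially. (C + 1) * E i * \<epsilon> m powr (\<alpha> - \<delta>) \<le> (1/2) ^ Suc i"
      by eventually_elim simp
    have "\<forall>\<^sub>F m in sequentially. \<epsilon> m < (1/2) ^ i" by (intro order_tendstoD(2)[OF \<epsilon>lim]) simp
    then show "\<forall>\<^sub>F m in sequentially. L m \<le> (1/2) ^ i" by eventually_elim (use L in \<open>meson less_imp_le order_trans\<close>)
    fix i'
    have "\<forall>\<^sub>F m in sequentially. \<epsilon> m < (1/8) ^ Suc i * min 1 (\<sigma> i')"
      using \<sigma>[of i'] by (intro order_tendstoD(2)[OF \<epsilon>lim]) simp
    then show "\<forall>\<^sub>F m in sequentially. H m \<le> (1/8) ^ Suc i * min 1 (\<sigma> i')"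
      by eventually_elim (use H in \<open>meson less_imp_le order_trans\<close>)
  qed simp
  obtain r :: "nat \<Rightarrow> nat" where r: "strict_mono r" and Rr: "\<And>j k. j < k \<Longrightarrow> R (r j) (r k)"
    by (rule ex_fast_subsequence[of R, OF ev]) blast
  have rk: "k \<le> r k" for k by (rule strict_mono_imp_increasing[OF r])
  have half: "(1/2) ^ r k \<le> (1/2 :: real) ^ k" for k by (intro power_decreasing rk) auto
  have eighth: "(1/8) ^ Suc (r k) \<le> (1/8 :: real) ^ Suc k" for k using rk[of k] by (intro power_decreasing) auto
  have L': "L (r (Suc n)) \<le> (1/2) ^ n" for n
    using order_trans[OF _ half[of n]] Rr[of n "Suc n"] unfolding R_def by blast
  have H': "H (r (Suc n)) \<le> (1/8) ^ Suc n * min 1 (\<sigma> (r j))" if "j \<le> n" for n j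
  proof -
    have "r j \<le> r n" using that strict_mono_leD[OF r] by auto
    then have "H (r (Suc n)) \<le> (1/8) ^ Suc (r n) * min 1 (\<sigma> (r j))" using Rr[of n "Suc n"] unfolding R_def by auto
    also have "\<dots> \<le> (1/8) ^ Suc n * min 1 (\<sigma> (r j))" using eighth \<sigma>[of "r j"] by (intro mult_right_mono) auto
    finally show ?thesis .
  qed
  have sumL: "summable (\<lambda>k. L (r k))"
  proof (subst summable_Suc_iff[symmetric], rule summable_comparison_test')
    show "summable (\<lambda>n. (1/2 :: real) ^ n)" by (rule summable_geometric) simp
    show "norm (L (r (Suc n))) \<le> (1/2) ^ n" for n using L'[of n] L0 by simp
  qed
  have sumg: "summable (\<lambda>k. cmod (g (r (k + m)) \<xi>))" for \<xi> m
    by (rule summable_comparison_test'[OF summable_ignore_initial_segment[OF sumL, of m]]) (use gL in auto)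
  define f where "f = series_distr (\<lambda>k. F (r k))"
  define G where "G \<xi> = (\<Sum>k. g (r k) \<xi>)" for \<xi>
  have temp: "tempered f" and ft: "has_fourier_transform f G"
    unfolding f_def G_def[abs_def] g_def using series_distr[of "\<lambda>k. F (r k)"] Fi sumL by (simp_all add: L_def)
  then have ft': "has_fourier_transform f (fhat f)" unfolding fhat_def by (metis someI)
  then have [measurable]: "fhat f \<in> borel_measurable borel" by (simp add: has_fourier_transform_def)
  have Gm[measurable]: "G \<in> borel_measurable borel" unfolding G_def by measurable
  \<comment> \<open>The representative \<open>fhat f\<close> is a choice, so it agrees with the
    explicit series only almost everywhere; this suffices inside integrals.\<close>
  have fG: "AE \<xi> in lborel. fhat f \<xi> = G \<xi>" by (rule has_fourier_transform_unique[OF ft' ft])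
  have fsob: "f \<in> sobolev s"
  proof -
    have "integrable lborel (\<lambda>\<xi>. (w \<xi> * cmod (\<Sum>k. g (r k) \<xi>))\<^sup>2)"
    proof (rule weighted_series_square_bound(1)[where b="\<lambda>k. 2 * (1/4) ^ k"])
      show "2 ^ Suc k * (LINT \<xi>|lborel. (w \<xi> * cmod (g (r k) \<xi>))\<^sup>2) \<le> 2 * (1/4) ^ k" for k
      proof -
        have "H (r k) \<le> (1/8) ^ k"
        proof (cases k)
          case 0
          then show ?thesis using H[of "r 0"] \<epsilon>(2)[of "r 0"] by simp
        next
          case (Suc n)
          have "(1/8) ^ Suc n * min 1 (\<sigma> (r n)) \<le> (1/8) ^ Suc n * 1" by (intro mult_left_mono) auto
          from order_trans[OF H'[OF order_refl] this] show ?thesis unfolding Suc by simp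
        qed
        then have "2 ^ Suc k * H (r k) \<le> 2 ^ Suc k * (1/8) ^ k" by (intro mult_left_mono) auto
        also have "\<dots> = 2 * (1/4) ^ k" by (simp add: power_mult_distrib[symmetric])
        finally show ?thesis by (simp add: H_def)
      qed
      show "summable (\<lambda>k. 2 * (1/4 :: real) ^ k)" by (intro summable_mult summable_geometric) simp
      show "summable (\<lambda>k. cmod (g (r k) \<xi>))" for \<xi> using sumg[of 0] by simp
    qed (use Hi in auto)
    then have "integrable lborel (\<lambda>\<xi>. (w \<xi> * cmod (G \<xi>))\<^sup>2)" by (simp add: G_def)
    then have "integrable lborel (\<lambda>\<xi>. (w \<xi> * cmod (fhat f \<xi>))\<^sup>2)"
      by (rule integrable_cong_AE_imp) (use fG in \<open>auto elim: eventually_mono\<close>)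
    then show ?thesis unfolding sobolev_def w_def using temp ft by auto
  qed
  define T where "T j \<xi> = (\<Sum>k. g (r (k + Suc j)) \<xi>)" for j \<xi>
  have [measurable]: "T j \<in> borel_measurable borel" for j unfolding T_def by measurable
  have Tsplit: "G \<xi> = (\<Sum>i\<le>j. g (r i) \<xi>) + T j \<xi>" for j \<xi>
    unfolding G_def T_def using suminf_split_initial_segment[of "\<lambda>k. g (r k) \<xi>" "Suc j"] summable_norm_cancel[OF sumg[of 0 \<xi>]]
    by (simp add: lessThan_Suc_atMost add.commute)
  have T2: "integrable lborel (\<lambda>\<xi>. (cmod (T j \<xi>))\<^sup>2)" and Tb: "(LINT \<xi>|lborel. (cmod (T j \<xi>))\<^sup>2) \<le> \<sigma> (r j)" for j
  proof -
    have b: "2 ^ Suc k * (LINT \<xi>|lborel. (w \<xi> * cmod (g (r (k + Suc j)) \<xi>))\<^sup>2) \<le> \<sigma> (r j) * (1/4) ^ Suc k" for k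
    proof -
      have "H (r (k + Suc j)) \<le> (1/8) ^ Suc (k + j) * min 1 (\<sigma> (r j))" using H'[of j "k + j"] by simp
      also have "\<dots> \<le> (1/8) ^ Suc k * \<sigma> (r j)" using \<sigma>[of "r j"] by (intro mult_mono power_decreasing) auto
      finally have "2 ^ Suc k * H (r (k + Suc j)) \<le> 2 ^ Suc k * ((1/8) ^ Suc k * \<sigma> (r j))" by (intro mult_left_mono) auto
      also have "\<dots> = \<sigma> (r j) * (2 * (1/8)) ^ Suc k" unfolding power_mult_distrib by (simp add: mult_ac)
      finally show ?thesis by (simp add: H_def)
    qed
    have sb: "(\<lambda>k. \<sigma> (r j) * (1/4) ^ Suc k) sums (\<sigma> (r j) * (1/3))"
      using sums_mult[OF geometric_sums[of "1/4 :: real"], of "\<sigma> (r j) * (1/4)"] by (simp add: mult_ac)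
    note wb = weighted_series_square_bound[where g="\<lambda>k. g (r (k + Suc j))" and w=w and b="\<lambda>k. \<sigma> (r j) * (1/4) ^ Suc k", OF gm wm sumg Hi b sums_summable[OF sb]]
    have le: "(cmod (T j \<xi>))\<^sup>2 \<le> (w \<xi> * cmod (T j \<xi>))\<^sup>2" for \<xi>
      using mult_right_mono[OF w1, of "cmod (T j \<xi>)" \<xi>] by (intro power_mono) auto
    show 1: "integrable lborel (\<lambda>\<xi>. (cmod (T j \<xi>))\<^sup>2)"
      by (rule Bochner_Integration.integrable_bound[OF wb(1)[folded T_def]]) (use le in auto)
    have "(LINT \<xi>|lborel. (cmod (T j \<xi>))\<^sup>2) \<le> (LINT \<xi>|lborel. (w \<xi> * cmod (T j \<xi>))\<^sup>2)"
      by (rule integral_mono[OF 1 wb(1)[folded T_def] le])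
    also have "\<dots> \<le> \<sigma> (r j) * (1/3)" using wb(2)[folded T_def] sb by (simp add: sums_iff)
    also have "\<dots> \<le> \<sigma> (r j)" using \<sigma>[of "r j"] by simp
    finally show "(LINT \<xi>|lborel. (cmod (T j \<xi>))\<^sup>2) \<le> \<sigma> (r j)" .
  qed
  define Z where "Z j t = {x\<in>{0..1}. ennreal ((\<mu> (r j))\<^sup>2) \<le> liminf (\<lambda>n. ennreal ((cmod (osc (\<gamma> x t) t (\<lambda>\<xi>. if \<bar>\<xi>\<bar> \<le> 2 ^ n then T j \<xi> else 0)))\<^sup>2))}" for j t
  have Mt: "t \<in> {-1..1}" if "t \<in> insert 0 (M (r j))" for t j
    using that M(3)[of "r j"] \<epsilon>(2)[of "r j"] by auto
  have Zm: "Z j t \<in> sets borel" and Zb: "emeasure lborel (Z j t) \<le> ennreal (D * \<sigma> (r j) / (\<mu> (r j))\<^sup>2)" if "t \<in> insert 0 (M (r j))" for t j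
  proof -
    note te = tail_est[OF Mt[OF that] _ T2[of j] \<mu>[of "r j"], folded Z_def]
    show "Z j t \<in> sets borel" using te by simp
    have "emeasure lborel (Z j t) \<le> ennreal (D * (LINT \<xi>|lborel. (cmod (T j \<xi>))\<^sup>2) / (\<mu> (r j))\<^sup>2)" using te by simp
    also have "\<dots> \<le> ennreal (D * \<sigma> (r j) / (\<mu> (r j))\<^sup>2)"
      using Tb[of j] D by (intro ennreal_leI divide_right_mono mult_left_mono) auto
    finally show "emeasure lborel (Z j t) \<le> ennreal (D * \<sigma> (r j) / (\<mu> (r j))\<^sup>2)" .
  qed
  \<comment> \<open>Points where the later blocks interfere at some relevant time, or where none of
    the chosen times shows the jump. The measures are summable, so by Borel-Cantelli almost every
    point is eventually good.\<close>
  define Bad where "Bad j = (\<Union>t\<in>insert 0 (M (r j)). Z j t) \<union> A (r j) (M (r j))" for j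
  have Badm: "Bad j \<in> sets lborel" for j
    unfolding Bad_def using Zm[of _ j] Am[of "r j"] M(1)[of "r j"] by (intro sets.Un sets.finite_UN) auto
  have Badb: "emeasure lborel (Bad j) \<le> ennreal (2 * (1/2) ^ j)" for j
  proof -
    define Y where "Y = D * \<sigma> (r j) / (\<mu> (r j))\<^sup>2"
    have Y0: "0 \<le> Y" using D \<sigma>[of "r j"] by (simp add: Y_def)
    have card: "card (insert 0 (M (r j))) = Suc (card (M (r j)))"
      using M(1,3)[of "r j"] by (intro card_insert_disjoint) auto
    have "emeasure lborel (\<Union>t\<in>insert 0 (M (r j)). Z j t) \<le> (\<Sum>t\<in>insert 0 (M (r j)). emeasure lborel (Z j t))"
      using Zm[of _ j] M(1) by (intro emeasure_subadditive_finite) auto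
    also have "\<dots> \<le> (\<Sum>t\<in>insert 0 (M (r j)). ennreal Y)" unfolding Y_def by (intro sum_mono Zb)
    also have "\<dots> = ennreal (real (Suc (card (M (r j)))) * Y)"
      using Y0 by (simp only: sum_constant card) (simp add: ennreal_of_nat_eq_real_of_nat ennreal_mult)
    also have "real (Suc (card (M (r j)))) * Y = (1/2) ^ r j"
      using D \<mu>[of "r j"] by (simp add: Y_def \<sigma>_def)
    finally have 1: "emeasure lborel (\<Union>t\<in>insert 0 (M (r j)). Z j t) \<le> ennreal ((1/2) ^ r j)" .
    have "emeasure lborel (Bad j) \<le> emeasure lborel (\<Union>t\<in>insert 0 (M (r j)). Z j t) + emeasure lborel (A (r j) (M (r j)))"
      unfolding Bad_def using Zm[of _ j] Am[of "r j"] M(1)[of "r j"] by (intro emeasure_subadditive sets.finite_UN) auto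
    also have "\<dots> \<le> ennreal ((1/2) ^ r j) + ennreal ((1/2) ^ r j)" by (intro add_mono 1 Ab)
    also have "\<dots> = ennreal (2 * (1/2) ^ r j)" by (simp flip: ennreal_plus)
    also have "\<dots> \<le> ennreal (2 * (1/2) ^ j)" using half[of j] by (intro ennreal_leI) simp
    finally show ?thesis .
  qed
  have Badev: "AE x in lborel. eventually (\<lambda>j. x \<in> space lborel - Bad j) sequentially"
  proof (rule borel_cantelli_AE1[OF Badm])
    show "emeasure lborel (Bad j) < \<infinity>" for j using Badb[of j] by (rule le_less_trans) simp
    show "summable (\<lambda>j. measure lborel (Bad j))"
    proof (rule summable_comparison_test')
      show "summable (\<lambda>j. 2 * (1/2 :: real) ^ j)" by (intro summable_mult summable_geometric) simp
      show "norm (measure lborel (Bad j)) \<le> 2 * (1/2) ^ j" for j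
        using enn2real_mono[OF Badb[of j]] by (simp add: measure_def)
    qed
  qed
  have "\<not> pointwise_rate \<gamma> \<delta> f"
  proof
    assume "pointwise_rate \<gamma> \<delta> f"
    then have pr: "AE x in lborel. U_exists \<gamma> f x 0 \<and> (\<forall>\<^sub>F t in at_right 0. U_exists \<gamma> f x t) \<and>
        ((\<lambda>t. (U \<gamma> f x t - U \<gamma> f x 0) / complex_of_real (t powr \<delta>)) \<longlongrightarrow> 0) (at_right 0)"
      by (simp add: pointwise_rate_def)
    from pr Badev have "AE x in lborel. x \<notin> {0..1::real}"
    proof eventually_elim
      case (elim x)
      show "x \<notin> {0..1}"
      proof
        assume x: "x \<in> {0..1}"
        have Ux: "U_exists \<gamma> f x 0" and Ut: "\<forall>\<^sub>F t in at_right 0. U_exists \<gamma> f x t"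
          and lim: "((\<lambda>t. (U \<gamma> f x t - U \<gamma> f x 0) / complex_of_real (t powr \<delta>)) \<longlongrightarrow> 0) (at_right 0)" using elim(1) by auto
        have "\<forall>\<^sub>F t in at_right 0. U_exists \<gamma> f x t \<and> dist ((U \<gamma> f x t - U \<gamma> f x 0) / complex_of_real (t powr \<delta>)) 0 < 1"
          using Ut tendstoD[OF lim, of 1] by (auto elim: eventually_elim2)
        then obtain \<tau> where \<tau>: "0 < \<tau>" "\<And>t. \<lbrakk>0 < t; t < \<tau>\<rbrakk> \<Longrightarrow> U_exists \<gamma> f x t \<and> dist ((U \<gamma> f x t - U \<gamma> f x 0) / complex_of_real (t powr \<delta>)) 0 < 1"
          unfolding eventually_at_right_field by auto
        have "\<forall>\<^sub>F j in sequentially. \<epsilon> j < \<tau>" using \<epsilon>lim \<tau>(1) by (intro order_tendstoD(2)) auto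
        with elim(2) have "\<forall>\<^sub>F j in sequentially. x \<notin> Bad j \<and> \<epsilon> j < \<tau>" by eventually_elim auto
        then obtain j where j: "x \<notin> Bad j" "\<epsilon> j < \<tau>" by (auto simp: eventually_sequentially)
        from j(1) x obtain t where tM: "t \<in> M (r j)" and foct: "10 * t powr \<delta> < cmod (osc (\<gamma> x t) t (g (r j)) - osc x 0 (g (r j)))"
          unfolding Bad_def A_def by auto
        have t0: "0 < t" "t < \<epsilon> (r j)" using tM M(3)[of "r j"] by auto
        have "\<epsilon> (r j) \<le> \<epsilon> j" unfolding \<epsilon>_def using rk[of j] by (intro divide_left_mono) auto
        then have t\<tau>: "t < \<tau>" using t0 j(2) by simp
        have t1: "t \<le> 1" using t0 \<epsilon>(2)[of "r j"] by simp
        define S where "S t = (\<Sum>i\<le>j. osc (\<gamma> x t) t (g (r i)))" for t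
        \<comment> \<open>Where \<open>U\<close> exists, the truncated integrals of the tail
          converge, so their \<open>liminf\<close> is the actual squared tail and lying outside
          \<open>Z\<close> bounds it.\<close>
        have near: "cmod (complex_of_real (2 * pi) * U \<gamma> f x u - S u) < \<mu> (r j)"
          if u: "u \<in> insert 0 (M (r j))" and Uu: "U_exists \<gamma> f x u" for u
        proof -
          define tr where "tr n h \<xi> = (if \<bar>\<xi>\<bar> \<le> 2 ^ n then h \<xi> else 0)" for n :: nat and h :: "real \<Rightarrow> complex" and \<xi>
          have trm[measurable]: "tr n h \<in> borel_measurable borel" if [measurable]: "h \<in> borel_measurable borel" for n h
            unfolding tr_def by measurable
          have tri: "integrable lborel (tr n (g m))" for n m
            by (rule Bochner_Integration.integrable_bound[OF gi[of m]]) (auto simp: tr_def)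
          have trT: "integrable lborel (tr n (T j))" for n
          proof (rule square_integrable_imp_integrable)
            show "integrable lborel (\<lambda>\<xi>. (cmod (tr n (T j) \<xi>))\<^sup>2)"
              by (rule Bochner_Integration.integrable_bound[OF T2[of j]]) (auto simp: tr_def)
          qed (auto simp: tr_def split: if_splits)
          have split: "U_partial \<gamma> f x u n = (\<Sum>i\<le>j. osc (\<gamma> x u) u (tr n (g (r i)))) + osc (\<gamma> x u) u (tr n (T j))" for n
          proof -
            have "U_partial \<gamma> f x u n = osc (\<gamma> x u) u (tr n G)"
              unfolding U_partial_eq_osc osc_def tr_def
              by (rule integral_cong_AE) (use fG in \<open>auto elim: eventually_mono\<close>)
            also have "tr n G = (\<lambda>\<xi>. (\<Sum>i\<le>j. tr n (g (r i)) \<xi>) + tr n (T j) \<xi>)"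
              unfolding tr_def Tsplit[of _ j] by auto
            also have "osc (\<gamma> x u) u \<dots> = (\<Sum>i\<le>j. osc (\<gamma> x u) u (tr n (g (r i)))) + osc (\<gamma> x u) u (tr n (T j))"
            proof -
              have "osc (\<gamma> x u) u (\<lambda>\<xi>. (\<Sum>i\<le>j. tr n (g (r i)) \<xi>) + tr n (T j) \<xi>) =
                (LINT \<xi>|lborel. (\<Sum>i\<le>j. cis (\<gamma> x u * \<xi> + u * \<xi>\<^sup>2) * tr n (g (r i)) \<xi>) + cis (\<gamma> x u * \<xi> + u * \<xi>\<^sup>2) * tr n (T j) \<xi>)"
                unfolding osc_def by (simp add: distrib_left sum_distrib_left)
              also have "\<dots> = (\<Sum>i\<le>j. osc (\<gamma> x u) u (tr n (g (r i)))) + osc (\<gamma> x u) u (tr n (T j))"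
                unfolding osc_def using integrable_osc[OF tri] integrable_osc[OF trT]
                by (subst Bochner_Integration.integral_add) (auto simp: Bochner_Integration.integral_sum)
              finally show ?thesis .
            qed
            finally show ?thesis .
          qed
          have "(\<lambda>n. U_partial \<gamma> f x u n - (\<Sum>i\<le>j. osc (\<gamma> x u) u (tr n (g (r i))))) \<longlonglongrightarrow> complex_of_real (2 * pi) * U \<gamma> f x u - S u"
            unfolding S_def tr_def
            by (intro tendsto_diff tendsto_sum osc_truncate_tendsto gi U_exists_tendsto Uu)
          then have "(\<lambda>n. osc (\<gamma> x u) u (tr n (T j))) \<longlonglongrightarrow> complex_of_real (2 * pi) * U \<gamma> f x u - S u"
            by (simp add: split)
          then have "(\<lambda>n. ennreal ((cmod (osc (\<gamma> x u) u (tr n (T j))))\<^sup>2)) \<longlonglongrightarrow> ennreal ((cmod (complex_of_real (2 * pi) * U \<gamma> f x u - S u))\<^sup>2)"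
            by (intro tendsto_intros)
          then have li: "liminf (\<lambda>n. ennreal ((cmod (osc (\<gamma> x u) u (tr n (T j))))\<^sup>2)) = ennreal ((cmod (complex_of_real (2 * pi) * U \<gamma> f x u - S u))\<^sup>2)"
            by (rule lim_imp_Liminf[OF trivial_limit_sequentially])
          have "x \<notin> Z j u" using j(1) u unfolding Bad_def by blast
          then have "\<not> ennreal ((\<mu> (r j))\<^sup>2) \<le> liminf (\<lambda>n. ennreal ((cmod (osc (\<gamma> x u) u (tr n (T j))))\<^sup>2))"
            unfolding Z_def tr_def using x by blast
          then have "(cmod (complex_of_real (2 * pi) * U \<gamma> f x u - S u))\<^sup>2 < (\<mu> (r j))\<^sup>2"
            unfolding li by (metis ennreal_leI not_le)
          then show ?thesis by (rule power2_less_imp_less) (use \<mu>[of "r j"] in simp)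
        qed
        define d where "d i = osc (\<gamma> x t) t (g (r i)) - osc x 0 (g (r i))" for i
        have dle: "cmod (d i) \<le> (1/2) ^ Suc i * t powr \<delta>" if i: "i < j" for i
        proof -
          have "cmod (d i) \<le> (C + 1) * E (r i) * t powr \<alpha>"
            unfolding d_def E_def
          proof (rule osc_time_difference[OF _ t0(1) t1 \<alpha> _ gi Ei])
            show "\<bar>\<gamma> x t - x\<bar> \<le> C * t powr \<alpha>" using hoelder[of t 0 x] t0 t1 by (simp add: \<gamma>0)
          qed (use C in simp)
          also have "t powr \<alpha> = t powr (\<alpha> - \<delta>) * t powr \<delta>" by (simp flip: powr_add)
          also have "(C + 1) * E (r i) * (t powr (\<alpha> - \<delta>) * t powr \<delta>) \<le> (C + 1) * E (r i) * (\<epsilon> (r j) powr (\<alpha> - \<delta>) * t powr \<delta>)"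
            using t0 \<delta> C E0[of "r i"] by (intro mult_left_mono mult_right_mono powr_mono2) auto
          also have "\<dots> = ((C + 1) * E (r i) * \<epsilon> (r j) powr (\<alpha> - \<delta>)) * t powr \<delta>" by (simp add: mult_ac)
          also have "\<dots> \<le> (1/2) ^ Suc i * t powr \<delta>"
          proof (rule mult_right_mono)
            have "(C + 1) * E (r i) * \<epsilon> (r j) powr (\<alpha> - \<delta>) \<le> (1/2) ^ Suc (r i)" using Rr[OF i] unfolding R_def by auto
            also have "\<dots> \<le> (1/2) ^ Suc i" using rk[of i] by (intro power_decreasing) auto
            finally show "(C + 1) * E (r i) * \<epsilon> (r j) powr (\<alpha> - \<delta>) \<le> (1/2) ^ Suc i" .
          qed simp
          finally show ?thesis .
        qed
        have "cmod (\<Sum>i<j. d i) \<le> (\<Sum>i<j. (1/2) ^ Suc i * t powr \<delta>)"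
          using dle by (intro sum_norm_le) auto
        also have "\<dots> = (\<Sum>i<j. (1/2) ^ Suc i) * t powr \<delta>" by (rule sum_distrib_right[symmetric])
        also have "\<dots> \<le> 1 * t powr \<delta>"
        proof (rule mult_right_mono)
          have "(\<Sum>i<j. (1/2 :: real) ^ Suc i) = 1 - (1/2) ^ j" by (induction j) auto
          then show "(\<Sum>i<j. (1/2 :: real) ^ Suc i) \<le> 1" by simp
        qed simp
        finally have dsum: "cmod (\<Sum>i<j. d i) \<le> t powr \<delta>" by simp
        \<comment> \<open>Isolates the jump of block \<open>j\<close>: it exceeds 10 t^\<delta>,
          whereas the partial sum, the tails and the earlier blocks together allow at most
          that.\<close>
        have "S t - S 0 = (\<Sum>i<j. d i) + d j"
          unfolding S_def d_def by (simp add: \<gamma>0 sum_subtractf lessThan_Suc_atMost[symmetric])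
        then have "cmod (d j) \<le> cmod (S t - S 0) + cmod (\<Sum>i<j. d i)"
          using norm_triangle_ineq4[of "S t - S 0" "\<Sum>i<j. d i"] by simp
        moreover have "cmod (S t - S 0) \<le> cmod (complex_of_real (2 * pi) * (U \<gamma> f x t - U \<gamma> f x 0)) +
            (cmod (complex_of_real (2 * pi) * U \<gamma> f x t - S t) + cmod (complex_of_real (2 * pi) * U \<gamma> f x 0 - S 0))"
        proof -
          have "S t - S 0 = complex_of_real (2 * pi) * (U \<gamma> f x t - U \<gamma> f x 0) -
             ((complex_of_real (2 * pi) * U \<gamma> f x t - S t) - (complex_of_real (2 * pi) * U \<gamma> f x 0 - S 0))"
            by (simp add: algebra_simps)
          moreover have "cmod (a - (b - c)) \<le> cmod a + (cmod b + cmod c)" for a b c :: complex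
            using norm_triangle_ineq4[of a "b - c"] norm_triangle_ineq4[of b c] by linarith
          ultimately show ?thesis by (simp only:)
        qed
        moreover have "cmod (complex_of_real (2 * pi) * (U \<gamma> f x t - U \<gamma> f x 0)) \<le> 8 * t powr \<delta>"
        proof -
          have "cmod (U \<gamma> f x t - U \<gamma> f x 0) \<le> t powr \<delta>"
            using \<tau>(2)[OF t0(1) t\<tau>] t0(1) by (simp add: norm_divide divide_less_eq)
          then have "2 * pi * cmod (U \<gamma> f x t - U \<gamma> f x 0) \<le> 8 * t powr \<delta>"
            using pi_less_4 by (intro mult_mono) auto
          then show ?thesis by (simp add: norm_mult)
        qed
        moreover have "cmod (complex_of_real (2 * pi) * U \<gamma> f x t - S t) < t powr \<delta> / 2"
          using near[of t] \<tau>(2)[OF t0(1) t\<tau>] \<mu>t[OF tM] tM by force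
        moreover have "cmod (complex_of_real (2 * pi) * U \<gamma> f x 0 - S 0) < t powr \<delta> / 2"
          using near[of 0] Ux \<mu>t[OF tM] by force
        ultimately show False using dsum foct unfolding d_def[of j, symmetric] by linarith
      qed
    qed
    then have "{0..1::real} \<in> null_sets lborel" by (subst AE_iff_null_sets) auto
    then show False by (simp add: null_sets_def)
  qed
  then show ?thesis using fsob by blast
qed

section \<open>Gaussian wave packets with equally spaced frequencies\<close>

lemma sum_gauss_lattice_le:
  fixes q :: real
  assumes q: "0 < q" "q < 1"
  shows "(\<Sum>l<K. q ^ (nat \<bar>int k - int l\<bar>)) \<le> 2 / (1 - q)"
proof -
  have geo: "(\<Sum>i\<in>A. q ^ i) \<le> 1 / (1 - q)" if "finite A" for A
    using sum_le_suminf[of "\<lambda>i. q ^ i" A] that q suminf_geometric[of q] by (simp add: summable_geometric)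
  have "(\<Sum>l<K. q ^ (nat \<bar>int k - int l\<bar>)) \<le> (\<Sum>l\<in>{..k} \<union> {k<..<k + K + 1}. q ^ (nat \<bar>int k - int l\<bar>))"
    using q by (intro sum_mono2) auto
  also have "\<dots> = (\<Sum>l\<in>{..k}. q ^ (k - l)) + (\<Sum>l\<in>{k<..<k + K + 1}. q ^ (l - k))"
  proof (subst sum.union_disjoint)
    have "nat \<bar>int k - int l\<bar> = k - l" if "l \<le> k" for l using that by auto
    moreover have "nat \<bar>int k - int l\<bar> = l - k" if "k < l" for l using that by auto
    ultimately show "(\<Sum>l\<in>{..k}. q ^ (nat \<bar>int k - int l\<bar>)) + (\<Sum>l\<in>{k<..<k + K + 1}. q ^ (nat \<bar>int k - int l\<bar>)) =
        (\<Sum>l\<in>{..k}. q ^ (k - l)) + (\<Sum>l\<in>{k<..<k + K + 1}. q ^ (l - k))"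
      by (intro arg_cong2[where f="(+)"] sum.cong) auto
  qed auto
  also have "(\<Sum>l\<in>{..k}. q ^ (k - l)) = sum ((^) q) ((\<lambda>l. k - l) ` {..k})"
    by (subst sum.reindex) (auto simp: inj_on_def)
  also have "\<dots> \<le> 1 / (1 - q)" by (rule geo) simp
  also have "(\<Sum>l\<in>{k<..<k + K + 1}. q ^ (l - k)) = sum ((^) q) ((\<lambda>l. l - k) ` {k<..<k + K + 1})"
    by (subst sum.reindex) (auto simp: inj_on_def)
  also have "\<dots> \<le> 1 / (1 - q)" by (rule geo) simp
  finally show ?thesis by simp
qed

text \<open>Almost orthogonality of bumps with spacing at least 1: since n^2 \<ge> n, Gaussian decay
  in the index distance is dominated by a geometric series, and the double sum is of order K instead
  of K^2.\<close>

lemma sum_gauss_pairs_le: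
  fixes \<kappa> \<omega> :: real
  assumes \<kappa>: "0 < \<kappa>" and \<omega>: "1 \<le> \<omega>"
  shows "(\<Sum>k<K. \<Sum>l<K. exp (- \<kappa> * ((real k - real l) * \<omega>)\<^sup>2)) \<le> 2 / (1 - exp (- \<kappa>)) * real K"
proof -
  have "exp (- \<kappa> * ((real k - real l) * \<omega>)\<^sup>2) \<le> exp (- \<kappa>) ^ (nat \<bar>int k - int l\<bar>)" for k l
  proof -
    define n where "n = nat \<bar>int k - int l\<bar>"
    have n: "\<bar>real k - real l\<bar> = real n" unfolding n_def by simp
    have "real n \<le> (real n)\<^sup>2" by (cases n) (simp_all add: power2_eq_square)
    also have "\<dots> * 1 \<le> (real n)\<^sup>2 * \<omega>\<^sup>2" using \<omega> by (intro mult_left_mono) auto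
    also have "\<dots> = ((real k - real l) * \<omega>)\<^sup>2" using n by (metis power2_abs power_mult_distrib)
    finally have "- \<kappa> * ((real k - real l) * \<omega>)\<^sup>2 \<le> real n * (- \<kappa>)" using \<kappa> by (simp add: mult.commute)
    then show ?thesis unfolding n_def[symmetric] exp_of_nat_mult[symmetric] by simp
  qed
  then have "(\<Sum>k<K. \<Sum>l<K. exp (- \<kappa> * ((real k - real l) * \<omega>)\<^sup>2)) \<le> (\<Sum>k<K. \<Sum>l<K. exp (- \<kappa>) ^ (nat \<bar>int k - int l\<bar>))"
    by (intro sum_mono)
  also have "\<dots> \<le> (\<Sum>k<K. 2 / (1 - exp (- \<kappa>)))"
    using \<kappa> by (intro sum_mono sum_gauss_lattice_le) auto
  finally show ?thesis by (simp add: mult.commute)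
qed

text \<open>The phase factor is Lipschitz, so small changes of position and a small chirp cost only
  a Gaussian moment. The rate 1/4 is that of the Fourier transform of exp(-x^2).\<close>

lemma chirp_gauss_perturb:
  obtains c where "0 < c" "\<And>a b. cmod (chirp_gauss (1/4) a b) \<le> c"
    "\<And>a b y. cmod (chirp_gauss (1/4) a b - complex_of_real (2 * sqrt pi * exp (- y\<^sup>2))) \<le> (\<bar>a - y\<bar> + \<bar>b\<bar>) * c"
proof -
  define W where "W \<eta> = exp (- (1/4) * \<eta>\<^sup>2)" for \<eta> :: real
  have i0: "integrable lborel W" unfolding W_def by (rule integrable_gauss) simp
  have i2: "integrable lborel (\<lambda>\<eta>. \<eta>\<^sup>2 * W \<eta>)" unfolding W_def by (rule integrable_power_gauss) simp
  have ic: "integrable lborel (\<lambda>\<eta>. (1 + \<eta>\<^sup>2) * W \<eta>)" using i0 i2 by (simp add: distrib_right)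
  define c where "c = (LINT \<eta>|lborel. (1 + \<eta>\<^sup>2) * W \<eta>) + 1"
  have W0: "0 < W \<eta>" for \<eta> by (simp add: W_def)
  have c1: "(LINT \<eta>|lborel. (1 + \<eta>\<^sup>2) * W \<eta>) \<le> c" by (simp add: c_def)
  have "0 \<le> (LINT \<eta>|lborel. (1 + \<eta>\<^sup>2) * W \<eta>)"
    using W0 by (intro Bochner_Integration.integral_nonneg mult_nonneg_nonneg add_nonneg_nonneg) (auto simp: less_imp_le)
  then have c0: "0 < c" by (simp add: c_def)
  have J0: "chirp_gauss (1/4) y 0 = complex_of_real (2 * sqrt pi * exp (- y\<^sup>2))" for y
    using fourier_gauss[of "1/4" y] by (simp add: chirp_gauss_def real_sqrt_mult)
  show thesis
  proof (rule that[OF c0])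
    fix a b y :: real
    have "cmod (chirp_gauss (1/4) a b) \<le> (LINT \<eta>|lborel. cmod (cis (a * \<eta> + b * \<eta>\<^sup>2) * complex_of_real (exp (- (1/4) * \<eta>\<^sup>2))))"
      unfolding chirp_gauss_def by (rule integral_norm_bound)
    also have "\<dots> = (LINT \<eta>|lborel. W \<eta>)" by (simp add: norm_mult W_def)
    also have "\<dots> \<le> (LINT \<eta>|lborel. (1 + \<eta>\<^sup>2) * W \<eta>)"
      using W0 by (intro integral_mono i0 ic) (auto simp: distrib_right less_imp_le)
    finally show "cmod (chirp_gauss (1/4) a b) \<le> c" using c1 by simp
    have le: "cmod (cis (a * \<eta> + b * \<eta>\<^sup>2) * complex_of_real (exp (- (1/4) * \<eta>\<^sup>2)) - cis (y * \<eta> + 0 * \<eta>\<^sup>2) * complex_of_real (exp (- (1/4) * \<eta>\<^sup>2))) \<le>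
        (\<bar>a - y\<bar> + \<bar>b\<bar>) * ((1 + \<eta>\<^sup>2) * W \<eta>)" for \<eta>
    proof -
      have "cis (a * \<eta> + b * \<eta>\<^sup>2) = cis (y * \<eta> + 0 * \<eta>\<^sup>2) * cis ((a - y) * \<eta> + b * \<eta>\<^sup>2)"
        unfolding cis_mult by (rule arg_cong[where f=cis]) (simp add: algebra_simps)
      then have "cmod (cis (a * \<eta> + b * \<eta>\<^sup>2) * complex_of_real (exp (- (1/4) * \<eta>\<^sup>2)) - cis (y * \<eta> + 0 * \<eta>\<^sup>2) * complex_of_real (exp (- (1/4) * \<eta>\<^sup>2))) =
          cmod (cis (y * \<eta> + 0 * \<eta>\<^sup>2) * (cis ((a - y) * \<eta> + b * \<eta>\<^sup>2) - 1) * complex_of_real (W \<eta>))"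
        by (simp add: algebra_simps W_def)
      also have "\<dots> = cmod (cis ((a - y) * \<eta> + b * \<eta>\<^sup>2) - 1) * W \<eta>" using W0[of \<eta>] by (simp add: norm_mult)
      also have "\<dots> \<le> ((\<bar>a - y\<bar> + \<bar>b\<bar>) * (1 + \<eta>\<^sup>2)) * W \<eta>"
      proof (rule mult_right_mono)
        have "cmod (cis ((a - y) * \<eta> + b * \<eta>\<^sup>2) - 1) \<le> \<bar>(a - y) * \<eta> + b * \<eta>\<^sup>2\<bar>" by (rule norm_cis_minus_one_le)
        also have "\<dots> \<le> \<bar>a - y\<bar> * \<bar>\<eta>\<bar> + \<bar>b\<bar> * \<eta>\<^sup>2"
          by (rule order_trans[OF abs_triangle_ineq]) (simp add: abs_mult)
        also have "\<dots> \<le> \<bar>a - y\<bar> * (1 + \<eta>\<^sup>2) + \<bar>b\<bar> * (1 + \<eta>\<^sup>2)"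
        proof (intro add_mono mult_left_mono)
          have "0 \<le> (\<bar>\<eta>\<bar> - 1 / 2)\<^sup>2" by simp
          then show "\<bar>\<eta>\<bar> \<le> 1 + \<eta>\<^sup>2" unfolding power2_diff by (simp add: power2_eq_square)
        qed auto
        finally show "cmod (cis ((a - y) * \<eta> + b * \<eta>\<^sup>2) - 1) \<le> (\<bar>a - y\<bar> + \<bar>b\<bar>) * (1 + \<eta>\<^sup>2)"
          by (simp add: distrib_right)
      qed (use W0[of \<eta>] in simp)
      finally show ?thesis by (simp only: mult.assoc)
    qed
    have ii: "integrable lborel (\<lambda>\<eta>. cis (a * \<eta> + b * \<eta>\<^sup>2) * complex_of_real (exp (- (1/4) * \<eta>\<^sup>2)))" for a b
      by (rule integrable_chirp_gauss) simp
    have "cmod (chirp_gauss (1/4) a b - chirp_gauss (1/4) y 0) =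
       cmod (LINT \<eta>|lborel. cis (a * \<eta> + b * \<eta>\<^sup>2) * complex_of_real (exp (- (1/4) * \<eta>\<^sup>2)) - cis (y * \<eta> + 0 * \<eta>\<^sup>2) * complex_of_real (exp (- (1/4) * \<eta>\<^sup>2)))"
      unfolding chirp_gauss_def by (subst Bochner_Integration.integral_diff[OF ii ii]) (rule refl)
    also have "\<dots> \<le> (LINT \<eta>|lborel. cmod (cis (a * \<eta> + b * \<eta>\<^sup>2) * complex_of_real (exp (- (1/4) * \<eta>\<^sup>2)) - cis (y * \<eta> + 0 * \<eta>\<^sup>2) * complex_of_real (exp (- (1/4) * \<eta>\<^sup>2))))"
      by (rule integral_norm_bound)
    also have "\<dots> \<le> (LINT \<eta>|lborel. (\<bar>a - y\<bar> + \<bar>b\<bar>) * ((1 + \<eta>\<^sup>2) * W \<eta>))"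
      by (intro integral_mono integrable_norm Bochner_Integration.integrable_diff ii integrable_mult_right ic le)
    also have "\<dots> = (\<bar>a - y\<bar> + \<bar>b\<bar>) * (LINT \<eta>|lborel. (1 + \<eta>\<^sup>2) * W \<eta>)" by (rule integral_mult_right_zero)
    also have "\<dots> \<le> (\<bar>a - y\<bar> + \<bar>b\<bar>) * c" by (intro mult_left_mono c1) auto
    finally show "cmod (chirp_gauss (1/4) a b - complex_of_real (2 * sqrt pi * exp (- y\<^sup>2))) \<le> (\<bar>a - y\<bar> + \<bar>b\<bar>) * c"
      unfolding J0 .
  qed
qed

section \<open>Dirichlet kernels and the norms of packet trains\<close>

definition dirichlet_sum :: "nat \<Rightarrow> real \<Rightarrow> complex" where
  "dirichlet_sum K \<theta> = (\<Sum>k<K. cis (real (Suc k) * \<theta>))"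

lemma dirichlet_sum_peak: "dirichlet_sum K (2 * pi * of_int m) = of_nat K"
proof -
  have "cis (real (Suc k) * (2 * pi * of_int m)) = 1" for k
    using cis_multiple_2pi[of "real (Suc k) * of_int m"] by (simp add: mult_ac)
  then show ?thesis by (simp add: dirichlet_sum_def)
qed

text \<open>One K-th of a period past a peak the terms run through all K-th roots of unity; for K
  \<ge> 2 these sum to zero.\<close>

lemma dirichlet_sum_zero:
  assumes K: "2 \<le> K"
  shows "dirichlet_sum K (2 * pi * of_int m + 2 * pi / real K) = 0"
proof -
  define z where "z = cis (2 * pi / real K)"
  have "cis (real (Suc k) * (2 * pi * of_int m + 2 * pi / real K)) = z ^ Suc k" for k
  proof -
    have "cis (real (Suc k) * (2 * pi * of_int m + 2 * pi / real K)) =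
        cis (2 * pi * (real (Suc k) * of_int m)) * cis (real (Suc k) * (2 * pi / real K))"
      unfolding cis_mult by (rule arg_cong[where f=cis]) (simp add: algebra_simps)
    also have "cis (2 * pi * (real (Suc k) * of_int m)) = 1" by (rule cis_multiple_2pi) auto
    also have "cis (real (Suc k) * (2 * pi / real K)) = z ^ Suc k" unfolding z_def by (simp only: Complex.DeMoivre)
    finally show ?thesis by simp
  qed
  then have "dirichlet_sum K (2 * pi * of_int m + 2 * pi / real K) = z * (\<Sum>k<K. z ^ k)"
    by (simp add: dirichlet_sum_def sum_distrib_left)
  moreover have "z ^ K = 1" unfolding z_def Complex.DeMoivre using K by simp
  moreover have "z \<noteq> 1"
  proof
    assume "z = 1"
    then have "cos (2 * pi / real K) = 1" by (simp add: z_def complex_eq_iff)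
    then obtain n :: int where "2 * pi / real K = of_int n * 2 * pi" unfolding cos_one_2pi_int by auto
    then have "1 = of_int n * real K" using K by (simp add: field_simps)
    then have "1 = n * int K" by (metis of_int_1 of_int_eq_iff of_int_mult of_int_of_nat_eq)
    then have "int K dvd 1" by (metis dvd_triv_right)
    then show False using K by simp
  qed
  ultimately show ?thesis by (simp add: geometric_sum)
qed

text \<open>A Gaussian times a shifted Dirichlet kernel. Its Fourier transform consists of K bumps
  of unit width at spacing \<omega> beyond \<nu>. The explicit factor -1 in the exponent matches the
  Gaussian integrals for rate 1.\<close>

definition packet_train :: "real \<Rightarrow> nat \<Rightarrow> real \<Rightarrow> real \<Rightarrow> real \<Rightarrow> complex" where
  "packet_train a K \<nu> \<omega> x =
     complex_of_real (a * exp (- 1 * x\<^sup>2)) * (\<Sum>k<K. cis ((\<nu> + real (Suc k) * \<omega>) * x))"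

lemma fourier_packet_train:
  "fourier (packet_train a K \<nu> \<omega>) \<xi> =
     complex_of_real (a * sqrt pi * (\<Sum>k<K. exp (- (1/4) * (\<xi> - (\<nu> + real (Suc k) * \<omega>))\<^sup>2)))"
proof -
  define \<mu> where "\<mu> k = \<nu> + real (Suc k) * \<omega>" for k
  have i: "integrable lborel (\<lambda>x. cis ((\<mu> k - \<xi>) * x) * complex_of_real (exp (- 1 * x\<^sup>2)))" for k
    using integrable_gauss[of 1] by (intro integrable_cis_mult) auto
  have "fourier (packet_train a K \<nu> \<omega>) \<xi> = (LINT x|lborel. (\<Sum>k<K. complex_of_real a * (cis ((\<mu> k - \<xi>) * x) * complex_of_real (exp (- 1 * x\<^sup>2)))))"
    unfolding fourier_def packet_train_def \<mu>_def[symmetric] sum_distrib_left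
  proof (intro Bochner_Integration.integral_cong sum.cong refl)
    fix x k
    have "cis (- (x * \<xi>)) * cis (\<mu> k * x) = cis ((\<mu> k - \<xi>) * x)"
      unfolding cis_mult by (rule arg_cong[where f=cis]) (simp add: algebra_simps)
    then show "cis (- (x * \<xi>)) * (complex_of_real (a * exp (- 1 * x\<^sup>2)) * cis (\<mu> k * x)) = complex_of_real a * (cis ((\<mu> k - \<xi>) * x) * complex_of_real (exp (- 1 * x\<^sup>2)))"
      by (metis (no_types, lifting) mult.assoc mult.commute of_real_mult)
  qed
  also have "\<dots> = (\<Sum>k<K. complex_of_real a * (LINT x|lborel. cis ((\<mu> k - \<xi>) * x) * complex_of_real (exp (- 1 * x\<^sup>2))))"
    using i by (subst Bochner_Integration.integral_sum) auto
  also have "\<dots> = complex_of_real (a * sqrt pi * (\<Sum>k<K. exp (- (1/4) * (\<xi> - \<mu> k)\<^sup>2)))"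
    unfolding sum_distrib_left of_real_sum
  proof (rule sum.cong[OF refl])
    fix k
    have "(LINT x|lborel. cis ((\<mu> k - \<xi>) * x) * complex_of_real (exp (- 1 * x\<^sup>2))) = complex_of_real (sqrt (pi / 1) * exp (- (\<mu> k - \<xi>)\<^sup>2 / (4 * 1)))"
      by (rule fourier_gauss) simp
    then show "complex_of_real a * (LINT x|lborel. cis ((\<mu> k - \<xi>) * x) * complex_of_real (exp (- 1 * x\<^sup>2))) = complex_of_real (a * sqrt pi * exp (- (1/4) * (\<xi> - \<mu> k)\<^sup>2))"
      by (simp add: power2_commute[of "\<mu> k"])
  qed
  finally show ?thesis by (simp only: \<mu>_def)
qed

text \<open>Under the later normalisation a K is of size T^\<delta>, so the trivial bound of order a
  K would not become small for \<delta> = 0. The square root of K comes from Cauchy-Schwarz against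
  the Gaussian together with almost orthogonality of the modulations.\<close>

lemma packet_train_L1:
  obtains c where "0 < c"
    "\<And>a K \<nu> \<omega>. \<lbrakk>0 < a; 1 \<le> K; 1 \<le> \<omega>\<rbrakk> \<Longrightarrow> integrable lborel (packet_train a K \<nu> \<omega>) \<and>
       (LINT x|lborel. cmod (packet_train a K \<nu> \<omega> x)) \<le> c * a * sqrt (real K)"
proof
  define b where "b = sqrt pi * (2 / (1 - exp (- (1/4))))"
  have b0: "0 \<le> b" unfolding b_def by (intro mult_nonneg_nonneg divide_nonneg_nonneg) auto
  show "0 < sqrt pi + b" using b0 pi_gt_zero by (intro add_pos_nonneg) auto
  fix a \<nu> \<omega> :: real and K :: nat
  assume a: "0 < a" and K: "1 \<le> K" and \<omega>: "1 \<le> \<omega>"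
  define \<mu> where "\<mu> k = \<nu> + real (Suc k) * \<omega>" for k
  define e where "e x = exp (- 1 * x\<^sup>2)" for x :: real
  define z where "z x = (\<Sum>k<K. cis (\<mu> k * x))" for x
  have pt: "packet_train a K \<nu> \<omega> x = complex_of_real (a * e x) * z x" for x
    by (simp only: packet_train_def e_def z_def \<mu>_def)
  have e0: "0 < e x" for x by (simp add: e_def)
  have [measurable]: "e \<in> borel_measurable borel" "z \<in> borel_measurable borel" unfolding e_def z_def by measurable
  have ei: "integrable lborel e" unfolding e_def by (rule integrable_gauss) simp
  have eI: "(LINT x|lborel. e x) = sqrt pi"
  proof -
    have "complex_of_real (LINT x|lborel. e x) = complex_of_real (sqrt pi)"
      using fourier_gauss[of 1 0] by (simp add: e_def integral_complex_of_real)
    then show ?thesis by (simp only: of_real_eq_iff)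
  qed
  have zK: "cmod (z x) \<le> real K" for x
    unfolding z_def by (rule order_trans[OF norm_sum]) simp
  have ez2: "integrable lborel (\<lambda>x. e x * (cmod (z x))\<^sup>2)"
  proof (rule Bochner_Integration.integrable_bound)
    show "integrable lborel (\<lambda>x. e x * (real K)\<^sup>2)" using ei by simp
    show "AE x in lborel. norm (e x * (cmod (z x))\<^sup>2) \<le> norm (e x * (real K)\<^sup>2)"
      using e0 zK by (intro AE_I2) (auto simp: abs_mult less_imp_le intro!: mult_left_mono power_mono)
  qed measurable
  have B: "(LINT x|lborel. e x * (cmod (z x))\<^sup>2) \<le> b * real K"
  proof -
    have ii: "integrable lborel (\<lambda>x. cis ((\<mu> k - \<mu> l) * x) * complex_of_real (exp (- 1 * x\<^sup>2)))" for k l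
      using integrable_gauss[of 1] by (intro integrable_cis_mult) auto
    have "complex_of_real (LINT x|lborel. e x * (cmod (z x))\<^sup>2) = (LINT x|lborel. (\<Sum>k<K. \<Sum>l<K. cis ((\<mu> k - \<mu> l) * x) * complex_of_real (exp (- 1 * x\<^sup>2))))"
      unfolding integral_complex_of_real[symmetric]
    proof (rule Bochner_Integration.integral_cong[OF refl])
      fix x
      have "complex_of_real ((cmod (z x))\<^sup>2) = (\<Sum>k<K. \<Sum>l<K. cis (\<mu> k * x) * cnj (cis (\<mu> l * x)))"
        unfolding complex_norm_square z_def cnj_sum sum_product ..
      also have "\<dots> = (\<Sum>k<K. \<Sum>l<K. cis ((\<mu> k - \<mu> l) * x))"
        unfolding cis_cnj cis_mult by (simp add: left_diff_distrib)
      finally show "complex_of_real (e x * (cmod (z x))\<^sup>2) = (\<Sum>k<K. \<Sum>l<K. cis ((\<mu> k - \<mu> l) * x) * complex_of_real (exp (- 1 * x\<^sup>2)))"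
        unfolding of_real_mult by (simp add: sum_distrib_left e_def mult.commute)
    qed
    also have "\<dots> = (\<Sum>k<K. \<Sum>l<K. (LINT x|lborel. cis ((\<mu> k - \<mu> l) * x) * complex_of_real (exp (- 1 * x\<^sup>2))))"
      using ii by (simp only: Bochner_Integration.integral_sum Bochner_Integration.integrable_sum)
    also have "\<dots> = complex_of_real (\<Sum>k<K. \<Sum>l<K. sqrt pi * exp (- (1/4) * ((real k - real l) * \<omega>)\<^sup>2))"
      unfolding of_real_sum
    proof (intro sum.cong refl)
      fix k l
      have m: "\<mu> k - \<mu> l = (real k - real l) * \<omega>" by (simp add: \<mu>_def algebra_simps)
      have "(LINT x|lborel. cis ((\<mu> k - \<mu> l) * x) * complex_of_real (exp (- 1 * x\<^sup>2))) = complex_of_real (sqrt (pi / 1) * exp (- (\<mu> k - \<mu> l)\<^sup>2 / (4 * 1)))"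
        by (rule fourier_gauss) simp
      then show "(LINT x|lborel. cis ((\<mu> k - \<mu> l) * x) * complex_of_real (exp (- 1 * x\<^sup>2))) = complex_of_real (sqrt pi * exp (- (1/4) * ((real k - real l) * \<omega>)\<^sup>2))"
        by (simp add: m)
    qed
    finally have "(LINT x|lborel. e x * (cmod (z x))\<^sup>2) = sqrt pi * (\<Sum>k<K. \<Sum>l<K. exp (- (1/4) * ((real k - real l) * \<omega>)\<^sup>2))"
      unfolding of_real_eq_iff sum_distrib_left .
    also have "\<dots> \<le> sqrt pi * (2 / (1 - exp (- (1/4))) * real K)"
      using \<omega> by (intro mult_left_mono sum_gauss_pairs_le) auto
    finally show ?thesis by (simp add: b_def mult.assoc)
  qed
  \<comment> \<open>The balance in the arithmetic-geometric mean: the Gaussian mass is of order 1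
    and the weighted square norm of order K.\<close>
  define \<Lambda> where "\<Lambda> = sqrt (real K)"
  have L0: "0 < \<Lambda>" using K by (simp add: \<Lambda>_def)
  have L2: "real K = \<Lambda> * \<Lambda>" by (simp add: \<Lambda>_def)
  have bi: "integrable lborel (\<lambda>x. a * (\<Lambda> * e x + 1 / \<Lambda> * (e x * (cmod (z x))\<^sup>2)))" using ei ez2 by auto
  have le: "cmod (packet_train a K \<nu> \<omega> x) \<le> a * (\<Lambda> * e x + 1 / \<Lambda> * (e x * (cmod (z x))\<^sup>2))" for x
  proof -
    have "0 \<le> (\<Lambda> - cmod (z x))\<^sup>2" by simp
    then have "2 * \<Lambda> * cmod (z x) \<le> \<Lambda>\<^sup>2 + (cmod (z x))\<^sup>2" by (simp add: power2_diff)
    moreover have "0 \<le> \<Lambda> * cmod (z x)" using L0 by simp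
    ultimately have "\<Lambda> * cmod (z x) \<le> \<Lambda>\<^sup>2 + (cmod (z x))\<^sup>2" by linarith
    then have "cmod (z x) \<le> \<Lambda> + 1 / \<Lambda> * (cmod (z x))\<^sup>2"
      using L0 by (simp add: field_simps power2_eq_square)
    then have "(a * e x) * cmod (z x) \<le> (a * e x) * (\<Lambda> + 1 / \<Lambda> * (cmod (z x))\<^sup>2)"
      using a e0[of x] by (intro mult_left_mono) auto
    then show ?thesis using a e0[of x] by (simp add: pt norm_mult abs_mult distrib_left mult_ac)
  qed
  have ptm: "packet_train a K \<nu> \<omega> \<in> borel_measurable borel" unfolding pt by measurable
  have i: "integrable lborel (packet_train a K \<nu> \<omega>)"
    by (rule Bochner_Integration.integrable_bound[OF bi]) (use ptm le in \<open>auto intro!: AE_I2 order_trans[OF le]\<close>)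
  have "(LINT x|lborel. cmod (packet_train a K \<nu> \<omega> x)) \<le> (LINT x|lborel. a * (\<Lambda> * e x + 1 / \<Lambda> * (e x * (cmod (z x))\<^sup>2)))"
    using i by (intro integral_mono bi le) auto
  also have "\<dots> = a * (\<Lambda> * sqrt pi + 1 / \<Lambda> * (LINT x|lborel. e x * (cmod (z x))\<^sup>2))"
    using ei ez2 by (simp add: eI)
  also have "\<dots> \<le> a * (\<Lambda> * sqrt pi + 1 / \<Lambda> * (b * real K))"
    using a L0 B by (intro mult_left_mono add_mono) auto
  also have "\<dots> = (sqrt pi + b) * a * \<Lambda>" unfolding L2 using L0 by (simp add: field_simps)
  finally show "integrable lborel (packet_train a K \<nu> \<omega>) \<and> (LINT x|lborel. cmod (packet_train a K \<nu> \<omega> x)) \<le> (sqrt pi + b) * a * sqrt (real K)"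
    using i by (simp add: \<Lambda>_def)
qed

text \<open>Peetre's inequality; it moves the Sobolev weight to the centre of a bump.\<close>

lemma one_plus_square_shift: "1 + \<xi>\<^sup>2 \<le> 2 * (1 + \<mu>\<^sup>2) * (1 + (\<xi> - \<mu>)\<^sup>2)" for \<xi> \<mu> :: real
proof -
  define \<eta> where "\<eta> = \<xi> - \<mu>"
  have "\<xi>\<^sup>2 = (\<mu> + \<eta>)\<^sup>2" by (simp add: \<eta>_def)
  also have "\<dots> \<le> 2 * \<mu>\<^sup>2 + 2 * \<eta>\<^sup>2" using zero_le_power2[of "\<mu> - \<eta>"] unfolding power2_sum power2_diff by linarith
  moreover have "0 \<le> \<mu>\<^sup>2 * \<eta>\<^sup>2" by simp
  ultimately have "1 + \<xi>\<^sup>2 \<le> 2 * (1 + \<mu>\<^sup>2) * (1 + \<eta>\<^sup>2)" unfolding distrib_left distrib_right by linarith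
  then show ?thesis by (simp add: \<eta>_def)
qed

lemma integrable_shifted_poly_gauss:
  fixes c m :: real
  assumes c: "0 < c"
  shows "integrable lborel (\<lambda>\<xi>. (1 + (\<xi> - m)\<^sup>2) * exp (- c * (\<xi> - m)\<^sup>2))"
    "(LINT \<xi>|lborel. (1 + (\<xi> - m)\<^sup>2) * exp (- c * (\<xi> - m)\<^sup>2)) = (LINT \<xi>|lborel. (1 + \<xi>\<^sup>2) * exp (- c * \<xi>\<^sup>2))"
proof -
  have i: "integrable lborel (\<lambda>\<xi>::real. (1 + \<xi>\<^sup>2) * exp (- c * \<xi>\<^sup>2))"
    using integrable_gauss[OF c] integrable_power_gauss[OF c, of 2] by (simp add: distrib_right)
  show "integrable lborel (\<lambda>\<xi>. (1 + (\<xi> - m)\<^sup>2) * exp (- c * (\<xi> - m)\<^sup>2))"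
    using lborel_integrable_real_affine[OF i, of 1 "- m"] by simp
  show "(LINT \<xi>|lborel. (1 + (\<xi> - m)\<^sup>2) * exp (- c * (\<xi> - m)\<^sup>2)) = (LINT \<xi>|lborel. (1 + \<xi>\<^sup>2) * exp (- c * \<xi>\<^sup>2))"
    using lborel_integral_real_affine[of 1 "\<lambda>\<xi>. (1 + \<xi>\<^sup>2) * exp (- c * \<xi>\<^sup>2)" "- m"] by simp
qed

text \<open>All bumps lie below \<nu> + K \<omega>, so the weight is taken there, and overlaps are
  summed by almost orthogonality. The restriction s \<le> 1 allows the shifted weight to be bounded
  by its first power, which the Gaussian absorbs.\<close>

lemma packet_train_sobolev:
  assumes s: "0 \<le> s" "s \<le> 1"
  obtains c where "0 < c"
    "\<And>a K \<nu> \<omega>. \<lbrakk>0 < a; 0 \<le> \<nu>; 1 \<le> \<omega>\<rbrakk> \<Longrightarrow>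
       integrable lborel (\<lambda>\<xi>. (1 + \<xi>\<^sup>2) * cmod (fourier (packet_train a K \<nu> \<omega>) \<xi>)) \<and>
       integrable lborel (\<lambda>\<xi>. ((1 + \<xi>\<^sup>2) powr (s / 2) * cmod (fourier (packet_train a K \<nu> \<omega>) \<xi>))\<^sup>2) \<and>
       (LINT \<xi>|lborel. ((1 + \<xi>\<^sup>2) powr (s / 2) * cmod (fourier (packet_train a K \<nu> \<omega>) \<xi>))\<^sup>2)
         \<le> c * a\<^sup>2 * real K * (1 + (\<nu> + real K * \<omega>)\<^sup>2) powr s"
proof
  define J where "J = (LINT \<xi>|lborel. (1 + \<xi>\<^sup>2) * exp (- (1/8) * (\<xi>::real)\<^sup>2)) + 1"
  have "0 \<le> (LINT \<xi>|lborel. (1 + \<xi>\<^sup>2) * exp (- (1/8) * (\<xi>::real)\<^sup>2))"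
    by (intro Bochner_Integration.integral_nonneg mult_nonneg_nonneg add_nonneg_nonneg) auto
  then have J: "0 < J" "(LINT \<xi>|lborel. (1 + \<xi>\<^sup>2) * exp (- (1/8) * (\<xi>::real)\<^sup>2)) \<le> J" unfolding J_def by linarith+
  define b where "b = 2 / (1 - exp (- (1/16) :: real))"
  have b0: "0 < b" by (simp add: b_def)
  show "0 < pi * 2 * J * b" using J b0 by simp
  fix a \<nu> \<omega> :: real and K :: nat
  assume a: "0 < a" and \<nu>: "0 \<le> \<nu>" and \<omega>: "1 \<le> \<omega>"
  define \<mu> where "\<mu> k = \<nu> + real (Suc k) * \<omega>" for k
  define M where "M = \<nu> + real K * \<omega>"
  have \<mu>M: "(\<mu> k)\<^sup>2 \<le> M\<^sup>2" if "k < K" for k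
    using that \<nu> \<omega> unfolding \<mu>_def M_def by (intro power_mono add_mono mult_right_mono) auto
  define W where "W \<eta> = exp (- (1/4) * \<eta>\<^sup>2)" for \<eta> :: real
  have W0: "0 < W \<eta>" for \<eta> by (simp add: W_def)
  define \<Sigma> where "\<Sigma> \<xi> = (\<Sum>k<K. W (\<xi> - \<mu> k))" for \<xi>
  have S0: "0 \<le> \<Sigma> \<xi>" for \<xi> unfolding \<Sigma>_def using W0 by (intro sum_nonneg) (auto simp: less_imp_le)
  have [measurable]: "\<Sigma> \<in> borel_measurable borel" unfolding \<Sigma>_def W_def by measurable
  have ft: "cmod (fourier (packet_train a K \<nu> \<omega>) \<xi>) = a * sqrt pi * \<Sigma> \<xi>" for \<xi>
    unfolding fourier_packet_train W_def[symmetric] \<mu>_def[symmetric] \<Sigma>_def[symmetric] norm_of_real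
    using a S0[of \<xi>] by simp
  have i1: "integrable lborel (\<lambda>\<xi>. (1 + \<xi>\<^sup>2) * W (\<xi> - \<mu> k))" for k
  proof (rule Bochner_Integration.integrable_bound)
    show "integrable lborel (\<lambda>\<xi>. 2 * (1 + (\<mu> k)\<^sup>2) * ((1 + (\<xi> - \<mu> k)\<^sup>2) * W (\<xi> - \<mu> k)))"
      unfolding W_def by (intro integrable_mult_right integrable_shifted_poly_gauss) simp
    show "AE \<xi> in lborel. norm ((1 + \<xi>\<^sup>2) * W (\<xi> - \<mu> k)) \<le> norm (2 * (1 + (\<mu> k)\<^sup>2) * ((1 + (\<xi> - \<mu> k)\<^sup>2) * W (\<xi> - \<mu> k)))"
    proof (intro AE_I2)
      fix \<xi>
      have "(1 + \<xi>\<^sup>2) * W (\<xi> - \<mu> k) \<le> (2 * (1 + (\<mu> k)\<^sup>2) * (1 + (\<xi> - \<mu> k)\<^sup>2)) * W (\<xi> - \<mu> k)"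
        using W0 by (intro mult_right_mono one_plus_square_shift) (auto simp: less_imp_le)
      moreover have "0 \<le> (1 + \<xi>\<^sup>2) * W (\<xi> - \<mu> k)" using W0[of "\<xi> - \<mu> k"] by (intro mult_nonneg_nonneg) (auto simp: less_imp_le)
      ultimately show "norm ((1 + \<xi>\<^sup>2) * W (\<xi> - \<mu> k)) \<le> norm (2 * (1 + (\<mu> k)\<^sup>2) * ((1 + (\<xi> - \<mu> k)\<^sup>2) * W (\<xi> - \<mu> k)))"
        by (simp only: mult.assoc real_norm_def)
    qed
  qed (simp add: W_def)
  have I1: "integrable lborel (\<lambda>\<xi>. (1 + \<xi>\<^sup>2) * cmod (fourier (packet_train a K \<nu> \<omega>) \<xi>))"
  proof -
    have "integrable lborel (\<lambda>\<xi>. a * sqrt pi * (\<Sum>k<K. (1 + \<xi>\<^sup>2) * W (\<xi> - \<mu> k)))"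
      by (intro integrable_mult_right Bochner_Integration.integrable_sum i1)
    then show ?thesis unfolding ft \<Sigma>_def by (simp only: sum_distrib_left mult_ac)
  qed
  define P where "P = a\<^sup>2 * pi * (2 * (1 + M\<^sup>2)) powr s"
  have P0: "0 \<le> P" by (simp add: P_def)
  define Y where "Y k \<xi> = (1 + (\<xi> - \<mu> k)\<^sup>2) * exp (- (1/8) * (\<xi> - \<mu> k)\<^sup>2)" for k \<xi>
  define E where "E k l = exp (- (1/16) * ((real k - real l) * \<omega>)\<^sup>2)" for k l :: nat
  have Yi: "integrable lborel (Y k)" and YJ: "(LINT \<xi>|lborel. Y k \<xi>) \<le> J" for k
    unfolding Y_def using integrable_shifted_poly_gauss[of "1/8" "\<mu> k"] J by simp_all
  have ptw: "((1 + \<xi>\<^sup>2) powr (s / 2) * cmod (fourier (packet_train a K \<nu> \<omega>) \<xi>))\<^sup>2 \<le> P * (\<Sum>k<K. \<Sum>l<K. E k l * Y k \<xi>)" for \<xi>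
  proof -
    have one: "1 \<le> 1 + y\<^sup>2" for y :: real by simp
    have "((1 + \<xi>\<^sup>2) powr (s / 2) * cmod (fourier (packet_train a K \<nu> \<omega>) \<xi>))\<^sup>2 = a\<^sup>2 * pi * ((1 + \<xi>\<^sup>2) powr s * (\<Sigma> \<xi> * \<Sigma> \<xi>))"
      unfolding ft by (simp add: power_mult_distrib power2_eq_square[of "(1 + \<xi>\<^sup>2) powr (s / 2)"] powr_add[symmetric] power2_eq_square[of "\<Sigma> \<xi>"])
    also have "\<Sigma> \<xi> * \<Sigma> \<xi> = (\<Sum>k<K. \<Sum>l<K. W (\<xi> - \<mu> k) * W (\<xi> - \<mu> l))" unfolding \<Sigma>_def sum_product ..
    also have "(1 + \<xi>\<^sup>2) powr s * \<dots> = (\<Sum>k<K. \<Sum>l<K. (1 + \<xi>\<^sup>2) powr s * (W (\<xi> - \<mu> k) * W (\<xi> - \<mu> l)))"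
      by (simp only: sum_distrib_left)
    also have "\<dots> \<le> (\<Sum>k<K. \<Sum>l<K. (2 * (1 + M\<^sup>2)) powr s * (E k l * Y k \<xi>))"
    proof (intro sum_mono)
      fix k l assume k: "k \<in> {..<K}"
      have "(1 + \<xi>\<^sup>2) \<le> 2 * (1 + (\<mu> k)\<^sup>2) * (1 + (\<xi> - \<mu> k)\<^sup>2)" by (rule one_plus_square_shift)
      also have "\<dots> \<le> 2 * (1 + M\<^sup>2) * (1 + (\<xi> - \<mu> k)\<^sup>2)" using \<mu>M[of k] k by (intro mult_right_mono) auto
      finally have "(1 + \<xi>\<^sup>2) powr s \<le> (2 * (1 + M\<^sup>2) * (1 + (\<xi> - \<mu> k)\<^sup>2)) powr s"
        using s by (intro powr_mono2) auto
      also have "\<dots> = (2 * (1 + M\<^sup>2)) powr s * (1 + (\<xi> - \<mu> k)\<^sup>2) powr s" by (rule powr_mult)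
      also have "\<dots> \<le> (2 * (1 + M\<^sup>2)) powr s * (1 + (\<xi> - \<mu> k)\<^sup>2) powr 1"
        using s by (intro mult_left_mono powr_mono) auto
      finally have 1: "(1 + \<xi>\<^sup>2) powr s \<le> (2 * (1 + M\<^sup>2)) powr s * (1 + (\<xi> - \<mu> k)\<^sup>2)" by (simp add: add_nonneg_nonneg)
      \<comment> \<open>Part of the decay is kept for integrating in \<xi>; the rest becomes decay
        in the distance of the two centres, through (x - y)^2 \<le> 2 x^2 + 2 y^2.\<close>
      have 2: "W (\<xi> - \<mu> k) * W (\<xi> - \<mu> l) \<le> exp (- (1/8) * (\<xi> - \<mu> k)\<^sup>2) * E k l"
      proof -
        have "((real k - real l) * \<omega>)\<^sup>2 = ((\<xi> - \<mu> l) - (\<xi> - \<mu> k))\<^sup>2" by (simp add: \<mu>_def algebra_simps)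
        also have "\<dots> \<le> 2 * (\<xi> - \<mu> l)\<^sup>2 + 2 * (\<xi> - \<mu> k)\<^sup>2"
          using zero_le_power2[of "(\<xi> - \<mu> l) + (\<xi> - \<mu> k)"] unfolding power2_sum power2_diff[of "\<xi> - \<mu> l" "\<xi> - \<mu> k"] by linarith
        moreover have "0 \<le> (\<xi> - \<mu> l)\<^sup>2" by simp
        ultimately have "- (1/4) * (\<xi> - \<mu> k)\<^sup>2 + - (1/4) * (\<xi> - \<mu> l)\<^sup>2 \<le> - (1/8) * (\<xi> - \<mu> k)\<^sup>2 + - (1/16) * ((real k - real l) * \<omega>)\<^sup>2"
          by linarith
        then show ?thesis unfolding W_def E_def exp_add[symmetric] by simp
      qed
      have "(1 + \<xi>\<^sup>2) powr s * (W (\<xi> - \<mu> k) * W (\<xi> - \<mu> l)) \<le> ((2 * (1 + M\<^sup>2)) powr s * (1 + (\<xi> - \<mu> k)\<^sup>2)) * (exp (- (1/8) * (\<xi> - \<mu> k)\<^sup>2) * E k l)"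
        using W0[of "\<xi> - \<mu> k"] W0[of "\<xi> - \<mu> l"] by (intro mult_mono 1 2 mult_nonneg_nonneg) (auto simp: less_imp_le add_nonneg_nonneg)
      then show "(1 + \<xi>\<^sup>2) powr s * (W (\<xi> - \<mu> k) * W (\<xi> - \<mu> l)) \<le> (2 * (1 + M\<^sup>2)) powr s * (E k l * Y k \<xi>)"
        by (simp only: Y_def mult_ac)
    qed
    finally have "((1 + \<xi>\<^sup>2) powr (s / 2) * cmod (fourier (packet_train a K \<nu> \<omega>) \<xi>))\<^sup>2 \<le> a\<^sup>2 * pi * (\<Sum>k<K. \<Sum>l<K. (2 * (1 + M\<^sup>2)) powr s * (E k l * Y k \<xi>))"
      by (simp add: mult_left_mono)
    then show ?thesis by (simp only: P_def sum_distrib_left mult.assoc)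
  qed
  have bi: "integrable lborel (\<lambda>\<xi>. P * (\<Sum>k<K. \<Sum>l<K. E k l * Y k \<xi>))"
    by (intro integrable_mult_right Bochner_Integration.integrable_sum Yi)
  have fm: "(\<lambda>\<xi>. ((1 + \<xi>\<^sup>2) powr (s / 2) * cmod (fourier (packet_train a K \<nu> \<omega>) \<xi>))\<^sup>2) \<in> borel_measurable lborel"
    unfolding ft by measurable
  have I2: "integrable lborel (\<lambda>\<xi>. ((1 + \<xi>\<^sup>2) powr (s / 2) * cmod (fourier (packet_train a K \<nu> \<omega>) \<xi>))\<^sup>2)"
    by (rule Bochner_Integration.integrable_bound[OF bi fm]) (use ptw in \<open>auto intro!: AE_I2 order_trans[OF ptw abs_ge_self] simp del: power_mult_distrib\<close>)
  have "(LINT \<xi>|lborel. ((1 + \<xi>\<^sup>2) powr (s / 2) * cmod (fourier (packet_train a K \<nu> \<omega>) \<xi>))\<^sup>2) \<le> (LINT \<xi>|lborel. P * (\<Sum>k<K. \<Sum>l<K. E k l * Y k \<xi>))"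
    by (rule integral_mono[OF I2 bi ptw])
  also have "\<dots> = P * (\<Sum>k<K. \<Sum>l<K. E k l * (LINT \<xi>|lborel. Y k \<xi>))"
    using Yi by (simp only: integral_mult_right_zero Bochner_Integration.integral_sum Bochner_Integration.integrable_sum integrable_mult_right)
  also have "\<dots> \<le> P * (\<Sum>k<K. \<Sum>l<K. E k l * J)"
    using P0 YJ by (intro mult_left_mono sum_mono) (auto simp: E_def)
  also have "\<dots> = P * J * (\<Sum>k<K. \<Sum>l<K. E k l)" by (simp only: sum_distrib_left mult_ac)
  also have "\<dots> \<le> P * J * (b * real K)"
    unfolding E_def b_def using P0 J \<omega> by (intro mult_left_mono sum_gauss_pairs_le) auto
  also have "P \<le> a\<^sup>2 * pi * (2 * (1 + M\<^sup>2) powr s)"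
  proof -
    have "(2 * (1 + M\<^sup>2)) powr s = 2 powr s * (1 + M\<^sup>2) powr s" by (rule powr_mult)
    also have "\<dots> \<le> 2 powr 1 * (1 + M\<^sup>2) powr s" using s by (intro mult_right_mono powr_mono) auto
    finally show ?thesis unfolding P_def by (intro mult_left_mono) auto
  qed
  finally have "(LINT \<xi>|lborel. ((1 + \<xi>\<^sup>2) powr (s / 2) * cmod (fourier (packet_train a K \<nu> \<omega>) \<xi>))\<^sup>2) \<le> a\<^sup>2 * pi * (2 * (1 + M\<^sup>2) powr s) * J * (b * real K)"
    using J b0 by (simp add: mult_right_mono)
  then show "integrable lborel (\<lambda>\<xi>. (1 + \<xi>\<^sup>2) * cmod (fourier (packet_train a K \<nu> \<omega>) \<xi>)) \<and>
       integrable lborel (\<lambda>\<xi>. ((1 + \<xi>\<^sup>2) powr (s / 2) * cmod (fourier (packet_train a K \<nu> \<omega>) \<xi>))\<^sup>2) \<and>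
       (LINT \<xi>|lborel. ((1 + \<xi>\<^sup>2) powr (s / 2) * cmod (fourier (packet_train a K \<nu> \<omega>) \<xi>))\<^sup>2)
         \<le> pi * 2 * J * b * a\<^sup>2 * real K * (1 + (\<nu> + real K * \<omega>)\<^sup>2) powr s"
    using I1 I2 by (simp only: M_def mult_ac simp_thms)
qed

text \<open>Recentring each bump at its own frequency: the phase is evaluated at the centre, and the
  profile is displaced by t times the group velocity, twice the frequency.\<close>

lemma osc_fourier_packet_train:
  "osc p t (fourier (packet_train a K \<nu> \<omega>)) = complex_of_real (a * sqrt pi) *
     (\<Sum>k<K. cis (p * (\<nu> + real (Suc k) * \<omega>) + t * (\<nu> + real (Suc k) * \<omega>)\<^sup>2) *
        chirp_gauss (1/4) (p + 2 * t * (\<nu> + real (Suc k) * \<omega>)) t)"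
proof -
  define \<mu> where "\<mu> k = \<nu> + real (Suc k) * \<omega>" for k
  have i: "integrable lborel (\<lambda>\<xi>. cis (p * \<xi> + t * \<xi>\<^sup>2) * complex_of_real (exp (- (1/4) * (\<xi> - \<mu> k)\<^sup>2)))" for k
    using integrable_gauss_shift[of "1/4" "\<mu> k"] by (intro integrable_cis_mult) auto
  have one: "(LINT \<xi>|lborel. cis (p * \<xi> + t * \<xi>\<^sup>2) * complex_of_real (exp (- (1/4) * (\<xi> - \<mu> k)\<^sup>2))) =
      cis (p * \<mu> k + t * (\<mu> k)\<^sup>2) * chirp_gauss (1/4) (p + 2 * t * \<mu> k) t" for k
  proof -
    have "(LINT \<xi>|lborel. cis (p * \<xi> + t * \<xi>\<^sup>2) * complex_of_real (exp (- (1/4) * (\<xi> - \<mu> k)\<^sup>2))) =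
        \<bar>1\<bar> *\<^sub>R (LINT \<eta>|lborel. cis (p * (\<mu> k + 1 * \<eta>) + t * (\<mu> k + 1 * \<eta>)\<^sup>2) * complex_of_real (exp (- (1/4) * ((\<mu> k + 1 * \<eta>) - \<mu> k)\<^sup>2)))"
      by (rule lborel_integral_real_affine) simp
    also have "\<dots> = (LINT \<eta>|lborel. cis (p * \<mu> k + t * (\<mu> k)\<^sup>2) * (cis ((p + 2 * t * \<mu> k) * \<eta> + t * \<eta>\<^sup>2) * complex_of_real (exp (- (1/4) * \<eta>\<^sup>2))))"
    proof -
      have "cis (p * (\<mu> k + 1 * \<eta>) + t * (\<mu> k + 1 * \<eta>)\<^sup>2) = cis (p * \<mu> k + t * (\<mu> k)\<^sup>2) * cis ((p + 2 * t * \<mu> k) * \<eta> + t * \<eta>\<^sup>2)" for \<eta>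
        unfolding cis_mult by (rule arg_cong[where f=cis]) (simp add: power2_eq_square algebra_simps)
      then show ?thesis by (simp add: mult.assoc)
    qed
    also have "\<dots> = cis (p * \<mu> k + t * (\<mu> k)\<^sup>2) * chirp_gauss (1/4) (p + 2 * t * \<mu> k) t"
      unfolding chirp_gauss_def by (rule integral_mult_right_zero)
    finally show ?thesis .
  qed
  have "osc p t (fourier (packet_train a K \<nu> \<omega>)) =
      (LINT \<xi>|lborel. (\<Sum>k<K. complex_of_real (a * sqrt pi) * (cis (p * \<xi> + t * \<xi>\<^sup>2) * complex_of_real (exp (- (1/4) * (\<xi> - \<mu> k)\<^sup>2)))))"
    unfolding osc_def fourier_packet_train \<mu>_def[symmetric]
    by (intro Bochner_Integration.integral_cong refl) (simp only: of_real_mult of_real_sum sum_distrib_left mult_ac)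
  also have "\<dots> = (\<Sum>k<K. complex_of_real (a * sqrt pi) * (LINT \<xi>|lborel. cis (p * \<xi> + t * \<xi>\<^sup>2) * complex_of_real (exp (- (1/4) * (\<xi> - \<mu> k)\<^sup>2))))"
    using i by (simp only: integral_mult_right_zero Bochner_Integration.integral_sum integrable_mult_right)
  finally show ?thesis by (simp only: one sum_distrib_left flip: \<mu>_def)
qed

text \<open>At times small enough to make dispersion negligible, the solution is a Dirichlet kernel
  transported to the moving point \<open>p + 2 t \<nu>\<close>.\<close>

lemma packet_train_transport:
  obtains c where "0 < c"
    "\<And>a K \<nu> \<omega> T t p. \<lbrakk>0 < a; 0 \<le> \<omega>; 0 \<le> t; t \<le> T\<rbrakk> \<Longrightarrow>
       \<bar>cmod (osc p t (fourier (packet_train a K \<nu> \<omega>))) -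
          2 * pi * a * exp (- (p + 2 * t * \<nu>)\<^sup>2) * cmod (dirichlet_sum K (\<omega> * (p + 2 * t * \<nu>)))\<bar>
         \<le> c * a * real K * (T * (1 + real K * \<omega>)\<^sup>2)"
proof -
  obtain c where c: "0 < c" "\<And>a b. cmod (chirp_gauss (1/4) a b) \<le> c"
    "\<And>a b y. cmod (chirp_gauss (1/4) a b - complex_of_real (2 * sqrt pi * exp (- y\<^sup>2))) \<le> (\<bar>a - y\<bar> + \<bar>b\<bar>) * c"
    by (rule chirp_gauss_perturb) blast
  show thesis
  proof (rule that[of "sqrt pi * c"])
    show "0 < sqrt pi * c" using c by simp
    fix a \<nu> \<omega> T t p :: real and K :: nat
    assume a: "0 < a" and \<omega>: "0 \<le> \<omega>" and t: "0 \<le> t" "t \<le> T"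
    define y where "y = p + 2 * t * \<nu>"
    \<comment> \<open>In the phase at frequency \<nu> + m, the part free of m is \<theta> and common
      to all packets, the linear part m y is the phase of the Dirichlet kernel at the moving point,
      and the quadratic part t m^2 counts as error.\<close>
    define \<theta> where "\<theta> = p * \<nu> + t * \<nu>\<^sup>2"
    define e where "e = complex_of_real (2 * sqrt pi * exp (- y\<^sup>2))"
    define X where "X k = cis (p * (\<nu> + real (Suc k) * \<omega>) + t * (\<nu> + real (Suc k) * \<omega>)\<^sup>2) *
        chirp_gauss (1/4) (p + 2 * t * (\<nu> + real (Suc k) * \<omega>)) t" for k
    have Xk: "cmod (X k - cis \<theta> * cis (real (Suc k) * (\<omega> * y)) * e) \<le> c * (T * (1 + real K * \<omega>)\<^sup>2)" if k: "k < K" for k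
    proof -
      define m where "m = real (Suc k) * \<omega>"
      have m: "0 \<le> m" "m \<le> real K * \<omega>" using k \<omega> unfolding m_def by (auto intro!: mult_right_mono)
      define J where "J = chirp_gauss (1/4) (y + 2 * t * m) t"
      have "X k = cis \<theta> * cis (real (Suc k) * (\<omega> * y)) * (cis (t * m\<^sup>2) * J)"
      proof -
        have "cis (p * (\<nu> + m) + t * (\<nu> + m)\<^sup>2) = cis \<theta> * cis (real (Suc k) * (\<omega> * y)) * cis (t * m\<^sup>2)"
          unfolding cis_mult by (rule arg_cong[where f=cis]) (simp add: \<theta>_def y_def m_def power2_eq_square algebra_simps)
        moreover have "p + 2 * t * (\<nu> + m) = y + 2 * t * m" by (simp add: y_def algebra_simps)
        ultimately show ?thesis unfolding X_def m_def[symmetric] J_def by simp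
      qed
      then have "X k - cis \<theta> * cis (real (Suc k) * (\<omega> * y)) * e = cis \<theta> * cis (real (Suc k) * (\<omega> * y)) * ((cis (t * m\<^sup>2) - 1) * J + (J - e))"
        by (simp add: algebra_simps)
      then have "cmod (X k - cis \<theta> * cis (real (Suc k) * (\<omega> * y)) * e) = cmod ((cis (t * m\<^sup>2) - 1) * J + (J - e))"
        by (simp add: norm_mult)
      also have "\<dots> \<le> cmod (cis (t * m\<^sup>2) - 1) * cmod J + cmod (J - e)"
        by (rule order_trans[OF norm_triangle_ineq]) (simp add: norm_mult)
      also have "\<dots> \<le> (t * m\<^sup>2) * c + (2 * t * m + t) * c"
      proof (intro add_mono mult_mono)
        show "cmod (cis (t * m\<^sup>2) - 1) \<le> t * m\<^sup>2" using norm_cis_minus_one_le[of "t * m\<^sup>2"] t by simp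
        show "cmod J \<le> c" unfolding J_def by (rule c(2))
        show "cmod (J - e) \<le> (2 * t * m + t) * c"
          using c(3)[of "y + 2 * t * m" t y] t m unfolding J_def e_def by simp
      qed (use t in auto)
      \<comment> \<open>Phase error t m^2, displacement error 2 t m and chirp error t complete a
        square.\<close>
      also have "\<dots> = c * (t * (1 + m)\<^sup>2)" by (simp add: power2_eq_square algebra_simps)
      also have "\<dots> \<le> c * (T * (1 + real K * \<omega>)\<^sup>2)"
        using c(1) t m by (intro mult_left_mono mult_mono power_mono) auto
      finally show ?thesis .
    qed
    define V where "V = osc p t (fourier (packet_train a K \<nu> \<omega>))"
    define V' where "V' = complex_of_real (a * sqrt pi) * (cis \<theta> * e * dirichlet_sum K (\<omega> * y))"
    have "V - V' = complex_of_real (a * sqrt pi) * (\<Sum>k<K. X k - cis \<theta> * cis (real (Suc k) * (\<omega> * y)) * e)"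
      unfolding V_def V'_def osc_fourier_packet_train X_def[symmetric] dirichlet_sum_def
      by (simp add: sum_subtractf right_diff_distrib sum_distrib_left mult_ac)
    then have "cmod (V - V') = (a * sqrt pi) * cmod (\<Sum>k<K. X k - cis \<theta> * cis (real (Suc k) * (\<omega> * y)) * e)"
      using a by (simp only: norm_mult norm_of_real) simp
    also have "\<dots> \<le> (a * sqrt pi) * (\<Sum>k<K. c * (T * (1 + real K * \<omega>)\<^sup>2))"
      using a Xk by (intro mult_left_mono sum_norm_le) auto
    also have "\<dots> = sqrt pi * c * a * real K * (T * (1 + real K * \<omega>)\<^sup>2)" by simp
    finally have d: "cmod (V - V') \<le> sqrt pi * c * a * real K * (T * (1 + real K * \<omega>)\<^sup>2)" .
    have "cmod V' = 2 * pi * a * exp (- y\<^sup>2) * cmod (dirichlet_sum K (\<omega> * y))"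
      unfolding V'_def e_def norm_mult norm_of_real using a by simp
    then show "\<bar>cmod (osc p t (fourier (packet_train a K \<nu> \<omega>))) -
          2 * pi * a * exp (- (p + 2 * t * \<nu>)\<^sup>2) * cmod (dirichlet_sum K (\<omega> * (p + 2 * t * \<nu>)))\<bar>
         \<le> sqrt pi * c * a * real K * (T * (1 + real K * \<omega>)\<^sup>2)"
      using d norm_triangle_ineq3[of V V'] unfolding V_def y_def by linarith
  qed
qed

text \<open>The moving point sweeps more than one period of the Dirichlet kernel, hence meets both a peak
  and a zero of it; the modulus at one of these two times differs from the initial one.\<close>

lemma packet_train_focus:
  obtains c where "0 < c"
    "\<And>a K \<nu> \<omega> T \<gamma> x. \<lbrakk>0 < a; 2 \<le> K; 2 * pi \<le> \<omega>; 0 < T; x \<in> {0..1}; continuous_on {0..T} (\<gamma> x); \<gamma> x 0 = x;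
        x + 4 * pi / \<omega> \<le> \<gamma> x T + 2 * T * \<nu>; c * (T * (1 + real K * \<omega>)\<^sup>2) \<le> exp (- 9)\<rbrakk> \<Longrightarrow>
      \<exists>t\<in>{0<..T}. 2 * exp (- 9) * a * real K \<le>
        cmod (osc (\<gamma> x t) t (fourier (packet_train a K \<nu> \<omega>)) - osc x 0 (fourier (packet_train a K \<nu> \<omega>)))"
proof -
  obtain c where c: "0 < c" and transport: "\<And>a K \<nu> \<omega> T t p. \<lbrakk>0 < a; 0 \<le> \<omega>; 0 \<le> t; t \<le> T\<rbrakk> \<Longrightarrow>
       \<bar>cmod (osc p t (fourier (packet_train a K \<nu> \<omega>))) -
          2 * pi * a * exp (- (p + 2 * t * \<nu>)\<^sup>2) * cmod (dirichlet_sum K (\<omega> * (p + 2 * t * \<nu>)))\<bar>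
         \<le> c * a * real K * (T * (1 + real K * \<omega>)\<^sup>2)"
    by (rule packet_train_transport) blast
  show thesis
  proof (rule that[OF c])
    fix a \<nu> \<omega> T x :: real and K :: nat and \<gamma> :: "real \<Rightarrow> real \<Rightarrow> real"
    assume a: "0 < a" and K: "2 \<le> K" and \<omega>: "2 * pi \<le> \<omega>" and T: "0 < T" and x: "x \<in> {0..1}"
      and cont: "continuous_on {0..T} (\<gamma> x)" and \<gamma>0: "\<gamma> x 0 = x"
      and sweep: "x + 4 * pi / \<omega> \<le> \<gamma> x T + 2 * T * \<nu>" and small: "c * (T * (1 + real K * \<omega>)\<^sup>2) \<le> exp (- 9)"
    have \<omega>0: "0 < \<omega>" using \<omega> pi_gt_zero by linarith
    define V where "V t = osc (\<gamma> x t) t (fourier (packet_train a K \<nu> \<omega>))" for t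
    define y where "y t = \<gamma> x t + 2 * t * \<nu>" for t
    have y0: "y 0 = x" by (simp add: y_def \<gamma>0)
    have ycont: "continuous_on {0..T} y" unfolding y_def by (intro continuous_intros cont)
    \<comment> \<open>\<open>Y1\<close> is the first peak strictly to the right of x, less than or
      equal to one period away, and \<open>Y2\<close> the zero next to it. The sweep of two periods
      in the hypothesis reaches both.\<close>
    define m where "m = \<lfloor>\<omega> * x / (2 * pi)\<rfloor> + 1"
    define Y1 where "Y1 = 2 * pi * of_int m / \<omega>"
    define Y2 where "Y2 = Y1 + 2 * pi / real K / \<omega>"
    have m: "\<omega> * x / (2 * pi) < of_int m" "of_int m \<le> \<omega> * x / (2 * pi) + 1" unfolding m_def by linarith+
    have Y1: "x < Y1" "Y1 \<le> x + 2 * pi / \<omega>"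
      using m \<omega>0 pi_gt_zero by (simp_all add: Y1_def field_simps)
    have "2 * pi / real K / \<omega> \<le> 2 * pi / 1 / \<omega>" using K \<omega>0 by (intro divide_right_mono divide_left_mono) auto
    moreover have "0 < 2 * pi / real K / \<omega>" using K \<omega>0 by simp
    moreover have "4 * pi / \<omega> = 2 * pi / \<omega> + 2 * pi / \<omega>" by simp
    ultimately have Y2: "x < Y2" "Y2 \<le> y T" "Y1 \<le> y T" using Y1 sweep unfolding Y2_def y_def by simp_all
    have hit: "\<exists>t\<in>{0<..T}. y t = Y" if Y: "x < Y" "Y \<le> y T" for Y
    proof -
      obtain t where t: "0 \<le> t" "t \<le> T" "y t = Y" using IVT'[of y 0 Y T] Y y0 T ycont by auto
      moreover have "t \<noteq> 0" using t Y y0 by auto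
      ultimately show ?thesis by auto
    qed
    obtain t1 where t1: "t1 \<in> {0<..T}" "y t1 = Y1" using hit[of Y1] Y1 Y2 by blast
    obtain t2 where t2: "t2 \<in> {0<..T}" "y t2 = Y2" using hit[of Y2] Y2 by blast
    define err where "err = c * a * real K * (T * (1 + real K * \<omega>)\<^sup>2)"
    have err: "err \<le> exp (- 9) * a * real K"
      using mult_right_mono[OF small, of "a * real K"] a by (simp add: err_def mult_ac)
    have V1: "2 * pi * a * exp (- 9) * real K - err \<le> cmod (V t1)"
    proof -
      \<comment> \<open>Origin of exp(-9): the Gaussian envelope is at least this large at every
        peak that is met.\<close>
      have "Y1 \<le> 3"
      proof -
        have "2 * pi / \<omega> \<le> 1" using \<omega> \<omega>0 by simp
        then show ?thesis using Y1 x by auto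
      qed
      then have "Y1\<^sup>2 \<le> 3\<^sup>2" using Y1 x by (intro power_mono) auto
      then have "exp (- 9) \<le> exp (- Y1\<^sup>2)" by simp
      then have "2 * pi * a * exp (- 9) * real K \<le> 2 * pi * a * exp (- Y1\<^sup>2) * real K"
        using a by (intro mult_right_mono mult_left_mono) auto
      moreover have "\<omega> * Y1 = 2 * pi * of_int m" using \<omega>0 by (simp add: Y1_def)
      then have D: "cmod (dirichlet_sum K (\<omega> * Y1)) = real K" using dirichlet_sum_peak[of K m] by simp
      moreover have "\<bar>cmod (V t1) - 2 * pi * a * exp (- Y1\<^sup>2) * real K\<bar> \<le> err"
        unfolding D[symmetric] using transport[of a \<omega> t1 T "\<gamma> x t1" K \<nu>] a \<omega>0 t1 unfolding V_def err_def y_def by simp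
      ultimately show ?thesis by linarith
    qed
    have V2: "cmod (V t2) \<le> err"
    proof -
      have "\<omega> * Y2 = 2 * pi * of_int m + 2 * pi / real K"
        using \<omega>0 by (simp add: Y2_def Y1_def distrib_left)
      then have "dirichlet_sum K (\<omega> * Y2) = 0" using dirichlet_sum_zero[OF K, of m] by simp
      moreover have "\<bar>cmod (V t2) - 2 * pi * a * exp (- Y2\<^sup>2) * cmod (dirichlet_sum K (\<omega> * Y2))\<bar> \<le> err"
        using transport[of a \<omega> t2 T "\<gamma> x t2" K \<nu>] a \<omega>0 t2 unfolding V_def err_def y_def by simp
      ultimately show ?thesis by simp
    qed
    have e0: "0 < exp (- 9) * a * real K" using a K by simp
    \<comment> \<open>In units of exp(-9) a K the peak is at least 6 - 1 and the zero at most 1. The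
      gap 4 forces a deviation of at least 2 from the initial value at one of the two times.\<close>
    have "6 * (exp (- 9) * a * real K) \<le> 2 * pi * (exp (- 9) * a * real K)"
      using pi_gt3 e0 by (intro mult_right_mono) auto
    then have "4 * (exp (- 9) * a * real K) \<le> cmod (V t1) - cmod (V t2)" using V1 V2 err by (simp add: mult_ac)
    also have "\<dots> \<le> cmod (V t1 - V t2)" by (rule norm_triangle_ineq2)
    also have "\<dots> \<le> cmod (V t1 - V 0) + cmod (V t2 - V 0)"
      using norm_triangle_ineq4[of "V t1 - V 0" "V t2 - V 0"] by simp
    finally have "2 * exp (- 9) * a * real K \<le> cmod (V t1 - V 0) \<or> 2 * exp (- 9) * a * real K \<le> cmod (V t2 - V 0)"
      by linarith
    moreover have "V 0 = osc x 0 (fourier (packet_train a K \<nu> \<omega>))" by (simp add: V_def \<gamma>0)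
    ultimately show "\<exists>t\<in>{0<..T}. 2 * exp (- 9) * a * real K \<le>
        cmod (osc (\<gamma> x t) t (fourier (packet_train a K \<nu> \<omega>)) - osc x 0 (fourier (packet_train a K \<nu> \<omega>)))"
      using t1(1) t2(1) unfolding V_def by auto
  qed
qed

text \<open>\<open>lim2\<close> says that dispersion is negligible, \<open>lim3\<close> that the
  Sobolev energy vanishes once the jump is normalised to size T^\<delta>, and \<open>sweep\<close>
  that the moving point crosses two periods. Any sequences meeting these demands give blocks of
  arbitrarily small size.\<close>

proposition ex_focusing_block:
  fixes \<gamma> :: "real \<Rightarrow> real \<Rightarrow> real" and T \<omega> \<nu> :: "nat \<Rightarrow> real" and K :: "nat \<Rightarrow> nat"
  assumes s: "0 \<le> s" "s \<le> 1" and \<delta>: "0 \<le> \<delta>" and \<epsilon>: "0 < \<epsilon>"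
    and K: "\<And>n. 2 \<le> K n" and \<omega>: "\<And>n. 2 * pi \<le> \<omega> n" and \<nu>: "\<And>n. 0 \<le> \<nu> n" and T: "\<And>n. 0 < T n"
    and lim1: "T \<longlonglongrightarrow> 0" and lim2: "(\<lambda>n. T n * (1 + real (K n) * \<omega> n)\<^sup>2) \<longlonglongrightarrow> 0"
    and lim3: "(\<lambda>n. T n powr (2 * \<delta>) / real (K n) * (1 + (\<nu> n + real (K n) * \<omega> n)\<^sup>2) powr s) \<longlonglongrightarrow> 0"
    and cont: "\<And>n x. continuous_on {0..T n} (\<gamma> x)" and \<gamma>0: "\<And>x. \<gamma> x 0 = x"
    and sweep: "\<And>n x. x + 4 * pi / \<omega> n \<le> \<gamma> x (T n) + 2 * T n * \<nu> n"
  shows "\<exists>F. focusing_block \<gamma> \<delta> s \<epsilon> F"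
proof -
  obtain c1 where c1: "0 < c1" and L1: "\<And>a K \<nu> \<omega>. \<lbrakk>0 < a; 1 \<le> K; 1 \<le> \<omega>\<rbrakk> \<Longrightarrow> integrable lborel (packet_train a K \<nu> \<omega>) \<and>
       (LINT x|lborel. cmod (packet_train a K \<nu> \<omega> x)) \<le> c1 * a * sqrt (real K)"
    by (rule packet_train_L1) blast
  obtain c2 where c2: "0 < c2" and sob: "\<And>a K \<nu> \<omega>. \<lbrakk>0 < a; 0 \<le> \<nu>; 1 \<le> \<omega>\<rbrakk> \<Longrightarrow>
       integrable lborel (\<lambda>\<xi>. (1 + \<xi>\<^sup>2) * cmod (fourier (packet_train a K \<nu> \<omega>) \<xi>)) \<and>
       integrable lborel (\<lambda>\<xi>. ((1 + \<xi>\<^sup>2) powr (s / 2) * cmod (fourier (packet_train a K \<nu> \<omega>) \<xi>))\<^sup>2) \<and>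
       (LINT \<xi>|lborel. ((1 + \<xi>\<^sup>2) powr (s / 2) * cmod (fourier (packet_train a K \<nu> \<omega>) \<xi>))\<^sup>2)
         \<le> c2 * a\<^sup>2 * real K * (1 + (\<nu> + real K * \<omega>)\<^sup>2) powr s"
    by (rule packet_train_sobolev[OF s]) blast
  obtain c3 where c3: "0 < c3" and focus: "\<And>a K \<nu> \<omega> T \<gamma> x. \<lbrakk>0 < a; 2 \<le> K; 2 * pi \<le> \<omega>; 0 < T; x \<in> {0..1}; continuous_on {0..T} (\<gamma> x); \<gamma> x 0 = x;
        x + 4 * pi / \<omega> \<le> \<gamma> x T + 2 * T * \<nu>; c3 * (T * (1 + real K * \<omega>)\<^sup>2) \<le> exp (- 9)\<rbrakk> \<Longrightarrow>
      \<exists>t\<in>{0<..T}. 2 * exp (- 9) * a * real K \<le>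
        cmod (osc (\<gamma> x t) t (fourier (packet_train a K \<nu> \<omega>)) - osc x 0 (fourier (packet_train a K \<nu> \<omega>)))"
    by (rule packet_train_focus) blast
  \<comment> \<open>Calibrates the jump 2 exp(-9) a K to 12 T^\<delta>, safely above the required 10
    t^\<delta>.\<close>
  define b where "b = 6 * exp (9 :: real)"
  have b0: "0 < b" by (simp add: b_def)
  define q where "q n = T n powr (2 * \<delta>) / real (K n) * (1 + (\<nu> n + real (K n) * \<omega> n)\<^sup>2) powr s" for n
  have "\<forall>\<^sub>F n in sequentially. T n < \<epsilon>" using lim1 \<epsilon> by (intro order_tendstoD(2)) auto
  moreover have "\<forall>\<^sub>F n in sequentially. T n * (1 + real (K n) * \<omega> n)\<^sup>2 < exp (- 9) / c3"
    using lim2 c3 by (intro order_tendstoD(2)) auto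
  moreover have "\<forall>\<^sub>F n in sequentially. q n < min (\<epsilon> / (c2 * b\<^sup>2)) ((\<epsilon> / (c1 * b))\<^sup>2)"
    using lim3 c1 c2 b0 \<epsilon> unfolding q_def by (intro order_tendstoD(2)) auto
  ultimately have "\<forall>\<^sub>F n in sequentially. T n < \<epsilon> \<and> T n * (1 + real (K n) * \<omega> n)\<^sup>2 < exp (- 9) / c3 \<and>
     q n < min (\<epsilon> / (c2 * b\<^sup>2)) ((\<epsilon> / (c1 * b))\<^sup>2)" by eventually_elim blast
  then obtain n where T\<epsilon>: "T n < \<epsilon>" and n2: "T n * (1 + real (K n) * \<omega> n)\<^sup>2 < exp (- 9) / c3"
    and q1: "q n < \<epsilon> / (c2 * b\<^sup>2)" and q2: "q n < (\<epsilon> / (c1 * b))\<^sup>2" by (auto simp: eventually_sequentially)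
  \<comment> \<open>The jump is proportional to a K, whereas the energy is proportional to a^2 K;
    many packets of small amplitude are therefore favourable.\<close>
  define a where "a = b * T n powr \<delta> / real (K n)"
  have K0: "0 < real (K n)" using K[of n] by simp
  have a0: "0 < a" using b0 T[of n] K0 by (simp add: a_def)
  have \<omega>1: "1 \<le> \<omega> n" using \<omega>[of n] pi_gt3 by simp
  have a2: "a\<^sup>2 * real (K n) = b\<^sup>2 * (T n powr (2 * \<delta>) / real (K n))"
  proof -
    have "(T n powr \<delta>)\<^sup>2 = T n powr (2 * \<delta>)" by (simp add: power2_eq_square powr_add[symmetric])
    then show ?thesis using K0 by (simp add: a_def power_mult_distrib power_divide power2_eq_square[of "real (K n)"])
  qed
  define F where "F = packet_train a (K n) (\<nu> n) (\<omega> n)"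
  have "focusing_block \<gamma> \<delta> s \<epsilon> F"
    unfolding focusing_block_def
  proof (intro conjI ballI)
    have l: "integrable lborel F" "(LINT x|lborel. cmod (F x)) \<le> c1 * a * sqrt (real (K n))"
      using L1[of a "K n" "\<omega> n" "\<nu> n"] a0 K[of n] \<omega>1 by (simp_all add: F_def)
    show "integrable lborel F" by (rule l)
    have "(c1 * a * sqrt (real (K n)))\<^sup>2 = c1\<^sup>2 * (a\<^sup>2 * real (K n))" by (simp add: power_mult_distrib)
    also have "\<dots> = (c1 * b)\<^sup>2 * (T n powr (2 * \<delta>) / real (K n) * 1)" by (simp add: a2 power_mult_distrib)
    also have "\<dots> \<le> (c1 * b)\<^sup>2 * q n"
      unfolding q_def using s K0 by (intro mult_left_mono ge_one_powr_ge_zero) auto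
    also have "\<dots> \<le> (c1 * b)\<^sup>2 * (\<epsilon> / (c1 * b))\<^sup>2" using q2 by (intro mult_left_mono) auto
    also have "\<dots> = \<epsilon>\<^sup>2" using c1 b0 by (simp add: power_mult_distrib power_divide)
    finally have "c1 * a * sqrt (real (K n)) \<le> \<epsilon>" by (rule power2_le_imp_le) (use \<epsilon> in simp)
    with l show "(LINT x|lborel. cmod (F x)) \<le> \<epsilon>" by simp
    note so = sob[OF a0 \<nu>[of n] \<omega>1, of "K n", folded F_def]
    show "integrable lborel (\<lambda>\<xi>. ((1 + \<xi>\<^sup>2) powr (s / 2) * cmod (fourier F \<xi>))\<^sup>2)"
      "integrable lborel (\<lambda>\<xi>. (1 + \<xi>\<^sup>2) * cmod (fourier F \<xi>))" using so by blast+
    have "c2 * a\<^sup>2 * real (K n) * (1 + (\<nu> n + real (K n) * \<omega> n)\<^sup>2) powr s = c2 * (a\<^sup>2 * real (K n)) * (1 + (\<nu> n + real (K n) * \<omega> n)\<^sup>2) powr s"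
      by (simp only: mult.assoc)
    also have "\<dots> = (c2 * b\<^sup>2) * q n" unfolding a2 q_def by (simp only: mult_ac)
    also have "\<dots> \<le> (c2 * b\<^sup>2) * (\<epsilon> / (c2 * b\<^sup>2))" using q1 c2 by (intro mult_left_mono) auto
    also have "\<dots> = \<epsilon>" using c2 b0 by simp
    finally show "(LINT \<xi>|lborel. ((1 + \<xi>\<^sup>2) powr (s / 2) * cmod (fourier F \<xi>))\<^sup>2) \<le> \<epsilon>" using so by linarith
    fix x :: real assume x: "x \<in> {0..1}"
    have "c3 * (T n * (1 + real (K n) * \<omega> n)\<^sup>2) \<le> exp (- 9)" using n2 c3 by (simp add: field_simps)
    from focus[where T="T n" and \<gamma>=\<gamma>, OF a0 K \<omega> T x cont \<gamma>0 sweep this] obtain t where t: "t \<in> {0<..T n}"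
      and big: "2 * exp (- 9) * a * real (K n) \<le> cmod (osc (\<gamma> x t) t (fourier F) - osc x 0 (fourier F))"
      unfolding F_def by blast
    have "10 * t powr \<delta> < 12 * t powr \<delta>" using t by simp
    also have "\<dots> \<le> 12 * T n powr \<delta>" using t \<delta> by (intro mult_left_mono powr_mono2) auto
    also have "\<dots> = 2 * exp (- 9) * a * real (K n)"
      using K0 by (simp add: a_def b_def exp_minus)
    also note big
    finally show "\<exists>t\<in>{0<..<\<epsilon>}. 10 * t powr \<delta> < cmod (osc (\<gamma> x t) t (fourier F) - osc x 0 (fourier F))"
      using t T\<epsilon> by (intro bexI[of _ t]) auto
  qed
  then show ?thesis by blast
qed

section \<open>Failure below the critical exponent\<close>

lemma tendsto_const_powr_neg:
  assumes "e < 0"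
  shows "(\<lambda>n. c * real (Suc n) powr e) \<longlonglongrightarrow> 0"
proof -
  have "filterlim (\<lambda>n. real (Suc n)) at_top sequentially"
    using filterlim_compose[OF filterlim_real_sequentially filterlim_Suc] .
  then have "(\<lambda>n. c * real (Suc n) powr e) \<longlonglongrightarrow> c * 0"
    using assms by (intro tendsto_mult tendsto_const tendsto_neg_powr)
  then show ?thesis by simp
qed

text \<open>The power laws T = N^(-\<beta>), K of order N^\<kappa>, spacing w N^\<sigma> and
  frequency shift \<nu> N. The condition 2 (\<kappa> + \<sigma>) < \<beta> suppresses dispersion,
  \<kappa> + \<sigma> \<le> 1 keeps all frequencies of order N, and \<open>neg\<close> makes the
  Sobolev energy decay.\<close>

lemma ex_focusing_block_powers:
  fixes \<gamma> :: "real \<Rightarrow> real \<Rightarrow> real"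
  assumes s: "0 \<le> s" "s \<le> 1" and \<delta>: "0 \<le> \<delta>" and \<epsilon>: "0 < \<epsilon>"
    and \<beta>: "0 < \<beta>" and \<kappa>: "0 \<le> \<kappa>" and \<sigma>: "0 \<le> \<sigma>" and \<kappa>\<sigma>: "\<kappa> + \<sigma> \<le> 1" "2 * (\<kappa> + \<sigma>) < \<beta>"
    and neg: "2 * s < 2 * \<beta> * \<delta> + \<kappa>"
    and w: "2 * pi \<le> w" "w \<le> 16" and \<nu>: "0 \<le> \<nu>" "\<nu> \<le> 1"
    and cont: "\<And>x. continuous_on {0..1} (\<gamma> x)" and \<gamma>0: "\<And>x. \<gamma> x 0 = x"
    and sweep: "\<And>x N. 1 \<le> N \<Longrightarrow> x + 4 * pi / (w * N powr \<sigma>) \<le> \<gamma> x (N powr (- \<beta>)) + 2 * N powr (- \<beta>) * (\<nu> * N)"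
  shows "\<exists>F. focusing_block \<gamma> \<delta> s \<epsilon> F"
proof -
  define N where "N n = real (Suc n)" for n
  have N: "1 \<le> N n" "0 < N n" for n by (auto simp: N_def)
  \<comment> \<open>The added 1 ensures at least two packets even for \<kappa> = 0, as a zero of the
    Dirichlet kernel requires.\<close>
  define K where "K n = nat \<lceil>N n powr \<kappa>\<rceil> + 1" for n
  have Np: "1 \<le> N n powr e" if "0 \<le> e" for n e using N that by (simp add: ge_one_powr_ge_zero)
  have Kr: "real (K n) = of_int \<lceil>N n powr \<kappa>\<rceil> + 1" for n
    using Np[OF \<kappa>, of n] by (simp add: K_def)
  have K1: "N n powr \<kappa> \<le> real (K n)" "real (K n) \<le> 3 * N n powr \<kappa>" "2 \<le> K n" for n
  proof -
    show "N n powr \<kappa> \<le> real (K n)" unfolding Kr by linarith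
    show "real (K n) \<le> 3 * N n powr \<kappa>" unfolding Kr using Np[OF \<kappa>, of n] by linarith
    have "1 \<le> \<lceil>N n powr \<kappa>\<rceil>" using Np[OF \<kappa>, of n] by linarith
    then show "2 \<le> K n" unfolding K_def by linarith
  qed
  define \<omega> where "\<omega> n = w * N n powr \<sigma>" for n
  have w0: "0 < w" using w pi_gt_zero by linarith
  have \<omega>: "2 * pi \<le> \<omega> n" for n
    using mult_mono[OF w(1) Np[OF \<sigma>, of n]] w0 by (simp add: \<omega>_def)
  have \<omega>0: "0 \<le> \<omega> n" for n using \<omega>[of n] pi_gt_zero by linarith
  define T where "T n = N n powr (- \<beta>)" for n
  have T0: "0 < T n" for n using N(2)[of n] by (simp add: T_def)
  have T1: "T n \<le> 1" for n
  proof -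
    have "T n \<le> N n powr 0" unfolding T_def using N[of n] \<beta> by (intro powr_mono) auto
    then show ?thesis using N[of n] by simp
  qed
  \<comment> \<open>The bound 48 = 3 * 16 determines the constants below: 49 includes the added
    term, 2401 is its square, and 2402 adds the 1 of the Sobolev weight.\<close>
  have K\<omega>: "real (K n) * \<omega> n \<le> 48 * N n powr (\<kappa> + \<sigma>)" for n
  proof -
    have "real (K n) * \<omega> n \<le> (3 * N n powr \<kappa>) * (16 * N n powr \<sigma>)"
      unfolding \<omega>_def using K1(2)[of n] w w0 by (intro mult_mono mult_right_mono) auto
    then show ?thesis by (simp add: powr_add)
  qed
  show ?thesis
  proof (rule ex_focusing_block[OF s \<delta> \<epsilon> K1(3) \<omega> _ T0, where \<nu>="\<lambda>n. \<nu> * N n"])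
    show "0 \<le> \<nu> * N n" for n using \<nu> N[of n] by simp
    show "T \<longlonglongrightarrow> 0" using tendsto_const_powr_neg[of "- \<beta>" 1] \<beta> by (simp add: T_def[abs_def] N_def)
    show "(\<lambda>n. T n * (1 + real (K n) * \<omega> n)\<^sup>2) \<longlonglongrightarrow> 0"
    proof (rule Lim_null_comparison)
      show "(\<lambda>n. 2401 * real (Suc n) powr (2 * (\<kappa> + \<sigma>) - \<beta>)) \<longlonglongrightarrow> 0"
        using \<kappa>\<sigma> by (intro tendsto_const_powr_neg) simp
      have "norm (T n * (1 + real (K n) * \<omega> n)\<^sup>2) \<le> 2401 * real (Suc n) powr (2 * (\<kappa> + \<sigma>) - \<beta>)" for n
      proof -
        have "1 + real (K n) * \<omega> n \<le> 49 * N n powr (\<kappa> + \<sigma>)"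
          using K\<omega>[of n] Np[of "\<kappa> + \<sigma>" n] \<kappa> \<sigma> by simp
        then have "(1 + real (K n) * \<omega> n)\<^sup>2 \<le> (49 * N n powr (\<kappa> + \<sigma>))\<^sup>2"
          using \<omega>0[of n] by (intro power_mono) auto
        also have "\<dots> = 2401 * N n powr (2 * (\<kappa> + \<sigma>))"
          by (simp add: power_mult_distrib power2_eq_square[of "N n powr (\<kappa> + \<sigma>)"] powr_add[symmetric])
        finally have "T n * (1 + real (K n) * \<omega> n)\<^sup>2 \<le> T n * (2401 * N n powr (2 * (\<kappa> + \<sigma>)))"
          using T0[of n] by (intro mult_left_mono) auto
        also have "\<dots> = 2401 * (N n powr (2 * (\<kappa> + \<sigma>)) * N n powr (- \<beta>))" by (simp add: T_def)
        also have "N n powr (2 * (\<kappa> + \<sigma>)) * N n powr (- \<beta>) = N n powr (2 * (\<kappa> + \<sigma>) - \<beta>)" by (simp add: powr_add[symmetric])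
        finally show ?thesis using T0[of n] by (simp add: abs_mult N_def)
      qed
      then show "\<forall>\<^sub>F n in sequentially. norm (T n * (1 + real (K n) * \<omega> n)\<^sup>2) \<le> 2401 * real (Suc n) powr (2 * (\<kappa> + \<sigma>) - \<beta>)" by simp
    qed
    show "(\<lambda>n. T n powr (2 * \<delta>) / real (K n) * (1 + (\<nu> * N n + real (K n) * \<omega> n)\<^sup>2) powr s) \<longlonglongrightarrow> 0"
    proof (rule Lim_null_comparison)
      show "(\<lambda>n. 2402 * real (Suc n) powr (2 * s - 2 * \<beta> * \<delta> - \<kappa>)) \<longlonglongrightarrow> 0"
        using neg by (intro tendsto_const_powr_neg) simp
      have "norm (T n powr (2 * \<delta>) / real (K n) * (1 + (\<nu> * N n + real (K n) * \<omega> n)\<^sup>2) powr s) \<le> 2402 * real (Suc n) powr (2 * s - 2 * \<beta> * \<delta> - \<kappa>)" for n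
      proof -
        have "N n powr (\<kappa> + \<sigma>) \<le> N n powr 1" using \<kappa>\<sigma> N[of n] by (intro powr_mono) auto
        then have "real (K n) * \<omega> n \<le> 48 * N n" using K\<omega>[of n] N[of n] by simp
        moreover have "\<nu> * N n \<le> 1 * N n" using \<nu> N[of n] by (intro mult_right_mono) auto
        ultimately have "\<nu> * N n + real (K n) * \<omega> n \<le> 49 * N n" by linarith
        then have "(\<nu> * N n + real (K n) * \<omega> n)\<^sup>2 \<le> (49 * N n)\<^sup>2"
          using \<nu> N[of n] \<omega>0[of n] by (intro power_mono) auto
        moreover have "1 \<le> (N n)\<^sup>2" using N[of n] by simp
        ultimately have "1 + (\<nu> * N n + real (K n) * \<omega> n)\<^sup>2 \<le> 2402 * (N n)\<^sup>2" by (simp add: power_mult_distrib)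
        then have "(1 + (\<nu> * N n + real (K n) * \<omega> n)\<^sup>2) powr s \<le> (2402 * (N n)\<^sup>2) powr s"
          using s by (intro powr_mono2) auto
        also have "\<dots> = 2402 powr s * ((N n)\<^sup>2) powr s" by (rule powr_mult)
        also have "((N n)\<^sup>2) powr s = N n powr (2 * s)" using N[of n] by (simp add: power2_powr)
        also have "2402 powr s * N n powr (2 * s) \<le> 2402 powr 1 * N n powr (2 * s)"
          using s by (intro mult_right_mono powr_mono) auto
        finally have A: "(1 + (\<nu> * N n + real (K n) * \<omega> n)\<^sup>2) powr s \<le> 2402 * N n powr (2 * s)" by simp
        have B: "T n powr (2 * \<delta>) / real (K n) \<le> N n powr (- (2 * \<beta> * \<delta>)) * N n powr (- \<kappa>)"
        proof -
          have "T n powr (2 * \<delta>) / real (K n) \<le> T n powr (2 * \<delta>) / N n powr \<kappa>"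
            using K1(1)[of n] N[of n] K1(3)[of n] by (intro divide_left_mono) auto
          also have "\<dots> = N n powr (- (2 * \<beta> * \<delta>)) * N n powr (- \<kappa>)"
            unfolding T_def powr_powr by (simp add: powr_minus divide_inverse mult_ac)
          finally show ?thesis .
        qed
        have "T n powr (2 * \<delta>) / real (K n) * (1 + (\<nu> * N n + real (K n) * \<omega> n)\<^sup>2) powr s \<le>
            (N n powr (- (2 * \<beta> * \<delta>)) * N n powr (- \<kappa>)) * (2402 * N n powr (2 * s))"
          using A B by (intro mult_mono) auto
        also have "\<dots> = 2402 * (N n powr (- (2 * \<beta> * \<delta>)) * N n powr (- \<kappa>) * N n powr (2 * s))" by simp
        also have "N n powr (- (2 * \<beta> * \<delta>)) * N n powr (- \<kappa>) * N n powr (2 * s) = N n powr (2 * s - 2 * \<beta> * \<delta> - \<kappa>)"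
          unfolding powr_add[symmetric] by (rule arg_cong[where f="\<lambda>z. N n powr z"]) simp
        finally show ?thesis by (simp add: N_def)
      qed
      then show "\<forall>\<^sub>F n in sequentially. norm (T n powr (2 * \<delta>) / real (K n) * (1 + (\<nu> * N n + real (K n) * \<omega> n)\<^sup>2) powr s) \<le> 2402 * real (Suc n) powr (2 * s - 2 * \<beta> * \<delta> - \<kappa>)" by simp
    qed
    show "continuous_on {0..T n} (\<gamma> x)" for n x
      by (rule continuous_on_subset[OF cont]) (use T1[of n] in auto)
    show "\<gamma> x 0 = x" for x by (rule \<gamma>0)
    show "x + 4 * pi / \<omega> n \<le> \<gamma> x (T n) + 2 * T n * (\<nu> * N n)" for n x
      unfolding \<omega>_def T_def by (rule sweep[OF N(1)])
  qed
qed

text \<open>At time 1/N packets near frequency N travel a distance 2, exactly two periods for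
  spacing 2 pi. The number of packets is N^\<kappa> with \<kappa> below the dispersive limit 1/2,
  chosen as a midpoint so that the strict bound on s is met.\<close>

lemma ex_focusing_block_stationary:
  assumes "0 \<le> s" "s \<le> 1" "0 \<le> \<delta>" "0 < \<epsilon>" "s < 1 / 4 + \<delta>"
  shows "\<exists>F. focusing_block (\<lambda>x t. x) \<delta> s \<epsilon> F"
proof -
  define \<kappa> where "\<kappa> = (max 0 (2 * (s - \<delta>)) + 1 / 2) / 2"
  have \<kappa>: "0 \<le> \<kappa>" "2 * (s - \<delta>) < \<kappa>" "\<kappa> < 1 / 2" using assms by (auto simp: \<kappa>_def max_def)
  show ?thesis
  proof (rule ex_focusing_block_powers[of s \<delta> \<epsilon> 1 \<kappa> 0 "2 * pi" 1])
    show "2 * pi \<le> (16 :: real)" using pi_less_4 by simp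
    show "x + 4 * pi / (2 * pi * N powr 0) \<le> x + 2 * N powr (- 1) * (1 * N)" if "1 \<le> N" for x N :: real
      using that by (simp add: powr_minus)
  qed (use assms \<kappa> in auto)
qed

text \<open>Without frequency shift only the curve moves the point, by T^\<alpha> = N^(-\<alpha>
  \<beta>). The spacing 4 pi N^(\<alpha> \<beta>) makes this exactly two periods, and N^(1 -
  \<alpha> \<beta>) packets fill the frequencies up to order N. Then \<beta> > 2 keeps dispersion
  negligible.\<close>

lemma ex_focusing_block_moving:
  fixes \<alpha> \<beta> :: real
  assumes "0 \<le> s" "s \<le> 1" "0 \<le> \<delta>" "0 < \<epsilon>" "0 < \<alpha>" "2 < \<beta>" "\<alpha> * \<beta> < 1" and s: "s < 1 / 2 + \<beta> * (\<delta> - \<alpha> / 2)"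
  shows "\<exists>F. focusing_block (\<lambda>x t. x + \<bar>t\<bar> powr \<alpha>) \<delta> s \<epsilon> F"
proof (rule ex_focusing_block_powers[of s \<delta> \<epsilon> \<beta> "1 - \<alpha> * \<beta>" "\<alpha> * \<beta>" "4 * pi" 0])
  show "4 * pi \<le> (16 :: real)" using pi_less_4 by simp
  show "x + 4 * pi / (4 * pi * N powr (\<alpha> * \<beta>)) \<le> (x + \<bar>N powr (- \<beta>)\<bar> powr \<alpha>) + 2 * N powr (- \<beta>) * (0 * N)" if "1 \<le> N" for x N :: real
  proof -
    have "\<bar>N powr (- \<beta>)\<bar> powr \<alpha> = N powr (- (\<alpha> * \<beta>))"
      by (simp only: abs_of_nonneg[OF powr_ge_zero] powr_powr) (simp add: mult.commute)
    then show ?thesis by (simp add: powr_minus_divide)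
  qed
  show "continuous_on {0..1} (\<lambda>t. x + \<bar>t\<bar> powr \<alpha>)" for x :: real
    using assms by (intro continuous_intros continuous_on_powr') auto
  show "2 * s < 2 * \<beta> * \<delta> + (1 - \<alpha> * \<beta>)" using s by (simp add: algebra_simps)
qed (use assms in auto)

text \<open>The shares of u and d in their sum lie in [0,1] and add up to 1; raising them to a power
  at most 1 does not decrease them.\<close>

lemma powr_add_le_add_powr:
  fixes u d \<alpha> :: real
  assumes u: "0 \<le> u" and d: "0 \<le> d" and \<alpha>: "0 < \<alpha>" "\<alpha> \<le> 1"
  shows "(u + d) powr \<alpha> \<le> u powr \<alpha> + d powr \<alpha>"
proof (cases "u + d = 0")
  case True
  then show ?thesis by simp
next
  case False
  then have S: "0 < u + d" using u d by linarith
  have le: "v / (u + d) \<le> v powr \<alpha> / (u + d) powr \<alpha>" if "0 \<le> v" "v \<le> u + d" for v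
  proof -
    have "(v / (u + d)) powr 1 \<le> (v / (u + d)) powr \<alpha>"
      using that S \<alpha> by (intro powr_mono') auto
    then show ?thesis using that S by (simp add: powr_divide)
  qed
  have "1 = u / (u + d) + d / (u + d)" using S by (simp add: add_divide_distrib[symmetric])
  also have "\<dots> \<le> u powr \<alpha> / (u + d) powr \<alpha> + d powr \<alpha> / (u + d) powr \<alpha>"
    using u d by (intro add_mono le) auto
  finally show ?thesis using S by (simp add: field_simps)
qed

text \<open>The factor \<open>c\<close> covers the stationary and the moving curve at once.
  Lipschitz bounds in x are trivial for translations, and the Hoelder bound is subadditivity of the
  power.\<close>

lemma admissible_moving:
  fixes \<alpha> c :: real
  assumes \<alpha>: "0 < \<alpha>" "\<alpha> \<le> 1" and c: "0 \<le> c" "c \<le> 1"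
  shows "admissible_curve \<alpha> (\<lambda>x t. x + c * \<bar>t\<bar> powr \<alpha>)"
  unfolding admissible_curve_def
proof (intro conjI)
  show "continuous_on (UNIV \<times> {-1..1}) (\<lambda>(x, t). x + c * \<bar>t\<bar> powr \<alpha>)"
    unfolding case_prod_beta using \<alpha> by (intro continuous_intros continuous_on_powr') auto
  show "\<forall>x. x + c * \<bar>0\<bar> powr \<alpha> = x" by simp
  show "bilipschitz_in_x (\<lambda>x t. x + c * \<bar>t\<bar> powr \<alpha>)"
    unfolding bilipschitz_in_x_def by (rule exI[of _ 1], rule conjI, simp, rule exI[of _ 1]) simp
  have h: "\<bar>\<bar>u\<bar> powr \<alpha> - \<bar>v\<bar> powr \<alpha>\<bar> \<le> \<bar>u - v\<bar> powr \<alpha>" for u v :: real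
  proof -
    have half: "\<bar>u\<bar> powr \<alpha> \<le> \<bar>v\<bar> powr \<alpha> + \<bar>u - v\<bar> powr \<alpha>" for u v :: real
    proof -
      have "\<bar>u\<bar> powr \<alpha> \<le> (\<bar>v\<bar> + \<bar>u - v\<bar>) powr \<alpha>" using \<alpha> by (intro powr_mono2) auto
      also have "\<dots> \<le> \<bar>v\<bar> powr \<alpha> + \<bar>u - v\<bar> powr \<alpha>" using \<alpha> by (intro powr_add_le_add_powr) auto
      finally show ?thesis .
    qed
    from half[of u v] half[of v u] show ?thesis by (simp add: abs_minus_commute abs_le_iff)
  qed
  show "hoelder_in_t \<alpha> (\<lambda>x t. x + c * \<bar>t\<bar> powr \<alpha>)"
    unfolding hoelder_in_t_def
  proof (intro exI[of _ 1] conjI allI ballI)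
    fix x t t' :: real
    have "\<bar>(x + c * \<bar>t\<bar> powr \<alpha>) - (x + c * \<bar>t'\<bar> powr \<alpha>)\<bar> = c * \<bar>\<bar>t\<bar> powr \<alpha> - \<bar>t'\<bar> powr \<alpha>\<bar>"
      using c by (simp add: abs_mult flip: right_diff_distrib)
    also have "\<dots> \<le> 1 * \<bar>t - t'\<bar> powr \<alpha>" using c by (intro mult_mono h) auto
    finally show "\<bar>(x + c * \<bar>t\<bar> powr \<alpha>) - (x + c * \<bar>t'\<bar> powr \<alpha>)\<bar> \<le> 1 * \<bar>t - t'\<bar> powr \<alpha>" .
  qed simp
qed

lemma sobolev_antimono:
  assumes "s \<le> s'"
  shows "sobolev s' \<subseteq> sobolev s"
proof
  fix f assume f: "f \<in> sobolev s'"
  then have ex: "\<exists>g. has_fourier_transform f g" and W: "integrable lborel (\<lambda>\<xi>. ((1 + \<xi>\<^sup>2) powr (s' / 2) * cmod (fhat f \<xi>))\<^sup>2)"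
    by (auto simp: sobolev_def)
  have "has_fourier_transform f (fhat f)" unfolding fhat_def by (rule someI_ex[OF ex])
  then have [measurable]: "fhat f \<in> borel_measurable borel" by (simp add: has_fourier_transform_def)
  have "integrable lborel (\<lambda>\<xi>. ((1 + \<xi>\<^sup>2) powr (s / 2) * cmod (fhat f \<xi>))\<^sup>2)"
  proof (rule Bochner_Integration.integrable_bound[OF W])
    have "((1 + \<xi>\<^sup>2) powr (s / 2) * cmod (fhat f \<xi>))\<^sup>2 \<le> ((1 + \<xi>\<^sup>2) powr (s' / 2) * cmod (fhat f \<xi>))\<^sup>2" for \<xi> :: real
      using assms by (intro power_mono mult_right_mono powr_mono) auto
    then show "AE \<xi> in lborel. norm (((1 + \<xi>\<^sup>2) powr (s / 2) * cmod (fhat f \<xi>))\<^sup>2) \<le> norm (((1 + \<xi>\<^sup>2) powr (s' / 2) * cmod (fhat f \<xi>))\<^sup>2)"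
      by simp
  qed measurable
  then show "f \<in> sobolev s" using f by (simp add: sobolev_def)
qed

text \<open>The bound for s is affine in \<beta> with the sign of its slope given by \<delta> -
  \<alpha>/2, so it is nearly attained at \<beta> close to 2 or close to 1/\<alpha>. The endpoints
  themselves are excluded, and the strict inequality for s leaves the necessary room.\<close>

lemma ex_time_exponent:
  fixes \<alpha> \<delta> s :: real
  assumes \<alpha>: "1/4 < \<alpha>" "\<alpha> < 1/2" and \<delta>: "\<alpha> - 1/4 < \<delta>" and s: "s < s_crit \<alpha> \<delta>"
  shows "\<exists>\<beta>>2. \<alpha> * \<beta> < 1 \<and> s < 1 / 2 + \<beta> * (\<delta> - \<alpha> / 2)"
proof -
  define h where "h \<beta> = 1 / 2 + \<beta> * (\<delta> - \<alpha> / 2)" for \<beta> :: real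
  have a2: "2 < 1 / \<alpha>" using \<alpha> by (simp add: field_simps)
  have hc: "continuous (at \<beta> within S) h" for \<beta> S unfolding h_def by (intro continuous_intros)
  have "\<exists>\<beta>. 2 < \<beta> \<and> \<beta> < 1 / \<alpha> \<and> s < h \<beta>"
  proof (cases "\<delta> < \<alpha> / 2")
    case True
    then have "s < h 2" using s \<delta> by (simp add: h_def s_crit_def)
    then have "\<forall>\<^sub>F \<beta> in at_right 2. s < h \<beta>"
      using hc[of 2 "{2<..}"] by (intro order_tendstoD(1)) (auto simp: continuous_within)
    moreover have "\<forall>\<^sub>F \<beta> in at_right 2. 2 < \<beta> \<and> \<beta> < 1 / \<alpha>"
      using a2 by (intro eventually_at_rightI[of 2 "1 / \<alpha>"]) auto
    ultimately have "\<forall>\<^sub>F \<beta> in at_right (2::real). 2 < \<beta> \<and> \<beta> < 1 / \<alpha> \<and> s < h \<beta>" by eventually_elim auto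
    then show ?thesis by (rule eventually_happens'[rotated]) simp
  next
    case False
    then have "s < h (1 / \<alpha>)" using s \<delta> \<alpha> by (simp add: h_def s_crit_def diff_divide_distrib)
    then have "\<forall>\<^sub>F \<beta> in at_left (1 / \<alpha>). s < h \<beta>"
      using hc[of "1 / \<alpha>" "{..<1 / \<alpha>}"] by (intro order_tendstoD(1)) (auto simp: continuous_within)
    moreover have "\<forall>\<^sub>F \<beta> in at_left (1 / \<alpha>). 2 < \<beta> \<and> \<beta> < 1 / \<alpha>"
      using a2 by (intro eventually_at_leftI[of 2 "1 / \<alpha>"]) auto
    ultimately have "\<forall>\<^sub>F \<beta> in at_left (1 / \<alpha>). 2 < \<beta> \<and> \<beta> < 1 / \<alpha> \<and> s < h \<beta>" by eventually_elim auto
    then show ?thesis by (rule eventually_happens'[rotated]) simp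
  qed
  then show ?thesis using \<alpha> by (auto simp: h_def field_simps)
qed

theorem ex_curve_failing_below_s_crit:
  fixes \<alpha> \<delta> :: real
  assumes \<alpha>: "1/4 < \<alpha>" "\<alpha> < 1/2" and \<delta>: "0 \<le> \<delta>" "\<delta> < \<alpha>"
  shows "\<exists>\<gamma>. admissible_curve \<alpha> \<gamma> \<and> (\<forall>s < s_crit \<alpha> \<delta>. \<not> (\<forall>f \<in> sobolev s. pointwise_rate \<gamma> \<delta> f))"
proof -
  \<comment> \<open>The curve may depend on \<alpha> and \<delta> but not on s, since one curve has
    to fail for all smaller s.\<close>
  define c :: real where "c = (if \<delta> \<le> \<alpha> - 1/4 then 0 else 1)"
  define \<gamma> where "\<gamma> x t = x + c * \<bar>t\<bar> powr \<alpha>" for x t :: real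
  have \<alpha>01: "0 < \<alpha>" "\<alpha> \<le> 1" using \<alpha> by auto
  have adm: "admissible_curve \<alpha> \<gamma>"
    using admissible_moving[OF \<alpha>01, of c] by (simp add: \<gamma>_def[abs_def] c_def)
  have "\<not> (\<forall>f \<in> sobolev s. pointwise_rate \<gamma> \<delta> f)" if s: "s < s_crit \<alpha> \<delta>" for s
  proof -
    \<comment> \<open>Negative exponents are reduced to s = 0: the spaces grow as s decreases, and
      the critical exponent is positive.\<close>
    define s' where "s' = max s 0"
    have "0 < s_crit \<alpha> \<delta>" using s_crit_ge(1)[OF \<alpha> \<delta>] \<delta> by linarith
    then have s': "0 \<le> s'" "s \<le> s'" "s' < s_crit \<alpha> \<delta>" using s by (auto simp: s'_def)
    have "s_crit \<alpha> \<delta> \<le> 1" using \<alpha> \<delta> by (auto simp: s_crit_def)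
    then have s1: "s' \<le> 1" using s' by simp
    have "\<exists>F. focusing_block \<gamma> \<delta> s' \<epsilon> F" if \<epsilon>: "0 < \<epsilon>" for \<epsilon>
    proof (cases "\<delta> \<le> \<alpha> - 1/4")
      case True
      then have "\<gamma> = (\<lambda>x t. x)" by (simp add: \<gamma>_def[abs_def] c_def)
      moreover have "s' < 1 / 4 + \<delta>" using s' True by (simp add: s_crit_def)
      ultimately show ?thesis using ex_focusing_block_stationary[OF s'(1) s1 \<delta>(1) \<epsilon>] by simp
    next
      case False
      then have "\<gamma> = (\<lambda>x t. x + \<bar>t\<bar> powr \<alpha>)" by (simp add: \<gamma>_def[abs_def] c_def)
      moreover obtain \<beta> where "2 < \<beta>" "\<alpha> * \<beta> < 1" "s' < 1 / 2 + \<beta> * (\<delta> - \<alpha> / 2)"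
        using ex_time_exponent[OF \<alpha> _ s'(3)] False by auto
      ultimately show ?thesis using ex_focusing_block_moving[OF s'(1) s1 \<delta>(1) \<epsilon> \<alpha>01(1)] by simp
    qed
    then have "\<exists>f\<in>sobolev s'. \<not> pointwise_rate \<gamma> \<delta> f" by (rule gliding_hump[OF adm \<alpha>01 \<delta> s'(1)])
    then show ?thesis using sobolev_antimono[OF s'(2)] by blast
  qed
  then show ?thesis using adm by blast
qed

theorem theorem1p4:
  fixes \<alpha> \<delta> :: real
  assumes "1/4 < \<alpha>" "\<alpha> < 1/2" "0 \<le> \<delta>" "\<delta> < \<alpha>"
  shows "(\<forall>\<gamma>. admissible_curve \<alpha> \<gamma> \<longrightarrow>
            (\<forall>s > s_crit \<alpha> \<delta>. \<forall>f \<in> sobolev s. pointwise_rate \<gamma> \<delta> f)) \<and>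
         (\<exists>\<gamma>. admissible_curve \<alpha> \<gamma> \<and>
            (\<forall>s < s_crit \<alpha> \<delta>. \<not> (\<forall>f \<in> sobolev s. pointwise_rate \<gamma> \<delta> f)))"
  using pointwise_rate_above_s_crit[OF assms] ex_curve_failing_below_s_crit[OF assms] by blast

end
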